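(* Let $(\xi_j)_{j\ge 0}$ be independent and identically distributed real random variables with $\mathbb{E}\,\xi_0=0$, $\mathrm{Var}(\xi_0)=1$, and $\mathbb{E}|\xi_0|^{2+\epsilon}<\infty$ for some $\epsilon>0$. Let $p_n(x)=\sum_{j=0}^n \xi_j x^j$. Then almost surely $$\lim_{n\to\infty}\frac{N_n([-1,1])}{\log n}=\frac1\pi .$$ Furthermore, almost surely $$\lim_{n\to\infty}\frac{N_n([0,1])}{\log n}=\frac1{2\pi}\qquad\text{and}\qquad \lim_{n\to\infty}\frac{N_n([-1,0])}{\log n}=\frac1{2\pi}.$$
   Context: For $I\subset\mathbb{R}$, $N_n(I)$ denotes the number of real roots of $p_n$ in $I$, counted with multiplicity, with the convention $N_n(I)=0$ if $p_n$ is identically zero. The same sequence $(\xi_j)_{j\ge0}$ is used for all $n$. *)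

theory Defs
  imports "HOL-Probability.Probability" "HOL-Computational_Algebra.Polynomial"
begin

definition kac_poly :: "(nat \<Rightarrow> real) \<Rightarrow> nat \<Rightarrow> real poly"
  where "kac_poly a n = (\<Sum>j\<le>n. monom (a j) j)"

(* proots p is the multiset of roots of p, each occurring as often as its multiplicity;
   since proots 0 = {#}, the zero polynomial is assigned the value 0. *)
definition num_roots_in :: "real poly \<Rightarrow> real set \<Rightarrow> nat"
  where "num_roots_in p I = size (filter_mset (\<lambda>x. x \<in> I) (proots p))"

end

theory Submission
  imports Defs "HOL-Real_Asymp.Real_Asymp"
begin

text \<open>
  Let N n be the number of roots of the random polynomial p n in the half-open interval from 0
  (excluded) to 1. Everything follows from the almost sure convergence of N n / ln n to
  1 / (2 * pi) for independent coefficients with mean 0, variance 1 and a uniform bound on a moment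
  of order q > 2 (locale kac_coeffs, theorem roots_limit). That formulation covers the coefficients
  (-1)^j * \<xi> j as well, whose polynomial is the reflection of p n; this gives the roots in the
  interval from -1 to 0. The multiplicity of
  the root 0 is almost surely bounded in n.

  The obstacle to an almost sure statement is that p n changes with n. Both bounds replace N n by a
  count of sign changes that depends on n only through the range of the count.

  Upper bound. Descartes' rule of signs, applied to the power series p n (x) / (1 - x)^k instead of
  p n itself, bounds N n by the number of sign changes of its coefficient sequence. Up to index n these
  coefficients are the k-fold partial sums of the sequence \<xi>, which do not involve n, and beyond n
  there are boundedly many further changes (num_roots_le_sign_changes). The crude bound k = 0 is far
  too large, but summation smooths the sequence: for k = d + 1 the k-fold partial sums at a and a + D
  are almost collinear linear forms, whose angle is about \<kappa> * D / a with
  \<kappa>^2 = (2 d + 1) / (4 (2 d - 1)) (weight_angle). Two linear forms with small coefficients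
  differ in sign with probability approximately angle / pi, so that about \<kappa> / pi sign changes
  are expected per unit of ln n. As d grows, \<kappa> tends to 1 / 2 and the bound to 1 / (2 * pi).

  Lower bound. Count the sign changes of p n along the grid points 1 - \<beta>^(- m). At such a point
  only about m^2 * \<beta>^m coefficients matter, so that for large n the sign of p n there is
  almost surely that of a linear form which does not involve n. Neighbouring forms have an angle that
  tends to arccos (2 * sqrt \<beta> / (1 + \<beta>)) >= (\<beta> - 1) / (\<beta> + 1), and there are
  1 / ln \<beta> grid points per unit of ln n. As \<beta> decreases to 1 this gives 1 / (2 * pi) again.

  Both bounds rest on the following tools.

  \<^item> Universality (sign_change_prob): the probability that two linear forms differ in sign is the
    Gaussian value angle / pi, up to a power of the largest coefficient. The sign is replaced by the sine
    integral Si (L x), an integral of trigonometric functions, so that only characteristic functions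
    have to be compared; a moment of order above 2 makes every error a power.

  \<^item> Anti-concentration (small_ball), also from characteristic functions.

  \<^item> Decorrelation (changes_cov): a form with a much later range keeps its sign with high probability
    when its early coefficients are deleted, and is then independent of the earlier forms. The resulting
    decay is enough for a strong law of large numbers (strong_law_weakly_dependent).

  \<^item> A discrete Rolle argument (psum_small_of_many_changes): if a k-fold partial sum changes sign r
    times in a short interval, then its value there is bounded by sums of order k - r, hence is
    atypically small. Anti-concentration turns this into a probability bound (many_changes_prob). With
    r = 2 it shows that a sufficiently fine grid eventually misses no sign change; with r = 6 it bounds the second
    moment of the number of sign changes in a dyadic block, as the strong law requires.
\<close>

section \<open>Characteristic functions of linear forms in the coefficients\<close>

text \<open>
  The moments are controlled uniformly instead of assuming a common distribution, because the signs
  (-1)^j have to be absorbed into the coefficients. A moment of order at most 3 is as good as a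
  higher one for the Taylor estimates below.
\<close>

locale kac_coeffs = prob_space M for M :: "'a measure" +
  fixes \<xi> :: "nat \<Rightarrow> 'a \<Rightarrow> real" and q B :: real
  assumes indep: "indep_vars (\<lambda>_. borel) \<xi> UNIV"
    and mean: "\<And>j. expectation (\<xi> j) = 0"
    and second: "\<And>j. expectation (\<lambda>\<omega>. (\<xi> j \<omega>)\<^sup>2) = 1"
    and int_q: "\<And>j. integrable M (\<lambda>\<omega>. \<bar>\<xi> j \<omega>\<bar> powr q)"
    and mom_q: "\<And>j. expectation (\<lambda>\<omega>. \<bar>\<xi> j \<omega>\<bar> powr q) \<le> B"
    and q: "2 < q" "q \<le> 3"
begin

lemma rv [measurable]: "\<xi> j \<in> borel_measurable M"
  using indep by (auto simp: indep_vars_def)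

lemma int_sq: "integrable M (\<lambda>\<omega>. (\<xi> j \<omega>)\<^sup>2)"
  using second[of j] not_integrable_integral_eq by fastforce

lemma int_xi: "integrable M (\<xi> j)"
  by (rule square_integrable_imp_integrable[OF _ int_sq]) auto

lemma B_nonneg: "0 \<le> B"
  using mom_q[of 0] by (rule order_trans[rotated]) (auto intro: integral_nonneg)

definition lin :: "nat \<Rightarrow> (nat \<Rightarrow> real) \<Rightarrow> 'a \<Rightarrow> real"
  where "lin J w \<omega> = (\<Sum>j<J. w j * \<xi> j \<omega>)"

lemma lin_measurable [measurable]: "lin J w \<in> borel_measurable M"
  unfolding lin_def by measurable

text \<open>
  The second-order Taylor remainder is bounded both by the square and by the cube of |x|, hence by
  every power in between.
\<close>

lemma iexp_taylor_powr:
  fixes x :: real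
  shows "cmod (iexp x - (1 + \<i> * x - x\<^sup>2 / 2)) \<le> \<bar>x\<bar> powr q"
proof -
  have s: "(\<Sum>k\<le>(2::nat). (\<i> * x)^k / fact k) = 1 + \<i> * x - x\<^sup>2 / 2"
    by (simp add: numeral_2_eq_2 power2_eq_square) (simp add: algebra_simps)
  have 1: "cmod (iexp x - (1 + \<i> * x - x\<^sup>2 / 2)) \<le> \<bar>x\<bar>^3"
  proof -
    have "cmod (iexp x - (1 + \<i> * x - x\<^sup>2 / 2)) \<le> \<bar>x\<bar>^3 / 6"
      using iexp_approx1[of x 2] unfolding s by (simp add: eval_nat_numeral fact_numeral)
    also have "\<dots> \<le> \<bar>x\<bar>^3" by simp
    finally show ?thesis .
  qed
  have 2: "cmod (iexp x - (1 + \<i> * x - x\<^sup>2 / 2)) \<le> \<bar>x\<bar>^2"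
    using iexp_approx2[of x 2] unfolding s by (simp add: eval_nat_numeral fact_numeral)
  show ?thesis
  proof (cases "\<bar>x\<bar> \<le> 1")
    case True
    show ?thesis
    proof (cases "x = 0")
      case False
      have "\<bar>x\<bar>^3 = \<bar>x\<bar> powr 3" using False by (simp add: powr_numeral)
      also have "\<dots> \<le> \<bar>x\<bar> powr q" using True q False by (intro powr_mono') auto
      finally show ?thesis using 1 by linarith
    qed simp
  next
    case False
    have "\<bar>x\<bar>^2 = \<bar>x\<bar> powr 2" using False by (simp add: powr_numeral)
    also have "\<dots> \<le> \<bar>x\<bar> powr q" using False q by (intro powr_mono) auto
    finally show ?thesis using 2 by linarith
  qed
qed

lemma exp_gauss_taylor_powr:
  fixes x :: real
  shows "\<bar>exp (- x\<^sup>2 / 2) - (1 - x\<^sup>2 / 2)\<bar> \<le> \<bar>x\<bar> powr q"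
proof -
  define y where "y = x\<^sup>2 / 2"
  have y: "y \<ge> 0" by (simp add: y_def)
  have lo: "exp (-y) \<ge> 1 - y" using exp_ge_add_one_self[of "-y"] by simp
  have up1: "exp (-y) - (1 - y) \<le> y" using y by simp
  have up2: "exp (-y) - (1 - y) \<le> y\<^sup>2"
  proof -
    have "exp (-y) \<le> 1 / (1 + y)"
      using exp_ge_add_one_self[of y] y by (simp add: exp_minus field_simps)
    also have "\<dots> \<le> 1 - y + y\<^sup>2"
      using y by (simp add: field_simps power2_eq_square)
    finally show ?thesis by simp
  qed
  show ?thesis
  proof (cases "\<bar>x\<bar> \<le> 1")
    case True
    show ?thesis
    proof (cases "x = 0")
      case False
      have "y\<^sup>2 = x^4 / 4" by (simp add: y_def power_divide)
      also have "\<dots> \<le> \<bar>x\<bar>^4" by simp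
      also have "\<bar>x\<bar>^4 = \<bar>x\<bar> powr 4" using False by (simp add: powr_numeral)
      also have "\<dots> \<le> \<bar>x\<bar> powr q" using True q False by (intro powr_mono') auto
      finally have "\<bar>exp (- y) - (1 - y)\<bar> \<le> \<bar>x\<bar> powr q" using up2 lo by linarith
      then show ?thesis by (simp add: y_def)
    qed simp
  next
    case False
    have "y \<le> \<bar>x\<bar>^2" by (simp add: y_def)
    also have "\<bar>x\<bar>^2 = \<bar>x\<bar> powr 2" using False by (simp add: powr_numeral)
    also have "\<dots> \<le> \<bar>x\<bar> powr q" using False q by (intro powr_mono) auto
    finally have "\<bar>exp (- y) - (1 - y)\<bar> \<le> \<bar>x\<bar> powr q" using up1 lo by linarith
    then show ?thesis by (simp add: y_def)
  qed
qed

lemma char_xi: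
  "cmod (char (distr M borel (\<lambda>\<omega>. t * \<xi> j \<omega>)) 1 - exp (- t\<^sup>2 / 2)) \<le> (B + 1) * \<bar>t\<bar> powr q"
proof -
  have ii: "integrable M (\<lambda>\<omega>. iexp (t * \<xi> j \<omega>))"
    by (rule integrable_const_bound[of _ 1]) auto
  have i1: "integrable M (\<lambda>\<omega>. complex_of_real (t * \<xi> j \<omega>))"
    using int_xi[of j] by (auto intro!: integrable_mult_right)
  have i2: "integrable M (\<lambda>\<omega>. complex_of_real ((t * \<xi> j \<omega>)\<^sup>2))"
    using int_sq[of j] by (auto simp: power_mult_distrib simp del: of_real_power of_real_mult intro!: integrable_of_real integrable_mult_right)
  have e1: "(CLINT \<omega>|M. complex_of_real (t * \<xi> j \<omega>)) = 0"
    using mean[of j] by (subst integral_complex_of_real) simp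
  have e2: "(CLINT \<omega>|M. complex_of_real ((t * \<xi> j \<omega>)\<^sup>2)) = t\<^sup>2"
    using second[of j] by (subst integral_complex_of_real) (simp add: power_mult_distrib)
  let ?T = "\<lambda>\<omega>. 1 + \<i> * complex_of_real (t * \<xi> j \<omega>) - complex_of_real ((t * \<xi> j \<omega>)\<^sup>2) / 2"
  have eT: "(CLINT \<omega>|M. ?T \<omega>) = 1 - t\<^sup>2 / 2"
    using i1 i2 e1 e2 by (simp add: prob_space del: of_real_mult of_real_power)
  have iT: "integrable M ?T" using i1 i2 by auto
  have c: "char (distr M borel (\<lambda>\<omega>. t * \<xi> j \<omega>)) 1 = (CLINT \<omega>|M. iexp (t * \<xi> j \<omega>))"
    by (simp add: char_def integral_distr)
  have "cmod ((CLINT \<omega>|M. iexp (t * \<xi> j \<omega>)) - (1 - t\<^sup>2 / 2)) = cmod (CLINT \<omega>|M. iexp (t * \<xi> j \<omega>) - ?T \<omega>)"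
    by (subst Bochner_Integration.integral_diff[OF ii iT], subst eT) simp
  also have "\<dots> \<le> (\<integral>\<omega>. cmod (iexp (t * \<xi> j \<omega>) - ?T \<omega>) \<partial>M)"
    by (rule integral_norm_bound)
  also have "\<dots> \<le> (\<integral>\<omega>. \<bar>t\<bar> powr q * \<bar>\<xi> j \<omega>\<bar> powr q \<partial>M)"
  proof (rule integral_mono)
    show "integrable M (\<lambda>\<omega>. cmod (iexp (t * \<xi> j \<omega>) - ?T \<omega>))" using ii iT by auto
    show "integrable M (\<lambda>\<omega>. \<bar>t\<bar> powr q * \<bar>\<xi> j \<omega>\<bar> powr q)" using int_q by auto
    fix \<omega>
    show "cmod (iexp (t * \<xi> j \<omega>) - ?T \<omega>) \<le> \<bar>t\<bar> powr q * \<bar>\<xi> j \<omega>\<bar> powr q"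
      using iexp_taylor_powr[of "t * \<xi> j \<omega>"] by (simp add: abs_mult powr_mult)
  qed
  also have "\<dots> \<le> \<bar>t\<bar> powr q * B"
    using mom_q[of j] by (simp add: mult_left_mono)
  finally have 1: "cmod ((CLINT \<omega>|M. iexp (t * \<xi> j \<omega>)) - (1 - t\<^sup>2 / 2)) \<le> \<bar>t\<bar> powr q * B" .
  have 2: "cmod (complex_of_real (1 - t\<^sup>2 / 2) - complex_of_real (exp (- t\<^sup>2 / 2))) \<le> \<bar>t\<bar> powr q"
    using exp_gauss_taylor_powr[of t] unfolding of_real_diff[symmetric] norm_of_real by (simp add: abs_minus_commute)
  have "cmod ((CLINT \<omega>|M. iexp (t * \<xi> j \<omega>)) - exp (- t\<^sup>2 / 2)) \<le> \<bar>t\<bar> powr q * B + \<bar>t\<bar> powr q"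
    using norm_triangle_mono[OF 1 2] by simp
  then show ?thesis unfolding c by (simp add: algebra_simps)
qed

text \<open>
  Lindeberg's replacement in multiplicative form: by independence the characteristic function is a
  product of factors of modulus at most 1, and such products differ by at most the sum of the
  differences of their factors.
\<close>

lemma char_lin:
  "cmod (char (distr M borel (lin J w)) 1 - exp (- (\<Sum>j<J. (w j)\<^sup>2) / 2))
     \<le> (B + 1) * (\<Sum>j<J. \<bar>w j\<bar> powr q)"
proof -
  have iv: "indep_vars (\<lambda>_. borel) (\<lambda>j \<omega>. w j * \<xi> j \<omega>) {..<J}"
    by (rule indep_vars_compose2[OF indep_vars_subset[OF indep]]) auto
  have 1: "char (distr M borel (lin J w)) 1 = (\<Prod>j<J. char (distr M borel (\<lambda>\<omega>. w j * \<xi> j \<omega>)) 1)"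
    using char_distr_sum[OF iv, of 1] by (simp add: lin_def[abs_def])
  have 2: "complex_of_real (exp (- (\<Sum>j<J. (w j)\<^sup>2) / 2)) = (\<Prod>j<J. complex_of_real (exp (- (w j)\<^sup>2 / 2)))"
    by (simp add: exp_sum[symmetric] sum_negf sum_divide_distrib flip: of_real_prod)
  have "cmod ((\<Prod>j<J. char (distr M borel (\<lambda>\<omega>. w j * \<xi> j \<omega>)) 1) - (\<Prod>j<J. complex_of_real (exp (- (w j)\<^sup>2 / 2))))
    \<le> (\<Sum>j<J. cmod (char (distr M borel (\<lambda>\<omega>. w j * \<xi> j \<omega>)) 1 - complex_of_real (exp (- (w j)\<^sup>2 / 2))))"
  proof (rule norm_prod_diff)
    fix j
    interpret D: real_distribution "distr M borel (\<lambda>\<omega>. w j * \<xi> j \<omega>)"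
      by (rule real_distribution_distr) auto
    show "cmod (char (distr M borel (\<lambda>\<omega>. w j * \<xi> j \<omega>)) 1) \<le> 1" by (rule D.cmod_char_le_1)
    show "cmod (complex_of_real (exp (- (w j)\<^sup>2 / 2))) \<le> 1" by (simp only: norm_of_real) simp
  qed
  also have "\<dots> \<le> (\<Sum>j<J. (B + 1) * \<bar>w j\<bar> powr q)"
    by (intro sum_mono char_xi)
  finally show ?thesis unfolding 1 2 by (simp add: sum_distrib_left)
qed

lemma char_lin_scaled:
  "char (distr M borel (lin J w)) u = char (distr M borel (lin J (\<lambda>j. u * w j))) 1"
  by (simp add: char_def integral_distr lin_def sum_distrib_left mult.assoc)

end

section \<open>Small balls and the sine integral\<close>

abbreviation "std_normal \<equiv> density lborel std_normal_density"

interpretation std_normal: prob_space std_normal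
  by (rule prob_space_normal_density) simp

lemma gaussian_integral_std_normal:
  fixes \<tau> :: real
  assumes "\<tau> > 0"
  shows "(\<integral>u. exp (- (u / \<tau>)\<^sup>2 / 2) \<partial>std_normal) \<le> \<tau>"
proof -
  define s where "s = \<tau> / sqrt (1 + \<tau>\<^sup>2)"
  have s: "s > 0" using assms by (simp add: s_def add_pos_nonneg)
  have s2: "1 / s\<^sup>2 = 1 + 1 / \<tau>\<^sup>2"
    using assms by (simp add: s_def power_divide add_pos_nonneg field_simps)
  have eq: "std_normal_density u * exp (- (u / \<tau>)\<^sup>2 / 2) = s * normal_density 0 s u" for u
  proof -
    have "- u\<^sup>2 / 2 + - (u / \<tau>)\<^sup>2 / 2 = - (u\<^sup>2 / 2) * (1 + 1 / \<tau>\<^sup>2)"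
      by (simp add: power_divide algebra_simps)
    also have "\<dots> = - u\<^sup>2 / (2 * s\<^sup>2)" by (simp add: s2[symmetric])
    finally have e: "- u\<^sup>2 / 2 + - (u / \<tau>)\<^sup>2 / 2 = - u\<^sup>2 / (2 * s\<^sup>2)" .
    have "std_normal_density u * exp (- (u / \<tau>)\<^sup>2 / 2) = 1 / sqrt (2 * pi) * exp (- u\<^sup>2 / 2 + - (u / \<tau>)\<^sup>2 / 2)"
      by (simp add: std_normal_density_def mult_exp_exp)
    also have "\<dots> = s * normal_density 0 s u"
      unfolding e using s by (simp add: normal_density_def real_sqrt_mult)
    finally show ?thesis .
  qed
  have "(\<integral>u. exp (- (u / \<tau>)\<^sup>2 / 2) \<partial>std_normal) = (\<integral>u. std_normal_density u * exp (- (u / \<tau>)\<^sup>2 / 2) \<partial>lborel)"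
    by (subst integral_density) (auto simp: normal_density_nonneg)
  also have "\<dots> = s * (\<integral>u. normal_density 0 s u \<partial>lborel)" by (simp only: eq integral_mult_right_zero)
  also have "\<dots> = s" using s by simp
  also have "s \<le> \<tau> / 1" unfolding s_def using assms by (intro divide_left_mono) (auto intro!: mult_pos_pos add_pos_nonneg)
  also have "\<dots> = \<tau>" by simp
  finally show ?thesis .
qed

text \<open>
  The indicator of the ball is dominated by a Gaussian, and the mean of that Gaussian under D is an
  average of the characteristic function of D. The factor \<tau>^(-3) is the price of rescaling the
  error term.
\<close>

lemma small_ball_char:
  fixes e q \<tau> :: real
  assumes D: "real_distribution D" and e: "e \<ge> 0" and q: "2 < q" "q \<le> 3" and \<tau>: "0 < \<tau>" "\<tau> \<le> 1"
    and ch: "\<And>u. cmod (char D u) \<le> exp (- u\<^sup>2 / 2) + e * \<bar>u\<bar> powr q"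
  shows "measure D {-\<tau>..\<tau>} \<le> 2 * (\<tau> + e / \<tau>^3 * (1 + (\<integral>u. \<bar>u\<bar>^3 \<partial>std_normal)))"
proof -
  interpret D: real_distribution D by fact
  interpret pair_prob_space D std_normal ..
  have i3: "integrable std_normal (\<lambda>u. \<bar>u\<bar>^3)"
    using integrable_std_normal_moment_abs[of 3]
    by (subst integrable_density) (auto simp: normal_density_nonneg)
  have ie: "integrable std_normal (\<lambda>u. exp (- (u / \<tau>)\<^sup>2 / 2))"
    by (rule std_normal.integrable_const_bound[of _ 1]) auto
  have ipair: "integrable (D \<Otimes>\<^sub>M std_normal) (\<lambda>(x,u). iexp (x / \<tau> * u))"
    by (rule integrable_const_bound[of _ 1]) (auto simp: split_beta' simp del: of_real_mult of_real_divide)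
  have iD: "integrable D (\<lambda>x. exp (- (x / \<tau>)\<^sup>2 / 2))"
    by (rule D.integrable_const_bound[of _ 1]) auto
  have pw: "indicator {-\<tau>..\<tau>} x \<le> 2 * exp (- (x / \<tau>)\<^sup>2 / 2)" for x
  proof (cases "x \<in> {-\<tau>..\<tau>}")
    case True
    then have "\<bar>x / \<tau>\<bar> \<le> 1" using \<tau> by (auto simp: abs_le_iff field_simps)
    then have "(x / \<tau>)\<^sup>2 \<le> 1" by (simp add: abs_square_le_1)
    moreover have "exp (- (x / \<tau>)\<^sup>2 / 2) \<ge> 1 + - (x / \<tau>)\<^sup>2 / 2"
      by (rule exp_ge_add_one_self)
    ultimately have "exp (- (x / \<tau>)\<^sup>2 / 2) \<ge> 1 / 2" by linarith
    then show ?thesis using True by simp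
  qed simp
  have "measure D {-\<tau>..\<tau>} = (\<integral>x. indicator {-\<tau>..\<tau>} x \<partial>D)" by simp
  also have "\<dots> \<le> (\<integral>x. 2 * exp (- (x / \<tau>)\<^sup>2 / 2) \<partial>D)"
  proof (rule integral_mono)
    show "integrable D (indicat_real {- \<tau>..\<tau>})"
      by (rule D.integrable_const_bound[of _ 1]) auto
  qed (use iD pw in auto)
  finally have 1: "measure D {-\<tau>..\<tau>} \<le> 2 * (\<integral>x. exp (- (x / \<tau>)\<^sup>2 / 2) \<partial>D)" by simp
  (* The Gaussian function is the characteristic function of a normal variable. *)
  have ch0: "complex_of_real (exp (- (x / \<tau>)\<^sup>2 / 2)) = (CLINT u|std_normal. iexp (x / \<tau> * u))" for x
    using fun_cong[OF char_std_normal_distribution, of "x / \<tau>"] by (simp only: char_def)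
  have "complex_of_real (\<integral>x. exp (- (x / \<tau>)\<^sup>2 / 2) \<partial>D) = (CLINT x|D. complex_of_real (exp (- (x / \<tau>)\<^sup>2 / 2)))"
    by (rule integral_complex_of_real[symmetric])
  also have "\<dots> = (CLINT x|D. (CLINT u|std_normal. iexp (x / \<tau> * u)))"
    by (subst ch0) (rule refl)
  also have "\<dots> = (CLINT u|std_normal. (CLINT x|D. iexp (x / \<tau> * u)))"
    using Fubini_integral[OF ipair] by simp
  also have "\<dots> = (CLINT u|std_normal. char D (u / \<tau>))"
    by (simp add: char_def mult.commute)
  finally have 2: "complex_of_real (\<integral>x. exp (- (x / \<tau>)\<^sup>2 / 2) \<partial>D) = (CLINT u|std_normal. char D (u / \<tau>))" .
  have "(\<integral>x. exp (- (x / \<tau>)\<^sup>2 / 2) \<partial>D) \<le> cmod (CLINT u|std_normal. char D (u / \<tau>))"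
    unfolding 2[symmetric] by (simp only: norm_of_real)
  also have "\<dots> \<le> (\<integral>u. cmod (char D (u / \<tau>)) \<partial>std_normal)" by (rule integral_norm_bound)
  also have "\<dots> \<le> (\<integral>u. exp (- (u / \<tau>)\<^sup>2 / 2) + e / \<tau>^3 * (1 + \<bar>u\<bar>^3) \<partial>std_normal)"
  proof (rule integral_mono)
    show "integrable std_normal (\<lambda>u. cmod (char D (u / \<tau>)))"
      by (rule std_normal.integrable_const_bound[of _ 1]) (auto simp: D.cmod_char_le_1)
    show "integrable std_normal (\<lambda>u. exp (- (u / \<tau>)\<^sup>2 / 2) + e / \<tau>^3 * (1 + \<bar>u\<bar>^3))"
      using i3 ie by (intro Bochner_Integration.integrable_add integrable_mult_right) auto
    fix u
    have "\<bar>u / \<tau>\<bar> powr q \<le> (1 + \<bar>u\<bar>^3) / \<tau>^3"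
    proof -
      have "\<bar>u\<bar> powr q \<le> 1 + \<bar>u\<bar>^3"
      proof (cases "\<bar>u\<bar> \<le> 1")
        case True
        then have "\<bar>u\<bar> powr q \<le> 1" using q by (intro powr_le1) auto
        moreover have "0 \<le> \<bar>u\<bar>^3" by simp
        ultimately show ?thesis by linarith
      next
        case False
        then have "\<bar>u\<bar> powr q \<le> \<bar>u\<bar> powr 3" using q by (intro powr_mono) auto
        then show ?thesis using False by (simp add: powr_numeral)
      qed
      moreover have "\<tau>^3 \<le> \<tau> powr q"
      proof -
        have "\<tau>^3 = \<tau> powr 3" using \<tau> by (simp add: powr_numeral)
        also have "\<dots> \<le> \<tau> powr q" using \<tau> q by (intro powr_mono') auto
        finally show ?thesis .
      qed
      moreover have "\<bar>u / \<tau>\<bar> powr q = \<bar>u\<bar> powr q / \<tau> powr q"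
        using \<tau> by (simp add: powr_divide)
      ultimately show ?thesis using \<tau> by (auto intro!: frac_le)
    qed
    then have "e * \<bar>u / \<tau>\<bar> powr q \<le> e / \<tau>^3 * (1 + \<bar>u\<bar>^3)"
      using e by (metis mult_left_mono times_divide_eq_left times_divide_eq_right)
    then show "cmod (char D (u / \<tau>)) \<le> exp (- (u / \<tau>)\<^sup>2 / 2) + e / \<tau>^3 * (1 + \<bar>u\<bar>^3)"
      using ch[of "u / \<tau>"] by linarith
  qed
  also have "\<dots> = (\<integral>u. exp (- (u / \<tau>)\<^sup>2 / 2) \<partial>std_normal) + e / \<tau>^3 * (1 + (\<integral>u. \<bar>u\<bar>^3 \<partial>std_normal))"
    using i3 ie std_normal.prob_space by (subst Bochner_Integration.integral_add) auto
  also have "\<dots> \<le> \<tau> + e / \<tau>^3 * (1 + (\<integral>u. \<bar>u\<bar>^3 \<partial>std_normal))"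
    using gaussian_integral_std_normal[OF \<tau>(1)] by simp
  finally show ?thesis using 1 by simp
qed

text \<open>
  The sign with the convention that 0 counts as positive. With only two values, a comparison of signs
  is an event without exceptional cases.
\<close>

definition sg :: "real \<Rightarrow> real" where "sg x = (if x \<ge> 0 then 1 else -1)"

lemma sg_measurable [measurable]: "sg \<in> borel_measurable borel"
  unfolding sg_def[abs_def] by measurable

text \<open>
  One integration by parts: Si t + cos t / t has derivative - cos t / t^2, whose integral from x to
  infinity is at most 1 / x in absolute value.
\<close>

lemma Si_rate:
  fixes x :: real
  assumes "x > 0"
  shows "\<bar>Si x - pi / 2\<bar> \<le> 2 / x"
proof -
  define G where "G = (\<lambda>t. Si t + cos t / t)"
  have dG: "(G has_real_derivative - cos t / t\<^sup>2) (at t)" if "t > 0" for t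
    unfolding G_def using that
    by (auto intro!: derivative_eq_intros DERIV_Si simp: power2_eq_square field_simps)
  have bd: "\<bar>G y - G x\<bar> \<le> 1 / x - 1 / y" if "x \<le> y" for y
  proof -
    (* Adding or subtracting 1 / t makes G monotone. *)
    have a: "G x + 1 / x \<ge> G y + 1 / y"
    proof (rule DERIV_nonpos_imp_nonincreasing[OF that])
      fix t assume t: "x \<le> t" "t \<le> y"
      have "((\<lambda>t. G t + 1 / t) has_real_derivative - cos t / t\<^sup>2 + - 1 / t\<^sup>2) (at t)"
        using t assms by (intro DERIV_add dG) (auto intro!: derivative_eq_intros simp: power2_eq_square)
      moreover have "- cos t / t\<^sup>2 + - 1 / t\<^sup>2 \<le> 0"
        using cos_ge_minus_one[of t] divide_right_mono[of "-1" "cos t" "t\<^sup>2"] by simp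
      ultimately show "\<exists>z. ((\<lambda>t. G t + 1 / t) has_real_derivative z) (at t) \<and> z \<le> 0" by blast
    qed
    have b: "G x - 1 / x \<le> G y - 1 / y"
    proof (rule DERIV_nonneg_imp_nondecreasing[OF that])
      fix t assume t: "x \<le> t" "t \<le> y"
      have "((\<lambda>t. G t - 1 / t) has_real_derivative - cos t / t\<^sup>2 - - 1 / t\<^sup>2) (at t)"
        using t assms by (intro DERIV_diff dG) (auto intro!: derivative_eq_intros simp: power2_eq_square)
      moreover have "- cos t / t\<^sup>2 - - 1 / t\<^sup>2 \<ge> 0"
        using cos_le_one[of t] divide_right_mono[of "cos t" 1 "t\<^sup>2"] by (simp add: minus_divide_left[symmetric])
      ultimately show "\<exists>z. ((\<lambda>t. G t - 1 / t) has_real_derivative z) (at t) \<and> 0 \<le> z" by blast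
    qed
    show ?thesis using a b by (simp add: abs_le_iff)
  qed
  have lim: "((\<lambda>y. \<bar>G y - G x\<bar>) \<longlongrightarrow> \<bar>pi / 2 + 0 - G x\<bar>) at_top"
  proof -
    have "((\<lambda>y. cos y / y) \<longlongrightarrow> 0) (at_top :: real filter)"
    proof (rule Lim_null_comparison)
      show "\<forall>\<^sub>F y in at_top. norm (cos y / y) \<le> 1 / (y::real)"
        using eventually_gt_at_top[of 0] by eventually_elim (auto intro!: divide_right_mono)
      show "((\<lambda>y. 1 / y) \<longlongrightarrow> 0) (at_top :: real filter)"
        by real_asymp
    qed
    then show ?thesis unfolding G_def by (intro tendsto_intros Si_at_top)
  qed
  have "\<bar>pi / 2 + 0 - G x\<bar> \<le> 1 / x"
  proof (rule tendsto_upperbound[OF lim])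
    show "\<forall>\<^sub>F y in at_top. \<bar>G y - G x\<bar> \<le> 1 / x"
      using eventually_ge_at_top[of x]
    proof eventually_elim
      case (elim y)
      then show ?case using bd[of y] assms by (smt (verit) divide_nonneg_nonneg)
    qed
  qed simp
  moreover have "\<bar>cos x / x\<bar> \<le> 1 / x" using assms by (auto intro!: divide_right_mono)
  moreover have "2 / x = 1 / x + 1 / x" by simp
  ultimately show ?thesis unfolding G_def by linarith
qed

lemma Si_zero: "Si 0 = 0"
  unfolding Si_def zero_ereal_def by (rule interval_integral_endpoints_same)

lemma Si_sg:
  fixes L x :: real
  assumes "L > 0" "x \<noteq> 0"
  shows "\<bar>2 / pi * Si (L * x) - sg x\<bar> \<le> 2 / (L * \<bar>x\<bar>)"
proof -
  have p: "\<bar>2 / pi * Si y - 1\<bar> \<le> 2 / y" if "y > 0" for y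
  proof -
    have "2 / pi * Si y - 1 = 2 / pi * (Si y - pi / 2)"
      by (simp add: right_diff_distrib)
    then have "\<bar>2 / pi * Si y - 1\<bar> = 2 / pi * \<bar>Si y - pi / 2\<bar>"
      by (simp only: abs_mult) simp
    also have "\<dots> \<le> 2 / pi * (2 / y)" by (intro mult_left_mono Si_rate that) auto
    also have "\<dots> \<le> 1 * (2 / y)" using pi_ge_two that by (intro mult_right_mono) (auto simp: field_simps)
    finally show ?thesis by simp
  qed
  show ?thesis
  proof (cases "x > 0")
    case True
    then show ?thesis using p[of "L * x"] assms by (simp add: sg_def)
  next
    case False
    then have x: "x < 0" using assms by simp
    have "Si (L * x) = - Si (L * (- x))" using Si_neg[of "L * (-x)"] x assms by (simp add: mult_nonneg_nonpos)
    then have "\<bar>2 / pi * Si (L * x) - sg x\<bar> = \<bar>2 / pi * Si (L * (- x)) - 1\<bar>"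
      using x by (simp add: sg_def)
    then show ?thesis using p[of "L * (-x)"] x assms by (simp add: mult_pos_neg)
  qed
qed

section \<open>Comparing sign correlations through the sine integral\<close>

text \<open>
  Lebesgue measure on an interval as a finite measure, so that Fubini's theorem applies to products
  with a probability space.
\<close>

abbreviation "seg L \<equiv> restrict_space lborel {0..L::real}"

lemma finite_measure_seg: "finite_measure (seg L)"
  by (rule finite_measureI) (simp add: emeasure_restrict_space space_restrict_space emeasure_lborel_Icc_eq)

lemma sinc_bounded: "\<bar>sinc x\<bar> \<le> 1"
  using abs_sin_x_le_abs_x[of x] by (auto simp: abs_divide divide_le_eq)

lemma Si_integral_seg:
  assumes "L \<ge> 0"
  shows "(\<integral>u. x * sinc (u * x) \<partial>seg L) = Si (L * x)"
proof -
  have "(\<integral>u. (x * sinc (u * x)) * indicator {0..L} u \<partial>lborel) = Si (L * x) - Si (0 * x)"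
  proof (rule integral_FTC_Icc_real[OF assms])
    fix u :: real
    show "DERIV (\<lambda>u. Si (u * x)) u :> x * sinc (u * x)"
    proof -
      have "((\<lambda>u. u * x) has_real_derivative x) (at u)" by (auto intro!: derivative_eq_intros)
      from DERIV_chain2[OF DERIV_Si this] show ?thesis by (simp only: mult.commute)
    qed
    show "isCont (\<lambda>u. x * sinc (u * x)) u"
      by (intro continuous_intros isCont_o2[OF _ isCont_sinc])
  qed
  then show ?thesis
    by (subst integral_restrict_space)
      (simp_all add: Si_zero mult.commute del: integral_mult_right_zero integral_mult_left_zero)
qed

text \<open>
  The sine integral is itself an integral of bounded functions; Fubini's theorem moves the expectation
  inside.
\<close>

lemma expectation_Si:
  assumes N: "prob_space N" and [measurable]: "X \<in> borel_measurable N" "Y \<in> borel_measurable N"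
    and int: "integrable N (\<lambda>\<omega>. X \<omega> * Y \<omega>)" and L: "L \<ge> 0"
  shows "(\<integral>\<omega>. Si (L * X \<omega>) * Y \<omega> \<partial>N) = (\<integral>u. (\<integral>\<omega>. X \<omega> * sinc (u * X \<omega>) * Y \<omega> \<partial>N) \<partial>seg L)"
    and "integrable (seg L) (\<lambda>u. \<integral>\<omega>. X \<omega> * sinc (u * X \<omega>) * Y \<omega> \<partial>N)"
proof -
  interpret N: prob_space N by fact
  interpret L: finite_measure "seg L" by (rule finite_measure_seg)
  interpret pair_sigma_finite N "seg L" ..
  have [measurable]: "sinc \<in> borel_measurable borel" by (rule borel_measurable_sinc)
  have ip: "integrable (N \<Otimes>\<^sub>M seg L) (\<lambda>(\<omega>, u). X \<omega> * sinc (u * X \<omega>) * Y \<omega>)"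
  proof (rule Bochner_Integration.integrable_bound)
    show "integrable (N \<Otimes>\<^sub>M seg L) (\<lambda>(\<omega>, u). X \<omega> * Y \<omega>)"
    proof (rule Fubini_integrable)
      show "integrable N (\<lambda>x. \<integral>y. norm (case (x, y) of (\<omega>, u) \<Rightarrow> X \<omega> * Y \<omega>) \<partial>seg L)"
        using int by auto
    qed auto
    have [measurable]: "snd \<in> borel_measurable (N \<Otimes>\<^sub>M seg L)"
      by (rule measurable_compose[OF measurable_snd]) (simp add: measurable_restrict_space1)
    have "(\<lambda>p. sinc (snd p * X (fst p))) \<in> borel_measurable (N \<Otimes>\<^sub>M seg L)"
      by (rule measurable_compose[OF _ borel_measurable_sinc]) measurable
    then show "(\<lambda>(\<omega>, u). X \<omega> * sinc (u * X \<omega>) * Y \<omega>) \<in> borel_measurable (N \<Otimes>\<^sub>M seg L)"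
      unfolding split_beta' by measurable
    show "AE x in N \<Otimes>\<^sub>M seg L. norm (case x of (\<omega>, u) \<Rightarrow> X \<omega> * sinc (u * X \<omega>) * Y \<omega>) \<le> norm (case x of (\<omega>, u) \<Rightarrow> X \<omega> * Y \<omega>)"
    proof (rule AE_I2, clarify)
      fix \<omega> and u :: real
      have "\<bar>X \<omega>\<bar> * \<bar>sinc (u * X \<omega>)\<bar> * \<bar>Y \<omega>\<bar> \<le> \<bar>X \<omega>\<bar> * 1 * \<bar>Y \<omega>\<bar>"
        by (intro mult_right_mono mult_left_mono sinc_bounded) auto
      then show "norm (X \<omega> * sinc (u * X \<omega>) * Y \<omega>) \<le> norm (X \<omega> * Y \<omega>)"
        by (simp only: real_norm_def abs_mult mult_1_right)
    qed
  qed
  have "(\<integral>\<omega>. Si (L * X \<omega>) * Y \<omega> \<partial>N) = (\<integral>\<omega>. (\<integral>u. X \<omega> * sinc (u * X \<omega>) * Y \<omega> \<partial>seg L) \<partial>N)"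
    by (subst Si_integral_seg[OF L, symmetric]) simp
  also have "\<dots> = (\<integral>u. (\<integral>\<omega>. X \<omega> * sinc (u * X \<omega>) * Y \<omega> \<partial>N) \<partial>seg L)"
    using Fubini_integral[OF ip] by simp
  finally show "(\<integral>\<omega>. Si (L * X \<omega>) * Y \<omega> \<partial>N) = (\<integral>u. (\<integral>\<omega>. X \<omega> * sinc (u * X \<omega>) * Y \<omega> \<partial>N) \<partial>seg L)" .
  show "integrable (seg L) (\<lambda>u. \<integral>\<omega>. X \<omega> * sinc (u * X \<omega>) * Y \<omega> \<partial>N)"
    using integrable_snd[OF ip] by simp
qed

text \<open>
  Two square-integrable variables of second moment at most 1, with an arbitrary joint distribution.
  The locale is interpreted twice, by a pair of linear forms in the coefficients and by the Gaussian
  pair with the same covariance, and the two are then compared.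
\<close>

locale normal_pair = prob_space N for N :: "'b measure" +
  fixes S T :: "'b \<Rightarrow> real"
  assumes rvS [measurable]: "S \<in> borel_measurable N" and rvT [measurable]: "T \<in> borel_measurable N"
    and intS: "integrable N (\<lambda>\<omega>. (S \<omega>)\<^sup>2)" and intT: "integrable N (\<lambda>\<omega>. (T \<omega>)\<^sup>2)"
    and varS: "expectation (\<lambda>\<omega>. (S \<omega>)\<^sup>2) \<le> 1" and varT: "expectation (\<lambda>\<omega>. (T \<omega>)\<^sup>2) \<le> 1"
begin

text \<open>
  The integrand that is left when both sine integrals in E (Si (L S) * Si (L T)) are written out. As
  u * sinc (v * u) = sin (v * u) / v, it is a difference of expectations of cosines divided by
  2 * u * v.
\<close>

definition kern :: "real \<Rightarrow> real \<Rightarrow> real"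
  where "kern u v = expectation (\<lambda>\<omega>. T \<omega> * sinc (v * T \<omega>) * (S \<omega> * sinc (u * S \<omega>)))"

lemma int_ST: "integrable N (\<lambda>\<omega>. S \<omega> * T \<omega>)"
proof (rule Bochner_Integration.integrable_bound)
  show "integrable N (\<lambda>\<omega>. ((S \<omega>)\<^sup>2 + (T \<omega>)\<^sup>2) / 2)" using intS intT by auto
  show "AE \<omega> in N. norm (S \<omega> * T \<omega>) \<le> norm (((S \<omega>)\<^sup>2 + (T \<omega>)\<^sup>2) / 2)"
  proof (rule AE_I2)
    fix \<omega>
    show "norm (S \<omega> * T \<omega>) \<le> norm (((S \<omega>)\<^sup>2 + (T \<omega>)\<^sup>2) / 2)"
      using sum_squares_bound[of "\<bar>S \<omega>\<bar>" "\<bar>T \<omega>\<bar>"] by (simp add: abs_mult)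
  qed
qed measurable

lemma meas_sinc [measurable]: "X \<in> borel_measurable N \<Longrightarrow> (\<lambda>\<omega>. sinc (u * X \<omega>)) \<in> borel_measurable N"
  by (rule measurable_compose[OF _ borel_measurable_sinc]) simp

lemma int_kern_part: "integrable N (\<lambda>\<omega>. T \<omega> * (S \<omega> * sinc (u * S \<omega>)))"
proof (rule Bochner_Integration.integrable_bound[OF int_ST])
  show "AE \<omega> in N. norm (T \<omega> * (S \<omega> * sinc (u * S \<omega>))) \<le> norm (S \<omega> * T \<omega>)"
  proof (rule AE_I2)
    fix \<omega>
    have "\<bar>T \<omega>\<bar> * (\<bar>S \<omega>\<bar> * \<bar>sinc (u * S \<omega>)\<bar>) \<le> \<bar>T \<omega>\<bar> * (\<bar>S \<omega>\<bar> * 1)"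
      by (intro mult_left_mono sinc_bounded) auto
    also have "\<dots> = \<bar>S \<omega>\<bar> * \<bar>T \<omega>\<bar>" by simp
    finally show "norm (T \<omega> * (S \<omega> * sinc (u * S \<omega>))) \<le> norm (S \<omega> * T \<omega>)"
      by (simp only: real_norm_def abs_mult)
  qed
qed measurable

lemma Si_Si_eq:
  assumes L: "L \<ge> 0"
  shows "expectation (\<lambda>\<omega>. Si (L * S \<omega>) * Si (L * T \<omega>)) = (\<integral>u. (\<integral>v. kern u v \<partial>seg L) \<partial>seg L)"
    and "integrable (seg L) (\<lambda>u. (\<integral>v. kern u v \<partial>seg L))"
    and "integrable (seg L) (\<lambda>v. kern u v)"
proof -
  obtain b where b: "\<And>x. \<bar>Si x\<bar> \<le> b" using bounded_Si by blast
  have i1: "integrable N (\<lambda>\<omega>. S \<omega> * Si (L * T \<omega>))"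
  proof (rule Bochner_Integration.integrable_bound)
    show "integrable N (\<lambda>\<omega>. S \<omega> * b)"
      using square_integrable_imp_integrable[OF rvS intS] by simp
    show "AE \<omega> in N. norm (S \<omega> * Si (L * T \<omega>)) \<le> norm (S \<omega> * b)"
      using b by (auto simp: abs_mult intro!: mult_left_mono AE_I2) (meson abs_ge_self order_trans b)
  qed measurable
  note A = expectation_Si[OF prob_space_axioms rvS _ i1 L]
  have m1: "(\<lambda>\<omega>. Si (L * T \<omega>)) \<in> borel_measurable N" by measurable
  have B: "expectation (\<lambda>\<omega>. S \<omega> * sinc (u * S \<omega>) * Si (L * T \<omega>)) = (\<integral>v. kern u v \<partial>seg L)"
      and C: "integrable (seg L) (\<lambda>v. kern u v)" for u
  proof -
    have m2: "(\<lambda>\<omega>. S \<omega> * sinc (u * S \<omega>)) \<in> borel_measurable N" by measurable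
    note D = expectation_Si[OF prob_space_axioms rvT m2 int_kern_part L]
    show "expectation (\<lambda>\<omega>. S \<omega> * sinc (u * S \<omega>) * Si (L * T \<omega>)) = (\<integral>v. kern u v \<partial>seg L)"
      using D(1) unfolding kern_def by (simp only: mult.commute)
    show "integrable (seg L) (\<lambda>v. kern u v)"
      using D(2) unfolding kern_def by (simp only: mult.commute)
  qed
  show "expectation (\<lambda>\<omega>. Si (L * S \<omega>) * Si (L * T \<omega>)) = (\<integral>u. (\<integral>v. kern u v \<partial>seg L) \<partial>seg L)"
    using A(1)[OF m1] by (simp only: B)
  show "integrable (seg L) (\<lambda>u. (\<integral>v. kern u v \<partial>seg L))"
    using A(2)[OF m1] by (simp only: B)
  show "integrable (seg L) (\<lambda>v. kern u v)" by (rule C)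
qed

lemma kern_le_1: "\<bar>kern u v\<bar> \<le> 1"
proof -
  have "\<bar>kern u v\<bar> \<le> expectation (\<lambda>\<omega>. \<bar>T \<omega> * sinc (v * T \<omega>) * (S \<omega> * sinc (u * S \<omega>))\<bar>)"
    unfolding kern_def by (rule integral_abs_bound)
  also have "\<dots> \<le> expectation (\<lambda>\<omega>. ((S \<omega>)\<^sup>2 + (T \<omega>)\<^sup>2) / 2)"
  proof (rule integral_mono')
    show "integrable N (\<lambda>\<omega>. ((S \<omega>)\<^sup>2 + (T \<omega>)\<^sup>2) / 2)" using intS intT by auto
    fix \<omega>
    have "\<bar>T \<omega>\<bar> * \<bar>sinc (v * T \<omega>)\<bar> * (\<bar>S \<omega>\<bar> * \<bar>sinc (u * S \<omega>)\<bar>) \<le> (\<bar>T \<omega>\<bar> * 1) * (\<bar>S \<omega>\<bar> * 1)"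
      by (intro mult_mono mult_left_mono sinc_bounded) auto
    also have "\<dots> \<le> ((S \<omega>)\<^sup>2 + (T \<omega>)\<^sup>2) / 2"
      using sum_squares_bound[of "\<bar>S \<omega>\<bar>" "\<bar>T \<omega>\<bar>"] by (simp add: algebra_simps)
    finally show "\<bar>T \<omega> * sinc (v * T \<omega>) * (S \<omega> * sinc (u * S \<omega>))\<bar> \<le> ((S \<omega>)\<^sup>2 + (T \<omega>)\<^sup>2) / 2"
      by (simp only: abs_mult)
  qed simp
  also have "\<dots> \<le> 1" using intS intT varS varT by simp
  finally show ?thesis .
qed

lemma kern_cos:
  assumes "u > 0" "v > 0"
  shows "kern u v = (expectation (\<lambda>\<omega>. cos (u * S \<omega> + (- v) * T \<omega>)) - expectation (\<lambda>\<omega>. cos (u * S \<omega> + v * T \<omega>))) / (2 * u * v)"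
proof -
  have s: "y * sinc (a * y) = sin (a * y) / a" if "a > 0" for a y :: real using that by auto
  have ic: "integrable N (\<lambda>\<omega>. cos (a * S \<omega> + b * T \<omega>))" for a b
    by (rule integrable_const_bound[of _ 1]) auto
  have "kern u v = expectation (\<lambda>\<omega>. (cos (u * S \<omega> + (- v) * T \<omega>) - cos (u * S \<omega> + v * T \<omega>)) / (2 * u * v))"
    unfolding kern_def s[OF assms(1)] s[OF assms(2)]
    by (intro Bochner_Integration.integral_cong refl) (use assms in \<open>simp add: cos_add cos_diff field_simps\<close>)
  also have "\<dots> = (expectation (\<lambda>\<omega>. cos (u * S \<omega> + (- v) * T \<omega>)) - expectation (\<lambda>\<omega>. cos (u * S \<omega> + v * T \<omega>))) / (2 * u * v)"
    using ic[of u v] ic[of u "-v"] by simp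
  finally show ?thesis .
qed

text \<open>
  Away from 0 the function 2 / pi * Si (L x) is within 2 / (L |x|) of the sign, and within \<tau> of 0 it is
  bounded; the latter event is rare by anti-concentration.
\<close>

lemma sg_Si_error:
  assumes b: "\<And>x. \<bar>2 / pi * Si x\<bar> \<le> b" "b \<ge> 1" and L: "L > 0" and \<tau>: "\<tau> > 0"
  shows "\<bar>expectation (\<lambda>\<omega>. (2 / pi * Si (L * S \<omega>)) * (2 / pi * Si (L * T \<omega>))) - expectation (\<lambda>\<omega>. sg (S \<omega>) * sg (T \<omega>))\<bar>
    \<le> b * (b + 1) * (prob {\<omega> \<in> space N. \<bar>S \<omega>\<bar> \<le> \<tau>} + prob {\<omega> \<in> space N. \<bar>T \<omega>\<bar> \<le> \<tau>}) + b * (4 / (L * \<tau>))"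
proof -
  define h where "h = (\<lambda>x. 2 / pi * Si (L * x))"
  have [measurable]: "h \<in> borel_measurable borel" unfolding h_def by measurable
  have hb: "\<bar>h x\<bar> \<le> b" for x unfolding h_def by (rule b)
  have sb: "\<bar>sg x\<bar> = 1" for x by (simp add: sg_def)
  have pw: "\<bar>h x - sg x\<bar> \<le> (b + 1) * (if \<bar>x\<bar> \<le> \<tau> then 1 else 0) + 2 / (L * \<tau>)" for x
  proof (cases "\<bar>x\<bar> \<le> \<tau>")
    case True
    have "\<bar>h x - sg x\<bar> \<le> b + 1" using hb[of x] sb[of x] by linarith
    moreover have "2 / (L * \<tau>) \<ge> 0" using L \<tau> by simp
    ultimately show ?thesis using True by (simp only: if_True mult_1_right)
  next
    case False
    then have "\<bar>h x - sg x\<bar> \<le> 2 / (L * \<bar>x\<bar>)" unfolding h_def using \<tau> by (intro Si_sg L) auto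
    also have "\<dots> \<le> 2 / (L * \<tau>)" using False L \<tau> by (intro divide_left_mono mult_left_mono mult_pos_pos) auto
    finally show ?thesis using False by simp
  qed
  have i1: "integrable N (\<lambda>\<omega>. h (S \<omega>) * h (T \<omega>))"
    using hb by (intro integrable_const_bound[of _ "b * b"]) (auto simp: abs_mult intro!: mult_mono order_trans[OF abs_ge_zero hb])
  have i2: "integrable N (\<lambda>\<omega>. sg (S \<omega>) * sg (T \<omega>))"
    by (intro integrable_const_bound[of _ 1]) (auto simp: abs_mult sb)
  let ?I = "\<lambda>X \<omega>. indicat_real {\<omega> \<in> space N. \<bar>X \<omega>\<bar> \<le> \<tau>} \<omega>"
  have iI: "integrable N (?I X)" if "X \<in> borel_measurable N" for X
    using that by (intro integrable_const_bound[of _ 1]) auto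
  have "\<bar>expectation (\<lambda>\<omega>. h (S \<omega>) * h (T \<omega>)) - expectation (\<lambda>\<omega>. sg (S \<omega>) * sg (T \<omega>))\<bar>
      = \<bar>expectation (\<lambda>\<omega>. h (S \<omega>) * h (T \<omega>) - sg (S \<omega>) * sg (T \<omega>))\<bar>"
    using i1 i2 by simp
  also have "\<dots> \<le> expectation (\<lambda>\<omega>. \<bar>h (S \<omega>) * h (T \<omega>) - sg (S \<omega>) * sg (T \<omega>)\<bar>)"
    by (rule integral_abs_bound)
  also have "\<dots> \<le> expectation (\<lambda>\<omega>. b * (b + 1) * (?I S \<omega> + ?I T \<omega>) + b * (4 / (L * \<tau>)))"
  proof (rule integral_mono')
    show "integrable N (\<lambda>\<omega>. b * (b + 1) * (?I S \<omega> + ?I T \<omega>) + b * (4 / (L * \<tau>)))"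
      using iI[OF rvS] iI[OF rvT] by auto
    fix \<omega> assume w: "\<omega> \<in> space N"
    have "\<bar>h (S \<omega>) * h (T \<omega>) - sg (S \<omega>) * sg (T \<omega>)\<bar> = \<bar>(h (S \<omega>) - sg (S \<omega>)) * h (T \<omega>) + sg (S \<omega>) * (h (T \<omega>) - sg (T \<omega>))\<bar>"
      by (simp add: algebra_simps)
    also have "\<dots> \<le> \<bar>h (S \<omega>) - sg (S \<omega>)\<bar> * \<bar>h (T \<omega>)\<bar> + \<bar>sg (S \<omega>)\<bar> * \<bar>h (T \<omega>) - sg (T \<omega>)\<bar>"
      by (rule order_trans[OF abs_triangle_ineq]) (simp add: abs_mult)
    also have "\<dots> \<le> \<bar>h (S \<omega>) - sg (S \<omega>)\<bar> * b + b * \<bar>h (T \<omega>) - sg (T \<omega>)\<bar>"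
      using b(2) by (intro add_mono mult_mono hb) (auto simp: sb)
    also have "\<dots> = b * (\<bar>h (S \<omega>) - sg (S \<omega>)\<bar> + \<bar>h (T \<omega>) - sg (T \<omega>)\<bar>)" by (simp add: algebra_simps)
    also have "\<dots> \<le> b * (((b + 1) * (if \<bar>S \<omega>\<bar> \<le> \<tau> then 1 else 0) + 2 / (L * \<tau>)) + ((b + 1) * (if \<bar>T \<omega>\<bar> \<le> \<tau> then 1 else 0) + 2 / (L * \<tau>)))"
      using b(2) by (intro mult_left_mono add_mono pw) auto
    also have "\<dots> = b * (b + 1) * (?I S \<omega> + ?I T \<omega>) + b * (4 / (L * \<tau>))"
      using w by (simp add: indicator_def algebra_simps)
    finally show "\<bar>h (S \<omega>) * h (T \<omega>) - sg (S \<omega>) * sg (T \<omega>)\<bar> \<le> b * (b + 1) * (?I S \<omega> + ?I T \<omega>) + b * (4 / (L * \<tau>))" .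
  qed (use b L \<tau> in \<open>auto intro!: add_nonneg_nonneg mult_nonneg_nonneg\<close>)
  also have "\<dots> = b * (b + 1) * (prob {\<omega> \<in> space N. \<bar>S \<omega>\<bar> \<le> \<tau>} + prob {\<omega> \<in> space N. \<bar>T \<omega>\<bar> \<le> \<tau>}) + b * (4 / (L * \<tau>))"
    using iI[OF rvS] iI[OF rvT] by (simp add: prob_space)
  finally show ?thesis unfolding h_def .
qed

end

text \<open>
  Close characteristic functions give close sine integrals. The division by u * v makes the cosine
  estimate useless near the axes, where instead both kernels are bounded by 1; \<kappa> is the width of
  the strip in which the trivial bound is used.
\<close>

lemma kern_compare:
  assumes A: "normal_pair N1 S1 T1" and B: "normal_pair N2 S2 T2" and L: "L > 0" and \<kappa>: "\<kappa> > 0" and E: "E \<ge> 0"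
    and cos: "\<And>u v. \<bar>u\<bar> \<le> L \<Longrightarrow> \<bar>v\<bar> \<le> L \<Longrightarrow>
      \<bar>(\<integral>\<omega>. cos (u * S1 \<omega> + v * T1 \<omega>) \<partial>N1) - (\<integral>\<omega>. cos (u * S2 \<omega> + v * T2 \<omega>) \<partial>N2)\<bar> \<le> E"
  shows "\<bar>(\<integral>\<omega>. Si (L * S1 \<omega>) * Si (L * T1 \<omega>) \<partial>N1) - (\<integral>\<omega>. Si (L * S2 \<omega>) * Si (L * T2 \<omega>) \<partial>N2)\<bar>
    \<le> 4 * \<kappa> * L + E * L\<^sup>2 / \<kappa>\<^sup>2"
proof -
  interpret A: normal_pair N1 S1 T1 by fact
  interpret B: normal_pair N2 S2 T2 by fact
  interpret L: finite_measure "seg L" by (rule finite_measure_seg)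
  have L0: "L \<ge> 0" using L by simp
  have mL: "measure (seg L) (space (seg L)) = L"
    using L by (simp add: measure_restrict_space)
  then have mL: "measure (seg L) {0..L} = L" by (simp add: space_restrict_space)
  have mk: "(\<integral>v. indicat_real {..<\<kappa>} v \<partial>seg L) \<le> \<kappa>"
  proof -
    have "(\<integral>v. indicat_real {..<\<kappa>} v \<partial>seg L) = measure lborel ({..<\<kappa>} \<inter> {0..L})"
      by (simp add: space_restrict_space measure_restrict_space)
    also have "\<dots> \<le> measure lborel {0..\<kappa>}"
      by (rule measure_mono_fmeasurable) (auto intro!: fmeasurableI simp: emeasure_lborel_Icc_eq)
    also have "\<dots> = \<kappa>" using \<kappa> by simp
    finally show ?thesis .
  qed
  have ik: "integrable (seg L) (indicat_real {..<\<kappa>})"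
    by (rule L.integrable_const_bound[of _ 1]) (auto simp: measurable_restrict_space1)
  have kd: "\<bar>A.kern u v - B.kern u v\<bar> \<le> 2 * indicat_real {..<\<kappa>} u + (2 * indicat_real {..<\<kappa>} v + E / \<kappa>\<^sup>2)"
    if "u \<in> {0..L}" "v \<in> {0..L}" for u v
  proof (cases "u < \<kappa> \<or> v < \<kappa>")
    case True
    have "\<bar>A.kern u v - B.kern u v\<bar> \<le> 2" using A.kern_le_1[of u v] B.kern_le_1[of u v] by linarith
    moreover have "E / \<kappa>\<^sup>2 \<ge> 0" using E by simp
    ultimately show ?thesis using True by (auto simp: indicator_def)
  next
    case False
    then have uv: "u > 0" "v > 0" "u \<ge> \<kappa>" "v \<ge> \<kappa>" using \<kappa> by auto
    let ?a1 = "\<integral>\<omega>. cos (u * S1 \<omega> + (- v) * T1 \<omega>) \<partial>N1" and ?a2 = "\<integral>\<omega>. cos (u * S1 \<omega> + v * T1 \<omega>) \<partial>N1"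
    let ?b1 = "\<integral>\<omega>. cos (u * S2 \<omega> + (- v) * T2 \<omega>) \<partial>N2" and ?b2 = "\<integral>\<omega>. cos (u * S2 \<omega> + v * T2 \<omega>) \<partial>N2"
    have "A.kern u v - B.kern u v = ((?a1 - ?b1) - (?a2 - ?b2)) / (2 * u * v)"
      unfolding A.kern_cos[OF uv(1,2)] B.kern_cos[OF uv(1,2)] by (simp add: diff_divide_distrib)
    then have "\<bar>A.kern u v - B.kern u v\<bar> = \<bar>(?a1 - ?b1) - (?a2 - ?b2)\<bar> / (2 * u * v)"
      using uv by (simp add: abs_mult)
    also have "\<dots> \<le> (2 * E) / (2 * u * v)"
    proof (rule divide_right_mono)
      have "\<bar>?a1 - ?b1\<bar> \<le> E" "\<bar>?a2 - ?b2\<bar> \<le> E" using that cos[of u "-v"] cos[of u v] by simp_all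
      then show "\<bar>(?a1 - ?b1) - (?a2 - ?b2)\<bar> \<le> 2 * E" by linarith
    qed (use uv in auto)
    also have "\<dots> = E / (u * v)" by simp
    also have "\<dots> \<le> E / \<kappa>\<^sup>2"
      unfolding power2_eq_square using uv \<kappa> E by (intro divide_left_mono mult_mono mult_pos_pos) auto
    finally show ?thesis using False by auto
  qed
  (* The same splitting a second time, now in the variable u. *)
  define d where "d u = (\<integral>v. A.kern u v \<partial>seg L) - (\<integral>v. B.kern u v \<partial>seg L)" for u
  have d: "\<bar>d u\<bar> \<le> 2 * L * indicat_real {..<\<kappa>} u + (2 * \<kappa> + E * L / \<kappa>\<^sup>2)" if u: "u \<in> {0..L}" for u
  proof -
    have "d u = (\<integral>v. A.kern u v - B.kern u v \<partial>seg L)"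
      unfolding d_def using A.Si_Si_eq(3)[OF L0] B.Si_Si_eq(3)[OF L0] by simp
    then have "\<bar>d u\<bar> \<le> (\<integral>v. \<bar>A.kern u v - B.kern u v\<bar> \<partial>seg L)" by (metis integral_abs_bound)
    also have "\<dots> \<le> (\<integral>v. 2 * indicat_real {..<\<kappa>} u + (2 * indicat_real {..<\<kappa>} v + E / \<kappa>\<^sup>2) \<partial>seg L)"
    proof (rule integral_mono')
      show "integrable (seg L) (\<lambda>v. 2 * indicat_real {..<\<kappa>} u + (2 * indicat_real {..<\<kappa>} v + E / \<kappa>\<^sup>2))"
        using ik by auto
      fix v assume "v \<in> space (seg L)"
      then show "\<bar>A.kern u v - B.kern u v\<bar> \<le> 2 * indicat_real {..<\<kappa>} u + (2 * indicat_real {..<\<kappa>} v + E / \<kappa>\<^sup>2)"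
        using kd[OF u, of v] by (simp add: space_restrict_space)
    qed (use E in \<open>auto intro!: add_nonneg_nonneg\<close>)
    also have "\<dots> = 2 * L * indicat_real {..<\<kappa>} u + (2 * (\<integral>v. indicat_real {..<\<kappa>} v \<partial>seg L) + E * L / \<kappa>\<^sup>2)"
      using ik by (simp add: mL space_restrict_space)
    also have "\<dots> \<le> 2 * L * indicat_real {..<\<kappa>} u + (2 * \<kappa> + E * L / \<kappa>\<^sup>2)" using mk by simp
    finally show ?thesis .
  qed
  have "(\<integral>\<omega>. Si (L * S1 \<omega>) * Si (L * T1 \<omega>) \<partial>N1) - (\<integral>\<omega>. Si (L * S2 \<omega>) * Si (L * T2 \<omega>) \<partial>N2)
     = (\<integral>u. d u \<partial>seg L)"
    unfolding d_def A.Si_Si_eq(1)[OF L0] B.Si_Si_eq(1)[OF L0]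
    using A.Si_Si_eq(2)[OF L0] B.Si_Si_eq(2)[OF L0] by simp
  also have "\<bar>\<dots>\<bar> \<le> (\<integral>u. \<bar>d u\<bar> \<partial>seg L)" by (rule integral_abs_bound)
  also have "\<dots> \<le> (\<integral>u. 2 * L * indicat_real {..<\<kappa>} u + (2 * \<kappa> + E * L / \<kappa>\<^sup>2) \<partial>seg L)"
  proof (rule integral_mono')
    show "integrable (seg L) (\<lambda>u. 2 * L * indicat_real {..<\<kappa>} u + (2 * \<kappa> + E * L / \<kappa>\<^sup>2))" using ik by auto
  qed (use d E L \<kappa> in \<open>auto simp: space_restrict_space intro!: add_nonneg_nonneg\<close>)
  also have "\<dots> = 2 * L * (\<integral>u. indicat_real {..<\<kappa>} u \<partial>seg L) + (2 * \<kappa> + E * L / \<kappa>\<^sup>2) * L"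
    using ik by (simp add: mL space_restrict_space)
  also have "\<dots> \<le> 2 * L * \<kappa> + (2 * \<kappa> + E * L / \<kappa>\<^sup>2) * L" using mk L by simp
  also have "\<dots> = 4 * \<kappa> * L + E * L\<^sup>2 / \<kappa>\<^sup>2" by (simp add: power2_eq_square field_simps)
  finally show ?thesis .
qed

section \<open>Gaussian pairs\<close>

abbreviation "normal2 \<equiv> std_normal \<Otimes>\<^sub>M std_normal"

interpretation normal2: pair_prob_space std_normal std_normal ..

lemma std_normal_moments:
  "integrable std_normal (\<lambda>x. x)" "integrable std_normal (\<lambda>x. x\<^sup>2)"
  "(\<integral>x. x \<partial>std_normal) = 0" "(\<integral>x. x\<^sup>2 \<partial>std_normal) = 1"
proof -
  show "integrable std_normal (\<lambda>x. x)"
    using integrable_std_normal_distribution_moment[of 1] by simp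
  show "integrable std_normal (\<lambda>x. x\<^sup>2)"
    using integrable_std_normal_distribution_moment[of 2] by simp
  show "(\<integral>x. x \<partial>std_normal) = 0"
    using integral_std_normal_distribution_moment_odd[of 1] by simp
  show "(\<integral>x. x\<^sup>2 \<partial>std_normal) = 1"
    using std_normal_distribution_even_moments(1)[of 1] by simp
qed

lemma normal2_second_moment:
  assumes "a\<^sup>2 + b\<^sup>2 = (1::real)"
  shows "integrable normal2 (\<lambda>p. (a * fst p + b * snd p)\<^sup>2)"
    and "normal2.expectation (\<lambda>p. (a * fst p + b * snd p)\<^sup>2) = 1"
proof -
  note m = std_normal_moments
  have inner_int: "integrable std_normal (\<lambda>y. (a * x + b * y)\<^sup>2)" for x
  proof -
    have "integrable std_normal (\<lambda>y. (a * x)\<^sup>2 + (2 * a * b * x) * y + b\<^sup>2 * y\<^sup>2)"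
      using m by (intro Bochner_Integration.integrable_add integrable_mult_right) auto
    also have "(\<lambda>y. (a * x)\<^sup>2 + (2 * a * b * x) * y + b\<^sup>2 * y\<^sup>2) = (\<lambda>y. (a * x + b * y)\<^sup>2)"
      by (auto simp: power2_eq_square algebra_simps)
    finally show ?thesis .
  qed
  have inner: "(\<integral>y. (a * x + b * y)\<^sup>2 \<partial>std_normal) = a\<^sup>2 * x\<^sup>2 + b\<^sup>2" for x
  proof -
    have "(\<integral>y. (a * x + b * y)\<^sup>2 \<partial>std_normal) = (\<integral>y. ((a * x)\<^sup>2 + (2 * a * b * x) * y) + b\<^sup>2 * y\<^sup>2 \<partial>std_normal)"
      by (auto simp: power2_eq_square algebra_simps intro!: Bochner_Integration.integral_cong)
    also have "\<dots> = (\<integral>y. (a * x)\<^sup>2 + (2 * a * b * x) * y \<partial>std_normal) + (\<integral>y. b\<^sup>2 * y\<^sup>2 \<partial>std_normal)"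
      using m by (intro Bochner_Integration.integral_add Bochner_Integration.integrable_add integrable_mult_right) auto
    also have "(\<integral>y. (a * x)\<^sup>2 + (2 * a * b * x) * y \<partial>std_normal) = (\<integral>y. (a * x)\<^sup>2 \<partial>std_normal) + (\<integral>y. (2 * a * b * x) * y \<partial>std_normal)"
      using m by (intro Bochner_Integration.integral_add integrable_mult_right) auto
    finally show ?thesis using m std_normal.prob_space by (simp add: power_mult_distrib)
  qed
  show int: "integrable normal2 (\<lambda>p. (a * fst p + b * snd p)\<^sup>2)"
  proof (rule normal2.Fubini_integrable)
    show "integrable std_normal (\<lambda>x. \<integral>y. norm ((a * fst (x, y) + b * snd (x, y))\<^sup>2) \<partial>std_normal)"
      using m by (simp add: inner)
  qed (use inner_int in auto)
  show "normal2.expectation (\<lambda>p. (a * fst p + b * snd p)\<^sup>2) = 1"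
    using normal2.integral_fst'[OF int] m assms std_normal.prob_space by (simp add: inner)
qed

lemma normal2_cos:
  "normal2.expectation (\<lambda>p. cos (a * fst p + b * snd p)) = exp (- (a\<^sup>2 + b\<^sup>2) / 2)"
  "cmod (char (distr normal2 borel (\<lambda>p. a * fst p + b * snd p)) u) = exp (- ((u * a)\<^sup>2 + (u * b)\<^sup>2) / 2)"
proof -
  have c: "(CLINT p|normal2. iexp (a * fst p + b * snd p)) = complex_of_real (exp (- (a\<^sup>2 + b\<^sup>2) / 2))" for a b
  proof -
    have int: "integrable normal2 (\<lambda>p. iexp (a * fst p + b * snd p))"
      by (rule normal2.P.integrable_const_bound[of _ 1]) auto
    have ch: "(CLINT x|std_normal. iexp (t * x)) = complex_of_real (exp (- (t\<^sup>2) / 2))" for t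
      using fun_cong[OF char_std_normal_distribution, of t] by (simp only: char_def)
    have "(CLINT p|normal2. iexp (a * fst p + b * snd p)) = (CLINT x|std_normal. CLINT y|std_normal. iexp (a * x) * iexp (b * y))"
      using normal2.integral_fst'[OF int] by (simp add: exp_add distrib_left)
    also have "\<dots> = (CLINT x|std_normal. iexp (a * x) * complex_of_real (exp (- (b\<^sup>2) / 2)))"
      by (simp only: integral_mult_right_zero ch)
    also have "\<dots> = complex_of_real (exp (- (a\<^sup>2) / 2)) * complex_of_real (exp (- (b\<^sup>2) / 2))"
      by (simp only: integral_mult_left_zero ch)
    also have "\<dots> = complex_of_real (exp (- (a\<^sup>2 + b\<^sup>2) / 2))"
      by (simp add: mult_exp_exp add_divide_distrib flip: of_real_mult)
    finally show ?thesis .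
  qed
  have int: "integrable normal2 (\<lambda>p. iexp (a * fst p + b * snd p))"
    by (rule normal2.P.integrable_const_bound[of _ 1]) auto
  have "Re (CLINT p|normal2. iexp (a * fst p + b * snd p)) = normal2.expectation (\<lambda>p. Re (iexp (a * fst p + b * snd p)))"
    by (rule integral_Re[symmetric, OF int])
  then show "normal2.expectation (\<lambda>p. cos (a * fst p + b * snd p)) = exp (- (a\<^sup>2 + b\<^sup>2) / 2)"
    unfolding c Re_complex_of_real by (simp add: Re_exp)
  have "char (distr normal2 borel (\<lambda>p. a * fst p + b * snd p)) u = (CLINT p|normal2. iexp ((u * a) * fst p + (u * b) * snd p))"
    unfolding char_def by (subst integral_distr) (auto simp: algebra_simps)
  then show "cmod (char (distr normal2 borel (\<lambda>p. a * fst p + b * snd p)) u) = exp (- ((u * a)\<^sup>2 + (u * b)\<^sup>2) / 2)"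
    by (simp only: c norm_of_real abs_exp_cancel)
qed

text \<open>
  The density at s of the quotient of two independent standard normal variables, which is the Cauchy
  density.
\<close>

lemma normal_density_product_moment:
  "(\<integral>\<^sup>+x. ennreal (\<bar>x\<bar> * (std_normal_density x * std_normal_density (x * s))) \<partial>lborel) = ennreal (1 / pi * (1 / (1 + s\<^sup>2)))"
proof -
  define d where "d = 1 / sqrt (1 + s\<^sup>2)"
  have pos: "1 + s\<^sup>2 > 0" by (simp add: add_pos_nonneg)
  have d: "d > 0" using pos by (simp add: d_def)
  have d2: "d\<^sup>2 = 1 / (1 + s\<^sup>2)" using pos by (simp add: d_def power_divide)
  have eq: "\<bar>x\<bar> * (std_normal_density x * std_normal_density (x * s)) = d / sqrt (2 * pi) * (normal_density 0 d x * \<bar>x - 0\<bar> ^ (2 * 0 + 1))" for x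
  proof -
    have "- (x\<^sup>2 / 2) + - ((x * s)\<^sup>2 / 2) = - x\<^sup>2 / (2 * d\<^sup>2)"
      by (simp add: d2 field_simps power_mult_distrib)
    then have e: "exp (- (x\<^sup>2 / 2)) * exp (- ((x * s)\<^sup>2 / 2)) = exp (- x\<^sup>2 / (2 * d\<^sup>2))"
      by (simp only: mult_exp_exp)
    have "std_normal_density x * std_normal_density (x * s) = (1 / sqrt (2 * pi))\<^sup>2 * (exp (- (x\<^sup>2 / 2)) * exp (- ((x * s)\<^sup>2 / 2)))"
      by (simp add: std_normal_density_def power2_eq_square)
    also have "\<dots> = d / sqrt (2 * pi) * normal_density 0 d x"
      unfolding e using d by (simp add: normal_density_def real_sqrt_mult power2_eq_square)
    finally show ?thesis by simp
  qed
  have hb: "has_bochner_integral lborel (\<lambda>x. normal_density 0 d x * \<bar>x - 0\<bar> ^ (2 * 0 + 1)) (2 ^ 0 * fact 0 * d ^ (2 * 0 + 1) * sqrt (2 / pi))"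
    using normal_moment_abs_odd[of d 0 0] d by simp
  have "has_bochner_integral lborel (\<lambda>x. d / sqrt (2 * pi) * (normal_density 0 d x * \<bar>x - 0\<bar> ^ (2 * 0 + 1))) (d / sqrt (2 * pi) * (2 ^ 0 * fact 0 * d ^ (2 * 0 + 1) * sqrt (2 / pi)))"
    using hb by (rule has_bochner_integral_mult_right) 
  then have hb2: "has_bochner_integral lborel (\<lambda>x. \<bar>x\<bar> * (std_normal_density x * std_normal_density (x * s))) (d / sqrt (2 * pi) * (2 ^ 0 * fact 0 * d ^ (2 * 0 + 1) * sqrt (2 / pi)))"
    by (simp only: eq)
  have "d / sqrt (2 * pi) * (2 ^ 0 * fact 0 * d ^ (2 * 0 + 1) * sqrt (2 / pi)) = d\<^sup>2 * (sqrt (2 / pi) / sqrt (2 * pi))"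
    by (simp add: power2_eq_square)
  also have "sqrt (2 / pi) / sqrt (2 * pi) = sqrt ((1 / pi)\<^sup>2)"
    by (simp add: real_sqrt_divide[symmetric] power2_eq_square)
  also have "\<dots> = 1 / pi" by (simp add: real_sqrt_abs)
  finally have v: "d / sqrt (2 * pi) * (2 ^ 0 * fact 0 * d ^ (2 * 0 + 1) * sqrt (2 / pi)) = 1 / pi * (1 / (1 + s\<^sup>2))"
    by (simp add: d2)
  show ?thesis
    using hb2 unfolding v
    by (subst nn_integral_eq_integral) (auto simp: has_bochner_integral_iff)
qed

text \<open>
  The sign of the second form differs from the sign of x exactly when the point (x, y) lies in a double
  sector of angle \<alpha>, up to its boundary. Written in terms of the slope s = - y / x this is the event
  s >= cot \<alpha>, whose probability is computed from the Cauchy density.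
\<close>

lemma gaussian_sign_change:
  assumes \<alpha>: "0 \<le> \<alpha>" "\<alpha> \<le> pi"
  shows "measure normal2 {p \<in> space normal2. sg (fst p) \<noteq> sg (cos \<alpha> * fst p + sin \<alpha> * snd p)} = \<alpha> / pi"
    (is "measure _ ?A = _")
proof -
  consider "\<alpha> = 0" | "\<alpha> = pi" | "0 < \<alpha>" "\<alpha> < pi" using \<alpha> by linarith
  then show ?thesis
  proof cases
    case 1
    then show ?thesis by simp
  next
    case 2
    have "measure normal2 ?A = 1"
    proof (subst normal2.P.prob_eq_1)
      show "?A \<in> sets normal2" by measurable
      have "AE x in std_normal. x \<noteq> 0"
        by (subst AE_density) (auto intro: AE_lborel_singleton[of 0, THEN AE_mp])
      then have "AE x in std_normal. AE y in std_normal. (x, y) \<in> ?A"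
        by eventually_elim (auto simp: 2 sg_def space_pair_measure)
      moreover have "{p \<in> space normal2. p \<in> ?A} \<in> sets normal2" by measurable
      ultimately show "AE p in normal2. p \<in> ?A"
        by (rule normal2.AE_pair_measure[rotated])
    qed
    then show ?thesis using 2 by simp
  next
    case 3
    define \<kappa> where "\<kappa> = cos \<alpha> / sin \<alpha>"
    have s: "sin \<alpha> > 0" using 3 by (rule sin_gt_zero)
    have iff: "(cos \<alpha> * x + sin \<alpha> * y \<ge> 0) = (y \<ge> - \<kappa> * x)" for x y
    proof -
      have "cos \<alpha> * x + sin \<alpha> * y = sin \<alpha> * (y - (- \<kappa> * x))" using s by (simp add: \<kappa>_def field_simps)
      then show ?thesis using s by (simp add: zero_le_mult_iff) linarith
    qed
    have A: "?A = {p. (fst p \<ge> 0) \<noteq> (snd p \<ge> - \<kappa> * fst p)}"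
      unfolding space_pair_measure sg_def iff by auto
    have "{p \<in> space (borel \<Otimes>\<^sub>M borel). (fst p \<ge> 0) \<noteq> (snd p \<ge> - \<kappa> * fst p)} \<in> sets (borel \<Otimes>\<^sub>M borel)"
      by measurable
    then have Am [measurable]: "{p. (fst p \<ge> 0) \<noteq> (snd p \<ge> - \<kappa> * fst p)} \<in> sets (borel \<Otimes>\<^sub>M borel)"
      by (simp add: space_pair_measure)
    (* Substitute y = - x * s; the Jacobian |x| is the extra factor in the Cauchy computation. *)
    have inner: "(\<integral>\<^sup>+y. ennreal (std_normal_density y) * indicator ?A (x, y) \<partial>lborel)
       = (\<integral>\<^sup>+s. ennreal \<bar>x\<bar> * (ennreal (std_normal_density (x * s)) * indicator {\<kappa>..} s) \<partial>lborel)" if x: "x \<noteq> 0" for x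
    proof -
      have "(\<integral>\<^sup>+y. ennreal (std_normal_density y) * indicator ?A (x, y) \<partial>lborel)
        = \<bar>- x\<bar> * (\<integral>\<^sup>+s. ennreal (std_normal_density (0 + (- x) * s)) * indicator ?A (x, 0 + (- x) * s) \<partial>lborel)"
        using x unfolding A by (intro nn_integral_real_affine) auto
      also have "(\<integral>\<^sup>+s. ennreal (std_normal_density (0 + (- x) * s)) * indicator ?A (x, 0 + (- x) * s) \<partial>lborel)
         = (\<integral>\<^sup>+s. ennreal (std_normal_density (x * s)) * indicator {\<kappa>..} s \<partial>lborel)"
      proof (rule nn_integral_cong_AE)
        show "AE s in lborel. ennreal (std_normal_density (0 + (- x) * s)) * indicator ?A (x, 0 + (- x) * s) = ennreal (std_normal_density (x * s)) * indicator {\<kappa>..} s"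
          using AE_lborel_singleton[of \<kappa>]
        proof eventually_elim
          case (elim s)
          have "((x, 0 + (- x) * s) \<in> ?A) = (s \<in> {\<kappa>..})"
            unfolding A using x elim by (cases "x > 0") (auto simp: mult.commute[of x])
          then show ?case by (auto simp: indicator_def std_normal_density_def)
        qed
      qed
      finally show ?thesis by (simp add: nn_integral_cmult)
    qed
    have "emeasure normal2 ?A = (\<integral>\<^sup>+x. (\<integral>\<^sup>+y. indicator ?A (x, y) \<partial>std_normal) \<partial>std_normal)"
      unfolding A by (rule std_normal.emeasure_pair_measure) (use Am in simp)
    also have "\<dots> = (\<integral>\<^sup>+x. (\<integral>\<^sup>+y. ennreal (std_normal_density y) * indicator ?A (x, y) \<partial>lborel) \<partial>std_normal)"
      unfolding A by (intro nn_integral_cong nn_integral_density) auto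
    also have "\<dots> = (\<integral>\<^sup>+x. ennreal (std_normal_density x) * (\<integral>\<^sup>+y. ennreal (std_normal_density y) * indicator ?A (x, y) \<partial>lborel) \<partial>lborel)"
      unfolding A by (intro nn_integral_density) (auto intro!: lborel.borel_measurable_nn_integral)
    also have "\<dots> = (\<integral>\<^sup>+x. (\<integral>\<^sup>+s. ennreal (\<bar>x\<bar> * (std_normal_density x * std_normal_density (x * s))) * indicator {\<kappa>..} s \<partial>lborel) \<partial>lborel)"
    proof (rule nn_integral_cong_AE)
      show "AE x in lborel. ennreal (std_normal_density x) * (\<integral>\<^sup>+y. ennreal (std_normal_density y) * indicator ?A (x, y) \<partial>lborel)
         = (\<integral>\<^sup>+s. ennreal (\<bar>x\<bar> * (std_normal_density x * std_normal_density (x * s))) * indicator {\<kappa>..} s \<partial>lborel)"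
        using AE_lborel_singleton[of 0]
      proof eventually_elim
        case (elim x)
        then show ?case unfolding inner[OF elim]
          by (subst nn_integral_cmult[symmetric]) (auto intro!: nn_integral_cong simp: ennreal_mult mult_ac)
      qed
    qed
    also have "\<dots> = (\<integral>\<^sup>+s. (\<integral>\<^sup>+x. ennreal (\<bar>x\<bar> * (std_normal_density x * std_normal_density (x * s))) * indicator {\<kappa>..} s \<partial>lborel) \<partial>lborel)"
      by (rule lborel_pair.Fubini') (measurable)
    also have "\<dots> = (\<integral>\<^sup>+s. ennreal (1 / pi * (1 / (1 + s\<^sup>2))) * indicator {\<kappa>..} s \<partial>lborel)"
      by (simp add: nn_integral_multc normal_density_product_moment)
    also have "\<dots> = ennreal (1 / pi * (pi / 2) - 1 / pi * arctan \<kappa>)"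
    proof (rule nn_integral_FTC_atLeast)
      show "((\<lambda>s. 1 / pi * arctan s) \<longlongrightarrow> 1 / pi * (pi / 2)) at_top"
        by (intro tendsto_intros tendsto_arctan_at_top)
      fix s :: real
      show "((\<lambda>s. 1 / pi * arctan s) has_real_derivative 1 / pi * (1 / (1 + s\<^sup>2))) (at s)"
        by (auto intro!: derivative_eq_intros simp: inverse_eq_divide)
    qed auto
    also have "arctan \<kappa> = pi / 2 - \<alpha>"
    proof -
      have "\<kappa> = tan (pi / 2 - \<alpha>)" by (simp add: \<kappa>_def tan_def sin_diff cos_diff)
      then show ?thesis using 3 by (simp add: arctan_tan)
    qed
    also have "1 / pi * (pi / 2) - 1 / pi * (pi / 2 - \<alpha>) = \<alpha> / pi" by (simp add: field_simps)
    finally show ?thesis using 3 by (simp add: measure_def)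
  qed
qed

section \<open>Sign changes between two linear forms\<close>

lemma (in prob_space) prob_sg_neq:
  assumes [measurable]: "X \<in> borel_measurable M" "Y \<in> borel_measurable M"
  shows "2 * prob {\<omega> \<in> space M. sg (X \<omega>) \<noteq> sg (Y \<omega>)} = 1 - expectation (\<lambda>\<omega>. sg (X \<omega>) * sg (Y \<omega>))"
proof -
  have "expectation (\<lambda>\<omega>. sg (X \<omega>) * sg (Y \<omega>)) = expectation (\<lambda>\<omega>. 1 - 2 * indicat_real {\<omega> \<in> space M. sg (X \<omega>) \<noteq> sg (Y \<omega>)} \<omega>)"
    by (intro Bochner_Integration.integral_cong) (auto simp: sg_def indicator_def)
  also have "\<dots> = 1 - 2 * prob {\<omega> \<in> space M. sg (X \<omega>) \<noteq> sg (Y \<omega>)}"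
  proof -
    have "integrable M (indicat_real {\<omega> \<in> space M. sg (X \<omega>) \<noteq> sg (Y \<omega>)})"
      by (rule integrable_const_bound[of _ 1]) auto
    then show ?thesis by (simp add: prob_space)
  qed
  finally show ?thesis by simp
qed

context kac_coeffs
begin

text \<open>
  The Lyapunov sum of a form is small as soon as its coefficients are.
\<close>

lemma sum_powr_le:
  assumes w: "\<And>j. j < J \<Longrightarrow> \<bar>w j\<bar> \<le> \<epsilon>" and \<epsilon>: "\<epsilon> > 0"
  shows "(\<Sum>j<J. \<bar>w j\<bar> powr q) \<le> \<epsilon> powr (q - 2) * (\<Sum>j<J. (w j)\<^sup>2)"
  unfolding sum_distrib_left
proof (rule sum_mono)
  fix j assume "j \<in> {..<J}"
  then have wj: "\<bar>w j\<bar> \<le> \<epsilon>" using w by simp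
  have "\<bar>w j\<bar> powr q = \<bar>w j\<bar> powr (q - 2) * \<bar>w j\<bar> powr 2"
    by (subst powr_add[symmetric]) simp
  also have "\<bar>w j\<bar> powr 2 = (w j)\<^sup>2" by (cases "w j = 0") (auto simp: powr_numeral)
  also have "\<bar>w j\<bar> powr (q - 2) * (w j)\<^sup>2 \<le> \<epsilon> powr (q - 2) * (w j)\<^sup>2"
    using wj q by (intro mult_right_mono powr_mono2) auto
  finally show "\<bar>w j\<bar> powr q \<le> \<epsilon> powr (q - 2) * (w j)\<^sup>2" .
qed

text \<open>
  The exponent of all error bounds. The denominator 20 leaves room for the powers lost when the
  truncation parameters in the proofs below are chosen as powers of \<epsilon> powr rate.
\<close>

definition rate :: real where "rate = (q - 2) / 20"

lemma rate_pos: "rate > 0" using q by (simp add: rate_def)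

lemma powr_rate: "(\<epsilon>::real) > 0 \<Longrightarrow> \<epsilon> powr (q - 2) = (\<epsilon> powr rate) ^ 20"
proof -
  assume \<epsilon>: "\<epsilon> > 0"
  have "(\<epsilon> powr rate) ^ 20 = \<epsilon> powr (rate * 20)"
    using \<epsilon> by (subst powr_realpow[symmetric]) (auto simp: powr_powr)
  also have "rate * 20 = q - 2" by (simp add: rate_def)
  finally show ?thesis by simp
qed

lemma char_lin_le:
  assumes w: "\<And>j. j < J \<Longrightarrow> \<bar>w j\<bar> \<le> \<epsilon>" and \<epsilon>: "\<epsilon> > 0" and 1: "(\<Sum>j<J. (w j)\<^sup>2) = 1"
  shows "cmod (char (distr M borel (lin J w)) u) \<le> exp (- u\<^sup>2 / 2) + (B + 1) * \<epsilon> powr (q - 2) * \<bar>u\<bar> powr q"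
proof -
  have e: "cmod (complex_of_real (exp (- (\<Sum>j<J. (u * w j)\<^sup>2) / 2))) = exp (- u\<^sup>2 / 2)"
    by (simp only: norm_of_real power_mult_distrib sum_distrib_left[symmetric] 1) simp
  have "cmod (char (distr M borel (lin J w)) u) \<le> exp (- u\<^sup>2 / 2) + (B + 1) * (\<Sum>j<J. \<bar>u * w j\<bar> powr q)"
    using norm_triangle_sub[of "char (distr M borel (lin J w)) u" "complex_of_real (exp (- (\<Sum>j<J. (u * w j)\<^sup>2) / 2))"]
      char_lin[of J "\<lambda>j. u * w j"]
    unfolding char_lin_scaled[of J w u] e by linarith
  also have "(\<Sum>j<J. \<bar>u * w j\<bar> powr q) = \<bar>u\<bar> powr q * (\<Sum>j<J. \<bar>w j\<bar> powr q)"
    by (simp add: abs_mult powr_mult sum_distrib_left)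
  also have "(B + 1) * (\<bar>u\<bar> powr q * (\<Sum>j<J. \<bar>w j\<bar> powr q)) \<le> (B + 1) * (\<bar>u\<bar> powr q * \<epsilon> powr (q - 2))"
    using sum_powr_le[of J w \<epsilon>, OF w \<epsilon>] B_nonneg 1 by (intro mult_left_mono) auto
  finally show ?thesis by (simp add: mult_ac)
qed

text \<open>
  At scales above \<epsilon> powr rate a linear form has the concentration of a normal variable.
\<close>

lemma small_ball:
  obtains C where "C > 0"
    and "\<And>J (w :: nat \<Rightarrow> real) (\<epsilon> :: real) \<tau>. (\<And>j. j < J \<Longrightarrow> \<bar>w j\<bar> \<le> \<epsilon>) \<Longrightarrow> 0 < \<epsilon> \<Longrightarrow> \<epsilon> \<le> 1 \<Longrightarrow> (\<Sum>j<J. (w j)\<^sup>2) = 1 \<Longrightarrow>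
       prob {\<omega> \<in> space M. \<bar>lin J w \<omega>\<bar> \<le> \<tau>} \<le> C * (\<bar>\<tau>\<bar> + \<epsilon> powr rate)"
proof -
  define C3 where "C3 = 1 + (\<integral>u. \<bar>u\<bar>^3 \<partial>std_normal)"
  have C3: "C3 \<ge> 1" unfolding C3_def by (auto intro!: integral_nonneg)
  define C where "C = 2 * (1 + (B + 1) * C3)"
  have BC: "(B + 1) * C3 \<ge> 1" using C3 B_nonneg mult_mono[of 1 "B+1" 1 C3] by simp
  have C: "C \<ge> 2" using BC by (simp add: C_def)
  show thesis
  proof (rule that)
    show "C > 0" using C by simp
    fix J and w :: "nat \<Rightarrow> real" and \<epsilon> \<tau> :: real
    assume w: "\<And>j. j < J \<Longrightarrow> \<bar>w j\<bar> \<le> \<epsilon>" and \<epsilon>: "0 < \<epsilon>" "\<epsilon> \<le> 1" and 1: "(\<Sum>j<J. (w j)\<^sup>2) = 1"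
    define z where "z = \<epsilon> powr rate"
    have z: "0 < z" "z \<le> 1" using \<epsilon> rate_pos by (auto simp: z_def intro!: powr_le1)
    (* Below z the error term would dominate, and above 1 there is nothing to prove. *)
    define t where "t = max z (min \<bar>\<tau>\<bar> 1)"
    have t: "z \<le> t" "0 < t" "t \<le> 1" "t \<le> z + \<bar>\<tau>\<bar>" using z by (auto simp: t_def)
    have small: "prob {\<omega> \<in> space M. \<bar>lin J w \<omega>\<bar> \<le> t} \<le> C * t"
    proof -
      have "measure (distr M borel (lin J w)) {-t..t} \<le> 2 * (t + (B + 1) * \<epsilon> powr (q - 2) / t^3 * C3)"
        unfolding C3_def using B_nonneg t q
        by (intro small_ball_char[OF _ _ q(1) q(2)] real_distribution_distr char_lin_le[OF w \<epsilon>(1) 1]) auto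
      also have "\<epsilon> powr (q - 2) / t^3 \<le> t"
      proof -
        have "\<epsilon> powr (q - 2) = z ^ 20" using powr_rate[OF \<epsilon>(1)] by (simp add: z_def)
        also have "\<dots> \<le> z ^ 4" using z by (intro power_decreasing) auto
        also have "\<dots> \<le> t ^ 4" using z t by (intro power_mono) auto
        finally show ?thesis using t by (simp add: field_simps power4_eq_xxxx power3_eq_cube)
      qed
      then have "2 * (t + (B + 1) * \<epsilon> powr (q - 2) / t^3 * C3) \<le> 2 * (t + (B + 1) * t * C3)"
      proof -
        assume le: "\<epsilon> powr (q - 2) / t^3 \<le> t"
        have "(B + 1) * \<epsilon> powr (q - 2) / t^3 * C3 = (B + 1) * C3 * (\<epsilon> powr (q - 2) / t^3)" by simp
        also have "\<dots> \<le> (B + 1) * C3 * t" using le BC by (intro mult_left_mono) auto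
        also have "\<dots> = (B + 1) * t * C3" by simp
        finally show ?thesis by (intro mult_left_mono add_left_mono) auto
      qed
      also have "\<dots> = C * t" by (simp add: C_def algebra_simps)
      finally have "measure (distr M borel (lin J w)) {-t..t} \<le> C * t" by simp
      moreover have "lin J w -` {-t..t} \<inter> space M = {\<omega> \<in> space M. \<bar>lin J w \<omega>\<bar> \<le> t}"
        by auto
      ultimately show ?thesis by (simp add: measure_distr)
    qed
    show "prob {\<omega> \<in> space M. \<bar>lin J w \<omega>\<bar> \<le> \<tau>} \<le> C * (\<bar>\<tau>\<bar> + \<epsilon> powr rate)"
    proof (cases "\<tau> \<le> 1")
      case True
      have "prob {\<omega> \<in> space M. \<bar>lin J w \<omega>\<bar> \<le> \<tau>} \<le> prob {\<omega> \<in> space M. \<bar>lin J w \<omega>\<bar> \<le> t}"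
        using True by (intro finite_measure_mono) (auto simp: t_def)
      also have "\<dots> \<le> C * t" by (rule small)
      also have "\<dots> \<le> C * (\<bar>\<tau>\<bar> + \<epsilon> powr rate)" using t C by (intro mult_left_mono) (auto simp: z_def)
      finally show ?thesis .
    next
      case False
      have "prob {\<omega> \<in> space M. \<bar>lin J w \<omega>\<bar> \<le> \<tau>} \<le> 1" by simp
      also have "\<dots> \<le> C * 1" using C by simp
      also have "\<dots> \<le> C * (\<bar>\<tau>\<bar> + \<epsilon> powr rate)"
      proof (rule mult_left_mono)
        show "1 \<le> \<bar>\<tau>\<bar> + \<epsilon> powr rate" using False powr_ge_zero[of \<epsilon> rate] by linarith
      qed (use C in simp)
      finally show ?thesis .
    qed
  qed
qed

lemma lin_second_moment:
  "integrable M (\<lambda>\<omega>. (lin J w \<omega>)\<^sup>2)" "expectation (\<lambda>\<omega>. (lin J w \<omega>)\<^sup>2) = (\<Sum>j<J. (w j)\<^sup>2)"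
proof -
  have prod: "integrable M (\<lambda>\<omega>. \<xi> i \<omega> * \<xi> j \<omega>)" "expectation (\<lambda>\<omega>. \<xi> i \<omega> * \<xi> j \<omega>) = (if i = j then 1 else 0)" for i j
  proof -
    have iv: "indep_var borel (\<xi> i) borel (\<xi> j)" if "i \<noteq> j"
    proof -
      have "indep_var borel ((\<lambda>f. f i) \<circ> (\<lambda>\<omega>. restrict (\<lambda>i. \<xi> i \<omega>) {i})) borel ((\<lambda>f. f j) \<circ> (\<lambda>\<omega>. restrict (\<lambda>i. \<xi> i \<omega>) {j}))"
        using that by (intro indep_var_compose[OF indep_var_restrict[OF indep]]) auto
      then show ?thesis by (simp add: comp_def)
    qed
    show "integrable M (\<lambda>\<omega>. \<xi> i \<omega> * \<xi> j \<omega>)"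
      using indep_var_integrable[OF iv int_xi int_xi] int_sq[of i] by (cases "i = j") (auto simp: power2_eq_square)
    show "expectation (\<lambda>\<omega>. \<xi> i \<omega> * \<xi> j \<omega>) = (if i = j then 1 else 0)"
      using indep_var_lebesgue_integral[OF iv int_xi int_xi] second[of i] mean by (cases "i = j") (auto simp: power2_eq_square)
  qed
  have sq: "(\<lambda>\<omega>. (lin J w \<omega>)\<^sup>2) = (\<lambda>\<omega>. \<Sum>i<J. \<Sum>j<J. (w i * w j) * (\<xi> i \<omega> * \<xi> j \<omega>))"
    by (simp add: lin_def power2_eq_square sum_product mult_ac)
  show "integrable M (\<lambda>\<omega>. (lin J w \<omega>)\<^sup>2)" unfolding sq using prod by auto
  have "expectation (\<lambda>\<omega>. (lin J w \<omega>)\<^sup>2) = (\<Sum>i<J. \<Sum>j<J. (w i * w j) * (if i = j then 1 else 0))"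
    unfolding sq using prod by (simp add: Bochner_Integration.integral_sum)
  also have "\<dots> = (\<Sum>j<J. (w j)\<^sup>2)"
    by (simp add: power2_eq_square if_distrib[of "\<lambda>x. _ * x"] cong: if_cong)
  finally show "expectation (\<lambda>\<omega>. (lin J w \<omega>)\<^sup>2) = (\<Sum>j<J. (w j)\<^sup>2)" .
qed

text \<open>
  Universality: replace signs by sine integrals, compare these with the Gaussian pair of the same
  correlation, and go back to signs. For the Gaussian pair the probability is angle / pi exactly.
\<close>

theorem sign_change_prob:
  obtains C where "C > 0"
    and "\<And>J (w :: nat \<Rightarrow> real) w' (\<epsilon> :: real). (\<And>j. j < J \<Longrightarrow> \<bar>w j\<bar> \<le> \<epsilon>) \<Longrightarrow> (\<And>j. j < J \<Longrightarrow> \<bar>w' j\<bar> \<le> \<epsilon>) \<Longrightarrow> 0 < \<epsilon> \<Longrightarrow> \<epsilon> \<le> 1 \<Longrightarrow>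
       (\<Sum>j<J. (w j)\<^sup>2) = 1 \<Longrightarrow> (\<Sum>j<J. (w' j)\<^sup>2) = 1 \<Longrightarrow>
       \<bar>prob {\<omega> \<in> space M. sg (lin J w \<omega>) \<noteq> sg (lin J w' \<omega>)} - arccos (\<Sum>j<J. w j * w' j) / pi\<bar> \<le> C * \<epsilon> powr rate"
proof -
  obtain b0 where b0: "\<And>x. \<bar>Si x\<bar> \<le> b0" using bounded_Si by blast
  define b where "b = max 1 (2 / pi * b0)"
  have b1: "b \<ge> 1" by (simp add: b_def)
  have b: "\<bar>2 / pi * Si x\<bar> \<le> b" for x
    using mult_left_mono[OF b0[of x], of "2 / pi"] by (simp add: abs_mult b_def)
  obtain K where K: "K > 0" and sb: "\<And>J (w :: nat \<Rightarrow> real) (\<epsilon> :: real) \<tau>. (\<And>j. j < J \<Longrightarrow> \<bar>w j\<bar> \<le> \<epsilon>) \<Longrightarrow> 0 < \<epsilon> \<Longrightarrow> \<epsilon> \<le> 1 \<Longrightarrow> (\<Sum>j<J. (w j)\<^sup>2) = 1 \<Longrightarrow>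
       prob {\<omega> \<in> space M. \<bar>lin J w \<omega>\<bar> \<le> \<tau>} \<le> K * (\<bar>\<tau>\<bar> + \<epsilon> powr rate)"
    using small_ball by blast
  define D where "D = (2 / pi)\<^sup>2 * (4 + 8 * (B + 1)) + 2 * (b * (b + 1) * (4 * K + 4)) + 8 * b"
  show thesis
  proof (rule that)
    have "D \<ge> (2 / pi)\<^sup>2 * (4 + 8 * (B + 1))"
      using b1 K by (simp add: D_def add_nonneg_nonneg)
    moreover have "(2 / pi)\<^sup>2 * (4 + 8 * (B + 1)) > 0" using B_nonneg by (intro mult_pos_pos) auto
    ultimately show "D > 0" by linarith
    fix J and w w' :: "nat \<Rightarrow> real" and \<epsilon> :: real
    assume w: "\<And>j. j < J \<Longrightarrow> \<bar>w j\<bar> \<le> \<epsilon>" and w': "\<And>j. j < J \<Longrightarrow> \<bar>w' j\<bar> \<le> \<epsilon>" and \<epsilon>: "0 < \<epsilon>" "\<epsilon> \<le> 1"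
      and n: "(\<Sum>j<J. (w j)\<^sup>2) = 1" and n': "(\<Sum>j<J. (w' j)\<^sup>2) = 1"
    define \<rho> where "\<rho> = (\<Sum>j<J. w j * w' j)"
    define \<alpha> where "\<alpha> = arccos \<rho>"
    have "\<rho>\<^sup>2 \<le> 1"
      using Cauchy_Schwarz_ineq_sum[of w w' "{..<J}"] n n' by (simp add: \<rho>_def)
    then have \<rho>: "-1 \<le> \<rho>" "\<rho> \<le> 1" by (auto simp: abs_square_le_1 abs_le_iff)
    have \<alpha>: "0 \<le> \<alpha>" "\<alpha> \<le> pi" using \<rho> by (auto simp: \<alpha>_def arccos_lbound arccos_ubound)
    have cos\<alpha>: "cos \<alpha> = \<rho>" using \<rho> by (simp add: \<alpha>_def)
    have sc: "(sin \<alpha>)\<^sup>2 = 1 - \<rho>\<^sup>2" using sin_squared_eq[of \<alpha>] cos\<alpha> by simp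
    define z where "z = \<epsilon> powr rate"
    have z: "0 < z" "z \<le> 1" using \<epsilon> rate_pos by (auto simp: z_def intro!: powr_le1)
    have e: "\<epsilon> powr (q - 2) = z ^ 20" using powr_rate[OF \<epsilon>(1)] by (simp add: z_def)
    (* Every error is a multiple of z: 1 / (L z) for the sine integral, and with the strip width z^4
       the comparison of kernels costs z^4 * L and L^5 * z^20 / z^8. *)
    define L where "L = 1 / z\<^sup>2"
    have L: "L \<ge> 1" using z by (simp add: L_def power_le_one)
    let ?S2 = "\<lambda>p::real\<times>real. 1 * fst p + 0 * snd p" and ?T2 = "\<lambda>p. cos \<alpha> * fst p + sin \<alpha> * snd p"
    interpret A: normal_pair M "lin J w" "lin J w'"
      by unfold_locales (auto simp: lin_second_moment n n')
    interpret G: normal_pair normal2 ?S2 ?T2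
    proof
      show "integrable normal2 (\<lambda>\<omega>. (?S2 \<omega>)\<^sup>2)" "normal2.expectation (\<lambda>\<omega>. (?S2 \<omega>)\<^sup>2) \<le> 1"
        using normal2_second_moment[of 1 0] by auto
      show "integrable normal2 (\<lambda>\<omega>. (?T2 \<omega>)\<^sup>2)" "normal2.expectation (\<lambda>\<omega>. (?T2 \<omega>)\<^sup>2) \<le> 1"
        using normal2_second_moment[of "cos \<alpha>" "sin \<alpha>"] by auto
    qed measurable
    define E where "E = 8 * (B + 1) * L^3 * z^20"
    have E: "E \<ge> 0" using B_nonneg L z by (simp add: E_def)
    have cosdiff: "\<bar>expectation (\<lambda>\<omega>. cos (u * lin J w \<omega> + v * lin J w' \<omega>)) - normal2.expectation (\<lambda>p. cos (u * ?S2 p + v * ?T2 p))\<bar> \<le> E"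
      if uv: "\<bar>u\<bar> \<le> L" "\<bar>v\<bar> \<le> L" for u v
    proof -
      (* One characteristic function with weights \<theta> covers the joint distribution. *)
      define \<theta> where "\<theta> j = u * w j + v * w' j" for j
      have lin: "u * lin J w \<omega> + v * lin J w' \<omega> = lin J \<theta> \<omega>" for \<omega>
        by (simp add: lin_def \<theta>_def sum_distrib_left sum.distrib algebra_simps)
      have sq: "(\<Sum>j<J. (\<theta> j)\<^sup>2) = u\<^sup>2 + v\<^sup>2 + 2 * u * v * \<rho>"
      proof -
        have "(\<Sum>j<J. (\<theta> j)\<^sup>2) = (\<Sum>j<J. u\<^sup>2 * (w j)\<^sup>2 + v\<^sup>2 * (w' j)\<^sup>2 + (2 * u * v) * (w j * w' j))"
          by (intro sum.cong refl) (simp add: \<theta>_def power2_eq_square algebra_simps)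
        also have "\<dots> = u\<^sup>2 * (\<Sum>j<J. (w j)\<^sup>2) + v\<^sup>2 * (\<Sum>j<J. (w' j)\<^sup>2) + (2 * u * v) * \<rho>"
          by (simp only: sum.distrib sum_distrib_left \<rho>_def)
        finally show ?thesis by (simp add: n n')
      qed
      have "u * ?S2 p + v * ?T2 p = (u + v * cos \<alpha>) * fst p + (v * sin \<alpha>) * snd p" for p
        by (simp add: algebra_simps)
      then have g: "normal2.expectation (\<lambda>p. cos (u * ?S2 p + v * ?T2 p)) = exp (- (\<Sum>j<J. (\<theta> j)\<^sup>2) / 2)"
      proof -
        have "(u + v * cos \<alpha>)\<^sup>2 + (v * sin \<alpha>)\<^sup>2 = (\<Sum>j<J. (\<theta> j)\<^sup>2)"
          unfolding sq power_mult_distrib sc by (simp add: cos\<alpha> power2_eq_square algebra_simps)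
        then show ?thesis
          using normal2_cos(1)[of "u + v * cos \<alpha>" "v * sin \<alpha>"] \<open>\<And>p. u * ?S2 p + v * ?T2 p = _ p\<close> by simp
      qed
      have int: "integrable M (\<lambda>\<omega>. iexp (lin J \<theta> \<omega>))"
        by (rule integrable_const_bound[of _ 1]) auto
      have "char (distr M borel (lin J \<theta>)) 1 = (CLINT \<omega>|M. iexp (lin J \<theta> \<omega>))"
        by (simp add: char_def integral_distr)
      then have "Re (char (distr M borel (lin J \<theta>)) 1) = expectation (\<lambda>\<omega>. Re (iexp (lin J \<theta> \<omega>)))"
        using integral_Re[OF int] by simp
      also have "\<dots> = expectation (\<lambda>\<omega>. cos (lin J \<theta> \<omega>))" by (simp add: Re_exp)
      finally have f: "expectation (\<lambda>\<omega>. cos (lin J \<theta> \<omega>)) = Re (char (distr M borel (lin J \<theta>)) 1)" ..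
      have "\<bar>expectation (\<lambda>\<omega>. cos (lin J \<theta> \<omega>)) - exp (- (\<Sum>j<J. (\<theta> j)\<^sup>2) / 2)\<bar>
         = \<bar>Re (char (distr M borel (lin J \<theta>)) 1 - complex_of_real (exp (- (\<Sum>j<J. (\<theta> j)\<^sup>2) / 2)))\<bar>"
        by (simp only: f minus_complex.sel Re_complex_of_real)
      also have "\<dots> \<le> (B + 1) * (\<Sum>j<J. \<bar>\<theta> j\<bar> powr q)"
        by (rule order_trans[OF abs_Re_le_cmod char_lin])
      also have "(\<Sum>j<J. \<bar>\<theta> j\<bar> powr q) \<le> (2 * L * \<epsilon>) powr (q - 2) * (\<Sum>j<J. (\<theta> j)\<^sup>2)"
      proof (rule sum_powr_le)
        fix j assume "j < J"
        have "\<bar>\<theta> j\<bar> \<le> \<bar>u\<bar> * \<bar>w j\<bar> + \<bar>v\<bar> * \<bar>w' j\<bar>"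
          unfolding \<theta>_def by (rule order_trans[OF abs_triangle_ineq]) (simp add: abs_mult)
        also have "\<dots> \<le> L * \<epsilon> + L * \<epsilon>" using L uv w w' \<open>j < J\<close> by (intro add_mono mult_mono) auto
        finally show "\<bar>\<theta> j\<bar> \<le> 2 * L * \<epsilon>" by simp
      qed (use L \<epsilon> in auto)
      also have "(2 * L * \<epsilon>) powr (q - 2) * (\<Sum>j<J. (\<theta> j)\<^sup>2) \<le> (2 * L * z^20) * (4 * L\<^sup>2)"
      proof (intro mult_mono)
        have "(2 * L) powr (q - 2) \<le> (2 * L) powr 1" using L q by (intro powr_mono) auto
        then show "(2 * L * \<epsilon>) powr (q - 2) \<le> 2 * L * z^20"
          using L \<epsilon> e z by (simp add: powr_mult mult_right_mono)
        have "u\<^sup>2 \<le> L\<^sup>2" "v\<^sup>2 \<le> L\<^sup>2" using uv L by (auto simp: abs_le_square_iff[symmetric])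
        moreover have "2 * u * v * \<rho> \<le> 2 * L\<^sup>2"
        proof -
          have "2 * u * v * \<rho> \<le> 2 * (\<bar>u\<bar> * \<bar>v\<bar> * \<bar>\<rho>\<bar>)" by (metis abs_ge_self abs_mult mult.assoc mult_left_mono zero_le_numeral)
          also have "\<dots> \<le> 2 * (L * L * 1)" using uv L \<rho> by (intro mult_left_mono mult_mono) auto
          finally show ?thesis by (simp add: power2_eq_square)
        qed
        ultimately show "(\<Sum>j<J. (\<theta> j)\<^sup>2) \<le> 4 * L\<^sup>2" unfolding sq by linarith
      qed (use L z in \<open>auto intro!: sum_nonneg\<close>)
      finally have "\<bar>expectation (\<lambda>\<omega>. cos (lin J \<theta> \<omega>)) - exp (- (\<Sum>j<J. (\<theta> j)\<^sup>2) / 2)\<bar> \<le> (B + 1) * ((2 * L * z^20) * (4 * L\<^sup>2))"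
        using B_nonneg by (simp add: mult_left_mono)
      also have "\<dots> = E" by (simp add: E_def power2_eq_square power3_eq_cube)
      finally show ?thesis unfolding lin g .
    qed
    define sA where "sA = expectation (\<lambda>\<omega>. sg (lin J w \<omega>) * sg (lin J w' \<omega>))"
    define sG where "sG = normal2.expectation (\<lambda>p. sg (?S2 p) * sg (?T2 p))"
    define hA where "hA = expectation (\<lambda>\<omega>. (2 / pi * Si (L * lin J w \<omega>)) * (2 / pi * Si (L * lin J w' \<omega>)))"
    define hG where "hG = normal2.expectation (\<lambda>p. (2 / pi * Si (L * ?S2 p)) * (2 / pi * Si (L * ?T2 p)))"
    have h: "\<bar>hA - hG\<bar> \<le> (2 / pi)\<^sup>2 * ((4 + 8 * (B + 1)) * z)"
    proof -
      have hA: "hA = (2 / pi)\<^sup>2 * expectation (\<lambda>\<omega>. Si (L * lin J w \<omega>) * Si (L * lin J w' \<omega>))"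
        unfolding hA_def power2_eq_square integral_mult_right_zero[symmetric] by (intro Bochner_Integration.integral_cong) auto
      have hG: "hG = (2 / pi)\<^sup>2 * normal2.expectation (\<lambda>p. Si (L * ?S2 p) * Si (L * ?T2 p))"
        unfolding hG_def power2_eq_square integral_mult_right_zero[symmetric] by (intro Bochner_Integration.integral_cong) auto
      have "\<bar>expectation (\<lambda>\<omega>. Si (L * lin J w \<omega>) * Si (L * lin J w' \<omega>)) - normal2.expectation (\<lambda>p. Si (L * ?S2 p) * Si (L * ?T2 p))\<bar>
         \<le> 4 * z^4 * L + E * L\<^sup>2 / (z^4)\<^sup>2"
        using L z by (intro kern_compare[OF A.normal_pair_axioms G.normal_pair_axioms] E cosdiff) auto
      also have "4 * z^4 * L = 4 * z\<^sup>2" using z by (simp add: L_def power2_eq_square power4_eq_xxxx)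
      also have "E * L\<^sup>2 / (z^4)\<^sup>2 = 8 * (B + 1) * z\<^sup>2"
      proof -
        have "L^3 * z^20 * L\<^sup>2 / (z^4)\<^sup>2 = z\<^sup>2"
          using z by (simp add: L_def power_divide power_mult[symmetric] field_simps power_add[symmetric])
        moreover have "E * L\<^sup>2 / (z^4)\<^sup>2 = 8 * (B + 1) * (L^3 * z^20 * L\<^sup>2 / (z^4)\<^sup>2)"
          by (simp add: E_def mult_ac)
        ultimately show ?thesis by simp
      qed
      also have "4 * z\<^sup>2 + 8 * (B + 1) * z\<^sup>2 = (4 + 8 * (B + 1)) * z\<^sup>2" by (simp add: algebra_simps)
      also have "\<dots> \<le> (4 + 8 * (B + 1)) * z"
        using z B_nonneg by (intro mult_left_mono) (auto simp: power2_eq_square mult_left_le)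
      finally show ?thesis unfolding hA hG right_diff_distrib[symmetric] abs_mult
        by (simp add: mult_left_mono)
    qed
    have Lz: "4 / (L * z) = 4 * z" using z by (simp add: L_def power2_eq_square)
    have a: "\<bar>hA - sA\<bar> \<le> (b * (b + 1) * (4 * K + 4) + 4 * b) * z"
    proof -
      have "prob {\<omega> \<in> space M. \<bar>lin J w \<omega>\<bar> \<le> z} \<le> K * (2 * z)" "prob {\<omega> \<in> space M. \<bar>lin J w' \<omega>\<bar> \<le> z} \<le> K * (2 * z)"
        using sb[OF w \<epsilon> n, of z] sb[OF w' \<epsilon> n', of z] z by (simp_all add: z_def)
      then have "prob {\<omega> \<in> space M. \<bar>lin J w \<omega>\<bar> \<le> z} + prob {\<omega> \<in> space M. \<bar>lin J w' \<omega>\<bar> \<le> z} \<le> (4 * K + 4) * z"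
        using z by (simp add: algebra_simps)
      then have "b * (b + 1) * (prob {\<omega> \<in> space M. \<bar>lin J w \<omega>\<bar> \<le> z} + prob {\<omega> \<in> space M. \<bar>lin J w' \<omega>\<bar> \<le> z}) + b * (4 / (L * z))
         \<le> b * (b + 1) * ((4 * K + 4) * z) + b * (4 / (L * z))"
        using b1 by (intro add_right_mono mult_left_mono) auto
      also have "\<dots> = (b * (b + 1) * (4 * K + 4) + 4 * b) * z" by (simp add: Lz algebra_simps)
      finally show ?thesis
        unfolding hA_def sA_def using A.sg_Si_error[OF b b1 _ z(1), of L] L by linarith
    qed
    (* The Gaussian pair satisfies the small ball estimate with error term 0. *)
    have g: "\<bar>hG - sG\<bar> \<le> (b * (b + 1) * (4 * K + 4) + 4 * b) * z"
    proof -
      have sm: "normal2.P.prob {p \<in> space normal2. \<bar>x * fst p + y * snd p\<bar> \<le> z} \<le> 2 * z" if "x\<^sup>2 + y\<^sup>2 = 1" for x y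
      proof -
        have sc: "(u * x)\<^sup>2 + (u * y)\<^sup>2 = u\<^sup>2" for u
          using that by (simp add: power_mult_distrib distrib_left[symmetric])
        have "measure (distr normal2 borel (\<lambda>p. x * fst p + y * snd p)) {-z..z} \<le> 2 * (z + 0 / z^3 * (1 + (\<integral>u. \<bar>u\<bar>^3 \<partial>std_normal)))"
          using z by (intro small_ball_char[OF _ _ q(1) q(2)] normal2.P.real_distribution_distr) (auto simp: normal2_cos(2) sc)
        moreover have "(\<lambda>p. x * fst p + y * snd p) -` {-z..z} \<inter> space normal2 = {p \<in> space normal2. \<bar>x * fst p + y * snd p\<bar> \<le> z}"
          by auto
        ultimately show ?thesis by (subst (asm) measure_distr) auto
      qed
      have "normal2.P.prob {p \<in> space normal2. \<bar>?S2 p\<bar> \<le> z} \<le> 2 * z" "normal2.P.prob {p \<in> space normal2. \<bar>?T2 p\<bar> \<le> z} \<le> 2 * z"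
        using sm[of 1 0] sm[of "cos \<alpha>" "sin \<alpha>"] by simp_all
      then have "normal2.P.prob {p \<in> space normal2. \<bar>?S2 p\<bar> \<le> z} + normal2.P.prob {p \<in> space normal2. \<bar>?T2 p\<bar> \<le> z} \<le> (4 * K + 4) * z"
      proof -
        assume *: "normal2.P.prob {p \<in> space normal2. \<bar>?S2 p\<bar> \<le> z} \<le> 2 * z" "normal2.P.prob {p \<in> space normal2. \<bar>?T2 p\<bar> \<le> z} \<le> 2 * z"
        have "(4 * K + 4) * z = 4 * (K * z) + 4 * z" by (simp add: algebra_simps)
        then show ?thesis using * mult_pos_pos[OF K z(1)] by linarith
      qed
      then have "b * (b + 1) * (normal2.P.prob {p \<in> space normal2. \<bar>?S2 p\<bar> \<le> z} + normal2.P.prob {p \<in> space normal2. \<bar>?T2 p\<bar> \<le> z}) + b * (4 / (L * z))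
         \<le> b * (b + 1) * ((4 * K + 4) * z) + b * (4 / (L * z))"
        using b1 by (intro add_right_mono mult_left_mono) auto
      also have "\<dots> = (b * (b + 1) * (4 * K + 4) + 4 * b) * z" by (simp add: Lz algebra_simps)
      finally show ?thesis
        unfolding hG_def sG_def using G.sg_Si_error[OF b b1 _ z(1), of L] L by linarith
    qed
    show "\<bar>prob {\<omega> \<in> space M. sg (lin J w \<omega>) \<noteq> sg (lin J w' \<omega>)} - arccos (\<Sum>j<J. w j * w' j) / pi\<bar> \<le> D * \<epsilon> powr rate"
    proof -
      have pA: "2 * prob {\<omega> \<in> space M. sg (lin J w \<omega>) \<noteq> sg (lin J w' \<omega>)} = 1 - sA"
        unfolding sA_def by (rule prob_sg_neq) auto
      have pG: "2 * (\<alpha> / pi) = 1 - sG"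
        using normal2.P.prob_sg_neq[OF G.rvS G.rvT] gaussian_sign_change[OF \<alpha>] unfolding sG_def by simp
      have "\<bar>sA - sG\<bar> \<le> \<bar>hA - sA\<bar> + \<bar>hA - hG\<bar> + \<bar>hG - sG\<bar>" by linarith
      also have "\<dots> \<le> (b * (b + 1) * (4 * K + 4) + 4 * b) * z + (2 / pi)\<^sup>2 * ((4 + 8 * (B + 1)) * z) + (b * (b + 1) * (4 * K + 4) + 4 * b) * z"
        by (intro add_mono a h g)
      also have "\<dots> = D * z" by (simp add: D_def algebra_simps)
      finally have "\<bar>prob {\<omega> \<in> space M. sg (lin J w \<omega>) \<noteq> sg (lin J w' \<omega>)} - \<alpha> / pi\<bar> \<le> D * z"
        using pA pG by linarith
      then show ?thesis by (simp add: \<alpha>_def \<rho>_def z_def)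
    qed
  qed
qed

end

section \<open>A strong law for weakly dependent variables\<close>

lemma (in prob_space) AE_tendsto_0_of_summable_second_moment:
  fixes X :: "nat \<Rightarrow> 'a \<Rightarrow> real"
  assumes int: "\<And>k. integrable M (\<lambda>\<omega>. (X k \<omega>)\<^sup>2)" and [measurable]: "\<And>k. X k \<in> borel_measurable M"
    and sum: "summable (\<lambda>k. expectation (\<lambda>\<omega>. (X k \<omega>)\<^sup>2))"
  shows "AE \<omega> in M. (\<lambda>k. X k \<omega>) \<longlonglongrightarrow> 0"
proof -
  have "(\<integral>\<^sup>+\<omega>. (\<Sum>k. ennreal ((X k \<omega>)\<^sup>2)) \<partial>M) = (\<Sum>k. \<integral>\<^sup>+\<omega>. ennreal ((X k \<omega>)\<^sup>2) \<partial>M)"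
    by (rule nn_integral_suminf) measurable
  also have "\<dots> = (\<Sum>k. ennreal (expectation (\<lambda>\<omega>. (X k \<omega>)\<^sup>2)))"
    using int by (intro suminf_cong nn_integral_eq_integral) auto
  also have "\<dots> \<noteq> \<infinity>"
    using sum by (simp add: suminf_ennreal2)
  finally have "AE \<omega> in M. (\<Sum>k. ennreal ((X k \<omega>)\<^sup>2)) \<noteq> \<infinity>"
    by (intro nn_integral_PInf_AE) auto
  then show ?thesis
  proof eventually_elim
    case (elim \<omega>)
    then have "summable (\<lambda>k. (X k \<omega>)\<^sup>2)"
      by (intro summable_suminf_not_top) auto
    then have "(\<lambda>k. sqrt ((X k \<omega>)\<^sup>2)) \<longlonglongrightarrow> sqrt 0"
      by (intro tendsto_real_sqrt summable_LIMSEQ_zero)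
    then show ?case by (simp add: tendsto_rabs_zero_iff)
  qed
qed

text \<open>
  The partial sums of z and of \<mu> are monotone, and consecutive fourth powers have ratio tending
  to 1. So convergence along fourth powers controls what happens in between.
\<close>

lemma interpolate_quartic:
  fixes z \<mu> :: "nat \<Rightarrow> real"
  assumes z: "\<And>m. z m \<ge> 0" and \<mu>: "\<And>m. \<mu> m \<ge> 0" "\<And>m. \<mu> m \<le> A"
    and lim: "(\<lambda>k. (\<Sum>m<k^4. z m - \<mu> m) / real (k^4)) \<longlonglongrightarrow> 0"
  shows "(\<lambda>T. (\<Sum>m<T. z m - \<mu> m) / real T) \<longlonglongrightarrow> 0"
proof -
  define r where "r k = \<bar>(\<Sum>m<k^4. z m - \<mu> m) / real (k^4)\<bar>" for k :: nat
  have r: "r \<longlonglongrightarrow> 0" using lim unfolding r_def[abs_def] by (rule tendsto_rabs_zero)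
  (* The bound at T in terms of the neighbouring fourth powers k^4 and (k + 1)^4. *)
  define b where "b k = (r (Suc k) + A) * ((real k + 1)^4 / real k^4) + r k - A" for k :: nat
  have b: "b \<longlonglongrightarrow> 0"
  proof -
    have "(\<lambda>k. (real k + 1)^4 / real k^4) \<longlonglongrightarrow> 1" by real_asymp
    then have "b \<longlonglongrightarrow> (0 + A) * 1 + 0 - A"
      unfolding b_def[abs_def] by (intro tendsto_intros r LIMSEQ_Suc)
    then show ?thesis by simp
  qed
  define kf where "kf T = nat \<lfloor>root 4 (real T)\<rfloor>" for T :: nat
  have kf_lim: "filterlim kf at_top sequentially"
  proof -
    have "filterlim (\<lambda>T. nat \<lfloor>root 4 (real T)\<rfloor>) at_top sequentially"
    proof (rule filterlim_at_top[THEN iffD2, rule_format])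
      fix Z :: nat
      show "\<forall>\<^sub>F T in sequentially. Z \<le> nat \<lfloor>root 4 (real T)\<rfloor>"
        using eventually_ge_at_top[of "Z^4"]
      proof eventually_elim
        case (elim T)
        have "real Z = root 4 (real Z ^ 4)" by (simp add: real_root_power_cancel)
        also have "\<dots> \<le> root 4 (real T)" using elim by (intro real_root_le_mono) (auto simp flip: of_nat_power)
        finally show ?case by (simp add: le_nat_iff le_floor_iff)
      qed
    qed
    then show ?thesis by (simp add: kf_def[abs_def])
  qed
  have kf: "(kf T)^4 \<le> T" "T \<le> (Suc (kf T))^4" for T
  proof -
    have nn: "root 4 (real T) \<ge> 0" by simp
    have p: "root 4 (real T) ^ 4 = real T" by (simp add: real_root_pow_pos2)
    have "real (kf T) \<le> root 4 (real T)" using nn by (simp add: kf_def)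
    then have "real (kf T) ^ 4 \<le> real T" using power_mono[of "real (kf T)" "root 4 (real T)" 4] p by simp
    then show "(kf T)^4 \<le> T" by (simp flip: of_nat_power)
    have "root 4 (real T) \<le> real (Suc (kf T))" using nn unfolding kf_def by linarith
    then have "real T \<le> real (Suc (kf T)) ^ 4" using power_mono[of "root 4 (real T)" "real (Suc (kf T))" 4] p nn by simp
    then show "T \<le> (Suc (kf T))^4" by (metis of_nat_le_iff of_nat_power)
  qed
  have main: "\<bar>(\<Sum>m<T. z m - \<mu> m) / real T\<bar> \<le> b (kf T)" if T: "kf T \<ge> 1" for T
  proof -
    define k where "k = kf T"
    have k: "k \<ge> 1" "k^4 \<le> T" "T \<le> (Suc k)^4" using T kf[of T] by (auto simp: k_def)
    have k4: "real k ^ 4 > 0" using k by simp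
    have Tk: "real T \<ge> real k ^ 4" using k(2) by (simp flip: of_nat_power)
    define s where "s T = (\<Sum>m<T. z m)" for T
    define e where "e T = (\<Sum>m<T. \<mu> m)" for T
    have se: "(\<Sum>m<T. z m - \<mu> m) = s T - e T" for T by (simp add: s_def e_def sum_subtractf)
    have s1: "s (k^4) \<le> s T" "s T \<le> s ((Suc k)^4)" unfolding s_def using k z by (auto intro!: sum_mono2)
    have e1: "e (k^4) \<le> e T" "e T \<le> e ((Suc k)^4)" unfolding e_def using k \<mu> by (auto intro!: sum_mono2)
    have e2: "e ((Suc k)^4) - e (k^4) \<le> A * ((real k + 1)^4 - real k^4)"
    proof -
      have "k^4 \<le> (Suc k)^4" by (intro power_mono) auto
      then have "e ((Suc k)^4) - e (k^4) = (\<Sum>m\<in>{k^4..<(Suc k)^4}. \<mu> m)"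
        unfolding e_def by (simp add: sum_diff_nat_ivl[of 0, simplified] atLeast0LessThan[symmetric])
      also have "\<dots> \<le> real (card {k^4..<(Suc k)^4}) * A"
        using \<mu>(2) by (intro sum_bounded_above) auto
      also have "real (card {k^4..<(Suc k)^4}) = (real k + 1)^4 - real k^4"
        using \<open>k^4 \<le> (Suc k)^4\<close> by (simp add: of_nat_diff add.commute)
      finally show ?thesis by (simp add: mult.commute)
    qed
    have rk: "\<bar>s (k^4) - e (k^4)\<bar> = r k * real k^4" using k4 by (simp add: r_def se)
    have rk1: "\<bar>s ((Suc k)^4) - e ((Suc k)^4)\<bar> = r (Suc k) * (real k + 1)^4"
      by (simp add: r_def se add.commute)
    have "\<bar>s T - e T\<bar> \<le> r (Suc k) * (real k + 1)^4 + r k * real k^4 + A * ((real k + 1)^4 - real k^4)"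
      using s1 e1 e2 rk rk1 by linarith
    also have "\<dots> = b k * real k^4" using k4 by (simp add: b_def field_simps)
    finally have 1: "\<bar>s T - e T\<bar> \<le> b k * real k^4" .
    then have "b k \<ge> 0" using k4 by (meson abs_ge_zero order_trans zero_le_mult_iff less_le_not_le mult_le_0_iff zero_le_mult_iff not_le)
    then have "b k * real k^4 \<le> b k * real T" using Tk by (intro mult_left_mono)
    then have "\<bar>s T - e T\<bar> \<le> b k * real T" using 1 by linarith
    moreover have "real T > 0" using Tk k4 by linarith
    ultimately show ?thesis unfolding se k_def by (simp add: abs_divide divide_le_eq)
  qed
  show ?thesis
  proof (rule Lim_null_comparison)
    show "(\<lambda>T. b (kf T)) \<longlonglongrightarrow> 0" by (rule filterlim_compose[OF b kf_lim])
    have "\<forall>\<^sub>F T in sequentially. 1 \<le> kf T" using kf_lim by (simp add: filterlim_at_top)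
    then show "\<forall>\<^sub>F T in sequentially. norm ((\<Sum>m<T. z m - \<mu> m) / real T) \<le> b (kf T)"
      by eventually_elim (use main in auto)
  qed
qed

text \<open>
  Pairs closer than sqrt T contribute at most of order T * sqrt T to the variance of the sum of the
  first T variables, and the remaining pairs of order T. The variance of the mean is therefore of
  order T^(- 1/2), which is summable along T = k^4.
\<close>

theorem (in prob_space) strong_law_weakly_dependent:
  fixes Z :: "nat \<Rightarrow> 'a \<Rightarrow> real"
  assumes [measurable]: "\<And>m. Z m \<in> borel_measurable M" and nonneg: "\<And>m \<omega>. Z m \<omega> \<ge> 0"
    and int: "\<And>m. integrable M (\<lambda>\<omega>. (Z m \<omega>)\<^sup>2)"
    and A: "\<And>m. expectation (\<lambda>\<omega>. (Z m \<omega>)\<^sup>2) \<le> A"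
    and cov: "\<And>m l. m < l \<Longrightarrow> real (l - m) > sqrt (real l) \<Longrightarrow>
       \<bar>expectation (\<lambda>\<omega>. Z m \<omega> * Z l \<omega>) - expectation (Z m) * expectation (Z l)\<bar> \<le> A / real (Suc l)"
  shows "AE \<omega> in M. (\<lambda>T. (\<Sum>m<T. Z m \<omega> - expectation (Z m)) / real T) \<longlonglongrightarrow> 0"
proof -
  have A0: "A \<ge> 0" using A[of 0] by (rule order_trans[rotated]) (auto intro: integral_nonneg)
  have i1: "integrable M (Z m)" for m by (rule square_integrable_imp_integrable[OF _ int]) auto
  have iprod: "integrable M (\<lambda>\<omega>. Z m \<omega> * Z l \<omega>)" for m l
  proof (rule Bochner_Integration.integrable_bound)
    show "integrable M (\<lambda>\<omega>. ((Z m \<omega>)\<^sup>2 + (Z l \<omega>)\<^sup>2) / 2)" using int by auto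
    show "AE \<omega> in M. norm (Z m \<omega> * Z l \<omega>) \<le> norm (((Z m \<omega>)\<^sup>2 + (Z l \<omega>)\<^sup>2) / 2)"
    proof (rule AE_I2)
      fix \<omega>
      show "norm (Z m \<omega> * Z l \<omega>) \<le> norm (((Z m \<omega>)\<^sup>2 + (Z l \<omega>)\<^sup>2) / 2)"
        using sum_squares_bound[of "\<bar>Z m \<omega>\<bar>" "\<bar>Z l \<omega>\<bar>"] by (simp add: abs_mult)
    qed
  qed measurable
  define \<mu> where "\<mu> m = expectation (Z m)" for m
  define Y where "Y m \<omega> = Z m \<omega> - \<mu> m" for m \<omega>
  have [measurable]: "Y m \<in> borel_measurable M" for m unfolding Y_def[abs_def] by measurable
  define c where "c m l = expectation (\<lambda>\<omega>. Y m \<omega> * Y l \<omega>)" for m l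
  have Yprod: "Y m \<omega> * Y l \<omega> = Z m \<omega> * Z l \<omega> - \<mu> l * Z m \<omega> - \<mu> m * Z l \<omega> + \<mu> m * \<mu> l" for m l \<omega>
    by (simp add: Y_def algebra_simps)
  have iY: "integrable M (\<lambda>\<omega>. Y m \<omega> * Y l \<omega>)" for m l
    unfolding Yprod using iprod i1 by auto
  have c_eq: "c m l = expectation (\<lambda>\<omega>. Z m \<omega> * Z l \<omega>) - \<mu> m * \<mu> l" for m l
    unfolding c_def Yprod using iprod i1 by (simp add: prob_space \<mu>_def[symmetric])
  have \<mu>0: "\<mu> m \<ge> 0" for m unfolding \<mu>_def using nonneg by (auto intro: integral_nonneg)
  have cs: "c m m \<le> A" for m
    using A[of m] \<mu>0[of m] by (simp add: c_eq power2_eq_square) (smt (verit) mult_nonneg_nonneg)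
  have cA: "\<bar>c m l\<bar> \<le> A" for m l
  proof -
    have "\<bar>c m l\<bar> \<le> expectation (\<lambda>\<omega>. \<bar>Y m \<omega> * Y l \<omega>\<bar>)" unfolding c_def by (rule integral_abs_bound)
    also have "\<dots> \<le> expectation (\<lambda>\<omega>. (Y m \<omega> * Y m \<omega> + Y l \<omega> * Y l \<omega>) / 2)"
    proof (rule integral_mono)
      fix \<omega>
      show "\<bar>Y m \<omega> * Y l \<omega>\<bar> \<le> (Y m \<omega> * Y m \<omega> + Y l \<omega> * Y l \<omega>) / 2"
        using sum_squares_bound[of "\<bar>Y m \<omega>\<bar>" "\<bar>Y l \<omega>\<bar>"] by (simp add: abs_mult power2_eq_square)
    qed (use iY in auto)
    also have "\<dots> = (c m m + c l l) / 2" using iY by (simp add: c_def)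
    also have "\<dots> \<le> A" using cs[of m] cs[of l] by simp
    finally show ?thesis .
  qed
  have c_far: "\<bar>c m l\<bar> \<le> A / real (Suc l)" if "m < l" "real (l - m) > sqrt (real l)" for m l
    using cov[OF that] by (simp add: c_eq \<mu>_def)
  have c_sym: "c m l = c l m" for m l by (simp add: c_def mult.commute)
  have var: "expectation (\<lambda>\<omega>. (\<Sum>m<T. Y m \<omega>)\<^sup>2) \<le> 5 * A * real T * sqrt (real T)" if T: "T \<ge> 1" for T
  proof -
    let ?n = "\<lambda>m l. A * (if \<bar>real l - real m\<bar> \<le> sqrt (real T) then 1 else 0)"
    let ?f = "\<lambda>m l. A / real (Suc l) * (if m \<le> l then 1 else 0)"
    (* Near pairs by their variances, far pairs by the assumption with the larger index. *)
    have bound: "\<bar>c m l\<bar> \<le> ?n m l + (?f m l + ?f l m)" if "m < T" "l < T" for m l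
    proof (cases "\<bar>real l - real m\<bar> \<le> sqrt (real T)")
      case True
      moreover have "?f m l \<ge> 0" "?f l m \<ge> 0" using A0 by auto
      ultimately show ?thesis using cA[of m l] by (simp only: if_True mult_1_right)
    next
      case False
      consider "m < l" | "l < m" using False by (cases "m < l"; cases "l < m") auto
      then show ?thesis
      proof cases
        case 1
        have "sqrt (real l) \<le> sqrt (real T)" using that by simp
        then have "real (l - m) > sqrt (real l)" using False 1 by (simp only: of_nat_diff[OF less_imp_le])
        from c_far[OF 1 this] show ?thesis using 1 A0 False by simp
      next
        case 2
        have "sqrt (real m) \<le> sqrt (real T)" using that by simp
        then have "real (m - l) > sqrt (real m)" using False 2 by (simp only: of_nat_diff[OF less_imp_le])
        from c_far[OF 2 this] show ?thesis using 2 A0 False by (simp add: c_sym[of m l])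
      qed
    qed
    have sq: "(\<Sum>m<T. Y m \<omega>)\<^sup>2 = (\<Sum>m<T. \<Sum>l<T. Y m \<omega> * Y l \<omega>)" for \<omega>
      by (simp add: power2_eq_square sum_product)
    have "expectation (\<lambda>\<omega>. (\<Sum>m<T. Y m \<omega>)\<^sup>2) = (\<Sum>m<T. \<Sum>l<T. c m l)"
      unfolding sq c_def using iY by (simp add: Bochner_Integration.integral_sum)
    also have "\<dots> \<le> (\<Sum>m<T. \<Sum>l<T. ?n m l + (?f m l + ?f l m))"
      by (intro sum_mono order_trans[OF abs_ge_self bound]) auto
    also have "\<dots> = (\<Sum>m<T. \<Sum>l<T. ?n m l) + ((\<Sum>m<T. \<Sum>l<T. ?f m l) + (\<Sum>m<T. \<Sum>l<T. ?f l m))"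
      by (simp only: sum.distrib)
    also have "(\<Sum>m<T. \<Sum>l<T. ?f m l) = (\<Sum>m<T. \<Sum>l<T. ?f l m)"
      by (rule sum.swap)
    also have "(\<Sum>m<T. \<Sum>l<T. ?f l m) \<le> (\<Sum>m<T. A)"
    proof (rule sum_mono)
      fix m assume "m \<in> {..<T}"
      have "(\<Sum>l<T. ?f l m) = A / real (Suc m) * (\<Sum>l<T. if l \<le> m then 1 else 0)"
        by (simp only: sum_distrib_left)
      also have "(\<Sum>l<T. if l \<le> m then 1 else 0) = (\<Sum>l\<in>{..m}. (1::real))"
        using \<open>m \<in> {..<T}\<close> by (intro sum.mono_neutral_cong_right) auto
      also have "A / real (Suc m) * \<dots> = A" by simp
      finally show "(\<Sum>l<T. ?f l m) \<le> A" by simp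
    qed
    also have "(\<Sum>m<T. \<Sum>l<T. ?n m l) \<le> (\<Sum>m<T. A * (2 * sqrt (real T) + 1))"
    proof (rule sum_mono)
      fix m assume "m \<in> {..<T}"
      define s where "s = nat \<lfloor>sqrt (real T)\<rfloor>"
      have s: "real s \<le> sqrt (real T)" by (simp add: s_def)
      have "(\<Sum>l<T. ?n m l) = A * (\<Sum>l<T. if \<bar>real l - real m\<bar> \<le> sqrt (real T) then 1 else 0)"
        by (simp only: sum_distrib_left)
      also have "(\<Sum>l<T. if \<bar>real l - real m\<bar> \<le> sqrt (real T) then 1 else 0) = real (card {l\<in>{..<T}. \<bar>real l - real m\<bar> \<le> sqrt (real T)})"
        by (simp add: sum.If_cases Int_def)
      also have "card {l\<in>{..<T}. \<bar>real l - real m\<bar> \<le> sqrt (real T)} \<le> card {m - s..m + s}"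
      proof (rule card_mono)
        show "{l\<in>{..<T}. \<bar>real l - real m\<bar> \<le> sqrt (real T)} \<subseteq> {m - s..m + s}"
        proof safe
          fix l assume l: "\<bar>real l - real m\<bar> \<le> sqrt (real T)"
          have "\<bar>int l - int m\<bar> \<le> \<lfloor>sqrt (real T)\<rfloor>" using l by (subst le_floor_iff) simp
          then have "\<bar>int l - int m\<bar> \<le> int s" by (simp add: s_def)
          then show "l \<in> {m - s..m + s}" by auto
        qed
      qed simp
      also have "real (card {m - s..m + s}) \<le> 2 * real s + 1" by simp
      finally show "(\<Sum>l<T. ?n m l) \<le> A * (2 * sqrt (real T) + 1)"
        using A0 s by (smt (verit, best) mult_left_mono of_nat_mono)
    qed
    finally have "expectation (\<lambda>\<omega>. (\<Sum>m<T. Y m \<omega>)\<^sup>2) \<le> real T * (A * (2 * sqrt (real T) + 1)) + (real T * A + real T * A)"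
      by simp
    also have "\<dots> = A * real T * (2 * sqrt (real T) + 3)" by (simp add: algebra_simps)
    also have "\<dots> \<le> A * real T * (5 * sqrt (real T))" using A0 T by (intro mult_left_mono) auto
    finally show ?thesis by (simp add: mult_ac)
  qed
  define X where "X k \<omega> = (\<Sum>m<k^4. Y m \<omega>) / real (k^4)" for k :: nat and \<omega>
  have iX: "integrable M (\<lambda>\<omega>. (X k \<omega>)\<^sup>2)" for k
  proof -
    have "(\<lambda>\<omega>. (X k \<omega>)\<^sup>2) = (\<lambda>\<omega>. (\<Sum>m<k^4. \<Sum>l<k^4. Y m \<omega> * Y l \<omega>) / (real (k^4))\<^sup>2)"
      by (simp add: X_def power_divide power2_eq_square sum_product)
    then show ?thesis using iY by simp
  qed
  have "AE \<omega> in M. (\<lambda>k. X k \<omega>) \<longlonglongrightarrow> 0"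
  proof (rule AE_tendsto_0_of_summable_second_moment[OF iX])
    show "X k \<in> borel_measurable M" for k unfolding X_def[abs_def] by measurable
    show "summable (\<lambda>k. expectation (\<lambda>\<omega>. (X k \<omega>)\<^sup>2))"
    proof (rule summable_comparison_test')
      show "summable (\<lambda>k. 5 * A * inverse (real k ^ 2))"
        by (intro summable_mult inverse_power_summable) auto
      fix k :: nat assume k: "k \<ge> 1"
      have "expectation (\<lambda>\<omega>. (X k \<omega>)\<^sup>2) = expectation (\<lambda>\<omega>. (\<Sum>m<k^4. Y m \<omega>)\<^sup>2) / (real (k^4))\<^sup>2"
        by (simp add: X_def power_divide)
      also have "\<dots> \<le> 5 * A * real (k^4) * sqrt (real (k^4)) / (real (k^4))\<^sup>2"
        using k by (intro divide_right_mono var) auto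
      also have "sqrt (real (k^4)) = real k ^ 2"
        using real_sqrt_abs[of "real k ^ 2"] by (simp add: power_mult[symmetric])
      also have "5 * A * real (k^4) * real k ^ 2 / (real (k^4))\<^sup>2 = 5 * A * inverse (real k ^ 2)"
        using k by (simp add: field_simps power_mult[symmetric] power_add[symmetric])
      finally show "norm (expectation (\<lambda>\<omega>. (X k \<omega>)\<^sup>2)) \<le> 5 * A * inverse (real k ^ 2)"
        by (simp add: integral_nonneg)
    qed
  qed
  then show ?thesis
  proof eventually_elim
    case (elim \<omega>)
    have "\<mu> m \<le> A + 1" for m
    proof -
      have "\<mu> m \<le> expectation (\<lambda>\<omega>. (Z m \<omega>)\<^sup>2 + 1)"
        unfolding \<mu>_def
      proof (rule integral_mono)
        fix \<omega> show "Z m \<omega> \<le> (Z m \<omega>)\<^sup>2 + 1"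
          using zero_le_power2[of "Z m \<omega> - 1"] by (simp add: power2_eq_square algebra_simps) (smt (verit) nonneg)
      qed (use int i1 in auto)
      also have "\<dots> \<le> A + 1" using int A[of m] by (simp add: prob_space)
      finally show ?thesis .
    qed
    then show ?case using elim nonneg \<mu>0 unfolding \<mu>_def[symmetric]
      by (intro interpolate_quartic[where A = "A + 1"]) (auto simp: X_def Y_def)
  qed
qed

section \<open>Counting sign changes along families of linear forms\<close>

lemma sg_changes_measurable:
  fixes h :: "nat \<Rightarrow> 'z \<Rightarrow> real"
  assumes [measurable]: "\<And>i. h i \<in> borel_measurable N"
  shows "(\<lambda>x. \<Sum>i<n. if sg (h i x) \<noteq> sg (h (Suc i) x) then 1 else (0::real)) \<in> borel_measurable N"
  by measurable

context kac_coeffs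
begin

text \<open>
  The family of forms is indexed by the positions of a grid; all forms of a family are read off from
  the first J coefficients.
\<close>

definition changes :: "nat \<Rightarrow> (nat \<Rightarrow> nat \<Rightarrow> real) \<Rightarrow> nat \<Rightarrow> 'a \<Rightarrow> real"
  where "changes J W n \<omega> = (\<Sum>i<n. if sg (lin J (W i) \<omega>) \<noteq> sg (lin J (W (Suc i)) \<omega>) then 1 else 0)"

lemma changes_measurable [measurable]: "changes J W n \<in> borel_measurable M"
  unfolding changes_def[abs_def] by measurable

lemma changes_bounds: "0 \<le> changes J W n \<omega>" "changes J W n \<omega> \<le> real n"
proof -
  show "0 \<le> changes J W n \<omega>" unfolding changes_def by (intro sum_nonneg) auto
  have "changes J W n \<omega> \<le> (\<Sum>i<n. 1)" unfolding changes_def by (intro sum_mono) auto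
  then show "changes J W n \<omega> \<le> real n" by simp
qed

lemma sg_neq_imp: "sg x \<noteq> sg y \<Longrightarrow> \<bar>x\<bar> \<le> \<bar>x - y\<bar>"
  by (auto simp: sg_def split: if_splits)

lemma prob_large_le:
  assumes "\<delta> > 0"
  shows "prob {\<omega> \<in> space M. \<bar>lin J w \<omega>\<bar> \<ge> \<delta>} \<le> (\<Sum>j<J. (w j)\<^sup>2) / \<delta>\<^sup>2"
proof -
  have "{\<omega> \<in> space M. \<bar>lin J w \<omega>\<bar> \<ge> \<delta>} = {\<omega> \<in> space M. (lin J w \<omega>)\<^sup>2 \<ge> \<delta>\<^sup>2}"
    using assms by (auto simp: abs_le_square_iff[symmetric])
  then show ?thesis
    using integral_Markov_inequality_measure[OF lin_second_moment(1)[of J w], of "space M" "\<delta>\<^sup>2"] assms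
    by (simp add: lin_second_moment)
qed

text \<open>
  A form with its first J coefficients deleted, which makes it independent of \<xi> 0, ..., \<xi> (J - 1).
\<close>

definition tail_weights :: "nat \<Rightarrow> (nat \<Rightarrow> real) \<Rightarrow> nat \<Rightarrow> real"
  where "tail_weights J w j = (if j < J then 0 else w j)"

text \<open>
  If the sign changes, then the deleted part is at least as large as the form itself. So either the
  form is at most \<delta>, or the deleted part is at least \<delta>; Chebyshev's inequality and the
  bound \<delta>^3 on its variance make the latter unlikely.
\<close>

lemma truncation_prob:
  assumes C: "\<And>J (w :: nat \<Rightarrow> real) (\<epsilon> :: real) \<tau>. (\<And>j. j < J \<Longrightarrow> \<bar>w j\<bar> \<le> \<epsilon>) \<Longrightarrow> 0 < \<epsilon> \<Longrightarrow> \<epsilon> \<le> 1 \<Longrightarrow> (\<Sum>j<J. (w j)\<^sup>2) = 1 \<Longrightarrow>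
       prob {\<omega> \<in> space M. \<bar>lin J w \<omega>\<bar> \<le> \<tau>} \<le> C * (\<bar>\<tau>\<bar> + \<epsilon> powr rate)"
    and w: "\<And>j. j < J' \<Longrightarrow> \<bar>w j\<bar> \<le> \<epsilon>" "0 < \<epsilon>" "\<epsilon> \<le> 1" "(\<Sum>j<J'. (w j)\<^sup>2) = 1"
    and J: "J \<le> J'" and \<delta>: "\<delta> > 0" and low: "(\<Sum>j<J. (w j)\<^sup>2) \<le> \<delta>^3"
  shows "prob {\<omega> \<in> space M. sg (lin J' w \<omega>) \<noteq> sg (lin J' (tail_weights J w) \<omega>)} \<le> C * (\<delta> + \<epsilon> powr rate) + \<delta>"
proof -
  have diff: "lin J' w \<omega> - lin J' (tail_weights J w) \<omega> = lin J w \<omega>" for \<omega>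
  proof -
    have "lin J' w \<omega> - lin J' (tail_weights J w) \<omega> = (\<Sum>j<J'. if j < J then w j * \<xi> j \<omega> else 0)"
      by (simp add: lin_def tail_weights_def sum_subtractf[symmetric]) (intro sum.cong; simp)
    also have "\<dots> = lin J w \<omega>"
      unfolding lin_def using J by (intro sum.mono_neutral_cong_right) auto
    finally show ?thesis .
  qed
  have "prob {\<omega> \<in> space M. sg (lin J' w \<omega>) \<noteq> sg (lin J' (tail_weights J w) \<omega>)}
     \<le> prob ({\<omega> \<in> space M. \<bar>lin J' w \<omega>\<bar> \<le> \<delta>} \<union> {\<omega> \<in> space M. \<bar>lin J w \<omega>\<bar> \<ge> \<delta>})"
  proof (intro finite_measure_mono subsetI)
    fix \<omega> assume "\<omega> \<in> {\<omega> \<in> space M. sg (lin J' w \<omega>) \<noteq> sg (lin J' (tail_weights J w) \<omega>)}"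
    then have "\<omega> \<in> space M" "\<bar>lin J' w \<omega>\<bar> \<le> \<bar>lin J w \<omega>\<bar>" using sg_neq_imp diff by force+
    then show "\<omega> \<in> {\<omega> \<in> space M. \<bar>lin J' w \<omega>\<bar> \<le> \<delta>} \<union> {\<omega> \<in> space M. \<bar>lin J w \<omega>\<bar> \<ge> \<delta>}" by auto
  qed measurable
  also have "\<dots> \<le> prob {\<omega> \<in> space M. \<bar>lin J' w \<omega>\<bar> \<le> \<delta>} + prob {\<omega> \<in> space M. \<bar>lin J w \<omega>\<bar> \<ge> \<delta>}"
    by (intro measure_Un_le) measurable
  also have "\<dots> \<le> C * (\<bar>\<delta>\<bar> + \<epsilon> powr rate) + \<delta>^3 / \<delta>\<^sup>2"
    using \<delta> by (intro add_mono C w order_trans[OF prob_large_le[OF \<delta>]] divide_right_mono low) auto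
  also have "\<dots> = C * (\<delta> + \<epsilon> powr rate) + \<delta>" using \<delta> by (simp add: power3_eq_cube power2_eq_square)
  finally show ?thesis .
qed

lemma changes_indep_expectation:
  "expectation (\<lambda>\<omega>. changes J W n \<omega> * changes J' (\<lambda>i. tail_weights J (V i)) n' \<omega>)
     = expectation (changes J W n) * expectation (changes J' (\<lambda>i. tail_weights J (V i)) n')"
proof -
  define f where "f K (W :: nat \<Rightarrow> nat \<Rightarrow> real) n A x = (\<Sum>i<n. if sg (\<Sum>j\<in>K\<inter>A. W i j * x j) \<noteq> sg (\<Sum>j\<in>K\<inter>A. W (Suc i) j * x j) then 1 else (0::real))"
    for K :: "nat set" and W n A and x :: "nat \<Rightarrow> real"
  have fm: "f {..<J} W n A \<in> borel_measurable (PiM A (\<lambda>_. borel))" for J W n A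
  proof -
    have [measurable]: "(\<lambda>x. \<Sum>j\<in>{..<J}\<inter>A. W i j * x j) \<in> borel_measurable (PiM A (\<lambda>_. borel))" for i
      by (intro borel_measurable_sum borel_measurable_times measurable_component_singleton) auto
    show ?thesis unfolding f_def
      by (rule sg_changes_measurable[where h = "\<lambda>i x. \<Sum>j\<in>{..<J}\<inter>A. W i j * x j"]) measurable
  qed
  have 1: "changes J W n = f {..<J} W n {..<J} \<circ> (\<lambda>\<omega>. restrict (\<lambda>i. \<xi> i \<omega>) {..<J})"
    by (auto simp: changes_def f_def lin_def fun_eq_iff intro!: sum.cong)
  have eq: "lin J' (tail_weights J v) \<omega> = (\<Sum>j\<in>{..<J'}\<inter>{J..}. v j * restrict (\<lambda>i. \<xi> i \<omega>) {J..} j)" for v \<omega>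
    unfolding lin_def by (intro sum.mono_neutral_cong_right) (auto simp: tail_weights_def)
  have 2: "changes J' (\<lambda>i. tail_weights J (V i)) n' = f {..<J'} V n' {J..} \<circ> (\<lambda>\<omega>. restrict (\<lambda>i. \<xi> i \<omega>) {J..})"
    unfolding changes_def f_def comp_def eq ..
  have "indep_var borel (changes J W n) borel (changes J' (\<lambda>i. tail_weights J (V i)) n')"
    unfolding 1 2 by (intro indep_var_compose[OF indep_var_restrict[OF indep]] fm) auto
  then show ?thesis
    by (rule indep_var_lebesgue_integral)
      (rule integrable_const_bound[where B = "real n"] integrable_const_bound[where B = "real n'"], auto simp: abs_of_nonneg changes_bounds)+
qed

text \<open>
  Deleting the first J coefficients makes the later count independent of the earlier one, at the cost of
  an error that is controlled by the probabilities that a sign is affected.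
\<close>

lemma changes_cov:
  assumes p: "\<And>i. i \<le> n' \<Longrightarrow> prob {\<omega> \<in> space M. sg (lin J' (V i) \<omega>) \<noteq> sg (lin J' (tail_weights J (V i)) \<omega>)} \<le> p"
  shows "\<bar>expectation (\<lambda>\<omega>. changes J W n \<omega> * changes J' V n' \<omega>) - expectation (changes J W n) * expectation (changes J' V n')\<bar>
     \<le> 4 * real n * real n' * p"
proof -
  let ?X = "changes J W n" and ?Y = "changes J' V n'" and ?Y' = "changes J' (\<lambda>i. tail_weights J (V i)) n'"
  let ?I = "\<lambda>i. indicat_real {\<omega> \<in> space M. sg (lin J' (V i) \<omega>) \<noteq> sg (lin J' (tail_weights J (V i)) \<omega>)}"
  have bi: "integrable M f" if "f \<in> borel_measurable M" "\<And>\<omega>. \<bar>f \<omega>\<bar> \<le> b" for f and b :: real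
    using that by (intro integrable_const_bound[of _ b]) auto
  have iX: "integrable M ?X" and iY: "integrable M ?Y" and iY': "integrable M ?Y'"
    using bi[of ?X "real n"] bi[of ?Y "real n'"] bi[of ?Y' "real n'"] by (auto simp: abs_of_nonneg changes_bounds)
  have iXY: "integrable M (\<lambda>\<omega>. ?X \<omega> * changes J' V' n' \<omega>)" for V'
    by (rule bi[of _ "real n * real n'"]) (auto simp: abs_of_nonneg changes_bounds intro!: mult_mono)
  have iI: "integrable M (?I i)" for i by (rule bi[of _ 1]) auto
  have D: "expectation (\<lambda>\<omega>. \<bar>?Y \<omega> - ?Y' \<omega>\<bar>) \<le> 2 * real n' * p"
  proof -
    have "expectation (\<lambda>\<omega>. \<bar>?Y \<omega> - ?Y' \<omega>\<bar>) \<le> expectation (\<lambda>\<omega>. \<Sum>i<n'. ?I i \<omega> + ?I (Suc i) \<omega>)"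
    proof (rule integral_mono)
      fix \<omega> assume \<omega>: "\<omega> \<in> space M"
      have "\<bar>?Y \<omega> - ?Y' \<omega>\<bar> \<le> (\<Sum>i<n'. \<bar>(if sg (lin J' (V i) \<omega>) \<noteq> sg (lin J' (V (Suc i)) \<omega>) then 1 else 0)
           - (if sg (lin J' (tail_weights J (V i)) \<omega>) \<noteq> sg (lin J' (tail_weights J (V (Suc i))) \<omega>) then 1 else 0)\<bar>)"
        unfolding changes_def sum_subtractf[symmetric] by (rule sum_abs)
      also have "\<dots> \<le> (\<Sum>i<n'. ?I i \<omega> + ?I (Suc i) \<omega>)"
        using \<omega> by (intro sum_mono) (auto simp: indicator_def sg_def)
      finally show "\<bar>?Y \<omega> - ?Y' \<omega>\<bar> \<le> (\<Sum>i<n'. ?I i \<omega> + ?I (Suc i) \<omega>)" .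
    qed (use iY iY' iI in auto)
    also have "\<dots> = (\<Sum>i<n'. expectation (?I i) + expectation (?I (Suc i)))"
      using iI by (subst Bochner_Integration.integral_sum) auto
    also have "\<dots> \<le> (\<Sum>i<n'. p + p)"
      by (intro sum_mono add_mono) (auto intro!: p)
    finally show ?thesis by simp
  qed
  have e1: "\<bar>expectation (\<lambda>\<omega>. ?X \<omega> * ?Y \<omega>) - expectation (\<lambda>\<omega>. ?X \<omega> * ?Y' \<omega>)\<bar> \<le> real n * (2 * real n' * p)"
  proof -
    have "\<bar>expectation (\<lambda>\<omega>. ?X \<omega> * ?Y \<omega>) - expectation (\<lambda>\<omega>. ?X \<omega> * ?Y' \<omega>)\<bar> = \<bar>expectation (\<lambda>\<omega>. ?X \<omega> * ?Y \<omega> - ?X \<omega> * ?Y' \<omega>)\<bar>"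
      using iXY by simp
    also have "\<dots> \<le> expectation (\<lambda>\<omega>. \<bar>?X \<omega> * ?Y \<omega> - ?X \<omega> * ?Y' \<omega>\<bar>)" by (rule integral_abs_bound)
    also have "\<dots> \<le> expectation (\<lambda>\<omega>. real n * \<bar>?Y \<omega> - ?Y' \<omega>\<bar>)"
    proof (rule integral_mono)
      fix \<omega>
      have "\<bar>?X \<omega> * ?Y \<omega> - ?X \<omega> * ?Y' \<omega>\<bar> = ?X \<omega> * \<bar>?Y \<omega> - ?Y' \<omega>\<bar>"
        by (simp add: right_diff_distrib[symmetric] abs_mult abs_of_nonneg changes_bounds)
      also have "\<dots> \<le> real n * \<bar>?Y \<omega> - ?Y' \<omega>\<bar>" by (intro mult_right_mono changes_bounds) auto
      finally show "\<bar>?X \<omega> * ?Y \<omega> - ?X \<omega> * ?Y' \<omega>\<bar> \<le> real n * \<bar>?Y \<omega> - ?Y' \<omega>\<bar>" .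
    qed (use iXY iY iY' in auto)
    also have "\<dots> \<le> real n * (2 * real n' * p)" using D by (simp add: mult_left_mono)
    finally show ?thesis .
  qed
  have e2: "\<bar>expectation ?X * expectation ?Y' - expectation ?X * expectation ?Y\<bar> \<le> real n * (2 * real n' * p)"
  proof -
    have "0 \<le> expectation ?X" by (intro integral_nonneg_AE AE_I2 changes_bounds)
    moreover have "expectation ?X \<le> real n"
      using integral_mono[OF iX, of "\<lambda>_. real n"] changes_bounds by (simp add: prob_space)
    moreover have "\<bar>expectation ?Y' - expectation ?Y\<bar> \<le> 2 * real n' * p"
      using D integral_abs_bound[of M "\<lambda>\<omega>. ?Y \<omega> - ?Y' \<omega>"] iY iY' by (simp add: abs_minus_commute)
    ultimately show ?thesis
      unfolding right_diff_distrib[symmetric] abs_mult by (intro mult_mono) auto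
  qed
  show ?thesis
    using e1 e2 changes_indep_expectation[of J W n J' V n'] by (simp add: algebra_simps) 
qed

end

section \<open>Iterated partial sums and Descartes' rule of signs\<close>

definition sign_changes :: "(nat \<Rightarrow> real) \<Rightarrow> nat \<Rightarrow> nat \<Rightarrow> nat"
  where "sign_changes s a b = card {j \<in> {a<..b}. sg (s j) \<noteq> sg (s (j - 1))}"

lemma sign_changes_refl [simp]: "sign_changes s a a = 0"
  by (simp add: sign_changes_def)

lemma sign_changes_Suc: "a \<le> b \<Longrightarrow> sign_changes s a (Suc b) = sign_changes s a b + (if sg (s (Suc b)) \<noteq> sg (s b) then 1 else 0)"
proof -
  assume "a \<le> b"
  then have "{j \<in> {a<..Suc b}. sg (s j) \<noteq> sg (s (j - 1))} =
     (if sg (s (Suc b)) \<noteq> sg (s b) then insert (Suc b) {j \<in> {a<..b}. sg (s j) \<noteq> sg (s (j - 1))}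
      else {j \<in> {a<..b}. sg (s j) \<noteq> sg (s (j - 1))})"
    by (auto simp: le_Suc_eq)
  then show ?thesis by (simp add: sign_changes_def)
qed

lemma sign_changes_split: "a \<le> b \<Longrightarrow> b \<le> c \<Longrightarrow> sign_changes s a c = sign_changes s a b + sign_changes s b c"
proof -
  assume ab: "a \<le> b"
  assume "b \<le> c"
  then show ?thesis
  proof (induction c rule: dec_induct)
    case (step n)
    then show ?case using ab by (simp add: sign_changes_Suc)
  qed simp
qed

lemma sign_changes_mono: "a' \<le> a \<Longrightarrow> a \<le> b \<Longrightarrow> b \<le> b' \<Longrightarrow> sign_changes s a b \<le> sign_changes s a' b'"
  unfolding sign_changes_def by (intro card_mono) auto

lemma sign_changes_cong: "(\<And>j. a \<le> j \<Longrightarrow> j \<le> b \<Longrightarrow> s j = t j) \<Longrightarrow> sign_changes s a b = sign_changes t a b"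
  unfolding sign_changes_def by (intro arg_cong[where f = card] Collect_cong) auto

lemma sign_changes_le: "sign_changes s a b \<le> b - a"
proof -
  have "card {j \<in> {a<..b}. sg (s j) \<noteq> sg (s (j - 1))} \<le> card {a<..b}" by (intro card_mono) auto
  then show ?thesis unfolding sign_changes_def by simp
qed

lemma sign_changes_pos_of_sg_neq: "a \<le> b \<Longrightarrow> sg (s a) \<noteq> sg (s b) \<Longrightarrow> sign_changes s a b \<ge> 1"
proof (induction b rule: dec_induct)
  case (step n)
  then show ?case by (cases "sg (s a) = sg (s n)") (auto simp: sign_changes_Suc)
qed simp

lemma sign_changes_eq_0: "a \<le> b \<Longrightarrow> sign_changes s a b = 0 \<Longrightarrow> sg (s a) = sg (s b)"
  using sign_changes_pos_of_sg_neq[of a b s] by linarith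

lemma sign_changes_eq_1: "a \<le> b \<Longrightarrow> sign_changes s a b = 1 \<Longrightarrow> sg (s a) \<noteq> sg (s b)"
proof (induction b rule: dec_induct)
  case (step n)
  then show ?case
    by (auto simp: sign_changes_Suc sg_def split: if_splits dest!: sign_changes_eq_0[OF step.hyps(1)])
qed simp

text \<open>
  Between two consecutive changes of sign of s, the increment that crosses zero has the new sign of s;
  hence the increments d change sign as well, with one possible exception.
\<close>

lemma sign_changes_difference:
  assumes "a \<le> b" and d: "\<And>j. a < j \<Longrightarrow> j \<le> b \<Longrightarrow> s j - s (j - 1) = d j"
  shows "sign_changes s a b \<le> sign_changes d a b + 1"
proof -
  have "sign_changes s a b = 0 \<or> sign_changes s a b \<le> sign_changes d a b + (if sg (d b) = sg (s b) then 1 else 0)"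
    using assms
  proof (induction b rule: dec_induct)
    case (step n)
    have IH: "sign_changes s a n = 0 \<or> sign_changes s a n \<le> sign_changes d a n + (if sg (d n) = sg (s n) then 1 else 0)"
      using step by auto
    have dn: "s (Suc n) - s n = d (Suc n)" using step.prems[of "Suc n"] step.hyps by simp
    show ?case
    proof (cases "sg (s (Suc n)) = sg (s n)")
      case True
      then show ?thesis using IH step.hyps by (auto simp: sign_changes_Suc sg_def split: if_splits)
    next
      case False
      then have "sg (d (Suc n)) = sg (s (Suc n))" using dn by (auto simp: sg_def split: if_splits)
      then show ?thesis using IH False step.hyps by (auto simp: sign_changes_Suc sg_def split: if_splits)
    qed
  qed simp
  then show ?thesis by (auto split: if_splits)
qed

text \<open>
  The coefficients of X(t) / (1 - t)^k, where X is the generating function of x.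
\<close>

fun psum :: "nat \<Rightarrow> (nat \<Rightarrow> real) \<Rightarrow> nat \<Rightarrow> real" where
  "psum 0 x n = x n"
| "psum (Suc k) x n = (\<Sum>j\<le>n. psum k x j)"

lemma psum_0 [simp]: "psum 0 x = x"
  by (rule ext) simp

lemma psum_diff: "j \<ge> 1 \<Longrightarrow> psum (Suc k) x j - psum (Suc k) x (j - 1) = psum k x j"
  by (cases j) auto

lemma psum_cong: "(\<And>j. j \<le> n \<Longrightarrow> x j = y j) \<Longrightarrow> psum k x n = psum k y n"
proof (induction k arbitrary: n)
  case (Suc k)
  then show ?case by (auto intro!: sum.cong)
qed simp

lemma sign_changes_psum: "a \<le> b \<Longrightarrow> i \<le> k \<Longrightarrow> sign_changes (psum k x) a b \<le> sign_changes (psum (k - i) x) a b + i"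
proof (induction i)
  case (Suc i)
  then obtain k' where k': "k - i = Suc k'" "k - Suc i = k'" by (metis Suc_diff_Suc Suc_le_lessD)
  have "sign_changes (psum (k - i) x) a b \<le> sign_changes (psum (k - Suc i) x) a b + 1"
    unfolding k' by (intro sign_changes_difference Suc psum_diff) auto
  then show ?case using Suc by simp
qed simp

text \<open>
  A sequence that changes sign is bounded by its total variation.
\<close>

lemma abs_le_sum_differences:
  assumes ab: "a \<le> b" and d: "\<And>j. a < j \<Longrightarrow> j \<le> b \<Longrightarrow> s j - s (j - 1) = d j"
    and v: "sign_changes s a b \<ge> 1" and j: "a \<le> j" "j \<le> b"
  shows "\<bar>s j\<bar> \<le> (\<Sum>l\<in>{a<..b}. \<bar>d l\<bar>)"
proof -
  have tel: "\<bar>s v - s u\<bar> \<le> (\<Sum>l\<in>{a<..b}. \<bar>d l\<bar>)" if "a \<le> u" "u \<le> v" "v \<le> b" for u v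
  proof -
    have "s v - s u = (\<Sum>l\<in>{u<..v}. d l)"
      using that(2,3)
    proof (induction v rule: dec_induct)
      case (step n)
      have "{u<..Suc n} = insert (Suc n) {u<..n}" using step by auto
      then show ?case using step d[of "Suc n"] that(1) by simp
    qed simp
    also have "\<bar>\<dots>\<bar> \<le> (\<Sum>l\<in>{u<..v}. \<bar>d l\<bar>)" by (rule sum_abs)
    also have "\<dots> \<le> (\<Sum>l\<in>{a<..b}. \<bar>d l\<bar>)" using that by (intro sum_mono2) auto
    finally show ?thesis .
  qed
  have "\<exists>i\<in>{a..b}. sg (s i) \<noteq> sg (s j)"
  proof (rule ccontr)
    assume "\<not> ?thesis"
    then have c: "\<And>i. i \<in> {a..b} \<Longrightarrow> sg (s i) = sg (s j)" by blast
    have "sg (s i) = sg (s (i - 1))" if "i \<in> {a<..b}" for i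
    proof -
      have "i \<in> {a..b}" "i - 1 \<in> {a..b}" using that by auto
      then show ?thesis using c[of i] c[of "i - 1"] by simp
    qed
    then have "{i \<in> {a<..b}. sg (s i) \<noteq> sg (s (i - 1))} = {}" by blast
    then show False using v unfolding sign_changes_def by (simp only: card.empty)
  qed
  then obtain i where i: "i \<in> {a..b}" "sg (s i) \<noteq> sg (s j)" by blast
  then have "\<bar>s j\<bar> \<le> \<bar>s j - s i\<bar>" by (auto simp: sg_def split: if_splits)
  also have "\<dots> \<le> (\<Sum>l\<in>{a<..b}. \<bar>d l\<bar>)"
    using tel[of i j] tel[of j i] i j by (cases "i \<le> j") (auto simp: abs_minus_commute)
  finally show ?thesis .
qed

text \<open>
  The sums of order k, k - 1, ..., k - r + 1 all change sign in the interval, by discrete Rolle. So each of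
  them is bounded by the total variation of itself, that is by the sum of the absolute values at the
  next lower order.
\<close>

lemma psum_small_of_many_changes:
  assumes ab: "a \<le> b" and r: "1 \<le> r" "r \<le> k" and v: "sign_changes (psum k x) a b \<ge> r"
  shows "\<bar>psum k x a\<bar> \<le> real (b - a) ^ (r - 1) * (\<Sum>l\<in>{a<..b}. \<bar>psum (k - r) x l\<bar>)"
proof -
  define S where "S i = (\<Sum>l\<in>{a<..b}. \<bar>psum (k - i) x l\<bar>)" for i
  have bd: "\<bar>psum (k - i) x j\<bar> \<le> S (Suc i)" if i: "i < r" and j: "a \<le> j" "j \<le> b" for i j
  proof -
    obtain k' where k': "k - i = Suc k'" "k - Suc i = k'" using i r by (metis Suc_diff_Suc le_trans not_less Suc_leI less_le_trans)
    have "sign_changes (psum (k - i) x) a b \<ge> 1" using sign_changes_psum[OF ab, of i k x] v i r by linarith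
    then have v1: "sign_changes (psum (Suc k') x) a b \<ge> 1" unfolding k' .
    show ?thesis unfolding S_def k'
      by (rule abs_le_sum_differences[OF ab psum_diff v1 j]) simp
  qed
  have step: "S i \<le> real (b - a) * S (Suc i)" if "i < r" for i
    unfolding S_def[of i] using sum_bounded_above[of "{a<..b}" "\<lambda>l. \<bar>psum (k - i) x l\<bar>" "S (Suc i)"] bd[OF that]
    by simp
  have "S (Suc 0) \<le> real (b - a) ^ i * S (Suc i)" if "i < r" for i
    using that
  proof (induction i)
    case (Suc i)
    have "S (Suc 0) \<le> real (b - a) ^ i * S (Suc i)" using Suc by simp
    also have "\<dots> \<le> real (b - a) ^ i * (real (b - a) * S (Suc (Suc i)))"
      using Suc.prems by (intro mult_left_mono step) auto
    finally show ?case by (simp add: mult_ac)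
  qed simp
  from this[of "r - 1"] have "S (Suc 0) \<le> real (b - a) ^ (r - 1) * S r" using r by simp
  moreover have "\<bar>psum k x a\<bar> \<le> S (Suc 0)" using bd[of 0 a] r ab by simp
  ultimately show ?thesis by (simp add: S_def)
qed

text \<open>
  Strict alternation, with nonzero values. In Descartes' argument zero terms must not count, whereas
  sign_changes treats 0 as positive.
\<close>

definition alternates :: "(nat \<Rightarrow> real) \<Rightarrow> nat \<Rightarrow> bool"
  where "alternates s N \<longleftrightarrow> (\<exists>j :: nat \<Rightarrow> nat. s (j 0) \<noteq> 0 \<and> (\<forall>i<N. j i < j (Suc i) \<and> s (j i) * s (j (Suc i)) < 0))"

lemma alternates_antimono: "alternates s N \<Longrightarrow> N' \<le> N \<Longrightarrow> alternates s N'"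
  unfolding alternates_def by (meson less_le_trans)

lemma alternates_scale:
  assumes "alternates s N" and "\<And>i. \<exists>c. c \<noteq> 0 \<and> t i = c * s i \<and> sgn c = \<sigma>"
  shows "alternates t N"
proof -
  from assms(1) obtain j where j: "s (j 0) \<noteq> 0" "\<And>i. i < N \<Longrightarrow> j i < j (Suc i) \<and> s (j i) * s (j (Suc i)) < 0"
    unfolding alternates_def by blast
  have "t (j i) * t (j (Suc i)) < 0" if "i < N" for i
  proof -
    obtain c c' where c: "c \<noteq> 0" "t (j i) = c * s (j i)" "sgn c = \<sigma>" "c' \<noteq> 0" "t (j (Suc i)) = c' * s (j (Suc i))" "sgn c' = \<sigma>"
      using assms(2) by metis
    have "c * c' > 0" using c(1,3,4,6) by (metis sgn_greater sgn_less linorder_neqE_linordered_idom mult_neg_neg mult_pos_pos not_less_iff_gr_or_eq)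
    moreover have "s (j i) * s (j (Suc i)) < 0" using j(2) that by blast
    ultimately have "(c * c') * (s (j i) * s (j (Suc i))) < 0" by (rule mult_pos_neg)
    then show ?thesis by (simp add: c mult_ac)
  qed
  moreover have "t (j 0) \<noteq> 0" using assms(2)[of "j 0"] j(1) by auto
  ultimately show ?thesis unfolding alternates_def using j(2) by blast
qed

lemma alternates_sign_changes:
  assumes "alternates s N"
  obtains b where "sign_changes s 0 b \<ge> N"
proof -
  from assms obtain j where j: "\<And>i. i < N \<Longrightarrow> j i < j (Suc i) \<and> s (j i) * s (j (Suc i)) < 0"
    unfolding alternates_def by blast
  have "i \<le> N \<Longrightarrow> sign_changes s 0 (j i) \<ge> i" for i
  proof (induction i)
    case (Suc i)
    have "sign_changes s 0 (j (Suc i)) = sign_changes s 0 (j i) + sign_changes s (j i) (j (Suc i))"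
      using j[of i] Suc.prems by (intro sign_changes_split) auto
    moreover have "sign_changes s (j i) (j (Suc i)) \<ge> 1"
      using j[of i] Suc.prems by (intro sign_changes_pos_of_sg_neq) (auto simp: sg_def mult_less_0_iff)
    ultimately show ?case using Suc by simp
  qed simp
  then show thesis using that[of "j N"] by blast
qed

text \<open>
  The step of Descartes' rule: an alternating sequence that starts from 0 (before index 0) and returns to
  0 in the limit has increments that alternate once more often.
\<close>

lemma alternates_difference:
  fixes h d :: "nat \<Rightarrow> real"
  assumes alternates: "alternates h N" and lim: "h \<longlonglongrightarrow> 0"
    and d0: "d 0 = h 0" and d: "\<And>i. d (Suc i) = h (Suc i) - h i"
  shows "alternates d (Suc N)"
proof -
  from alternates obtain j where j0: "h (j 0) \<noteq> 0" and j: "\<And>i. i < N \<Longrightarrow> j i < j (Suc i) \<and> h (j i) * h (j (Suc i)) < 0"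
    unfolding alternates_def by blast
  have hnz: "h (j i) \<noteq> 0" if "i \<le> N" for i
    using j0 j[of "i - 1"] that by (cases i) auto
  have sum0: "(\<Sum>i\<le>n. d i) = h n" for n by (induction n) (auto simp: d0 d)
  have sum1: "(\<Sum>i\<in>{a<..b}. d i) = h b - h a" if "a \<le> b" for a b
    using that
  proof (induction b rule: dec_induct)
    case (step n)
    have "{a<..Suc n} = insert (Suc n) {a<..n}" using step by auto
    then show ?case using step by (simp add: d)
  qed simp
  have ex: "\<exists>i\<in>A. d i * y > 0" if "finite A" "(\<Sum>i\<in>A. d i) * y > 0" for A and y :: real
  proof (rule ccontr)
    assume "\<not> ?thesis"
    then have "(\<Sum>i\<in>A. d i * y) \<le> 0" by (intro sum_nonpos) (auto simp: not_less)
    then show False using that by (simp add: sum_distrib_right)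
  qed
  (* Up to j 0 some increment has the sign of h (j 0), because the sum of these increments is h (j 0). *)
  have first: "\<exists>i. i \<le> j 0 \<and> d i * h (j 0) > 0"
  proof -
    have "(\<Sum>i\<le>j 0. d i) * h (j 0) > 0" unfolding sum0 using j0 by (simp add: zero_less_mult_iff) linarith
    then show ?thesis using ex[of "{..j 0}" "h (j 0)"] by auto
  qed
  have mid: "\<exists>i. j t < i \<and> i \<le> j (Suc t) \<and> d i * h (j (Suc t)) > 0" if "t < N" for t
  proof -
    have "(\<Sum>i\<in>{j t<..j (Suc t)}. d i) * h (j (Suc t)) = h (j (Suc t)) * h (j (Suc t)) - h (j t) * h (j (Suc t))"
      using j[OF that] by (subst sum1) (auto simp: algebra_simps)
    also have "\<dots> > 0" using j[OF that] zero_le_square[of "h (j (Suc t))"] by linarith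
    finally show ?thesis using ex[of "{j t<..j (Suc t)}" "h (j (Suc t))"] by auto
  qed
  (* The additional alternation: h has to return from h (j N) towards its limit 0. *)
  have last: "\<exists>i. j N < i \<and> d i * h (j N) < 0"
  proof (rule ccontr)
    assume "\<not> ?thesis"
    then have nn: "\<And>i. j N < i \<Longrightarrow> d i * h (j N) \<ge> 0" using not_less by blast
    have "h n * h (j N) \<ge> h (j N) * h (j N)" if "n \<ge> j N" for n
    proof -
      have "(h n - h (j N)) * h (j N) = (\<Sum>i\<in>{j N<..n}. d i * h (j N))"
        by (simp only: sum_distrib_right[symmetric] sum1[OF that])
      also have "\<dots> \<ge> 0" by (intro sum_nonneg, rule nn) simp
      finally show ?thesis by (simp add: algebra_simps)
    qed
    then have "h (j N) * h (j N) \<le> 0 * h (j N)"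
      by (intro LIMSEQ_le_const[OF tendsto_mult_right[OF lim, of "h (j N)"]]) (auto intro!: exI[of _ "j N"])
    then show False using hnz[of N] by (simp add: not_le[symmetric] zero_less_mult_iff) (metis linorder_neqE_linordered_idom mult_neg_neg mult_pos_pos not_less)
  qed
  (* The witnesses found above, uniformly in t, so that a sequence of them can be chosen. *)
  define good where "good t i \<longleftrightarrow> (t = 0 \<longrightarrow> i \<le> j 0) \<and> (0 < t \<longrightarrow> j (t - 1) < i) \<and> (t \<le> N \<longrightarrow> i \<le> j t \<and> d i * h (j t) > 0) \<and> (t = Suc N \<longrightarrow> d i * h (j N) < 0)" for t i
  have "\<exists>i. good t i" if "t \<le> Suc N" for t
  proof -
    have "t = 0 \<or> (\<exists>t'. t = Suc t' \<and> t' < N) \<or> t = Suc N" using that by (cases t) auto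
    then consider "t = 0" | t' where "t = Suc t'" "t' < N" | "t = Suc N" by blast
    then show ?thesis
    proof cases
      case 1 then show ?thesis using first by (auto simp: good_def)
    next
      case 2 then show ?thesis using mid[of t'] by (auto simp: good_def)
    next
      case 3 then show ?thesis using last by (auto simp: good_def)
    qed
  qed
  then obtain m where m: "\<And>t. t \<le> Suc N \<Longrightarrow> good t (m t)" by metis
  have "m t < m (Suc t) \<and> d (m t) * d (m (Suc t)) < 0" if t: "t < Suc N" for t
  proof -
    have g: "good t (m t)" "good (Suc t) (m (Suc t))" using m t by auto
    have lt: "m t < m (Suc t)" using g t by (auto simp: good_def)
    have p: "d (m t) * h (j t) > 0" using g t by (auto simp: good_def)
    have n: "d (m (Suc t)) * h (j t) < 0"
    proof (cases "t = N")
      case True then show ?thesis using g by (auto simp: good_def)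
    next
      case False
      then have "t < N" using t by simp
      then have "d (m (Suc t)) * h (j (Suc t)) > 0" "h (j t) * h (j (Suc t)) < 0" using g j by (auto simp: good_def)
      then show ?thesis by (auto simp: zero_less_mult_iff mult_less_0_iff)
    qed
    show ?thesis using lt p n by (auto simp: zero_less_mult_iff mult_less_0_iff)
  qed
  moreover have "d (m 0) \<noteq> 0" using m[of 0] by (auto simp: good_def)
  ultimately show ?thesis unfolding alternates_def by blast
qed

lemma psum_shift:
  assumes "\<And>j. x j = (if j = 0 then 0 else y (j - 1)) - c * y j"
  shows "psum k x n = (if n = 0 then 0 else psum k y (n - 1)) - c * psum k y n"
proof (induction k arbitrary: n)
  case (Suc k)
  have "(\<Sum>j\<le>n. if j = 0 then 0 else psum k y (j - 1)) = (if n = 0 then 0 else \<Sum>j\<le>n - 1. psum k y j)"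
    by (induction n) (auto split: nat.splits, metis (no_types, lifting) Suc_pred sum.atMost_Suc)
  then show ?case by (simp add: Suc sum_subtractf sum_distrib_left)
qed (simp add: assms)

lemma psum_bound:
  assumes "\<And>j. \<bar>x j\<bar> \<le> C" "C \<ge> 0"
  shows "\<bar>psum k x n\<bar> \<le> C * (real n + 1) ^ k"
proof (induction k arbitrary: n)
  case (Suc k)
  have "\<bar>psum (Suc k) x n\<bar> \<le> (\<Sum>j\<le>n. \<bar>psum k x j\<bar>)" by (simp add: sum_abs)
  also have "\<dots> \<le> (\<Sum>j\<le>n. C * (real n + 1) ^ k)"
    using assms(2) by (intro sum_mono order_trans[OF Suc] mult_left_mono power_mono) auto
  also have "\<dots> = C * (real n + 1) ^ Suc k" by (simp add: algebra_simps)
  finally show ?case .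
qed (use assms in auto)

lemma psum_eq_0:
  assumes "\<And>n. psum k x n = 0"
  shows "x n = 0"
  using assms
proof (induction k arbitrary: n)
  case (Suc k)
  have "psum k x n = 0" for n
    using psum_diff[of n k x] Suc.prems[of n] Suc.prems[of "n - 1"] Suc.prems[of 0]
    by (cases "n = 0") auto
  then show ?case by (rule Suc.IH)
qed simp

lemma power_times_geometric_tendsto_0:
  fixes c :: real
  assumes "0 < c" "c < 1"
  shows "(\<lambda>n. (real n + 1) ^ k * c ^ n) \<longlonglongrightarrow> 0"
proof -
  define e where "e = root (Suc k) c"
  have e: "0 < e" "e < 1" using assms by (auto simp: e_def)
  have ec: "e ^ Suc k = c" using assms by (simp add: e_def real_root_pow_pos del: power_Suc)
  have "(\<lambda>n. real n * e ^ n + e ^ n) \<longlonglongrightarrow> 0 + 0"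
    using e by (intro tendsto_add powser_times_n_limit_0 LIMSEQ_power_zero) auto
  then have "(\<lambda>n. (real n * e ^ n + e ^ n) ^ Suc k) \<longlonglongrightarrow> 0 ^ Suc k" by (intro tendsto_power) simp
  then have 1: "(\<lambda>n. (real n + 1) ^ Suc k * c ^ n) \<longlonglongrightarrow> 0"
  proof -
    have "(real n * e ^ n + e ^ n) ^ Suc k = (real n + 1) ^ Suc k * c ^ n" for n
    proof -
      have "real n * e ^ n + e ^ n = (real n + 1) * e ^ n" by (simp add: algebra_simps)
      then have "(real n * e ^ n + e ^ n) ^ Suc k = (real n + 1) ^ Suc k * (e ^ n) ^ Suc k" by (simp only: power_mult_distrib)
      also have "(e ^ n) ^ Suc k = c ^ n" unfolding ec[symmetric] by (simp only: power_mult[symmetric] mult.commute)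
      finally show ?thesis .
    qed
    then show ?thesis using \<open>(\<lambda>n. (real n * e ^ n + e ^ n) ^ Suc k) \<longlonglongrightarrow> 0 ^ Suc k\<close> by simp
  qed
  show ?thesis
  proof (rule Lim_null_comparison[OF _ 1])
    show "\<forall>\<^sub>F n in sequentially. norm ((real n + 1) ^ k * c ^ n) \<le> (real n + 1) ^ Suc k * c ^ n"
    proof (intro always_eventually allI)
      fix n
      have "(real n + 1) ^ k \<le> (real n + 1) ^ Suc k" by (intro power_increasing) auto
      then show "norm ((real n + 1) ^ k * c ^ n) \<le> (real n + 1) ^ Suc k * c ^ n"
        using assms by (simp add: mult_right_mono)
    qed
  qed
qed

text \<open>
  After multiplication of the j-th coefficient by c^j, the factor x - c acts as a difference operator.
  For c < 1 the factor c^j outweighs the polynomial growth of the k-fold sums, so that the rescaled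
  sequence tends to 0; for k = 0 and c = 1 it vanishes eventually.
\<close>

lemma descartes_step:
  assumes c: "0 < c" "c < 1 \<or> k = 0 \<and> c = 1" and alternates: "alternates (psum k (coeff q)) N"
  shows "alternates (psum k (coeff ([:- c, 1:] * q))) (Suc N)"
proof -
  define G where "G = psum k (coeff q)"
  define h where "h j = c ^ j * G j" for j
  define d where "d j = (if j = 0 then h 0 else h j - h (j - 1))" for j
  obtain C where C: "\<And>j. \<bar>coeff q j\<bar> \<le> C" "C \<ge> 0"
  proof -
    have "\<bar>coeff q j\<bar> \<le> (\<Sum>i\<le>degree q. \<bar>coeff q i\<bar>)" for j
    proof (cases "j \<le> degree q")
      case True
      then show ?thesis by (intro member_le_sum) auto
    next
      case False
      then show ?thesis by (simp add: coeff_eq_0 sum_nonneg)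
    qed
    then show thesis using that[of "\<Sum>i\<le>degree q. \<bar>coeff q i\<bar>"] by (simp add: sum_nonneg)
  qed
  have "h \<longlonglongrightarrow> 0"
  proof (cases "c < 1")
    case True
    have "(\<lambda>n. C * ((real n + 1) ^ k * c ^ n)) \<longlonglongrightarrow> C * 0"
      by (intro tendsto_mult tendsto_const power_times_geometric_tendsto_0 c True)
    then have "(\<lambda>n. C * ((real n + 1) ^ k * c ^ n)) \<longlonglongrightarrow> 0" by simp
    then show ?thesis
    proof (rule Lim_null_comparison[rotated])
      show "\<forall>\<^sub>F n in sequentially. norm (h n) \<le> C * ((real n + 1) ^ k * c ^ n)"
      proof (intro always_eventually allI)
        fix n
        have "\<bar>G n\<bar> \<le> C * (real n + 1) ^ k" unfolding G_def by (rule psum_bound[OF C])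
        then have "c ^ n * \<bar>G n\<bar> \<le> c ^ n * (C * (real n + 1) ^ k)" using c by (intro mult_left_mono) auto
        then show "norm (h n) \<le> C * ((real n + 1) ^ k * c ^ n)" using c by (simp add: h_def abs_mult mult_ac)
      qed
    qed
  next
    case False
    then have kc: "k = 0" "c = 1" using c by auto
    have "\<forall>\<^sub>F n in sequentially. h n = 0"
      using eventually_gt_at_top[of "degree q"] by eventually_elim (simp add: h_def G_def kc coeff_eq_0)
    then show ?thesis by (simp add: tendsto_eventually)
  qed
  moreover have "alternates h N"
    using alternates unfolding G_def[symmetric]
    by (rule alternates_scale[where \<sigma> = 1]) (use c in \<open>auto simp: h_def intro!: exI[of _ "c ^ _"]\<close>)
  ultimately have "alternates d (Suc N)"
    by (intro alternates_difference[where h = h]) (auto simp: d_def)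
  moreover have F: "psum k (coeff ([:- c, 1:] * q)) j = (if j = 0 then 0 else G (j - 1)) - c * G j" for j
    unfolding G_def by (rule psum_shift) (auto simp: coeff_pCons split: nat.splits)
  have "psum k (coeff ([:- c, 1:] * q)) j = (- c / c ^ j) * d j" for j
    unfolding F using c(1) by (cases j) (simp_all add: d_def h_def field_simps)
  then have "\<exists>e. e \<noteq> 0 \<and> psum k (coeff ([:- c, 1:] * q)) j = e * d j \<and> sgn e = -1" for j
    using c by (intro exI[of _ "- c / c ^ j"]) (auto simp: sgn_divide sgn_minus)
  ultimately show ?thesis by (rule alternates_scale)
qed

lemma num_roots_linear_mult:
  assumes "q \<noteq> 0"
  shows "num_roots_in ([:- c, 1:] * q) I = num_roots_in q I + (if c \<in> I then 1 else 0)"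
proof -
  have "proots ([:- c, 1:] * q) = {#c#} + proots q"
    using assms by (subst proots_mult) (auto simp: proots_linear_factor)
  then show ?thesis by (simp add: num_roots_in_def)
qed

text \<open>
  Roots in the open interval are split off by descartes_step, each adding an alternation. A root at 1 cancels
  one of the factors 1 / (1 - x) and so lowers k by one without a change of the sequence, up to its
  sign; once k = 0 it behaves as the other roots do. This costs at most k roots.
\<close>

theorem descartes_psum:
  assumes "p \<noteq> 0"
  shows "alternates (psum k (coeff p)) (num_roots_in p {0<..1} - k)"
proof -
  have "num_roots_in p {0<..1} = N \<Longrightarrow> alternates (psum k (coeff p)) (N - k)" for N
    using assms
  proof (induction N arbitrary: p k)
    case 0
    have "\<exists>n. psum k (coeff p) n \<noteq> 0"
      using psum_eq_0[of k "coeff p"] 0 by (metis leading_coeff_0_iff)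
    then show ?case by (auto simp: alternates_def)
  next
    case (Suc N)
    have ex: "\<exists>c\<in>I. poly p c = 0" if "num_roots_in p I > 0" for I
    proof -
      have "filter_mset (\<lambda>x. x \<in> I) (proots p) \<noteq> {#}" using that unfolding num_roots_in_def nonempty_has_size .
      then obtain x where "x \<in># filter_mset (\<lambda>x. x \<in> I) (proots p)" by (metis multiset_nonemptyE)
      then show ?thesis using Suc.prems by auto
    qed
    show ?case
    proof (cases "\<exists>c\<in>{0<..<1}. poly p c = 0")
      case True
      then obtain c where c: "0 < c" "c < 1" "poly p c = 0" by auto
      then obtain q where q: "p = [:- c, 1:] * q" by (metis dvdE poly_eq_0_iff_dvd)
      have q0: "q \<noteq> 0" using q Suc.prems by auto
      have "num_roots_in q {0<..1} = N" using num_roots_linear_mult[OF q0, of c "{0<..1}"] Suc.prems c by (simp add: q)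
      from Suc.IH[OF this q0] have "alternates (psum k (coeff p)) (Suc (N - k))"
        unfolding q using c by (intro descartes_step) auto
      then show ?thesis by (rule alternates_antimono) simp
    next
      (* All roots in question are at 1. *)
      case False
      obtain c where "c \<in> {0<..1}" "poly p c = 0" using ex[of "{0<..1}"] Suc.prems by auto
      then have "poly p 1 = 0" using False by (cases "c = 1") auto
      then obtain q where q: "p = [:- 1, 1:] * q" by (metis dvdE poly_eq_0_iff_dvd)
      have q0: "q \<noteq> 0" using q Suc.prems by auto
      have N: "num_roots_in q {0<..1} = N" using num_roots_linear_mult[OF q0, of 1 "{0<..1}"] Suc.prems by (simp add: q)
      show ?thesis
      proof (cases k)
        case 0
        have "alternates (psum k (coeff p)) (Suc (N - k))"
          unfolding q using Suc.IH[OF N q0, of 0] 0 by (intro descartes_step) auto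
        then show ?thesis using 0 by simp
      next
        case (Suc k')
        have "psum k (coeff p) n = - psum k' (coeff q) n" for n
        proof -
          have e: "psum k' (coeff p) n = (if n = 0 then 0 else psum k' (coeff q) (n - 1)) - 1 * psum k' (coeff q) n" for n
            by (rule psum_shift) (auto simp: q coeff_pCons split: nat.splits)
          have "(\<Sum>j\<le>n. psum k' (coeff p) j) = - psum k' (coeff q) n"
            by (induction n) (auto simp: e)
          then show ?thesis by (simp add: Suc)
        qed
        then have "\<And>i. \<exists>c. c \<noteq> 0 \<and> psum k (coeff p) i = c * psum k' (coeff q) i \<and> sgn c = -1"
          by (intro exI[of _ "-1"]) auto
        then have "alternates (psum k (coeff p)) (N - k')"
          by (rule alternates_scale[OF Suc.IH[OF N q0, of k']])
        then show ?thesis by (simp add: Suc del: psum.simps)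
      qed
    qed
  qed
  then show ?thesis by simp
qed

lemma coeff_kac_poly: "coeff (kac_poly a n) j = (if j \<le> n then a j else 0)"
  by (simp add: kac_poly_def coeff_sum)

text \<open>
  The bound of descartes_psum, cut off at n. Beyond n the k-fold differences of the sequence are the
  vanishing coefficients of the polynomial, so that the tail has boundedly many changes.
\<close>

theorem num_roots_le_sign_changes:
  "num_roots_in (kac_poly a n) {0<..1} \<le> sign_changes (psum k a) 0 n + 2 * k + 1"
proof (cases "kac_poly a n = 0")
  case True
  then show ?thesis by (simp add: num_roots_in_def)
next
  case False
  let ?s = "psum k (coeff (kac_poly a n))"
  obtain b where b: "sign_changes ?s 0 b \<ge> num_roots_in (kac_poly a n) {0<..1} - k"
    using alternates_sign_changes[OF descartes_psum[OF False, of k]] by blast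
  have "sign_changes ?s 0 b \<le> sign_changes ?s 0 (max n b)" by (intro sign_changes_mono) auto
  also have "\<dots> = sign_changes ?s 0 n + sign_changes ?s n (max n b)" by (intro sign_changes_split) auto
  (* Going down to order 0 costs k changes, and the coefficients vanish beyond n. *)
  also have "sign_changes ?s n (max n b) \<le> sign_changes (psum (k - k) (coeff (kac_poly a n))) n (max n b) + k"
    by (intro sign_changes_psum) auto
  also have "sign_changes (psum (k - k) (coeff (kac_poly a n))) n (max n b) \<le> card {Suc n}"
    unfolding sign_changes_def
  proof (intro card_mono subsetI)
    fix j assume "j \<in> {j \<in> {n<..max n b}. sg (psum (k - k) (coeff (kac_poly a n)) j) \<noteq> sg (psum (k - k) (coeff (kac_poly a n)) (j - 1))}"
    then show "j \<in> {Suc n}" by (auto simp: coeff_kac_poly split: if_splits)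
  qed simp
  also have "sign_changes ?s 0 n = sign_changes (psum k a) 0 n"
    by (intro sign_changes_cong psum_cong) (auto simp: coeff_kac_poly)
  finally show ?thesis using b by simp
qed

section \<open>Iterated partial sums as linear forms\<close>

text \<open>
  The polynomial (y + 1) * ... * (y + d).
\<close>

fun rising :: "nat \<Rightarrow> real poly" where
  "rising 0 = 1"
| "rising (Suc d) = rising d * [:real (Suc d), 1:]"

lemma rising_degree: "degree (rising d) = d" and rising_lead: "lead_coeff (rising d) = 1"
proof -
  have "degree (rising d) = d \<and> lead_coeff (rising d) = 1"
  proof (induction d)
    case (Suc d)
    then have "rising d \<noteq> 0" by auto
    then have "degree (rising d * [:real (Suc d), 1:]) = degree (rising d) + degree [:real (Suc d), 1:]"
      by (intro degree_mult_eq) auto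
    then have "degree (rising (Suc d)) = Suc d" using Suc by simp
    moreover have "lead_coeff (rising (Suc d)) = 1" by (simp only: rising.simps lead_coeff_mult) (use Suc in auto)
    ultimately show ?case by blast
  qed simp
  then show "degree (rising d) = d" "lead_coeff (rising d) = 1" by auto
qed

lemma poly_rising_binomial: "poly (rising d) (real i) = fact d * real (i + d choose d)"
proof (induction d)
  case (Suc d)
  have "real (Suc d) * real ((i + Suc d) choose Suc d) = real (i + Suc d) * real ((i + d) choose d)"
    using Suc_times_binomial_eq[of "i + d" d] by (simp only: of_nat_mult[symmetric] add_Suc_right mult.commute)
  then have "fact d * (real (Suc d) * real ((i + Suc d) choose Suc d)) = fact d * real ((i + d) choose d) * real (i + Suc d)"
    by simp
  moreover have "poly (rising (Suc d)) (real i) = poly (rising d) (real i) * real (i + Suc d)"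
    by (simp add: algebra_simps)
  ultimately show ?case using Suc by (simp add: mult_ac del: rising.simps binomial_Suc_Suc)
qed simp

lemma poly_rising_bounds:
  fixes y :: real
  assumes "y \<ge> 0"
  shows "y ^ d \<le> poly (rising d) y" "poly (rising d) y \<le> (y + real d) ^ d"
proof -
  have "y ^ d \<le> poly (rising d) y \<and> poly (rising d) y \<le> (y + real d) ^ d"
  proof (induction d)
    case (Suc d)
    have "y ^ d * y \<le> poly (rising d) y * (real (Suc d) + y)"
      using Suc assms by (intro mult_mono) (auto intro: order_trans[OF zero_le_power])
    moreover have "poly (rising d) y * (real (Suc d) + y) \<le> (y + real (Suc d)) ^ d * (y + real (Suc d))"
      using Suc assms by (intro mult_mono order_trans[OF conjunct2[OF Suc]] power_mono) auto
    ultimately show ?case by (simp add: algebra_simps)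
  qed simp
  then show "y ^ d \<le> poly (rising d) y" "poly (rising d) y \<le> (y + real d) ^ d" by auto
qed

lemma poly_rising_nonneg: "y \<ge> 0 \<Longrightarrow> poly (rising d) y \<ge> 0"
  using poly_rising_bounds(1)[of y d] zero_le_power[of y d] by linarith

text \<open>
  Its k-fold partial sums are the convolution kernel of k-fold summation.
\<close>

definition impulse :: "nat \<Rightarrow> real" where "impulse j = (if j = 0 then 1 else 0)"

lemma psum_convolution: "psum k x n = (\<Sum>j\<le>n. psum k impulse (n - j) * x j)"
proof (induction k arbitrary: n)
  case 0
  have "(\<Sum>j\<le>n. psum 0 impulse (n - j) * x j) = (\<Sum>j\<in>{n}. psum 0 impulse (n - j) * x j)"
    by (intro sum.mono_neutral_right) (auto simp: impulse_def)
  then show ?case by (simp add: impulse_def)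
next
  case (Suc k)
  show ?case
  proof (induction n)
    case 0
    show ?case using Suc.IH[of 0] by simp
  next
    case (Suc n)
    have s: "psum (Suc k) impulse (Suc n - j) = psum (Suc k) impulse (n - j) + psum k impulse (Suc n - j)" if "j \<le> n" for j
      using that by (simp add: Suc_diff_le)
    have "psum (Suc k) x (Suc n) = psum (Suc k) x n + psum k x (Suc n)" by simp
    also have "\<dots> = (\<Sum>j\<le>n. psum (Suc k) impulse (n - j) * x j) + (\<Sum>j\<le>Suc n. psum k impulse (Suc n - j) * x j)"
      unfolding Suc.IH by (subst \<open>\<And>n. psum k x n = _ n\<close>) simp
    also have "\<dots> = (\<Sum>j\<le>n. psum (Suc k) impulse (Suc n - j) * x j) + psum k impulse 0 * x (Suc n)"
    proof -
      have "(\<Sum>j\<le>n. psum (Suc k) impulse (n - j) * x j) + (\<Sum>j\<le>n. psum k impulse (Suc n - j) * x j)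
         = (\<Sum>j\<le>n. psum (Suc k) impulse (Suc n - j) * x j)"
        unfolding sum.distrib[symmetric] by (intro sum.cong refl) (simp add: s algebra_simps del: psum.simps)
      then show ?thesis by (simp del: psum.simps)
    qed
    also have "\<dots> = (\<Sum>j\<le>Suc n. psum (Suc k) impulse (Suc n - j) * x j)" by simp
    finally show ?case .
  qed
qed

lemma psum_impulse: "psum (Suc d) impulse i = poly (rising d) (real i) / fact d"
proof -
  have "psum (Suc d) impulse i = real (i + d choose d)"
  proof (induction d arbitrary: i)
    case 0
    have "(\<Sum>j\<le>i. impulse j) = (\<Sum>j\<in>{0}. impulse j)"
      by (intro sum.mono_neutral_right) (auto simp: impulse_def)
    then show ?case by (simp add: impulse_def)
  next
    case (Suc d)
    have "psum (Suc (Suc d)) impulse i = (\<Sum>j\<le>i. real (j + d choose d))" by (subst psum.simps) (simp add: Suc del: psum.simps)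
    also have "\<dots> = real (\<Sum>j\<le>i. (d + j choose d))" by (simp add: add.commute)
    also have "\<dots> = real (d + i + 1 choose (d + 1))" by (subst choose_rising_sum(1)) simp
    finally show ?case by (simp add: add.commute)
  qed
  then show ?thesis by (simp add: poly_rising_binomial)
qed

text \<open>
  The coefficient of \<xi> j in fact d times the (d + 1)-fold partial sum at n.
\<close>

definition raw_weight :: "nat \<Rightarrow> nat \<Rightarrow> nat \<Rightarrow> real"
  where "raw_weight d n j = (if j \<le> n then poly (rising d) (real (n - j)) else 0)"

definition weight_norm :: "nat \<Rightarrow> nat \<Rightarrow> real"
  where "weight_norm d n = sqrt (\<Sum>i\<le>n. (poly (rising d) (real i))\<^sup>2)"

text \<open>
  The weights of unit Euclidean length, as linear forms are compared in that normalisation.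
\<close>

definition weight :: "nat \<Rightarrow> nat \<Rightarrow> nat \<Rightarrow> real"
  where "weight d n j = raw_weight d n j / weight_norm d n"

lemma raw_weight_nonneg: "raw_weight d n j \<ge> 0"
  by (simp add: raw_weight_def poly_rising_nonneg)

text \<open>
  Compare the sum with the integral of the power function, one summand at a time; sum_power_le is the
  matching upper bound.
\<close>

lemma sum_power_ge: "real n ^ Suc p / real (Suc p) \<le> (\<Sum>i\<le>n. real i ^ p)"
proof (induction n)
  case (Suc n)
  have "real (Suc n) ^ Suc p - real n ^ Suc p = (real (Suc n) - real n) * (\<Sum>i<Suc p. real (Suc n) ^ i * real n ^ (Suc p - Suc i))"
    using power_diff_sumr2[of "real (Suc n)" "Suc p" "real n"] by (simp only: mult.commute)
  also have "\<dots> = (\<Sum>i<Suc p. real (Suc n) ^ i * real n ^ (p - i))" by simp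
  also have "\<dots> \<le> (\<Sum>i<Suc p. real (Suc n) ^ p)"
  proof (rule sum_mono)
    fix i assume "i \<in> {..<Suc p}"
    then have "i \<le> p" by auto
    have "real (Suc n) ^ i * real n ^ (p - i) \<le> real (Suc n) ^ i * real (Suc n) ^ (p - i)"
      by (intro mult_left_mono power_mono) auto
    also have "\<dots> = real (Suc n) ^ p" using \<open>i \<le> p\<close> by (simp add: power_add[symmetric])
    finally show "real (Suc n) ^ i * real n ^ (p - i) \<le> real (Suc n) ^ p" .
  qed
  finally have "real (Suc n) ^ Suc p - real n ^ Suc p \<le> real (Suc p) * real (Suc n) ^ p" by simp
  then have "real (Suc n) ^ Suc p / real (Suc p) \<le> real n ^ Suc p / real (Suc p) + real (Suc n) ^ p"
    by (simp add: field_simps del: power_Suc of_nat_Suc)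
  also have "\<dots> \<le> (\<Sum>i\<le>n. real i ^ p) + real (Suc n) ^ p" using Suc by linarith
  finally show ?case by simp
qed (cases p; simp)

lemma sum_power_le: "(\<Sum>i\<le>n. real i ^ p) \<le> real n ^ Suc p / real (Suc p) + real n ^ p"
proof (induction n)
  case 0
  show ?case by (cases p) auto
next
  case (Suc n)
  have "real (Suc n) ^ Suc p - real n ^ Suc p = (real (Suc n) - real n) * (\<Sum>i<Suc p. real (Suc n) ^ i * real n ^ (Suc p - Suc i))"
    using power_diff_sumr2[of "real (Suc n)" "Suc p" "real n"] by (simp only: mult.commute)
  also have "\<dots> = (\<Sum>i<Suc p. real (Suc n) ^ i * real n ^ (p - i))" by simp
  also have "\<dots> \<ge> (\<Sum>i<Suc p. real n ^ p)"
  proof (rule sum_mono)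
    fix i assume "i \<in> {..<Suc p}"
    then have "i \<le> p" by auto
    have "real n ^ p = real n ^ i * real n ^ (p - i)" using \<open>i \<le> p\<close> by (simp add: power_add[symmetric])
    also have "\<dots> \<le> real (Suc n) ^ i * real n ^ (p - i)"
      by (intro mult_right_mono power_mono) auto
    finally show "real n ^ p \<le> real (Suc n) ^ i * real n ^ (p - i)" .
  qed
  finally have "real (Suc p) * real n ^ p \<le> real (Suc n) ^ Suc p - real n ^ Suc p" by simp
  then have "(real n ^ Suc p + real (Suc p) * real n ^ p) / real (Suc p) \<le> real (Suc n) ^ Suc p / real (Suc p)"
    by (intro divide_right_mono) auto
  then have "real n ^ Suc p / real (Suc p) + real n ^ p \<le> real (Suc n) ^ Suc p / real (Suc p)"
    by (simp add: add_divide_distrib del: power_Suc of_nat_Suc)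
  then show ?case using Suc by simp
qed

lemma weight_norm_sq: "(weight_norm d n)\<^sup>2 = (\<Sum>i\<le>n. (poly (rising d) (real i))\<^sup>2)"
  by (simp add: weight_norm_def sum_nonneg)

lemma weight_norm_sq_ge: "(weight_norm d n)\<^sup>2 \<ge> real n ^ (2 * d + 1) / real (2 * d + 1)"
proof -
  have "real n ^ (2 * d + 1) / real (2 * d + 1) \<le> (\<Sum>i\<le>n. real i ^ (2 * d))"
    using sum_power_ge[of n "2 * d"] by simp
  also have "\<dots> \<le> (weight_norm d n)\<^sup>2"
    unfolding weight_norm_sq power_even_eq by (intro sum_mono power_mono poly_rising_bounds) auto
  finally show ?thesis .
qed

lemma weight_norm_pos: "weight_norm d n > 0"
proof -
  have "(poly (rising d) (real 0))\<^sup>2 \<le> (weight_norm d n)\<^sup>2"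
    unfolding weight_norm_sq by (intro member_le_sum) auto
  moreover have "poly (rising d) (real 0) \<noteq> 0" by (simp only: poly_rising_binomial) simp
  ultimately have "weight_norm d n \<noteq> 0" by auto
  then show ?thesis by (simp add: weight_norm_def sum_nonneg order_less_le)
qed

lemma sum_raw_weight:
  assumes "n < J"
  shows "(\<Sum>j<J. (raw_weight d n j)\<^sup>2) = (weight_norm d n)\<^sup>2"
proof -
  have "(\<Sum>j<J. (raw_weight d n j)\<^sup>2) = (\<Sum>j\<le>n. (poly (rising d) (real (n - j)))\<^sup>2)"
    using assms by (intro sum.mono_neutral_cong_right) (auto simp: raw_weight_def)
  also have "\<dots> = (\<Sum>i\<le>n. (poly (rising d) (real i))\<^sup>2)"
    using sum.atLeastAtMost_rev[of "\<lambda>j. (poly (rising d) (real j))\<^sup>2" 0 n] by (simp add: atLeast0AtMost)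
  finally show ?thesis by (simp add: weight_norm_sq)
qed

lemma sum_weight: "n < J \<Longrightarrow> (\<Sum>j<J. (weight d n j)\<^sup>2) = 1"
  using weight_norm_pos[of d n] by (simp add: weight_def power_divide sum_divide_distrib[symmetric] sum_raw_weight)

lemma raw_weight_le: "n \<ge> 1 \<Longrightarrow> raw_weight d n j \<le> real (d + 1) ^ d * real n ^ d"
proof -
  assume n: "n \<ge> 1"
  show ?thesis
  proof (cases "j \<le> n")
    case True
    have "raw_weight d n j \<le> (real (n - j) + real d) ^ d"
      using True by (simp add: raw_weight_def poly_rising_bounds)
    also have "\<dots> \<le> (real (d + 1) * real n) ^ d"
    proof (rule power_mono)
      have "real d * 1 \<le> real d * real n" using n by (intro mult_left_mono) auto
      moreover have "real (n - j) \<le> real n" by simp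
      ultimately show "real (n - j) + real d \<le> real (d + 1) * real n" by (simp add: algebra_simps)
    qed simp
    finally show ?thesis by (simp only: power_mult_distrib)
  qed (simp add: raw_weight_def)
qed

definition weight_const :: "nat \<Rightarrow> real" where "weight_const d = real (d + 1) ^ d * sqrt (real (2 * d + 1))"

lemma weight_const_ge_1: "weight_const d \<ge> 1"
proof -
  have "1 * 1 \<le> real (d + 1) ^ d * sqrt (real (2 * d + 1))" by (intro mult_mono one_le_power) auto
  then show ?thesis by (simp add: weight_const_def)
qed

lemma weight_sq_le:
  assumes n: "n \<ge> 1"
  shows "(weight d n j)\<^sup>2 \<le> (weight_const d)\<^sup>2 / real n"
proof -
  have "(weight d n j)\<^sup>2 = (raw_weight d n j)\<^sup>2 / (weight_norm d n)\<^sup>2" by (simp add: weight_def power_divide)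
  also have "\<dots> \<le> (real (d + 1) ^ d * real n ^ d)\<^sup>2 / (real n ^ (2 * d + 1) / real (2 * d + 1))"
    using n by (intro frac_le power_mono raw_weight_le weight_norm_sq_ge raw_weight_nonneg) auto
  also have "(real (d + 1) ^ d * real n ^ d)\<^sup>2 = (real (d + 1) ^ d)\<^sup>2 * real n ^ (2 * d)"
    by (simp add: power_mult_distrib power_mult[symmetric] mult.commute)
  also have "(real (d + 1) ^ d)\<^sup>2 * real n ^ (2 * d) / (real n ^ (2 * d + 1) / real (2 * d + 1)) = (weight_const d)\<^sup>2 / real n"
    using n by (simp add: weight_const_def power_mult_distrib)
  finally show ?thesis .
qed

lemma weight_le:
  assumes n: "n \<ge> 1"
  shows "\<bar>weight d n j\<bar> \<le> weight_const d / sqrt (real n)"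
proof (rule power2_le_imp_le)
  have "(weight_const d / sqrt (real n))\<^sup>2 = (weight_const d)\<^sup>2 / real n" by (simp only: power_divide) simp
  then show "\<bar>weight d n j\<bar>\<^sup>2 \<le> (weight_const d / sqrt (real n))\<^sup>2" using weight_sq_le[OF n, of d j] by (simp only: power2_abs)
  have "weight_const d \<ge> 0" using weight_const_ge_1[of d] by linarith
  then show "0 \<le> weight_const d / sqrt (real n)" by simp
qed

lemma (in kac_coeffs) psum_eq_lin:
  assumes "n < J"
  shows "psum (Suc d) (\<lambda>j. \<xi> j \<omega>) n = weight_norm d n / fact d * lin J (weight d n) \<omega>"
proof -
  have "psum (Suc d) (\<lambda>j. \<xi> j \<omega>) n = (\<Sum>j\<le>n. poly (rising d) (real (n - j)) / fact d * \<xi> j \<omega>)"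
    by (subst psum_convolution) (simp only: psum_impulse)
  also have "\<dots> = (\<Sum>j<J. weight_norm d n / fact d * (weight d n j * \<xi> j \<omega>))"
    using assms weight_norm_pos[of d n] by (intro sum.mono_neutral_cong_left) (auto simp: weight_def raw_weight_def)
  finally show ?thesis by (simp add: lin_def sum_distrib_left)
qed

lemma (in kac_coeffs) sg_psum: "n < J \<Longrightarrow> sg (psum (Suc d) (\<lambda>j. \<xi> j \<omega>) n) = sg (lin J (weight d n) \<omega>)"
proof -
  assume "n < J"
  moreover have "weight_norm d n / fact d > 0" using weight_norm_pos[of d n] by simp
  ultimately show ?thesis by (simp only: psum_eq_lin sg_def zero_le_mult_iff) auto
qed

section \<open>The angle between nearby iterated partial sums\<close>

lemma abs_diff_le_aux:
  fixes A B y :: real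
  assumes "0 \<le> A" "A \<le> y * 1" "0 \<le> B" "B \<le> (y + 1/2) * 1" "0 \<le> y"
  shows "\<bar>A - B\<bar> \<le> 2 * y + 1"
  using assms by (simp add: abs_le_iff)

lemma abs_triangle3_aux: "\<bar>a + b - c\<bar> \<le> \<bar>a\<bar> + \<bar>b\<bar> + \<bar>c\<bar>" for a b c :: real
  by linarith

lemma poly_growth:
  fixes f :: "real poly"
  assumes "degree f \<le> e"
  obtains K where "K \<ge> 0" "\<And>n y. n \<ge> 1 \<Longrightarrow> 0 \<le> y \<Longrightarrow> y \<le> 2 * n \<Longrightarrow> \<bar>poly f y\<bar> \<le> K * n ^ e"
proof (rule that)
  let ?K = "\<Sum>i\<le>degree f. \<bar>coeff f i\<bar> * 2 ^ i"
  show "?K \<ge> 0" by (intro sum_nonneg) auto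
  fix n y :: real assume n: "n \<ge> 1" and y: "0 \<le> y" "y \<le> 2 * n"
  have "\<bar>poly f y\<bar> \<le> (\<Sum>i\<le>degree f. \<bar>coeff f i * y ^ i\<bar>)"
    unfolding poly_altdef by (rule sum_abs)
  also have "\<dots> \<le> (\<Sum>i\<le>degree f. \<bar>coeff f i\<bar> * 2 ^ i * n ^ e)"
  proof (rule sum_mono)
    fix i assume i: "i \<in> {..degree f}"
    have "y ^ i \<le> (2 * n) ^ i" using y by (intro power_mono)
    also have "\<dots> = 2 ^ i * n ^ i" by (rule power_mult_distrib)
    also have "\<dots> \<le> 2 ^ i * n ^ e" using n i assms by (intro mult_left_mono power_increasing) auto
    finally have "\<bar>coeff f i\<bar> * y ^ i \<le> \<bar>coeff f i\<bar> * (2 ^ i * n ^ e)" by (intro mult_left_mono) auto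
    then show "\<bar>coeff f i * y ^ i\<bar> \<le> \<bar>coeff f i\<bar> * 2 ^ i * n ^ e" using y by (simp add: abs_mult mult.assoc)
  qed
  also have "\<dots> = ?K * n ^ e" by (simp add: sum_distrib_right)
  finally show "\<bar>poly f y\<bar> \<le> ?K * n ^ e" .
qed

lemma poly_taylor2:
  fixes f :: "real poly"
  assumes "degree f \<le> e + 2"
  obtains K where "K \<ge> 0" "\<And>n y D. n \<ge> 1 \<Longrightarrow> 0 \<le> y \<Longrightarrow> 0 < D \<Longrightarrow> y + D \<le> 2 * n \<Longrightarrow>
    \<bar>poly f (y + D) - poly f y - D * poly (pderiv f) y\<bar> \<le> K * (D\<^sup>2 * n ^ e)"
proof -
  have "degree (pderiv (pderiv f)) \<le> e" using assms by (simp add: degree_pderiv)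
  from poly_growth[OF this] obtain K where K: "K \<ge> 0" "\<And>n y. n \<ge> 1 \<Longrightarrow> 0 \<le> y \<Longrightarrow> y \<le> 2 * n \<Longrightarrow> \<bar>poly (pderiv (pderiv f)) y\<bar> \<le> K * n ^ e"
    by blast
  show thesis
  proof (rule that[OF K(1)])
    fix n y D :: real assume n: "n \<ge> 1" "0 \<le> y" "0 < D" "y + D \<le> 2 * n"
    obtain z where z: "y < z" "z < y + D" "poly f (y + D) - poly f y = (y + D - y) * poly (pderiv f) z"
      using poly_MVT[of y "y + D" f] n by auto
    obtain t where t: "y < t" "t < z" "poly (pderiv f) z - poly (pderiv f) y = (z - y) * poly (pderiv (pderiv f)) t"
      using poly_MVT[of y z "pderiv f"] z by auto
    have "poly f (y + D) - poly f y - D * poly (pderiv f) y = D * (poly (pderiv f) z - poly (pderiv f) y)"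
      using z(3) by (simp add: algebra_simps)
    also have "\<dots> = D * (z - y) * poly (pderiv (pderiv f)) t" unfolding t(3) by simp
    finally have "\<bar>poly f (y + D) - poly f y - D * poly (pderiv f) y\<bar> = D * (z - y) * \<bar>poly (pderiv (pderiv f)) t\<bar>"
      using n z by (simp add: abs_mult)
    also have "\<dots> \<le> (D * D) * (K * n ^ e)"
      using n z t K by (intro mult_mono mult_left_mono) auto
    finally show "\<bar>poly f (y + D) - poly f y - D * poly (pderiv f) y\<bar> \<le> K * (D\<^sup>2 * n ^ e)"
      by (simp add: power2_eq_square mult_ac)
  qed
qed

text \<open>
  First-order expansion of the weights under a shift by D. The factor 1 + D / n * (d + 1/2) is the
  relative growth of their norm, which is of order n^(d + 1/2); subtracting it leaves the component that turns
  the direction. All lower-order terms of the rising factorial are absorbed in the error because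
  D is at least 1.
\<close>

lemma rising_expansion:
  fixes e :: nat
  defines "d \<equiv> e + 2"
  obtains K where "K \<ge> 0"
    "\<And>n y D. n \<ge> 1 \<Longrightarrow> 0 \<le> y \<Longrightarrow> y \<le> n \<Longrightarrow> 1 \<le> D \<Longrightarrow> D \<le> n \<Longrightarrow>
      \<bar>(poly (rising d) (y + D) - (1 + D / n * (d + 1/2)) * poly (rising d) y)
        - D / n * n ^ d * (real d * (y / n) ^ (d - 1) - (d + 1/2) * (y / n) ^ d)\<bar> \<le> K * ((D / n)\<^sup>2 * n ^ d)"
proof -
  define R where "R = rising d - monom 1 d"
  have dR: "degree R \<le> e + 1"
  proof (rule degree_le, safe)
    fix i assume i: "e + 1 < i"
    show "coeff R i = 0"
    proof (cases "i = d")
      case True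
      then show ?thesis using rising_lead[of d] rising_degree[of d] by (simp add: R_def)
    next
      case False
      then have "i > d" using i by (simp add: d_def)
      then have "i > degree (rising d)" by (simp only: rising_degree)
      then show ?thesis using False by (simp add: R_def coeff_eq_0)
    qed
  qed
  have dR': "degree (pderiv R) \<le> e" using dR by (simp add: degree_pderiv)
  have "degree (rising d) \<le> e + 2" by (simp only: rising_degree) (simp add: d_def)
  from poly_taylor2[OF this] obtain K1 where K1: "K1 \<ge> 0" "\<And>n y D. n \<ge> 1 \<Longrightarrow> 0 \<le> y \<Longrightarrow> 0 < D \<Longrightarrow> y + D \<le> 2 * n \<Longrightarrow>
    \<bar>poly (rising d) (y + D) - poly (rising d) y - D * poly (pderiv (rising d)) y\<bar> \<le> K1 * (D\<^sup>2 * n ^ e)" by blast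
  from poly_growth[OF dR'] obtain K2 where K2: "K2 \<ge> 0" "\<And>n y. n \<ge> 1 \<Longrightarrow> 0 \<le> y \<Longrightarrow> y \<le> 2 * n \<Longrightarrow> \<bar>poly (pderiv R) y\<bar> \<le> K2 * n ^ e" by blast
  from poly_growth[OF dR] obtain K3 where K3: "K3 \<ge> 0" "\<And>n y. n \<ge> 1 \<Longrightarrow> 0 \<le> y \<Longrightarrow> y \<le> 2 * n \<Longrightarrow> \<bar>poly R y\<bar> \<le> K3 * n ^ (e + 1)" by blast
  have pR: "poly (rising d) y = poly R y + y ^ d" for y by (simp add: R_def poly_monom)
  have pR': "poly (pderiv (rising d)) y = poly (pderiv R) y + real d * y ^ (d - 1)" for y
    by (simp add: R_def pderiv_diff pderiv_monom poly_monom)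
  show thesis
  proof (rule that)
    show "K1 + K2 + (d + 1/2) * K3 \<ge> 0" using K1 K2 K3 by simp
    fix n y D :: real assume n: "n \<ge> 1" and y: "0 \<le> y" "y \<le> n" and D: "1 \<le> D" "D \<le> n"
    have n0: "n > 0" using n by simp
    let ?E1 = "poly (rising d) (y + D) - poly (rising d) y - D * poly (pderiv (rising d)) y"
    have main: "D / n * n ^ d * (real d * (y / n) ^ (d - 1) - (d + 1/2) * (y / n) ^ d) = D * real d * y ^ (d - 1) - D / n * (d + 1/2) * y ^ d"
    proof -
      have "n ^ d = n * n ^ (d - 1)" by (simp add: d_def)
      then have "D / n * n ^ d * (real d * (y / n) ^ (d - 1)) = D * real d * y ^ (d - 1)"
        using n0 by (simp add: power_divide)
      moreover have "D / n * n ^ d * ((d + 1/2) * (y / n) ^ d) = D / n * (d + 1/2) * y ^ d"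
        using n0 by (simp add: power_divide)
      ultimately show ?thesis by (simp only: right_diff_distrib)
    qed
    have id: "(poly (rising d) (y + D) - (1 + D / n * (d + 1/2)) * poly (rising d) y)
        - (D * real d * y ^ (d - 1) - D / n * (d + 1/2) * y ^ d)
       = ?E1 + D * poly (pderiv R) y - D / n * (d + 1/2) * poly R y"
      unfolding pR' by (simp add: pR[of y] algebra_simps add_divide_distrib)
    have 1: "\<bar>?E1\<bar> \<le> K1 * ((D / n)\<^sup>2 * n ^ d)"
    proof -
      have "D\<^sup>2 * n ^ e = (D / n)\<^sup>2 * n ^ d" using n0 by (simp add: d_def power_divide power2_eq_square)
      then show ?thesis using K1(2)[of n y D] n y D by simp
    qed
    have nD: "D * n ^ e \<le> (D / n)\<^sup>2 * n ^ d"
    proof -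
      have "D * n ^ e \<le> D * D * n ^ e" using D n by (intro mult_right_mono) auto
      also have "\<dots> = (D / n)\<^sup>2 * n ^ d" using n0 by (simp add: d_def power_divide power2_eq_square)
      finally show ?thesis .
    qed
    have 2: "\<bar>D * poly (pderiv R) y\<bar> \<le> K2 * ((D / n)\<^sup>2 * n ^ d)"
    proof -
      have "\<bar>D * poly (pderiv R) y\<bar> \<le> D * (K2 * n ^ e)"
        using K2(2)[of n y] n y D by (simp add: abs_mult mult_left_mono)
      also have "\<dots> = K2 * (D * n ^ e)" by simp
      also have "\<dots> \<le> K2 * ((D / n)\<^sup>2 * n ^ d)" by (rule mult_left_mono[OF nD K2(1)])
      finally show ?thesis .
    qed
    have 3: "\<bar>D / n * (d + 1/2) * poly R y\<bar> \<le> (d + 1/2) * K3 * ((D / n)\<^sup>2 * n ^ d)"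
    proof -
      have "\<bar>D / n * (d + 1/2) * poly R y\<bar> = D / n * (d + 1/2) * \<bar>poly R y\<bar>"
        using D n0 by (simp add: abs_mult)
      also have "\<dots> \<le> D / n * (d + 1/2) * (K3 * n ^ (e + 1))"
        using K3(2)[of n y] n y D by (intro mult_left_mono) auto
      also have "\<dots> = (d + 1/2) * K3 * (D * n ^ e)" using n0 by simp
      also have "\<dots> \<le> (d + 1/2) * K3 * ((D / n)\<^sup>2 * n ^ d)" using K3 by (intro mult_left_mono nD) auto
      finally show ?thesis .
    qed
    have "\<bar>?E1 + D * poly (pderiv R) y - D / n * (d + 1/2) * poly R y\<bar> \<le> \<bar>?E1\<bar> + \<bar>D * poly (pderiv R) y\<bar> + \<bar>D / n * (d + 1/2) * poly R y\<bar>"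
      by (rule abs_triangle3_aux)
    also have "\<dots> \<le> (K1 + K2 + (d + 1/2) * K3) * ((D / n)\<^sup>2 * n ^ d)"
      using 1 2 3 unfolding distrib_right by linarith
    finally show "\<bar>(poly (rising d) (y + D) - (1 + D / n * (d + 1/2)) * poly (rising d) y)
        - D / n * n ^ d * (real d * (y / n) ^ (d - 1) - (d + 1/2) * (y / n) ^ d)\<bar> \<le> (K1 + K2 + (d + 1/2) * K3) * ((D / n)\<^sup>2 * n ^ d)"
      unfolding main id .
  qed
qed

text \<open>
  A Riemann sum for the integral over the unit interval of (d x^(d-1) - (d + 1/2) x^d)^2, which is
  1 / (4 (2 d - 1)).
\<close>

lemma sum_main_term:
  assumes n: "n \<ge> 1" and d: "d \<ge> 2"
  shows "(\<Sum>i\<le>n. (real d * (real i / real n) ^ (d - 1) - (real d + 1/2) * (real i / real n) ^ d)\<^sup>2)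
    \<le> real n * (1 / (4 * (2 * real d - 1))) + ((real d)\<^sup>2 + (real d + 1/2)\<^sup>2)"
proof -
  have n0: "real n > 0" using n by simp
  have s: "real n / real (p + 1) \<le> (\<Sum>i\<le>n. (real i / real n) ^ p)" "(\<Sum>i\<le>n. (real i / real n) ^ p) \<le> real n / real (p + 1) + 1" for p
  proof -
    have e: "(\<Sum>i\<le>n. (real i / real n) ^ p) = (\<Sum>i\<le>n. real i ^ p) / real n ^ p"
      by (simp add: power_divide sum_divide_distrib)
    have "real n / real (p + 1) = (real n ^ Suc p / real (Suc p)) / real n ^ p" using n0 by simp
    also have "\<dots> \<le> (\<Sum>i\<le>n. real i ^ p) / real n ^ p" by (intro divide_right_mono sum_power_ge) auto
    finally show "real n / real (p + 1) \<le> (\<Sum>i\<le>n. (real i / real n) ^ p)" unfolding e .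
    have "(\<Sum>i\<le>n. real i ^ p) / real n ^ p \<le> (real n ^ Suc p / real (Suc p) + real n ^ p) / real n ^ p"
      by (intro divide_right_mono sum_power_le) auto
    also have "\<dots> = real n / real (p + 1) + 1" using n0 by (simp add: add_divide_distrib)
    finally show "(\<Sum>i\<le>n. (real i / real n) ^ p) \<le> real n / real (p + 1) + 1" unfolding e .
  qed
  let ?P = "\<lambda>p. \<Sum>i\<le>n. (real i / real n) ^ p"
  let ?d = "real d"
  have "(\<Sum>i\<le>n. (?d * (real i / real n) ^ (d - 1) - (?d + 1/2) * (real i / real n) ^ d)\<^sup>2)
     = (\<Sum>i\<le>n. ?d\<^sup>2 * (real i / real n) ^ (2 * d - 2) - 2 * ?d * (?d + 1/2) * (real i / real n) ^ (2 * d - 1) + (?d + 1/2)\<^sup>2 * (real i / real n) ^ (2 * d))"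
  proof (intro sum.cong refl)
    fix i
    define x where "x = real i / real n"
    have "x ^ (2 * d - 2) = (x ^ (d - 1))\<^sup>2" "x ^ (2 * d) = (x ^ d)\<^sup>2"
      by (simp_all add: power_mult[symmetric] diff_mult_distrib2 mult.commute)
    moreover have "x ^ (2 * d - 1) = x ^ (d - 1) * x ^ d"
      using d by (simp add: power_add[symmetric] mult_2)
    ultimately show "(?d * (real i / real n) ^ (d - 1) - (?d + 1/2) * (real i / real n) ^ d)\<^sup>2 =
       ?d\<^sup>2 * (real i / real n) ^ (2 * d - 2) - 2 * ?d * (?d + 1/2) * (real i / real n) ^ (2 * d - 1) + (?d + 1/2)\<^sup>2 * (real i / real n) ^ (2 * d)"
      unfolding x_def[symmetric] by (simp add: power2_diff power_mult_distrib)
  qed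
  also have "\<dots> = ?d\<^sup>2 * ?P (2 * d - 2) - 2 * ?d * (?d + 1/2) * ?P (2 * d - 1) + (?d + 1/2)\<^sup>2 * ?P (2 * d)"
    by (simp only: sum.distrib sum_subtractf sum_distrib_left)
  also have "\<dots> \<le> ?d\<^sup>2 * (real n / real (2 * d - 2 + 1) + 1) - 2 * ?d * (?d + 1/2) * (real n / real (2 * d - 1 + 1)) + (?d + 1/2)\<^sup>2 * (real n / real (2 * d + 1) + 1)"
    by (intro add_mono diff_mono mult_left_mono s) auto
  also have "\<dots> = real n * (?d\<^sup>2 / (2 * ?d - 1) - 2 * ?d * (?d + 1/2) / (2 * ?d) + (?d + 1/2)\<^sup>2 / (2 * ?d + 1)) + (?d\<^sup>2 + (?d + 1/2)\<^sup>2)"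
  proof -
    have "real (2 * d - 2 + 1) = 2 * ?d - 1" "real (2 * d - 1 + 1) = 2 * ?d" "real (2 * d + 1) = 2 * ?d + 1"
      using d by (auto simp: of_nat_diff)
    moreover have "A * (N / x + 1) - B * (N / y) + C * (N / z + 1) = N * (A / x - B / y + C / z) + (A + C)" for A B C N x y z :: real
      by (simp add: algebra_simps)
    ultimately show ?thesis by (simp only:)
  qed
  also have "?d\<^sup>2 / (2 * ?d - 1) - 2 * ?d * (?d + 1/2) / (2 * ?d) + (?d + 1/2)\<^sup>2 / (2 * ?d + 1) = 1 / (4 * (2 * ?d - 1))"
  proof -
    have a: "2 * ?d * (?d + 1/2) / (2 * ?d) = ?d + 1/2" using d by simp
    have b: "(?d + 1/2)\<^sup>2 / (2 * ?d + 1) = (2 * ?d + 1) / 4"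
      by (simp add: field_simps power2_eq_square)
    have c: "2 * ?d - 1 > 0" using d by simp
    have "?d\<^sup>2 / (2 * ?d - 1) - (?d + 1/2) + (2 * ?d + 1) / 4 = 1 / (4 * (2 * ?d - 1))"
      using c by (simp add: divide_simps) (simp add: power2_eq_square algebra_simps)
    then show ?thesis unfolding a b .
  qed
  finally show ?thesis .
qed

text \<open>
  The left side is the squared distance of u' from the line through u; any multiple c of u gives an
  upper bound.
\<close>

lemma one_minus_inner_sq_le:
  fixes u u' :: "nat \<Rightarrow> real"
  assumes "(\<Sum>j<J. (u j)\<^sup>2) = 1" "(\<Sum>j<J. (u' j)\<^sup>2) = 1"
  shows "1 - (\<Sum>j<J. u j * u' j)\<^sup>2 \<le> (\<Sum>j<J. (u' j - c * u j)\<^sup>2)"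
proof -
  define \<rho> where "\<rho> = (\<Sum>j<J. u j * u' j)"
  have "(\<Sum>j<J. (u' j - c * u j)\<^sup>2) = (\<Sum>j<J. (u' j)\<^sup>2 - 2 * c * (u j * u' j) + c\<^sup>2 * (u j)\<^sup>2)"
    by (intro sum.cong refl) (simp add: power2_eq_square algebra_simps)
  also have "\<dots> = 1 - 2 * c * \<rho> + c\<^sup>2"
    by (simp add: sum.distrib sum_subtractf sum_distrib_left[symmetric] assms \<rho>_def)
  also have "\<dots> = 1 - \<rho>\<^sup>2 + (c - \<rho>)\<^sup>2" by (simp add: power2_eq_square algebra_simps)
  finally show ?thesis by (simp add: \<rho>_def)
qed

text \<open>
  The squared sine of the angle between the weights at n and at n + D, estimated through the distance
  of the later weights from a suitable multiple of the earlier ones.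
\<close>

lemma weight_angle_sq:
  fixes e :: nat
  defines "d \<equiv> e + 2"
  obtains K where "K \<ge> 0"
    "\<And>n D J. 1 \<le> D \<Longrightarrow> D \<le> n \<Longrightarrow> n + D < J \<Longrightarrow>
      1 - (\<Sum>j<J. weight d n j * weight d (n + D) j)\<^sup>2 \<le> (real D / real n)\<^sup>2 * ((2 * real d + 1) / (4 * (2 * real d - 1)) + K * (real D / real n))"
proof -
  obtain K where K: "K \<ge> 0" "\<And>n y D. n \<ge> 1 \<Longrightarrow> 0 \<le> y \<Longrightarrow> y \<le> n \<Longrightarrow> 1 \<le> D \<Longrightarrow> D \<le> n \<Longrightarrow>
      \<bar>(poly (rising d) (y + D) - (1 + D / n * (real d + 1/2)) * poly (rising d) y)
        - D / n * n ^ d * (real d * (y / n) ^ (d - 1) - (real d + 1/2) * (y / n) ^ d)\<bar> \<le> K * ((D / n)\<^sup>2 * n ^ d)"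
    using rising_expansion[of e] unfolding d_def[symmetric] by blast
  define K5 where "K5 = 2 * (2 * real d + 1) * K + K\<^sup>2"
  have K5: "K5 \<ge> 0" using K by (simp add: K5_def)
  define K6 where "K6 = real (d + 1) ^ (2 * d)"
  define Q where "Q = ((real d)\<^sup>2 + (real d + 1/2)\<^sup>2) + 2 * K5 + K6"
  have Q: "Q \<ge> 0" using K5 by (simp add: Q_def K6_def)
  show thesis
  proof (rule that)
    show "(2 * real d + 1) * Q \<ge> 0" using Q by simp
    fix n D J :: nat assume D: "1 \<le> D" "D \<le> n" and J: "n + D < J"
    define \<eta> where "\<eta> = real D / real n"
    have n: "n \<ge> 1" using D by simp
    have n0: "real n > 0" using n by simp
    have \<eta>: "0 < \<eta>" "\<eta> \<le> 1" "1 / real n \<le> \<eta>" using D n0 by (auto simp: \<eta>_def divide_right_mono)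
    (* The ratio of the norms to first order; any other multiple would give a worse constant. *)
    define c where "c = 1 + \<eta> * (real d + 1/2)"
    define g where "g x = real d * x ^ (d - 1) - (real d + 1/2) * x ^ d" for x :: real
    have g_le: "\<bar>g x\<bar> \<le> 2 * real d + 1" if "0 \<le> x" "x \<le> 1" for x
    proof -
      have "0 \<le> x ^ (d - 1)" "x ^ (d - 1) \<le> 1" "0 \<le> x ^ d" "x ^ d \<le> 1" using that by (auto simp: power_le_one)
      then have "0 \<le> real d * x ^ (d - 1)" "real d * x ^ (d - 1) \<le> real d * 1" "0 \<le> (real d + 1/2) * x ^ d" "(real d + 1/2) * x ^ d \<le> (real d + 1/2) * 1"
        by (auto simp only: intro!: mult_left_mono mult_nonneg_nonneg)
      moreover have "real d \<ge> 0" by simp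
      ultimately show ?thesis unfolding g_def by (intro abs_diff_le_aux)
    qed
    have v_sq: "(poly (rising d) (real i + real D) - c * poly (rising d) (real i))\<^sup>2 \<le> (\<eta> * real n ^ d)\<^sup>2 * ((g (real i / real n))\<^sup>2 + K5 * \<eta>)"
      if i: "i \<le> n" for i
    proof -
      define v where "v = poly (rising d) (real i + real D) - c * poly (rising d) (real i)"
      define G where "G = g (real i / real n)"
      have G: "\<bar>G\<bar> \<le> 2 * real d + 1" unfolding G_def using i n0 by (intro g_le) auto
      have "\<bar>v - \<eta> * real n ^ d * G\<bar> \<le> K * (\<eta>\<^sup>2 * real n ^ d)"
        using K(2)[of "real n" "real i" "real D"] n i D by (simp add: v_def c_def G_def g_def \<eta>_def)
      moreover have "\<bar>\<eta> * real n ^ d * G\<bar> = \<eta> * real n ^ d * \<bar>G\<bar>" using \<eta> by (simp add: abs_mult)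
      ultimately have "\<bar>v\<bar> \<le> \<eta> * real n ^ d * \<bar>G\<bar> + K * (\<eta>\<^sup>2 * real n ^ d)" by linarith
      also have "\<dots> = \<eta> * real n ^ d * (\<bar>G\<bar> + K * \<eta>)" by (simp add: power2_eq_square algebra_simps)
      finally have "\<bar>v\<bar>\<^sup>2 \<le> (\<eta> * real n ^ d * (\<bar>G\<bar> + K * \<eta>))\<^sup>2" by (intro power_mono) auto
      then have "v\<^sup>2 \<le> (\<eta> * real n ^ d)\<^sup>2 * (\<bar>G\<bar> + K * \<eta>)\<^sup>2" by (simp only: power2_abs power_mult_distrib)
      also have "(\<bar>G\<bar> + K * \<eta>)\<^sup>2 \<le> G\<^sup>2 + K5 * \<eta>"
      proof -
        have "(\<bar>G\<bar> + K * \<eta>)\<^sup>2 = G\<^sup>2 + 2 * \<bar>G\<bar> * K * \<eta> + K\<^sup>2 * \<eta> * \<eta>" by (simp add: power2_eq_square algebra_simps)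
        also have "\<dots> \<le> G\<^sup>2 + 2 * (2 * real d + 1) * K * \<eta> + K\<^sup>2 * \<eta> * 1"
          using G K \<eta> by (intro add_mono mult_right_mono mult_left_mono) auto
        also have "\<dots> = G\<^sup>2 + K5 * \<eta>" by (simp add: K5_def algebra_simps)
        finally show ?thesis .
      qed
      finally show ?thesis unfolding v_def G_def by (simp add: mult_left_mono)
    qed
    have sumA: "(\<Sum>i\<le>n. (poly (rising d) (real i + real D) - c * poly (rising d) (real i))\<^sup>2)
       \<le> (\<eta> * real n ^ d)\<^sup>2 * (real n * (1 / (4 * (2 * real d - 1))) + ((real d)\<^sup>2 + (real d + 1/2)\<^sup>2) + (real n + 1) * (K5 * \<eta>))"
    proof -
      have "(\<Sum>i\<le>n. (poly (rising d) (real i + real D) - c * poly (rising d) (real i))\<^sup>2)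
         \<le> (\<Sum>i\<le>n. (\<eta> * real n ^ d)\<^sup>2 * ((g (real i / real n))\<^sup>2 + K5 * \<eta>))"
        by (intro sum_mono v_sq) auto
      also have "\<dots> = (\<eta> * real n ^ d)\<^sup>2 * ((\<Sum>i\<le>n. (g (real i / real n))\<^sup>2) + (real n + 1) * (K5 * \<eta>))"
        by (simp only: sum_distrib_left[symmetric] sum.distrib) (simp add: add.commute)
      also have "\<dots> \<le> (\<eta> * real n ^ d)\<^sup>2 * (real n * (1 / (4 * (2 * real d - 1))) + ((real d)\<^sup>2 + (real d + 1/2)\<^sup>2) + (real n + 1) * (K5 * \<eta>))"
        using sum_main_term[OF n, of d] unfolding g_def
        by (intro mult_left_mono add_right_mono) (auto simp: d_def)
      finally show ?thesis .
    qed
    have sumB: "(\<Sum>i<D. (poly (rising d) (real i))\<^sup>2) \<le> (\<eta> * real n ^ d)\<^sup>2 * (real n * (K6 * \<eta>))"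
    proof -
      have "(\<Sum>i<D. (poly (rising d) (real i))\<^sup>2) \<le> (\<Sum>i<D. (real (d + 1) * real D) ^ (2 * d))"
      proof (rule sum_mono)
        fix i assume "i \<in> {..<D}"
        then have "real i + real d \<le> real (d + 1) * real D"
          using D mult_left_mono[of 1 "real D" "real d"] by (simp add: algebra_simps)
        then have "poly (rising d) (real i) \<le> (real (d + 1) * real D) ^ d"
          by (intro order_trans[OF poly_rising_bounds(2)] power_mono) auto
        then have "(poly (rising d) (real i))\<^sup>2 \<le> ((real (d + 1) * real D) ^ d)\<^sup>2"
          by (intro power_mono poly_rising_nonneg) auto
        then show "(poly (rising d) (real i))\<^sup>2 \<le> (real (d + 1) * real D) ^ (2 * d)"
          by (simp only: power_even_eq)
      qed
      also have "\<dots> = K6 * (real D * real D ^ (2 * d))" by (simp add: K6_def power_mult_distrib)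
      also have "real D = \<eta> * real n" using n0 by (simp add: \<eta>_def)
      also have "K6 * (\<eta> * real n * (\<eta> * real n) ^ (2 * d)) = (real n ^ d)\<^sup>2 * real n * K6 * \<eta> * \<eta> ^ (2 * d)"
        by (simp add: power_mult_distrib power_mult[symmetric] mult_ac)
      also have "\<dots> \<le> (real n ^ d)\<^sup>2 * real n * K6 * \<eta> * \<eta> ^ 2"
        using \<eta> by (intro mult_left_mono power_decreasing) (auto simp: K6_def d_def)
      also have "\<dots> = (\<eta> * real n ^ d)\<^sup>2 * (real n * (K6 * \<eta>))" by (simp add: power_mult_distrib mult_ac)
      finally show ?thesis .
    qed
    (* The later weights have D additional entries, which are of smaller order as D / n is small. *)
    have split: "(\<Sum>j<J. (raw_weight d (n + D) j - c * raw_weight d n j)\<^sup>2) = (\<Sum>i\<le>n. (poly (rising d) (real i + real D) - c * poly (rising d) (real i))\<^sup>2) + (\<Sum>i<D. (poly (rising d) (real i))\<^sup>2)"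
    proof -
      have "(\<Sum>j<J. (raw_weight d (n + D) j - c * raw_weight d n j)\<^sup>2) = (\<Sum>j\<le>n + D. (raw_weight d (n + D) j - c * raw_weight d n j)\<^sup>2)"
        using J by (intro sum.mono_neutral_right) (auto simp: raw_weight_def)
      also have "\<dots> = (\<Sum>j\<le>n. (raw_weight d (n + D) j - c * raw_weight d n j)\<^sup>2) + (\<Sum>j\<in>{n<..n+D}. (raw_weight d (n + D) j - c * raw_weight d n j)\<^sup>2)"
      proof -
        have "{..n + D} = {..n} \<union> {n<..n+D}" by auto
        then show ?thesis by (simp only:) (intro sum.union_disjoint; auto)
      qed
      also have "(\<Sum>j\<le>n. (raw_weight d (n + D) j - c * raw_weight d n j)\<^sup>2) = (\<Sum>i\<le>n. (poly (rising d) (real i + real D) - c * poly (rising d) (real i))\<^sup>2)"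
        by (rule sum.reindex_bij_witness[of _ "\<lambda>i. n - i" "\<lambda>j. n - j"]) (auto simp: raw_weight_def of_nat_diff algebra_simps)
      also have "(\<Sum>j\<in>{n<..n+D}. (raw_weight d (n + D) j - c * raw_weight d n j)\<^sup>2) = (\<Sum>i<D. (poly (rising d) (real i))\<^sup>2)"
        by (rule sum.reindex_bij_witness[of _ "\<lambda>i. n + D - i" "\<lambda>j. n + D - j"]) (auto simp: raw_weight_def)
      finally show ?thesis .
    qed
    have total: "(\<Sum>j<J. (raw_weight d (n + D) j - c * raw_weight d n j)\<^sup>2) \<le> \<eta>\<^sup>2 * real n ^ (2 * d + 1) * (1 / (4 * (2 * real d - 1)) + Q * \<eta>)"
    proof -
      have "(real n + 1) \<le> 2 * real n" using n by simp
      then have a: "(real n + 1) * (K5 * \<eta>) \<le> 2 * real n * (K5 * \<eta>)" using K5 \<eta> by (intro mult_right_mono) auto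
      have "1 \<le> real n * \<eta>" using \<eta>(3) n0 by (simp add: field_simps)
      then have b: "((real d)\<^sup>2 + (real d + 1/2)\<^sup>2) * 1 \<le> ((real d)\<^sup>2 + (real d + 1/2)\<^sup>2) * (real n * \<eta>)" by (intro mult_left_mono) auto
      have "(real n * (1 / (4 * (2 * real d - 1))) + ((real d)\<^sup>2 + (real d + 1/2)\<^sup>2) + (real n + 1) * (K5 * \<eta>)) + real n * (K6 * \<eta>)
         \<le> real n * (1 / (4 * (2 * real d - 1)) + Q * \<eta>)"
        using a b unfolding Q_def by (simp only: distrib_left distrib_right mult_1_right) (simp add: mult_ac)
      then have "(\<eta> * real n ^ d)\<^sup>2 * ((real n * (1 / (4 * (2 * real d - 1))) + ((real d)\<^sup>2 + (real d + 1/2)\<^sup>2) + (real n + 1) * (K5 * \<eta>)) + real n * (K6 * \<eta>))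
        \<le> (\<eta> * real n ^ d)\<^sup>2 * (real n * (1 / (4 * (2 * real d - 1)) + Q * \<eta>))"
        by (intro mult_left_mono) auto
      also have "\<dots> = \<eta>\<^sup>2 * real n ^ (2 * d + 1) * (1 / (4 * (2 * real d - 1)) + Q * \<eta>)"
        by (simp add: power_mult_distrib power_mult[symmetric] mult_ac)
      finally show ?thesis unfolding split using sumA sumB by (simp only: distrib_left)
    qed
    have sg': "(weight_norm d (n + D))\<^sup>2 \<ge> real n ^ (2 * d + 1) / real (2 * d + 1)"
    proof -
      have "real n ^ (2 * d + 1) / real (2 * d + 1) \<le> real (n + D) ^ (2 * d + 1) / real (2 * d + 1)"
        by (intro divide_right_mono power_mono) auto
      then show ?thesis using weight_norm_sq_ge[where d = d and n = "n + D"] by linarith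
    qed
    have "1 - (\<Sum>j<J. weight d n j * weight d (n + D) j)\<^sup>2 \<le> (\<Sum>j<J. (weight d (n + D) j - (c * weight_norm d n / weight_norm d (n + D)) * weight d n j)\<^sup>2)"
      using J by (intro one_minus_inner_sq_le sum_weight) auto
    also have "\<dots> = (\<Sum>j<J. (raw_weight d (n + D) j - c * raw_weight d n j)\<^sup>2) / (weight_norm d (n + D))\<^sup>2"
      using weight_norm_pos[of d n] weight_norm_pos[of d "n + D"]
      by (simp add: weight_def sum_divide_distrib power_divide[symmetric] diff_divide_distrib)
    also have "\<dots> \<le> (\<eta>\<^sup>2 * real n ^ (2 * d + 1) * (1 / (4 * (2 * real d - 1)) + Q * \<eta>)) / (real n ^ (2 * d + 1) / real (2 * d + 1))"
      using n0 \<eta> Q by (intro frac_le total sg') (auto simp: d_def)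
    also have "\<dots> = \<eta>\<^sup>2 * (real (2 * d + 1) * (1 / (4 * (2 * real d - 1)) + Q * \<eta>))"
      using n0 by simp
    also have "\<dots> = \<eta>\<^sup>2 * ((2 * real d + 1) / (4 * (2 * real d - 1)) + (2 * real d + 1) * Q * \<eta>)"
    proof -
      have "real (2 * d + 1) = 2 * real d + 1" by simp
      then show ?thesis by (simp only: distrib_left times_divide_eq_right mult_1_right mult.assoc)
    qed
    finally show "1 - (\<Sum>j<J. weight d n j * weight d (n + D) j)\<^sup>2 \<le> (real D / real n)\<^sup>2 * ((2 * real d + 1) / (4 * (2 * real d - 1)) + (2 * real d + 1) * Q * (real D / real n))"
      by (simp only: \<eta>_def)
  qed
qed

text \<open>
  The constant on the right of the assumption tends to 1 / 4 as d grows, so that \<kappa> may be taken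
  arbitrarily close to 1 / 2.
\<close>

lemma weight_angle:
  fixes e :: nat and \<kappa> :: real
  defines "d \<equiv> e + 2"
  assumes \<kappa>: "\<kappa> > 0" "\<kappa>\<^sup>2 > (2 * real d + 1) / (4 * (2 * real d - 1))"
  obtains \<eta>0 where "\<eta>0 > 0"
    "\<And>n D J. 1 \<le> D \<Longrightarrow> D \<le> n \<Longrightarrow> n + D < J \<Longrightarrow> real D / real n \<le> \<eta>0 \<Longrightarrow>
      arccos (\<Sum>j<J. weight d n j * weight d (n + D) j) \<le> \<kappa> * (real D / real n)"
proof -
  obtain K where K: "K \<ge> 0" "\<And>n D J. 1 \<le> D \<Longrightarrow> D \<le> n \<Longrightarrow> n + D < J \<Longrightarrow>
      1 - (\<Sum>j<J. weight d n j * weight d (n + D) j)\<^sup>2 \<le> (real D / real n)\<^sup>2 * ((2 * real d + 1) / (4 * (2 * real d - 1)) + K * (real D / real n))"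
    using weight_angle_sq[of e] unfolding d_def[symmetric] by blast
  define k2 where "k2 = (2 * real d + 1) / (4 * (2 * real d - 1))"
  have "((\<lambda>x. (sin (\<kappa> * x) / x)\<^sup>2 - K * x) \<longlongrightarrow> \<kappa>\<^sup>2 - K * 0) (at_right 0)"
  proof (intro tendsto_intros)
    have "((\<lambda>x. sin (\<kappa> * x)) has_real_derivative \<kappa>) (at 0)"
      by (auto intro!: derivative_eq_intros)
    then show "((\<lambda>x. sin (\<kappa> * x) / x) \<longlongrightarrow> \<kappa>) (at_right 0)"
      by (simp add: has_field_derivative_iff filterlim_at_split)
  qed
  then have "\<forall>\<^sub>F x in at_right 0. (sin (\<kappa> * x) / x)\<^sup>2 - K * x > k2"
    by (rule order_tendstoD) (use \<kappa> in \<open>simp add: k2_def\<close>)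
  moreover have "\<forall>\<^sub>F x in at_right 0. \<kappa> * x < pi / 2"
  proof -
    have "((\<lambda>x. \<kappa> * x) \<longlongrightarrow> \<kappa> * 0) (at_right 0)" by (intro tendsto_intros)
    then show ?thesis by (rule order_tendstoD) simp
  qed
  ultimately have "\<forall>\<^sub>F x in at_right 0. (sin (\<kappa> * x) / x)\<^sup>2 - K * x > k2 \<and> \<kappa> * x < pi / 2"
    by eventually_elim auto
  then obtain b where b: "b > 0" "\<And>x. 0 < x \<Longrightarrow> x < b \<Longrightarrow> (sin (\<kappa> * x) / x)\<^sup>2 - K * x > k2 \<and> \<kappa> * x < pi / 2"
    unfolding eventually_at_right_field by auto
  show thesis
  proof (rule that[of "b / 2"])
    show "b / 2 > 0" using b by simp
    fix n D J :: nat assume D: "1 \<le> D" "D \<le> n" "n + D < J" and small: "real D / real n \<le> b / 2"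
    define \<eta> where "\<eta> = real D / real n"
    define \<rho> where "\<rho> = (\<Sum>j<J. weight d n j * weight d (n + D) j)"
    have "\<eta> \<le> b / 2" using small by (simp only: \<eta>_def)
    then have \<eta>b: "\<eta> < b" using b(1) by linarith
    have \<eta>p: "0 < \<eta>" using D by (simp add: \<eta>_def)
    note \<eta> = \<eta>p \<eta>b
    have \<rho>0: "\<rho> \<ge> 0" unfolding \<rho>_def weight_def
      by (intro sum_nonneg mult_nonneg_nonneg divide_nonneg_nonneg raw_weight_nonneg less_imp_le[OF weight_norm_pos])
    have "\<rho>\<^sup>2 \<le> 1"
      using Cauchy_Schwarz_ineq_sum[of "weight d n" "weight d (n + D)" "{..<J}"] D by (simp add: \<rho>_def sum_weight)
    then have \<rho>1: "\<rho> \<le> 1" using \<rho>0 by (simp add: abs_square_le_1)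
    have s: "sin (\<kappa> * \<eta>) ^ 2 \<ge> 1 - \<rho>\<^sup>2"
    proof -
      have "1 - \<rho>\<^sup>2 \<le> \<eta>\<^sup>2 * (k2 + K * \<eta>)"
        using K(2)[OF D] by (simp add: \<rho>_def \<eta>_def k2_def)
      also have "\<dots> \<le> \<eta>\<^sup>2 * (sin (\<kappa> * \<eta>) / \<eta>)\<^sup>2"
        using b(2)[OF \<eta>] by (intro mult_left_mono) auto
      also have "\<dots> = sin (\<kappa> * \<eta>) ^ 2" using \<eta> by (simp add: power_divide)
      finally show ?thesis .
    qed
    have k: "0 \<le> \<kappa> * \<eta>" "\<kappa> * \<eta> \<le> pi / 2" using b(2)[OF \<eta>] \<eta> \<kappa> by auto
    have "(cos (\<kappa> * \<eta>))\<^sup>2 \<le> \<rho>\<^sup>2" using s sin_cos_squared_add[of "\<kappa> * \<eta>"] by linarith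
    then have "cos (\<kappa> * \<eta>) \<le> \<rho>" by (rule power2_le_imp_le[OF _ \<rho>0])
    then have "arccos \<rho> \<le> arccos (cos (\<kappa> * \<eta>))"
      using \<rho>1 by (intro arccos_le_arccos) auto
    also have "\<dots> = \<kappa> * \<eta>" using k pi_gt_zero by (intro arccos_cos) auto
    finally show "arccos (\<Sum>j<J. weight d n j * weight d (n + D) j) \<le> \<kappa> * (real D / real n)"
      by (simp add: \<rho>_def \<eta>_def)
  qed
qed

section \<open>Several sign changes in a short interval\<close>

text \<open>
  A bound for the weights that is at most 1, as the estimates for linear forms require.
\<close>

definition weight_bound :: "nat \<Rightarrow> nat \<Rightarrow> real" where "weight_bound d n = min 1 (weight_const d / sqrt (real n))"

lemma weight_bound_bounds: "n \<ge> 1 \<Longrightarrow> 0 < weight_bound d n" "weight_bound d n \<le> 1"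
  using weight_const_ge_1[of d] by (auto simp: weight_bound_def)

lemma weight_le_weight_bound:
  assumes n: "n \<ge> 1"
  shows "\<bar>weight d n j\<bar> \<le> weight_bound d n"
proof -
  have "(weight d n j)\<^sup>2 \<le> (\<Sum>i<Suc (n + j). (weight d n i)\<^sup>2)" by (intro member_le_sum) auto
  also have "\<dots> = 1" by (rule sum_weight) simp
  finally have "\<bar>weight d n j\<bar> \<le> 1" by (simp add: abs_square_le_1)
  then show ?thesis using weight_le[OF n, of d j] by (simp add: weight_bound_def)
qed

lemma abs_sum_squared_le:
  fixes f :: "'b \<Rightarrow> real"
  assumes "finite A"
  shows "(\<Sum>x\<in>A. \<bar>f x\<bar>)\<^sup>2 \<le> real (card A) * (\<Sum>x\<in>A. (f x)\<^sup>2)"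
  using Cauchy_Schwarz_ineq_sum[of "\<lambda>_. 1" "\<lambda>x. \<bar>f x\<bar>" A] by simp

context kac_coeffs
begin

definition S :: "nat \<Rightarrow> 'a \<Rightarrow> nat \<Rightarrow> real" where "S k \<omega> = psum k (\<lambda>j. \<xi> j \<omega>)"

lemma S_measurable [measurable]: "(\<lambda>\<omega>. S k \<omega> n) \<in> borel_measurable M"
  unfolding S_def
proof (induction k arbitrary: n)
  case 0
  show ?case by simp
next
  case (Suc k)
  then show ?case by simp
qed

lemma sign_changes_eq_sum: "real (sign_changes s a b) = (\<Sum>j\<in>{a<..b}. if sg (s j) \<noteq> sg (s (j - 1)) then 1 else 0)"
  by (simp add: sign_changes_def sum.If_cases Int_def)

lemma sign_changes_measurable [measurable]: "(\<lambda>\<omega>. real (sign_changes (S k \<omega>) a b)) \<in> borel_measurable M"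
  unfolding sign_changes_eq_sum by measurable

lemma sign_changes_event [measurable]: "{\<omega> \<in> space M. sign_changes (S k \<omega>) a b \<ge> r} \<in> events"
proof -
  have "{\<omega> \<in> space M. real (sign_changes (S k \<omega>) a b) \<ge> real r} \<in> events" by measurable
  then show ?thesis by simp
qed

lemma S_second_moment:
  assumes "n \<ge> 1"
  shows "integrable M (\<lambda>\<omega>. (S (Suc d) \<omega> n)\<^sup>2)"
    and "expectation (\<lambda>\<omega>. (S (Suc d) \<omega> n)\<^sup>2) \<le> 2 * real (d + 1) ^ (2 * d) * real n ^ (2 * d + 1)"
proof -
  have eq: "(S (Suc d) \<omega> n)\<^sup>2 = (weight_norm d n / fact d)\<^sup>2 * (lin (Suc n) (weight d n) \<omega>)\<^sup>2" for \<omega>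
    unfolding S_def by (subst psum_eq_lin[of n "Suc n"]) (auto simp: power_mult_distrib power_divide)
  show "integrable M (\<lambda>\<omega>. (S (Suc d) \<omega> n)\<^sup>2)" unfolding eq using lin_second_moment(1) by simp
  have "expectation (\<lambda>\<omega>. (S (Suc d) \<omega> n)\<^sup>2) = (weight_norm d n / fact d)\<^sup>2"
    unfolding eq using lin_second_moment(2)[of "Suc n" "weight d n"] by (simp add: sum_weight del: sum.lessThan_Suc)
  also have "\<dots> \<le> (weight_norm d n / 1)\<^sup>2"
    using weight_norm_pos[of d n] by (intro power_mono divide_left_mono) (auto simp: fact_ge_1)
  also have "\<dots> \<le> (\<Sum>i\<le>n. (real (d + 1) ^ d * real n ^ d)\<^sup>2)"
    unfolding div_by_1 weight_norm_sq
  proof (intro sum_mono power_mono)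
    fix i assume "i \<in> {..n}"
    then show "poly (rising d) (real i) \<le> real (d + 1) ^ d * real n ^ d"
      using raw_weight_le[OF assms, of d "n - i"] by (simp add: raw_weight_def)
  qed (auto simp: poly_rising_nonneg)
  also have "\<dots> = (real n + 1) * (real (d + 1) ^ d * real n ^ d)\<^sup>2" by (simp add: add.commute)
  also have "\<dots> \<le> (2 * real n) * (real (d + 1) ^ d * real n ^ d)\<^sup>2" using assms by (intro mult_right_mono) auto
  also have "\<dots> = 2 * real (d + 1) ^ (2 * d) * real n ^ (2 * d + 1)"
    by (simp only: power_mult_distrib power_even_eq power_add power_one_right) (simp only: mult_ac)
  finally show "expectation (\<lambda>\<omega>. (S (Suc d) \<omega> n)\<^sup>2) \<le> 2 * real (d + 1) ^ (2 * d) * real n ^ (2 * d + 1)" .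
qed

lemma weight_bound_powr_le:
  assumes n: "n \<ge> 1"
  shows "weight_bound d n powr rate \<le> weight_const d powr rate * real n powr (- (rate / 2))"
proof -
  have "weight_bound d n powr rate \<le> (weight_const d / sqrt (real n)) powr rate"
    using rate_pos weight_bound_bounds(1)[OF n, of d] by (intro powr_mono2) (auto simp: weight_bound_def)
  also have "\<dots> = weight_const d powr rate / sqrt (real n) powr rate"
    using weight_const_ge_1[of d] n by (intro powr_divide)
  also have "sqrt (real n) powr rate = real n powr (rate / 2)"
  proof -
    have "sqrt (real n) = real n powr (1/2)" by (simp add: powr_half_sqrt)
    then have "sqrt (real n) powr rate = real n powr (1/2 * rate)" by (simp only: powr_powr)
    then show ?thesis by simp
  qed
  finally show ?thesis by (simp only: powr_minus divide_inverse)
qed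

text \<open>
  Either the normalised sum at a is at most \<tau>, or the discrete Rolle bound forces sums of order
  Suc d - r to be atypically large on the interval, which is excluded by Markov's inequality for their
  squares. Going down r orders of summation gains the factor (D / a)^(2 r).
\<close>

theorem many_changes_prob:
  assumes r: "1 \<le> r" "r \<le> d"
  obtains C where "C > 0" "\<And>a D \<tau>. 1 \<le> D \<Longrightarrow> D \<le> a \<Longrightarrow> \<tau> > 0 \<Longrightarrow>
     prob {\<omega> \<in> space M. sign_changes (S (Suc d) \<omega>) a (a + D) \<ge> r}
       \<le> C * (\<tau> + real a powr (- (rate / 2)) + (real D / real a) ^ (2 * r) / \<tau>\<^sup>2)"
proof -
  obtain K where K: "K > 0" and sb: "\<And>J (w :: nat \<Rightarrow> real) (\<epsilon> :: real) \<tau>. (\<And>j. j < J \<Longrightarrow> \<bar>w j\<bar> \<le> \<epsilon>) \<Longrightarrow> 0 < \<epsilon> \<Longrightarrow> \<epsilon> \<le> 1 \<Longrightarrow> (\<Sum>j<J. (w j)\<^sup>2) = 1 \<Longrightarrow>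
       prob {\<omega> \<in> space M. \<bar>lin J w \<omega>\<bar> \<le> \<tau>} \<le> K * (\<bar>\<tau>\<bar> + \<epsilon> powr rate)"
    using small_ball by blast
  define e where "e = d - r"
  have de: "d = e + r" using r by (simp add: e_def)
  have kr: "Suc d - r = Suc e" using r by (simp add: e_def)
  define R where "R = weight_const d powr rate"
  have R: "R \<ge> 1" using weight_const_ge_1[of d] rate_pos by (simp add: R_def ge_one_powr_ge_zero)
  define C2 where "C2 = 2 * real (e + 1) ^ (2 * e) * 2 ^ (2 * e + 1) * (fact d)\<^sup>2 * real (2 * d + 1)"
  have C2: "C2 > 0" unfolding C2_def by (intro mult_pos_pos) auto
  show thesis
  proof (rule that)
    show "K * R + C2 > 0" using K R C2 by (intro add_pos_pos mult_pos_pos) auto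
    fix a D :: nat and \<tau> :: real
    assume D: "1 \<le> D" "D \<le> a" and \<tau>: "\<tau> > 0"
    have a: "a \<ge> 1" using D by simp
    (* Y bounds the square of the Rolle bound, and T is the square of the threshold for the unnormalised sum. *)
    define Y where "Y \<omega> = real D ^ (2 * r - 1) * (\<Sum>l\<in>{a<..a+D}. (S (Suc e) \<omega> l)\<^sup>2)" for \<omega>
    define T where "T = (weight_norm d a / fact d)\<^sup>2 * \<tau>\<^sup>2"
    have T: "T > 0" using weight_norm_pos[of d a] \<tau> by (simp add: T_def)
    have iY: "integrable M Y" unfolding Y_def
      by (intro integrable_mult_right Bochner_Integration.integrable_sum S_second_moment(1)) auto
    have EY: "expectation Y \<le> real D ^ (2 * r) * (2 * real (e + 1) ^ (2 * e) * (2 * real a) ^ (2 * e + 1))"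
    proof -
      have "expectation Y = real D ^ (2 * r - 1) * (\<Sum>l\<in>{a<..a+D}. expectation (\<lambda>\<omega>. (S (Suc e) \<omega> l)\<^sup>2))"
        unfolding Y_def by (subst integral_mult_right_zero, subst Bochner_Integration.integral_sum) (auto intro!: S_second_moment(1))
      also have "\<dots> \<le> real D ^ (2 * r - 1) * (\<Sum>l\<in>{a<..a+D}. 2 * real (e + 1) ^ (2 * e) * (2 * real a) ^ (2 * e + 1))"
      proof (intro mult_left_mono sum_mono)
        fix l assume l: "l \<in> {a<..a+D}"
        have "expectation (\<lambda>\<omega>. (S (Suc e) \<omega> l)\<^sup>2) \<le> 2 * real (e + 1) ^ (2 * e) * real l ^ (2 * e + 1)"
          using l by (intro S_second_moment) auto
        also have "\<dots> \<le> 2 * real (e + 1) ^ (2 * e) * (2 * real a) ^ (2 * e + 1)"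
          using l D by (intro mult_left_mono power_mono) auto
        finally show "expectation (\<lambda>\<omega>. (S (Suc e) \<omega> l)\<^sup>2) \<le> 2 * real (e + 1) ^ (2 * e) * (2 * real a) ^ (2 * e + 1)" .
      qed auto
      also have "\<dots> = (real D ^ (2 * r - 1) * real D) * (2 * real (e + 1) ^ (2 * e) * (2 * real a) ^ (2 * e + 1))"
        by simp
      also have "real D ^ (2 * r - 1) * real D = real D ^ (2 * r)"
        using r by (metis One_nat_def Suc_diff_1 mult.commute nat_0_less_mult_iff power_Suc zero_less_numeral less_le_trans zero_less_one)
      finally show ?thesis .
    qed
    have "prob {\<omega> \<in> space M. sign_changes (S (Suc d) \<omega>) a (a + D) \<ge> r}
        \<le> prob ({\<omega> \<in> space M. \<bar>lin (Suc a) (weight d a) \<omega>\<bar> \<le> \<tau>} \<union> {\<omega> \<in> space M. T \<le> Y \<omega>})"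
    proof (intro finite_measure_mono subsetI)
      fix \<omega> assume "\<omega> \<in> {\<omega> \<in> space M. sign_changes (S (Suc d) \<omega>) a (a + D) \<ge> r}"
      then have \<omega>: "\<omega> \<in> space M" "sign_changes (S (Suc d) \<omega>) a (a + D) \<ge> r" by auto
      show "\<omega> \<in> {\<omega> \<in> space M. \<bar>lin (Suc a) (weight d a) \<omega>\<bar> \<le> \<tau>} \<union> {\<omega> \<in> space M. T \<le> Y \<omega>}"
      proof (cases "\<bar>lin (Suc a) (weight d a) \<omega>\<bar> \<le> \<tau>")
        case False
        have "\<bar>S (Suc d) \<omega> a\<bar> \<le> real (a + D - a) ^ (r - 1) * (\<Sum>l\<in>{a<..a+D}. \<bar>S (Suc d - r) \<omega> l\<bar>)"
          using \<omega>(2) r unfolding S_def by (intro psum_small_of_many_changes) auto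
        then have le: "\<bar>S (Suc d) \<omega> a\<bar> \<le> real D ^ (r - 1) * (\<Sum>l\<in>{a<..a+D}. \<bar>S (Suc e) \<omega> l\<bar>)"
          by (simp add: kr)
        have "T \<le> (weight_norm d a / fact d)\<^sup>2 * \<bar>lin (Suc a) (weight d a) \<omega>\<bar>\<^sup>2"
          unfolding T_def using False \<tau> by (intro mult_left_mono power_mono) auto
        also have "\<dots> = \<bar>S (Suc d) \<omega> a\<bar>\<^sup>2"
          unfolding S_def by (subst psum_eq_lin[of a "Suc a"]) (auto simp: power_mult_distrib power_divide)
        also have "\<dots> \<le> (real D ^ (r - 1) * (\<Sum>l\<in>{a<..a+D}. \<bar>S (Suc e) \<omega> l\<bar>))\<^sup>2"
          by (intro power_mono le) auto
        also have "\<dots> = (real D ^ (r - 1))\<^sup>2 * (\<Sum>l\<in>{a<..a+D}. \<bar>S (Suc e) \<omega> l\<bar>)\<^sup>2" by (rule power_mult_distrib)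
        also have "\<dots> \<le> (real D ^ (r - 1))\<^sup>2 * (real (card {a<..a+D}) * (\<Sum>l\<in>{a<..a+D}. (S (Suc e) \<omega> l)\<^sup>2))"
          by (intro mult_left_mono abs_sum_squared_le) auto
        also have "\<dots> = ((real D ^ (r - 1))\<^sup>2 * real D) * (\<Sum>l\<in>{a<..a+D}. (S (Suc e) \<omega> l)\<^sup>2)" by simp
        also have "(real D ^ (r - 1))\<^sup>2 * real D = real D ^ (2 * r - 1)"
        proof -
          have "2 * r - 1 = Suc (2 * (r - 1))" using r by simp
          then show ?thesis by (simp only: power_even_eq power_Suc) (simp only: mult.commute)
        qed
        finally show ?thesis using \<omega>(1) by (simp add: Y_def)
      qed (use \<omega> in auto)
    next
      show "{\<omega> \<in> space M. \<bar>lin (Suc a) (weight d a) \<omega>\<bar> \<le> \<tau>} \<union> {\<omega> \<in> space M. T \<le> Y \<omega>} \<in> events"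
        using borel_measurable_integrable[OF iY] by measurable
    qed
    also have "\<dots> \<le> prob {\<omega> \<in> space M. \<bar>lin (Suc a) (weight d a) \<omega>\<bar> \<le> \<tau>} + prob {\<omega> \<in> space M. T \<le> Y \<omega>}"
      using borel_measurable_integrable[OF iY] by (intro measure_Un_le) measurable
    also have "prob {\<omega> \<in> space M. \<bar>lin (Suc a) (weight d a) \<omega>\<bar> \<le> \<tau>} \<le> K * (\<tau> + R * real a powr (- (rate / 2)))"
    proof -
      have "prob {\<omega> \<in> space M. \<bar>lin (Suc a) (weight d a) \<omega>\<bar> \<le> \<tau>} \<le> K * (\<bar>\<tau>\<bar> + weight_bound d a powr rate)"
        using a weight_bound_bounds(1)[OF a, of d] weight_bound_bounds(2)[of d a] by (intro sb weight_le_weight_bound sum_weight) auto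
      also have "\<dots> \<le> K * (\<tau> + R * real a powr (- (rate / 2)))"
        using K \<tau> weight_bound_powr_le[OF a, of d] by (intro mult_left_mono) (auto simp: R_def)
      finally show ?thesis .
    qed
    also have "prob {\<omega> \<in> space M. T \<le> Y \<omega>} \<le> C2 * ((real D / real a) ^ (2 * r) / \<tau>\<^sup>2)"
    proof -
      have "prob {\<omega> \<in> space M. T \<le> Y \<omega>} \<le> expectation Y / T"
      proof -
        have "Y \<omega> \<ge> 0" for \<omega> unfolding Y_def by (intro mult_nonneg_nonneg sum_nonneg) auto
        then show ?thesis using integral_Markov_inequality_measure[OF iY, of "space M" T] T by simp
      qed
      also have "\<dots> \<le> (real D ^ (2 * r) * (2 * real (e + 1) ^ (2 * e) * (2 * real a) ^ (2 * e + 1))) / (real a ^ (2 * d + 1) / real (2 * d + 1) / (fact d)\<^sup>2 * \<tau>\<^sup>2)"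
      proof (rule frac_le[OF _ EY])
        show "0 < real a ^ (2 * d + 1) / real (2 * d + 1) / (fact d)\<^sup>2 * \<tau>\<^sup>2" using a \<tau> by (intro mult_pos_pos divide_pos_pos) auto
        have "real a ^ (2 * d + 1) / real (2 * d + 1) / (fact d)\<^sup>2 \<le> (weight_norm d a)\<^sup>2 / (fact d)\<^sup>2"
          by (intro divide_right_mono weight_norm_sq_ge) auto
        then show "real a ^ (2 * d + 1) / real (2 * d + 1) / (fact d)\<^sup>2 * \<tau>\<^sup>2 \<le> T"
          unfolding T_def power_divide by (intro mult_right_mono) auto
      qed auto
      also have "\<dots> = C2 * ((real D / real a) ^ (2 * r) / \<tau>\<^sup>2)"
      proof -
        have "real a ^ (2 * d + 1) = real a ^ (2 * e + 1) * real a ^ (2 * r)"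
          by (simp add: de power_add[symmetric])
        moreover have "(2 * real a) ^ (2 * e + 1) = 2 ^ (2 * e + 1) * real a ^ (2 * e + 1)" by (rule power_mult_distrib)
        moreover have "real a ^ (2 * e + 1) \<noteq> 0" using a by simp
        moreover have "(P * (k * (k2 * X))) / (X * Y / z / F * t) = (k * k2 * F * z) * (P / Y / t)" if "X \<noteq> 0" for P k k2 X Y z F t :: real
          using that by (simp add: field_simps)
        ultimately show ?thesis
          unfolding C2_def power_divide by (simp only:)
      qed
      finally show ?thesis .
    qed
    also have "K * (\<tau> + R * real a powr (- (rate / 2))) + C2 * ((real D / real a) ^ (2 * r) / \<tau>\<^sup>2)
       \<le> (K * R + C2) * (\<tau> + real a powr (- (rate / 2)) + (real D / real a) ^ (2 * r) / \<tau>\<^sup>2)"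
    proof -
      define x where "x = real a powr (- (rate / 2))"
      define y where "y = (real D / real a) ^ (2 * r) / \<tau>\<^sup>2"
      have xy: "x \<ge> 0" "y \<ge> 0" by (auto simp: x_def y_def)
      have "K * \<tau> \<le> K * R * \<tau>" using K R \<tau> by simp
      moreover have "0 \<le> K * R * y" "0 \<le> C2 * \<tau>" "0 \<le> C2 * x" using K R C2 xy \<tau> by auto
      ultimately have "K * (\<tau> + R * x) + C2 * y \<le> (K * R + C2) * (\<tau> + x + y)"
        by (simp add: algebra_simps)
      then show ?thesis by (simp only: x_def y_def)
    qed
    finally show "prob {\<omega> \<in> space M. sign_changes (S (Suc d) \<omega>) a (a + D) \<ge> r}
       \<le> (K * R + C2) * (\<tau> + real a powr (- (rate / 2)) + (real D / real a) ^ (2 * r) / \<tau>\<^sup>2)"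
      by simp
  qed
qed

end

section \<open>Dyadic blocks and their cells\<close>

lemma sign_changes_blocks: "sign_changes s g (g + n * D) = (\<Sum>i<n. sign_changes s (g + i * D) (g + i * D + D))"
proof (induction n)
  case (Suc n)
  have "sign_changes s g (g + Suc n * D) = sign_changes s g (g + n * D) + sign_changes s (g + n * D) (g + Suc n * D)"
    by (intro sign_changes_split) auto
  moreover have "g + Suc n * D = g + n * D + D" by simp
  ultimately show ?case using Suc by (simp only: sum.lessThan_Suc)
qed simp

lemma harmonic_block_le:
  assumes "N \<ge> (1::nat)"
  shows "(\<Sum>i<N. 1 / real (N + i)) \<le> ln 2 + 1 / real N"
proof -
  have "(\<Sum>i<n. 1 / real (N + Suc i)) \<le> ln (real (N + n)) - ln (real N)" for n
  proof (induction n)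
    case (Suc n)
    define x where "x = real (N + n)"
    have x: "x > 0" using assms by (simp add: x_def)
    have "ln (x / (x + 1)) \<le> x / (x + 1) - 1" using x by (intro ln_le_minus_one) auto
    moreover have "ln (x / (x + 1)) = ln x - ln (x + 1)" using x by (simp add: ln_div)
    moreover have "x / (x + 1) - 1 = - (1 / (x + 1))" using x by (simp add: field_simps)
    ultimately have "1 / (x + 1) \<le> ln (x + 1) - ln x" by linarith
    then show ?case using Suc by (simp add: x_def add.commute add.left_commute)
  qed simp
  from this[of N] have 1: "(\<Sum>i<N. 1 / real (N + Suc i)) \<le> ln 2"
    using assms by (simp add: ln_mult mult_2[symmetric])
  have "(\<Sum>i<N. 1 / real (N + i)) \<le> (\<Sum>i<N. 1 / real (N + i)) + 1 / real (N + N)" by simp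
  also have "\<dots> = (\<Sum>i<Suc N. 1 / real (N + i))" by simp
  also have "\<dots> = 1 / real N + (\<Sum>i<N. 1 / real (N + Suc i))" by (subst sum.lessThan_Suc_shift) simp
  finally show ?thesis using 1 by linarith
qed

text \<open>
  A layer-cake bound over dyadic thresholds.
\<close>

lemma square_le_dyadic_levels:
  fixes u c :: real
  assumes "0 \<le> u" "0 \<le> c" "u \<le> c * 2 ^ n"
  shows "u\<^sup>2 \<le> c\<^sup>2 + (\<Sum>b<n. c\<^sup>2 * 4 ^ Suc b * (if u > c * 2 ^ b then 1 else 0))"
  using assms(3)
proof (induction n)
  case 0
  then show ?case using assms by (simp add: power_mono)
next
  case (Suc n)
  show ?case
  proof (cases "u \<le> c * 2 ^ n")
    case True
    then show ?thesis using Suc.IH by simp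
  next
    case False
    have "u\<^sup>2 \<le> (c * 2 ^ Suc n)\<^sup>2" using Suc.prems assms by (intro power_mono) auto
    also have "\<dots> = c\<^sup>2 * 4 ^ Suc n" 
    proof -
      have "((2::real) ^ Suc n)\<^sup>2 = (2\<^sup>2) ^ Suc n" by (simp only: power_mult[symmetric] mult.commute)
      then show ?thesis by (simp add: power_mult_distrib)
    qed
    also have "\<dots> \<le> c\<^sup>2 + (\<Sum>b<Suc n. c\<^sup>2 * 4 ^ Suc b * (if u > c * 2 ^ b then 1 else 0))"
      using False by (simp add: sum_nonneg)
    finally show ?thesis .
  qed
qed

text \<open>
  The dyadic block from 2^m to 2^(m+1) is cut into 2^(3 l) cells of equal length, where 2^l is of order
  m^2. Powers of 2 make the cells end at integers. There are enough cells for single sign changes per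
  cell, and few enough for error terms exponentially small in m to be negligible after summation.
\<close>

definition level :: "nat \<Rightarrow> nat" where "level m = (LEAST l. (m + 1)\<^sup>2 \<le> 2 ^ l)"

lemma level_bounds: "(m + 1)\<^sup>2 \<le> 2 ^ level m" "2 ^ level m \<le> 2 * (m + 1)\<^sup>2"
proof -
  have ex: "\<exists>l. (m + 1)\<^sup>2 \<le> (2::nat) ^ l" by (metis less_exp less_imp_le)
  then show "(m + 1)\<^sup>2 \<le> 2 ^ level m" unfolding level_def by (rule LeastI_ex)
  show "2 ^ level m \<le> 2 * (m + 1)\<^sup>2"
  proof (cases "level m")
    case (Suc l)
    then have "\<not> (m + 1)\<^sup>2 \<le> (2::nat) ^ l" unfolding level_def by (intro not_less_Least) auto
    then show ?thesis using Suc by simp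
  qed simp
qed

definition cells :: "nat \<Rightarrow> nat" where "cells m = 2 ^ (3 * level m)"
definition width :: "nat \<Rightarrow> nat" where "width m = 2 ^ (m - 3 * level m)"
text \<open>
  The block is long enough to be cut into cells of integer length; this fails for finitely many m
  only.
\<close>

definition good :: "nat \<Rightarrow> bool" where "good m \<longleftrightarrow> 3 * level m \<le> m"

lemma cells_width: "good m \<Longrightarrow> cells m * width m = 2 ^ m"
  by (simp add: cells_def width_def good_def power_add[symmetric])

lemma width_pos: "width m \<ge> 1" by (simp add: width_def)

lemma cells_pos: "cells m \<ge> 1" by (simp add: cells_def)

lemma cells_le: "real (cells m) \<le> 8 * (real m + 1) ^ 6"
proof -
  have "cells m = (2 ^ level m) ^ 3" by (simp add: cells_def power_mult[symmetric] mult.commute)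
  also have "\<dots> \<le> (2 * (m + 1)\<^sup>2) ^ 3" by (intro power_mono level_bounds) auto
  also have "\<dots> = 8 * (m + 1) ^ 6" by (simp add: power_mult_distrib power_mult[symmetric])
  finally have "real (cells m) \<le> real (8 * (m + 1) ^ 6)" by (rule of_nat_mono)
  then show ?thesis by (simp add: add.commute)
qed

lemma cells_ge: "real (cells m) \<ge> (real m + 1)\<^sup>2"
proof -
  have "(m + 1)\<^sup>2 \<le> 2 ^ level m" by (rule level_bounds)
  also have "\<dots> \<le> cells m" unfolding cells_def by (intro power_increasing) auto
  finally have "real ((m + 1)\<^sup>2) \<le> real (cells m)" by (rule of_nat_mono)
  then show ?thesis by (simp add: add.commute)
qed

lemma eventually_good: "\<forall>\<^sub>F m in sequentially. good m"
proof -
  have "(\<lambda>m. (real m + 1) ^ 6 * (1/2) ^ m) \<longlonglongrightarrow> 0" by (rule power_times_geometric_tendsto_0) auto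
  then have "\<forall>\<^sub>F m in sequentially. (real m + 1) ^ 6 * (1/2) ^ m < 1 / 8" by (rule order_tendstoD) simp
  then show ?thesis
  proof eventually_elim
    case (elim m)
    then have "8 * (real m + 1) ^ 6 < 2 ^ m" by (simp add: power_divide field_simps)
    then have "real (cells m) < 2 ^ m" using cells_le[of m] by linarith
    then have "(2::nat) ^ (3 * level m) < 2 ^ m" by (simp add: cells_def flip: of_nat_power)
    then show ?case by (simp add: good_def)
  qed
qed

lemma poly_geometric_bounded:
  fixes \<theta> :: real
  assumes "0 < \<theta>" "\<theta> < 1"
  obtains B where "B > 0" "\<And>m. (real m + 1) ^ p * \<theta> ^ m \<le> B"
proof -
  have "Bseq (\<lambda>m. (real m + 1) ^ p * \<theta> ^ m)"
    using power_times_geometric_tendsto_0[OF assms, of p] by (intro convergent_imp_Bseq) (auto simp: convergent_def)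
  then obtain B where "B > 0" "\<And>m. norm ((real m + 1) ^ p * \<theta> ^ m) \<le> B" by (auto simp: Bseq_def)
  then show thesis using assms by (intro that[of B]) (auto simp: abs_mult)
qed

context kac_coeffs
begin

text \<open>
  The geometric rate at which the error terms of universality decay along the dyadic blocks.
\<close>

definition \<theta> :: real where "\<theta> = 2 powr (- (rate / 2))"

lemma \<theta>: "0 < \<theta>" "\<theta> < 1"
  using rate_pos by (auto simp: \<theta>_def powr_less_one)

lemma powr_rate_le:
  assumes "2 ^ m \<le> a"
  shows "real a powr (- (rate / 2)) \<le> \<theta> ^ m"
proof -
  have a: "(2::real) ^ m \<le> real a" using assms by (metis of_nat_le_iff of_nat_numeral of_nat_power)
  then have "real a powr (- (rate / 2)) \<le> (2 ^ m) powr (- (rate / 2))"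
    using rate_pos by (intro powr_mono2') auto
  also have "\<dots> = \<theta> ^ m" by (simp add: \<theta>_def powr_realpow[symmetric] powr_powr mult.commute powr_power)
  finally show ?thesis .
qed

definition node :: "nat \<Rightarrow> nat \<Rightarrow> nat" where "node m i = 2 ^ m + i * width m"

text \<open>
  Sign changes of the (d + 1)-fold partial sums between consecutive endpoints of cells. A single cell
  with two changes is invisible to this count, in exchange for which it consists of pair events that
  universality controls. The default 0 concerns finitely many blocks.
\<close>

definition block_changes :: "nat \<Rightarrow> nat \<Rightarrow> 'a \<Rightarrow> real"
  where "block_changes d m = (if good m then changes (Suc (2 ^ (m + 1))) (\<lambda>i. weight d (node m i)) (cells m) else (\<lambda>_. 0))"

lemma node_le: "good m \<Longrightarrow> i \<le> cells m \<Longrightarrow> node m i \<le> 2 ^ (m + 1)"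
  using mult_right_mono[of i "cells m" "width m"] cells_width[of m] by (simp add: node_def)

lemma node_ge: "node m i \<ge> 2 ^ m" by (simp add: node_def)

lemma node_pos: "node m i \<ge> 1" using node_ge[of m i] by (metis le_trans one_le_numeral one_le_power)

lemma block_changes_measurable [measurable]: "block_changes d m \<in> borel_measurable M"
  by (simp add: block_changes_def)

lemma block_changes_nonneg: "block_changes d m \<omega> \<ge> 0"
  by (simp add: block_changes_def changes_bounds)

lemma block_changes_eq_sum:
  assumes "good m"
  shows "block_changes d m \<omega> = (\<Sum>i<cells m. if sg (S (Suc d) \<omega> (node m i)) \<noteq> sg (S (Suc d) \<omega> (node m (Suc i))) then 1 else 0)"
proof -
  have "block_changes d m \<omega> = changes (Suc (2 ^ (m + 1))) (\<lambda>i. weight d (node m i)) (cells m) \<omega>" using assms by (simp add: block_changes_def)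
  also have "\<dots> = (\<Sum>i<cells m. if sg (S (Suc d) \<omega> (node m i)) \<noteq> sg (S (Suc d) \<omega> (node m (Suc i))) then 1 else 0)"
    unfolding changes_def
  proof (intro sum.cong refl)
    fix i assume "i \<in> {..<cells m}"
    then have "node m i < Suc (2 ^ (m + 1))" "node m (Suc i) < Suc (2 ^ (m + 1))"
      using node_le[OF assms, of i] node_le[OF assms, of "Suc i"] by auto
    then show "(if sg (lin (Suc (2 ^ (m + 1))) (weight d (node m i)) \<omega>) \<noteq> sg (lin (Suc (2 ^ (m + 1))) (weight d (node m (Suc i))) \<omega>) then 1 else 0)
       = (if sg (S (Suc d) \<omega> (node m i)) \<noteq> sg (S (Suc d) \<omega> (node m (Suc i))) then 1 else (0::real))"
      unfolding S_def by (simp only: sg_psum)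
  qed
  finally show ?thesis .
qed

lemma block_split:
  assumes "good m"
  shows "sign_changes s (2 ^ m) (2 ^ (m + 1)) = (\<Sum>i<cells m. sign_changes s (node m i) (node m i + width m))"
proof -
  have "(2::nat) ^ (m + 1) = 2 ^ m + cells m * width m" using cells_width[OF assms] by simp
  then show ?thesis by (simp only: sign_changes_blocks node_def)
qed

lemma node_Suc: "node m (Suc i) = node m i + width m" by (simp add: node_def)

lemma block_changes_le_sign_changes:
  assumes "good m"
  shows "block_changes d m \<omega> \<le> real (sign_changes (S (Suc d) \<omega>) (2 ^ m) (2 ^ (m + 1)))"
  unfolding block_changes_eq_sum[OF assms] block_split[OF assms] of_nat_sum
proof (rule sum_mono)
  fix i
  show "(if sg (S (Suc d) \<omega> (node m i)) \<noteq> sg (S (Suc d) \<omega> (node m (Suc i))) then 1 else 0) \<le> real (sign_changes (S (Suc d) \<omega>) (node m i) (node m i + width m))"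
    using sign_changes_pos_of_sg_neq[of "node m i" "node m i + width m" "S (Suc d) \<omega>"] by (auto simp: node_Suc)
qed

lemma block_changes_eq_sign_changes:
  assumes "good m" and "\<And>i. i < cells m \<Longrightarrow> sign_changes (S (Suc d) \<omega>) (node m i) (node m i + width m) < 2"
  shows "block_changes d m \<omega> = real (sign_changes (S (Suc d) \<omega>) (2 ^ m) (2 ^ (m + 1)))"
  unfolding block_changes_eq_sum[OF assms(1)] block_split[OF assms(1)] of_nat_sum
proof (rule sum.cong[OF refl])
  fix i assume "i \<in> {..<cells m}"
  then have "sign_changes (S (Suc d) \<omega>) (node m i) (node m i + width m) = 0 \<or> sign_changes (S (Suc d) \<omega>) (node m i) (node m i + width m) = 1"
    using assms(2)[of i] by auto
  then show "(if sg (S (Suc d) \<omega> (node m i)) \<noteq> sg (S (Suc d) \<omega> (node m (Suc i))) then 1 else 0) = real (sign_changes (S (Suc d) \<omega>) (node m i) (node m i + width m))"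
    using sign_changes_eq_0[of "node m i" "node m i + width m" "S (Suc d) \<omega>"] sign_changes_eq_1[of "node m i" "node m i + width m" "S (Suc d) \<omega>"]
    by (auto simp: node_Suc)
qed

text \<open>
  By Borel and Cantelli only finitely many cells contain two changes of sign, and the count at the
  endpoints of cells misses nothing else.
\<close>

lemma AE_single_changes:
  assumes d: "d \<ge> 2"
  shows "AE \<omega> in M. \<forall>\<^sub>F m in sequentially. block_changes d m \<omega> = real (sign_changes (S (Suc d) \<omega>) (2 ^ m) (2 ^ (m + 1)))"
proof -
  obtain C where C: "C > 0" "\<And>a D \<tau>. 1 \<le> D \<Longrightarrow> D \<le> a \<Longrightarrow> \<tau> > 0 \<Longrightarrow>
     prob {\<omega> \<in> space M. sign_changes (S (Suc d) \<omega>) a (a + D) \<ge> 2}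
       \<le> C * (\<tau> + real a powr (- (rate / 2)) + (real D / real a) ^ (2 * 2) / \<tau>\<^sup>2)"
    using many_changes_prob[of 2 d] d by auto
  obtain B where B: "B > 0" "\<And>m. (real m + 1) ^ 8 * \<theta> ^ m \<le> B" using poly_geometric_bounded[OF \<theta>] by blast
  define A where "A m = (\<Union>i<cells m. {\<omega> \<in> space M. sign_changes (S (Suc d) \<omega>) (node m i) (node m i + width m) \<ge> 2})" for m
  have A_sets: "A m \<in> events" for m unfolding A_def by measurable
  have PA: "prob (A m) \<le> C * (2 + 8 * B) * inverse (real (Suc m) ^ 2)" if "good m" for m
  proof -
    (* The cells have relative width \<delta>^3. With the threshold \<delta>^4 a cell has two changes with
       probability of order \<delta>^4, and there are \<delta>^(-3) cells; \<delta> itself is summable in m. *)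
    define \<delta> where "\<delta> = (1/2::real) ^ level m"
    have \<delta>: "\<delta> > 0" by (simp add: \<delta>_def)
    have c\<delta>: "real (cells m) * \<delta> ^ 3 = 1" 
    proof -
      have "real (cells m) = (2 ^ level m) ^ 3" by (simp only: cells_def mult.commute[of 3] power_mult of_nat_power of_nat_numeral)
      then have "real (cells m) * \<delta> ^ 3 = ((2 * (1 / 2)) ^ level m) ^ 3" by (simp only: \<delta>_def power_mult_distrib)
      then show ?thesis by simp
    qed
    have \<delta>m: "\<delta> \<le> inverse (real (Suc m) ^ 2)"
    proof -
      have "real ((m + 1)\<^sup>2) \<le> real (2 ^ level m)" using level_bounds(1)[of m] by (rule of_nat_mono)
      then show ?thesis by (simp add: \<delta>_def power_divide inverse_eq_divide field_simps)
    qed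
    have "prob (A m) \<le> (\<Sum>i<cells m. prob {\<omega> \<in> space M. sign_changes (S (Suc d) \<omega>) (node m i) (node m i + width m) \<ge> 2})"
      unfolding A_def by (intro finite_measure_subadditive_finite) auto
    also have "\<dots> \<le> (\<Sum>i<cells m. C * (\<delta> ^ 4 + \<theta> ^ m + \<delta> ^ 4))"
    proof (rule sum_mono)
      fix i assume "i \<in> {..<cells m}"
      have wm: "width m \<le> 2 ^ m" using cells_width[OF that] cells_pos[of m] by (metis One_nat_def le_square mult.commute mult_le_mono2 nat_mult_1_right)
      then have "width m \<le> node m i" using node_ge[of m i] by linarith
      have "prob {\<omega> \<in> space M. sign_changes (S (Suc d) \<omega>) (node m i) (node m i + width m) \<ge> 2}
         \<le> C * (\<delta> ^ 4 + real (node m i) powr (- (rate / 2)) + (real (width m) / real (node m i)) ^ (2 * 2) / (\<delta> ^ 4)\<^sup>2)"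
        using \<delta> by (intro C(2) width_pos \<open>width m \<le> node m i\<close>) auto
      also have "\<dots> \<le> C * (\<delta> ^ 4 + \<theta> ^ m + \<delta> ^ 4)"
      proof (intro mult_left_mono add_mono powr_rate_le node_ge order_refl)
        have "real (width m) / real (node m i) \<le> real (width m) / 2 ^ m"
          using node_ge[of m i] node_pos[of m i] by (intro divide_left_mono) (auto simp flip: of_nat_power intro!: of_nat_mono)
        also have "\<dots> = \<delta> ^ 3"
        proof -
          have "real (cells m) * real (width m) = 2 ^ m" using cells_width[OF that] by (metis of_nat_mult of_nat_numeral of_nat_power)
          then have "real (width m) / 2 ^ m = 1 / real (cells m)" using cells_pos[of m] by (simp add: field_simps)
          also have "\<dots> = \<delta> ^ 3" using c\<delta> cells_pos[of m] by (simp add: field_simps)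
          finally show ?thesis .
        qed
        finally have "(real (width m) / real (node m i)) ^ (2 * 2) \<le> (\<delta> ^ 3) ^ (2 * 2)" by (intro power_mono) auto
        then have "(real (width m) / real (node m i)) ^ (2 * 2) / (\<delta> ^ 4)\<^sup>2 \<le> (\<delta> ^ 3) ^ (2 * 2) / (\<delta> ^ 4)\<^sup>2" by (intro divide_right_mono) auto
        also have "\<dots> = \<delta> ^ 4" using \<delta> by (simp add: power_mult[symmetric] field_simps power_add[symmetric])
        finally show "(real (width m) / real (node m i)) ^ (2 * 2) / (\<delta> ^ 4)\<^sup>2 \<le> \<delta> ^ 4" .
      qed (use C in auto)
      finally show "prob {\<omega> \<in> space M. sign_changes (S (Suc d) \<omega>) (node m i) (node m i + width m) \<ge> 2} \<le> C * (\<delta> ^ 4 + \<theta> ^ m + \<delta> ^ 4)" .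
    qed
    also have "\<dots> = C * (2 * \<delta> * (real (cells m) * \<delta> ^ 3) + real (cells m) * \<theta> ^ m)"
      by (simp add: algebra_simps eval_nat_numeral)
    also have "\<dots> = C * (2 * \<delta> + real (cells m) * \<theta> ^ m)" by (simp only: c\<delta>) simp
    also have "\<dots> \<le> C * (2 * inverse (real (Suc m) ^ 2) + 8 * B * inverse (real (Suc m) ^ 2))"
    proof (intro mult_left_mono add_mono \<delta>m)
      have "real (cells m) * \<theta> ^ m \<le> 8 * (real m + 1) ^ 6 * \<theta> ^ m" using cells_le[of m] \<theta> by (intro mult_right_mono) auto
      also have "\<dots> = 8 * ((real m + 1) ^ 8 * \<theta> ^ m) * inverse (real (Suc m) ^ 2)"
      proof -
        have "(real m + 1) ^ 8 = (real m + 1) ^ 6 * real (Suc m) ^ 2" by (simp add: power_add[symmetric] add.commute)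
        then show ?thesis by (simp del: of_nat_Suc)
      qed
      also have "\<dots> \<le> 8 * B * inverse (real (Suc m) ^ 2)" using B by (intro mult_right_mono mult_left_mono) auto
      finally show "real (cells m) * \<theta> ^ m \<le> 8 * B * inverse (real (Suc m) ^ 2)" .
    qed (use C in auto)
    also have "\<dots> = C * (2 + 8 * B) * inverse (real (Suc m) ^ 2)" by (simp add: algebra_simps)
    finally show ?thesis .
  qed
  have "summable (\<lambda>m. prob (A m))"
  proof (rule summable_comparison_test_ev)
    show "\<forall>\<^sub>F m in sequentially. norm (prob (A m)) \<le> C * (2 + 8 * B) * inverse (real (Suc m) ^ 2)"
      using eventually_good by eventually_elim (use PA in auto)
    show "summable (\<lambda>m. C * (2 + 8 * B) * inverse (real (Suc m) ^ 2))"
      using inverse_power_summable[of 2, where 'a = real] by (intro summable_mult) (subst summable_Suc_iff[of "\<lambda>m. inverse (real m ^ 2)"], simp)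
  qed
  then have "AE \<omega> in M. \<forall>\<^sub>F m in sequentially. \<omega> \<in> space M - A m"
    using A_sets by (intro borel_cantelli_AE1) (auto simp: emeasure_eq_measure)
  then show ?thesis
  proof eventually_elim
    case (elim \<omega>)
    from elim eventually_good show ?case
    proof eventually_elim
      case (elim m)
      show ?case
      proof (rule block_changes_eq_sign_changes[OF elim(2)])
        fix i assume "i < cells m"
        then show "sign_changes (S (Suc d) \<omega>) (node m i) (node m i + width m) < 2"
          using elim(1) by (auto simp: A_def not_le)
      qed
    qed
  qed
qed

end

section \<open>Moments of the number of sign changes in a block\<close>

context kac_coeffs
begin

text \<open>
  If there are more than 6 * 2^b changes in a block, then one of its 2^b equal subintervals contains at least 6
  of them. The probability of this is essentially of order 8^(-b), which outweighs the growth 4^b of the square of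
  the threshold.
\<close>

lemma block_changes_second_moment:
  assumes d: "d \<ge> 6"
  obtains A where "\<And>m. expectation (\<lambda>\<omega>. (block_changes d m \<omega>)\<^sup>2) \<le> A"
proof -
  obtain C where C: "C > 0" "\<And>a D \<tau>. 1 \<le> D \<Longrightarrow> D \<le> a \<Longrightarrow> \<tau> > 0 \<Longrightarrow>
     prob {\<omega> \<in> space M. sign_changes (S (Suc d) \<omega>) a (a + D) \<ge> 6}
       \<le> C * (\<tau> + real a powr (- (rate / 2)) + (real D / real a) ^ (2 * 6) / \<tau>\<^sup>2)"
    using many_changes_prob[of 6 d] d by auto
  obtain B where B: "B > 0" "\<And>m. (real m + 1) ^ 18 * \<theta> ^ m \<le> B" using poly_geometric_bounded[OF \<theta>] by blast
  show thesis
  proof (rule that)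
    fix m
    show "expectation (\<lambda>\<omega>. (block_changes d m \<omega>)\<^sup>2) \<le> 36 + 144 * C * (4 + 512 * B)"
    proof (cases "good m")
      case False
      then show ?thesis using C B by (simp add: block_changes_def)
    next
      case good: True
      define n where "n = 3 * level m"
      have n: "cells m = 2 ^ n" "n \<le> m" using good by (auto simp: n_def cells_def good_def)
      (* The subintervals have relative length \<beta> = 2^(-b), and the threshold \<beta>^4 balances both terms. *)
      have bound: "prob {\<omega> \<in> space M. block_changes d m \<omega> > 6 * 2 ^ b} \<le> 2 ^ b * (C * (2 * ((1/2) ^ b) ^ 4 + \<theta> ^ m))" if b: "b < n" for b
      proof -
        define \<beta> where "\<beta> = (1/2::real) ^ b"
        have \<beta>: "\<beta> > 0" by (simp add: \<beta>_def)
        define D where "D = (2::nat) ^ (m - b)"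
        have D: "D \<ge> 1" by (simp add: D_def)
        have bD: "2 ^ b * D = 2 ^ m" using b n by (simp add: D_def power_add[symmetric])
        have D2: "D \<le> 2 ^ m" unfolding D_def by (intro power_increasing) auto
        have D\<beta>: "real D = \<beta> * 2 ^ m"
        proof -
          have "real (2 ^ b * D) = real (2 ^ m)" by (simp only: bD)
          then show ?thesis by (simp add: \<beta>_def power_divide field_simps)
        qed
        have "prob {\<omega> \<in> space M. block_changes d m \<omega> > 6 * 2 ^ b} \<le> prob (\<Union>i<2 ^ b. {\<omega> \<in> space M. sign_changes (S (Suc d) \<omega>) (2 ^ m + i * D) (2 ^ m + i * D + D) \<ge> 6})"
        proof (intro finite_measure_mono subsetI)
          fix \<omega> assume "\<omega> \<in> {\<omega> \<in> space M. block_changes d m \<omega> > 6 * 2 ^ b}"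
          then have \<omega>: "\<omega> \<in> space M" "block_changes d m \<omega> > 6 * 2 ^ b" by auto
          have "real (sign_changes (S (Suc d) \<omega>) (2 ^ m) (2 ^ (m + 1))) > 6 * 2 ^ b" using \<omega>(2) block_changes_le_sign_changes[OF good, of d \<omega>] by linarith
          moreover have "(2::nat) ^ (m + 1) = 2 ^ m + 2 ^ b * D" using bD by simp
          ultimately have big: "real (\<Sum>i<2 ^ b. sign_changes (S (Suc d) \<omega>) (2 ^ m + i * D) (2 ^ m + i * D + D)) > 6 * 2 ^ b"
            by (simp only: sign_changes_blocks)
          have "\<exists>i<2 ^ b. sign_changes (S (Suc d) \<omega>) (2 ^ m + i * D) (2 ^ m + i * D + D) \<ge> 6"
          proof (rule ccontr)
            assume "\<not> ?thesis"
            then have "(\<Sum>i<2 ^ b. sign_changes (S (Suc d) \<omega>) (2 ^ m + i * D) (2 ^ m + i * D + D)) \<le> (\<Sum>i<(2::nat) ^ b. 6)"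
              by (intro sum_mono) (auto simp: not_le)
            then have "real (\<Sum>i<2 ^ b. sign_changes (S (Suc d) \<omega>) (2 ^ m + i * D) (2 ^ m + i * D + D)) \<le> real (\<Sum>i<(2::nat) ^ b. 6)"
              by (rule of_nat_mono)
            then show False using big by simp
          qed
          then show "\<omega> \<in> (\<Union>i<2 ^ b. {\<omega> \<in> space M. sign_changes (S (Suc d) \<omega>) (2 ^ m + i * D) (2 ^ m + i * D + D) \<ge> 6})"
            using \<omega>(1) by auto
        qed measurable
        also have "\<dots> \<le> (\<Sum>i<2 ^ b. prob {\<omega> \<in> space M. sign_changes (S (Suc d) \<omega>) (2 ^ m + i * D) (2 ^ m + i * D + D) \<ge> 6})"
          by (intro finite_measure_subadditive_finite) auto
        also have "\<dots> \<le> (\<Sum>i<(2::nat) ^ b. C * (2 * \<beta> ^ 4 + \<theta> ^ m))"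
        proof (rule sum_mono)
          fix i :: nat
          define a where "a = 2 ^ m + i * D"
          have a: "2 ^ m \<le> a" "D \<le> a" using D2 by (auto simp: a_def)
          have ar: "(2::real) ^ m \<le> real a" using a(1) by (metis of_nat_le_iff of_nat_numeral of_nat_power)
          have "prob {\<omega> \<in> space M. sign_changes (S (Suc d) \<omega>) a (a + D) \<ge> 6}
             \<le> C * (\<beta> ^ 4 + real a powr (- (rate / 2)) + (real D / real a) ^ (2 * 6) / (\<beta> ^ 4)\<^sup>2)"
            using \<beta> by (intro C(2) D a) auto
          also have "\<dots> \<le> C * (\<beta> ^ 4 + \<theta> ^ m + \<beta> ^ 4)"
          proof (intro mult_left_mono add_mono powr_rate_le a order_refl)
            have "real D / real a \<le> real D / 2 ^ m"
            proof -
              have "real a > 0" using ar by (rule less_le_trans[rotated]) simp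
              then show ?thesis using ar by (intro divide_left_mono) auto
            qed
            also have "\<dots> = \<beta>" by (simp add: D\<beta>)
            finally have "(real D / real a) ^ (2 * 6) \<le> \<beta> ^ (2 * 6)" by (intro power_mono) auto
            then have "(real D / real a) ^ (2 * 6) / (\<beta> ^ 4)\<^sup>2 \<le> \<beta> ^ (2 * 6) / (\<beta> ^ 4)\<^sup>2" by (intro divide_right_mono) auto
            also have "\<dots> = \<beta> ^ 4"
            proof -
              have a: "\<beta> ^ (2 * 6) = \<beta> ^ 4 * \<beta> ^ 8" by (simp add: power_add[symmetric])
              have b: "(\<beta> ^ 4)\<^sup>2 = \<beta> ^ 8" by (simp add: power_mult[symmetric])
              show ?thesis unfolding a b by (rule nonzero_mult_div_cancel_right) (use \<beta> in simp)
            qed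
            finally show "(real D / real a) ^ (2 * 6) / (\<beta> ^ 4)\<^sup>2 \<le> \<beta> ^ 4" .
          qed (use C in auto)
          finally show "prob {\<omega> \<in> space M. sign_changes (S (Suc d) \<omega>) (2 ^ m + i * D) (2 ^ m + i * D + D) \<ge> 6} \<le> C * (2 * \<beta> ^ 4 + \<theta> ^ m)"
            by (simp add: a_def)
        qed
        also have "\<dots> = 2 ^ b * (C * (2 * \<beta> ^ 4 + \<theta> ^ m))" by simp
        finally show ?thesis by (simp only: \<beta>_def)
      qed
      define I where "I b = indicat_real {\<omega> \<in> space M. block_changes d m \<omega> > 6 * 2 ^ b}" for b :: nat
      have iI: "integrable M (I b)" for b unfolding I_def by (rule integrable_const_bound[of _ 1]) auto
      have EI: "expectation (I b) = prob {\<omega> \<in> space M. block_changes d m \<omega> > 6 * 2 ^ b}" for b unfolding I_def by simp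
      have I0: "I b \<omega> \<ge> 0" for b \<omega> by (simp add: I_def)
      have Un: "block_changes d m \<omega> \<le> 6 * 2 ^ n" for \<omega>
      proof -
        have "block_changes d m \<omega> \<le> 2 ^ n"
          using changes_bounds(2)[of "Suc (2 ^ (m + 1))" "\<lambda>i. weight d (node m i)" "cells m" \<omega>] good n(1) by (simp add: block_changes_def)
        moreover have "(2::real) ^ n \<le> 6 * 2 ^ n" by simp
        ultimately show ?thesis by (rule order_trans)
      qed
      have "expectation (\<lambda>\<omega>. (block_changes d m \<omega>)\<^sup>2) \<le> expectation (\<lambda>\<omega>. 36 + (\<Sum>b<n. 36 * 4 ^ Suc b * I b \<omega>))"
      proof (rule integral_mono')
        show "integrable M (\<lambda>\<omega>. 36 + (\<Sum>b<n. 36 * 4 ^ Suc b * I b \<omega>))" using iI by auto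
        fix \<omega> assume w: "\<omega> \<in> space M"
        have "(block_changes d m \<omega>)\<^sup>2 \<le> 6\<^sup>2 + (\<Sum>b<n. 6\<^sup>2 * 4 ^ Suc b * (if block_changes d m \<omega> > 6 * 2 ^ b then 1 else 0))"
          by (rule square_le_dyadic_levels) (auto simp: block_changes_nonneg Un)
        also have "\<dots> = 36 + (\<Sum>b<n. 36 * 4 ^ Suc b * I b \<omega>)" 
          by (intro arg_cong2[of _ _ _ _ "(+)"] sum.cong refl) (auto simp: I_def w)
        finally show "(block_changes d m \<omega>)\<^sup>2 \<le> 36 + (\<Sum>b<n. 36 * 4 ^ Suc b * I b \<omega>)" .
      qed (auto intro!: add_nonneg_nonneg sum_nonneg mult_nonneg_nonneg I0)
      also have "\<dots> = 36 + (\<Sum>b<n. 36 * 4 ^ Suc b * prob {\<omega> \<in> space M. block_changes d m \<omega> > 6 * 2 ^ b})"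
        using iI by (simp add: prob_space Bochner_Integration.integral_sum EI)
      also have "\<dots> \<le> 36 + (\<Sum>b<n. 144 * C * (2 * (1/2) ^ b + 8 ^ b * \<theta> ^ m))"
      proof (intro add_left_mono sum_mono)
        fix b assume "b \<in> {..<n}"
        then have b: "b < n" by simp
        have "36 * 4 ^ Suc b * prob {\<omega> \<in> space M. block_changes d m \<omega> > 6 * 2 ^ b} \<le> 36 * 4 ^ Suc b * (2 ^ b * (C * (2 * ((1/2) ^ b) ^ 4 + \<theta> ^ m)))"
          by (intro mult_left_mono bound b) auto
        also have "\<dots> = 144 * C * (2 * ((4 ^ b * 2 ^ b) * ((1/2) ^ b) ^ 4) + (4 ^ b * 2 ^ b) * \<theta> ^ m)"
          by (simp add: algebra_simps)
        also have "4 ^ b * 2 ^ b = (8::real) ^ b" by (simp add: power_mult_distrib[symmetric])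
        also have "8 ^ b * ((1/2::real) ^ b) ^ 4 = (1/2) ^ b"
        proof -
          have "8 ^ b * ((1/2::real) ^ b) ^ 4 = (8 * (1/2) ^ 4) ^ b"
            by (simp only: power_mult_distrib power_mult[symmetric] mult.commute[of b])
          then show ?thesis by (simp add: power_divide)
        qed
        finally show "36 * 4 ^ Suc b * prob {\<omega> \<in> space M. block_changes d m \<omega> > 6 * 2 ^ b} \<le> 144 * C * (2 * (1/2) ^ b + 8 ^ b * \<theta> ^ m)" .
      qed
      also have "(\<Sum>b<n. 144 * C * (2 * (1/2) ^ b + 8 ^ b * \<theta> ^ m)) = 144 * C * (2 * (\<Sum>b<n. (1/2) ^ b) + (\<Sum>b<n. 8 ^ b) * \<theta> ^ m)"
        by (simp add: sum_distrib_left sum.distrib sum_distrib_right distrib_left)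
      also have "\<dots> \<le> 144 * C * (2 * 2 + 512 * B)"
      proof (intro mult_left_mono add_mono)
        have "(\<Sum>b<n. (1/2::real) ^ b) = ((1/2) ^ n - 1) / (1/2 - 1)" by (rule geometric_sum) simp
        also have "\<dots> = 2 * (1 - (1/2) ^ n)" by (simp add: algebra_simps)
        also have "\<dots> \<le> 2" by simp
        finally show "(\<Sum>b<n. (1/2::real) ^ b) \<le> 2" .
        have "(\<Sum>b<n. (8::real) ^ b) \<le> 8 ^ n" by (simp add: geometric_sum field_simps)
        also have "\<dots> = real (cells m) ^ 3"
        proof -
          have "(8::real) ^ n = (2 ^ 3) ^ n" by simp
          also have "\<dots> = (2 ^ n) ^ 3" by (simp only: power_mult[symmetric] mult.commute)
          finally show ?thesis by (simp add: n(1))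
        qed
        also have "\<dots> \<le> (8 * (real m + 1) ^ 6) ^ 3" by (intro power_mono cells_le) auto
        also have "\<dots> = 512 * (real m + 1) ^ 18" by (simp add: power_mult_distrib power_mult[symmetric])
        finally have "(\<Sum>b<n. (8::real) ^ b) * \<theta> ^ m \<le> 512 * (real m + 1) ^ 18 * \<theta> ^ m" using \<theta> by (intro mult_right_mono) auto
        also have "\<dots> \<le> 512 * B" using B(2)[of m] by simp
        finally show "(\<Sum>b<n. (8::real) ^ b) * \<theta> ^ m \<le> 512 * B" .
      qed (use C in auto)
      finally show ?thesis by simp
    qed
  qed
qed

lemma expectation_changes:
  "expectation (changes J W n) = (\<Sum>i<n. prob {\<omega> \<in> space M. sg (lin J (W i) \<omega>) \<noteq> sg (lin J (W (Suc i)) \<omega>)})"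
proof -
  have iI: "integrable M (indicat_real {\<omega> \<in> space M. sg (lin J (W i) \<omega>) \<noteq> sg (lin J (W (Suc i)) \<omega>)})" for i
    by (rule integrable_const_bound[of _ 1]) auto
  have "expectation (changes J W n) = expectation (\<lambda>\<omega>. \<Sum>i<n. indicat_real {\<omega> \<in> space M. sg (lin J (W i) \<omega>) \<noteq> sg (lin J (W (Suc i)) \<omega>)} \<omega>)"
  proof (rule Bochner_Integration.integral_cong[OF refl])
    fix \<omega> assume "\<omega> \<in> space M"
    then show "changes J W n \<omega> = (\<Sum>i<n. indicat_real {\<omega> \<in> space M. sg (lin J (W i) \<omega>) \<noteq> sg (lin J (W (Suc i)) \<omega>)} \<omega>)"
      unfolding changes_def by (intro sum.cong refl) (auto simp: indicator_def)
  qed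
  then show ?thesis using iI by (simp add: Bochner_Integration.integral_sum)
qed

text \<open>
  The cell that starts at a and has width D contributes at most \<kappa> * D / (a * pi), and the sum of
  D / a over a dyadic block is a harmonic sum close to ln 2.
\<close>

lemma block_changes_mean:
  fixes e :: nat and \<kappa> \<gamma> :: real
  defines "d \<equiv> e + 2"
  assumes \<kappa>: "\<kappa> > 0" "\<kappa>\<^sup>2 > (2 * real d + 1) / (4 * (2 * real d - 1))" and \<gamma>: "\<gamma> > \<kappa> * ln 2 / pi"
  shows "\<forall>\<^sub>F m in sequentially. expectation (block_changes d m) \<le> \<gamma>"
proof -
  obtain \<eta>0 where \<eta>0: "\<eta>0 > 0"
    "\<And>n D J. 1 \<le> D \<Longrightarrow> D \<le> n \<Longrightarrow> n + D < J \<Longrightarrow> real D / real n \<le> \<eta>0 \<Longrightarrow>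
      arccos (\<Sum>j<J. weight d n j * weight d (n + D) j) \<le> \<kappa> * (real D / real n)"
    using weight_angle[of \<kappa> e] \<kappa> unfolding d_def by blast
  obtain C where C: "C > 0" "\<And>J (w :: nat \<Rightarrow> real) w' (\<epsilon> :: real). (\<And>j. j < J \<Longrightarrow> \<bar>w j\<bar> \<le> \<epsilon>) \<Longrightarrow> (\<And>j. j < J \<Longrightarrow> \<bar>w' j\<bar> \<le> \<epsilon>) \<Longrightarrow> 0 < \<epsilon> \<Longrightarrow> \<epsilon> \<le> 1 \<Longrightarrow>
       (\<Sum>j<J. (w j)\<^sup>2) = 1 \<Longrightarrow> (\<Sum>j<J. (w' j)\<^sup>2) = 1 \<Longrightarrow>
       \<bar>prob {\<omega> \<in> space M. sg (lin J w \<omega>) \<noteq> sg (lin J w' \<omega>)} - arccos (\<Sum>j<J. w j * w' j) / pi\<bar> \<le> C * \<epsilon> powr rate"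
    using sign_change_prob by blast
  define R where "R = weight_const d powr rate"
  have R: "R > 0" using weight_const_ge_1[of d] by (simp add: R_def)
  have Um: "expectation (block_changes d m) \<le> \<kappa> / pi * (ln 2 + 1 / (real m + 1)\<^sup>2) + 8 * C * R * ((real m + 1) ^ 6 * \<theta> ^ m)"
    if good: "good m" and sm: "1 / (real m + 1)\<^sup>2 \<le> \<eta>0" for m
  proof -
    let ?J = "Suc (2 ^ (m + 1))"
    have wm: "width m * cells m = 2 ^ m" using cells_width[OF good] by (simp add: mult.commute)
    have nodeN: "node m i = width m * (cells m + i)" for i
      unfolding node_def wm[symmetric] by (simp add: algebra_simps)
    have ratio: "real (width m) / real (node m i) = 1 / real (cells m + i)" for i
      using width_pos[of m] by (simp add: nodeN)
    have "expectation (block_changes d m) = (\<Sum>i<cells m. prob {\<omega> \<in> space M. sg (lin ?J (weight d (node m i)) \<omega>) \<noteq> sg (lin ?J (weight d (node m (Suc i))) \<omega>)})"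
      using good by (simp add: block_changes_def expectation_changes)
    also have "\<dots> \<le> (\<Sum>i<cells m. \<kappa> / pi * (1 / real (cells m + i)) + C * (R * \<theta> ^ m))"
    proof (rule sum_mono)
      fix i assume "i \<in> {..<cells m}"
      then have i: "i < cells m" by simp
      have lt: "node m (Suc i) < ?J" "node m i < ?J" using node_le[OF good, of "Suc i"] node_le[OF good, of i] i by auto
      define \<epsilon> where "\<epsilon> = weight_bound d (node m i)"
      have \<epsilon>: "0 < \<epsilon>" "\<epsilon> \<le> 1" using weight_bound_bounds node_pos by (auto simp: \<epsilon>_def)
      have w1: "\<bar>weight d (node m i) j\<bar> \<le> \<epsilon>" for j unfolding \<epsilon>_def by (rule weight_le_weight_bound[OF node_pos])
      have w2: "\<bar>weight d (node m (Suc i)) j\<bar> \<le> \<epsilon>" for j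
      proof -
        have "\<bar>weight d (node m (Suc i)) j\<bar> \<le> weight_bound d (node m (Suc i))" by (rule weight_le_weight_bound[OF node_pos])
        also have "\<dots> \<le> \<epsilon>" unfolding \<epsilon>_def weight_bound_def using weight_const_ge_1[of d] node_pos[of m i]
          by (intro min.mono divide_left_mono) (auto simp: node_Suc)
        finally show ?thesis .
      qed
      have "prob {\<omega> \<in> space M. sg (lin ?J (weight d (node m i)) \<omega>) \<noteq> sg (lin ?J (weight d (node m (Suc i))) \<omega>)}
         \<le> arccos (\<Sum>j<?J. weight d (node m i) j * weight d (node m (Suc i)) j) / pi + C * \<epsilon> powr rate"
        using C(2)[OF w1 w2 \<epsilon> sum_weight[OF lt(2)] sum_weight[OF lt(1)]] by linarith
      also have "arccos (\<Sum>j<?J. weight d (node m i) j * weight d (node m (Suc i)) j) \<le> \<kappa> * (real (width m) / real (node m i))"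
        unfolding node_Suc
      proof (rule \<eta>0(2))
        show "width m \<le> node m i" unfolding nodeN using cells_pos[of m] by simp
        show "node m i + width m < ?J" using lt(1) by (simp add: node_Suc)
        have "real (width m) / real (node m i) \<le> 1 / real (cells m)" unfolding ratio using cells_pos[of m] by (intro divide_left_mono) auto
        also have "\<dots> \<le> 1 / (real m + 1)\<^sup>2" using cells_ge[of m] cells_pos[of m] by (intro divide_left_mono) auto
        finally show "real (width m) / real (node m i) \<le> \<eta>0" using sm by linarith
      qed (rule width_pos)
      also have "\<epsilon> powr rate \<le> R * \<theta> ^ m"
      proof -
        have "\<epsilon> powr rate \<le> R * real (node m i) powr (- (rate / 2))" unfolding \<epsilon>_def R_def by (rule weight_bound_powr_le[OF node_pos])
        also have "\<dots> \<le> R * \<theta> ^ m" using R by (intro mult_left_mono powr_rate_le node_ge) auto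
        finally show ?thesis .
      qed
      finally show "prob {\<omega> \<in> space M. sg (lin ?J (weight d (node m i)) \<omega>) \<noteq> sg (lin ?J (weight d (node m (Suc i))) \<omega>)}
         \<le> \<kappa> / pi * (1 / real (cells m + i)) + C * (R * \<theta> ^ m)"
        using C(1) unfolding ratio by (simp add: divide_right_mono mult_left_mono mult.commute)
    qed
    also have "\<dots> = \<kappa> / pi * (\<Sum>i<cells m. 1 / real (cells m + i)) + real (cells m) * (C * (R * \<theta> ^ m))"
      by (simp add: sum.distrib sum_distrib_left)
    also have "\<dots> \<le> \<kappa> / pi * (ln 2 + 1 / (real m + 1)\<^sup>2) + (8 * (real m + 1) ^ 6) * (C * (R * \<theta> ^ m))"
    proof (intro add_mono mult_left_mono mult_right_mono cells_le)
      have "(\<Sum>i<cells m. 1 / real (cells m + i)) \<le> ln 2 + 1 / real (cells m)" by (rule harmonic_block_le[OF cells_pos])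
      also have "1 / real (cells m) \<le> 1 / (real m + 1)\<^sup>2" using cells_ge[of m] cells_pos[of m] by (intro divide_left_mono) auto
      finally show "(\<Sum>i<cells m. 1 / real (cells m + i)) \<le> ln 2 + 1 / (real m + 1)\<^sup>2" by simp
    qed (use \<kappa> C R \<theta> in auto)
    finally show ?thesis by (simp add: mult_ac)
  qed
  have lim: "(\<lambda>m. \<kappa> / pi * (ln 2 + 1 / (real m + 1)\<^sup>2) + 8 * C * R * ((real m + 1) ^ 6 * \<theta> ^ m)) \<longlonglongrightarrow> \<kappa> / pi * (ln 2 + 0) + 8 * C * R * 0"
  proof (intro tendsto_intros power_times_geometric_tendsto_0 \<theta>)
    show "(\<lambda>m. 1 / (real m + 1)\<^sup>2) \<longlonglongrightarrow> 0" by real_asymp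
  qed
  have "\<forall>\<^sub>F m in sequentially. \<kappa> / pi * (ln 2 + 1 / (real m + 1)\<^sup>2) + 8 * C * R * ((real m + 1) ^ 6 * \<theta> ^ m) < \<gamma>"
    using order_tendstoD(2)[OF lim, of \<gamma>] \<gamma> by simp
  moreover have "\<forall>\<^sub>F m in sequentially. 1 / (real m + 1)\<^sup>2 < \<eta>0"
  proof -
    have "(\<lambda>m. 1 / (real m + 1)\<^sup>2) \<longlonglongrightarrow> 0" by real_asymp
    then show ?thesis by (rule order_tendstoD) (rule \<eta>0)
  qed
  ultimately show ?thesis using eventually_good
    by eventually_elim (use Um in fastforce)
qed

text \<open>
  In block l the coefficients up to the end of block m carry a fraction of order 2^(m - l) of the
  variance; deleting them rarely changes a sign.
\<close>

lemma block_changes_cov: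
  obtains A where "A \<ge> 0" "\<And>m l. m < l \<Longrightarrow> real (l - m) > sqrt (real l) \<Longrightarrow>
     \<bar>expectation (\<lambda>\<omega>. block_changes d m \<omega> * block_changes d l \<omega>) - expectation (block_changes d m) * expectation (block_changes d l)\<bar> \<le> A / real (Suc l)"
proof -
  obtain C where C: "C > 0" and sb: "\<And>J (w :: nat \<Rightarrow> real) (\<epsilon> :: real) \<tau>. (\<And>j. j < J \<Longrightarrow> \<bar>w j\<bar> \<le> \<epsilon>) \<Longrightarrow> 0 < \<epsilon> \<Longrightarrow> \<epsilon> \<le> 1 \<Longrightarrow> (\<Sum>j<J. (w j)\<^sup>2) = 1 \<Longrightarrow>
       prob {\<omega> \<in> space M. \<bar>lin J w \<omega>\<bar> \<le> \<tau>} \<le> C * (\<bar>\<tau>\<bar> + \<epsilon> powr rate)"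
    using small_ball by blast
  define R where "R = weight_const d powr rate"
  have R: "R > 0" using weight_const_ge_1[of d] by (simp add: R_def)
  define K where "K = 4 * (weight_const d)\<^sup>2"
  have K: "K \<ge> 1" using one_le_power[OF weight_const_ge_1[of d], of 2] by (simp add: K_def)
  obtain B1 where B1: "B1 > 0" "\<And>m. (real m + 1) ^ 13 * \<theta> ^ m \<le> B1" using poly_geometric_bounded[OF \<theta>] by blast
  have "(\<lambda>l. (real l + 1) ^ 13 * 2 powr (- (sqrt (real l) / 3))) \<longlonglongrightarrow> 0" by real_asymp
  then have "Bseq (\<lambda>l. (real l + 1) ^ 13 * 2 powr (- (sqrt (real l) / 3)))"
    by (intro convergent_imp_Bseq) (auto simp: convergent_def)
  then obtain B2 where B2: "B2 > 0" "\<And>l. norm ((real l + 1) ^ 13 * 2 powr (- (sqrt (real l) / 3))) \<le> B2" by (auto simp: Bseq_def)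
  (* The exponent 13 collects the two cell counts, of order (l + 1)^6 each, and the factor l + 1. *)
  define A where "A = 256 * ((C + 1) * K * B2 + C * R * B1)"
  show thesis
  proof (rule that[of A])
    show "A \<ge> 0" using C K R B1 B2 by (simp add: A_def)
    fix m l :: nat assume ml: "m < l" "real (l - m) > sqrt (real l)"
    show "\<bar>expectation (\<lambda>\<omega>. block_changes d m \<omega> * block_changes d l \<omega>) - expectation (block_changes d m) * expectation (block_changes d l)\<bar> \<le> A / real (Suc l)"
    proof (cases "good m \<and> good l")
      case False
      then show ?thesis using \<open>A \<ge> 0\<close> by (auto simp: block_changes_def)
    next
      case True
      then have good: "good m" "good l" by auto
      let ?J = "Suc (2 ^ (m + 1))" and ?J' = "Suc (2 ^ (l + 1))"
      define \<delta> where "\<delta> = K * 2 powr (- (real (l - m) / 3))"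
      have \<delta>: "\<delta> > 0" using K by (simp add: \<delta>_def)
      have JJ: "?J \<le> ?J'" using ml by (simp add: power_increasing)
      have p: "prob {\<omega> \<in> space M. sg (lin ?J' (weight d (node l i)) \<omega>) \<noteq> sg (lin ?J' (tail_weights ?J (weight d (node l i))) \<omega>)} \<le> C * (\<delta> + R * \<theta> ^ l) + \<delta>"
        if i: "i \<le> cells l" for i
      proof -
        define \<epsilon> where "\<epsilon> = weight_bound d (node l i)"
        have \<epsilon>: "0 < \<epsilon>" "\<epsilon> \<le> 1" using weight_bound_bounds node_pos by (auto simp: \<epsilon>_def)
        have "node l i < ?J'" using node_le[OF good(2) i] by simp
        have nl: "(2::real) ^ l \<le> real (node l i)" using node_ge[of l i] by (metis of_nat_le_iff of_nat_numeral of_nat_power)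
        have low: "(\<Sum>j<?J. (weight d (node l i) j)\<^sup>2) \<le> \<delta> ^ 3"
        proof -
          have "(\<Sum>j<?J. (weight d (node l i) j)\<^sup>2) \<le> (\<Sum>j<?J. (weight_const d)\<^sup>2 / real (node l i))"
            by (intro sum_mono weight_sq_le node_pos)
          also have "\<dots> \<le> (4 * 2 ^ m) * ((weight_const d)\<^sup>2 / 2 ^ l)"
          proof -
            have "(1::real) \<le> 2 ^ m" by simp
            moreover have "real ?J = 1 + 2 * 2 ^ m" by simp
            ultimately have "real ?J \<le> 4 * 2 ^ m" by linarith
            moreover have "(weight_const d)\<^sup>2 / real (node l i) \<le> (weight_const d)\<^sup>2 / 2 ^ l" 
            proof -
              have "real (node l i) > 0" using nl by (rule less_le_trans[rotated]) simp
              then show ?thesis using nl by (intro divide_left_mono) auto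
            qed
            ultimately have "real ?J * ((weight_const d)\<^sup>2 / real (node l i)) \<le> (4 * 2 ^ m) * ((weight_const d)\<^sup>2 / 2 ^ l)" by (intro mult_mono) auto
            then show ?thesis by (simp only: sum_constant card_lessThan)
          qed
          also have "\<dots> = K * (2 ^ m / 2 ^ l)" by (simp add: K_def)
          also have "(2::real) ^ m / 2 ^ l = 2 powr (- real (l - m))"
          proof -
            have "2 powr (- real (l - m)) = inverse (2 powr real (l - m))" by (rule powr_minus)
            also have "2 powr real (l - m) = (2::real) ^ (l - m)" by (rule powr_realpow) simp
            finally have 1: "2 powr (- real (l - m)) = inverse ((2::real) ^ (l - m))" .
            have "(2::real) ^ l = 2 ^ m * 2 ^ (l - m)" using ml by (simp add: power_add[symmetric])
            then show ?thesis unfolding 1 by (simp add: divide_inverse)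
          qed
          also have "K * 2 powr (- real (l - m)) \<le> K ^ 3 * 2 powr (- real (l - m))"
            using K power_increasing[of 1 3 K] by (intro mult_right_mono) auto
          also have "\<dots> = \<delta> ^ 3"
          proof -
            have "(2 powr (- (real (l - m) / 3))) ^ 3 = 2 powr (- real (l - m))"
              by (simp add: powr_power)
            then show ?thesis by (simp add: \<delta>_def power_mult_distrib)
          qed
          finally show ?thesis .
        qed
        have "prob {\<omega> \<in> space M. sg (lin ?J' (weight d (node l i)) \<omega>) \<noteq> sg (lin ?J' (tail_weights ?J (weight d (node l i))) \<omega>)} \<le> C * (\<delta> + \<epsilon> powr rate) + \<delta>"
          by (rule truncation_prob[OF sb _ \<epsilon> sum_weight[OF \<open>node l i < ?J'\<close>] JJ \<delta> low])
            (auto simp: \<epsilon>_def intro!: weight_le_weight_bound node_pos)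
        also have "\<epsilon> powr rate \<le> R * \<theta> ^ l"
        proof -
          have "\<epsilon> powr rate \<le> R * real (node l i) powr (- (rate / 2))" unfolding \<epsilon>_def R_def by (rule weight_bound_powr_le[OF node_pos])
          also have "\<dots> \<le> R * \<theta> ^ l" using R by (intro mult_left_mono powr_rate_le node_ge) auto
          finally show ?thesis .
        qed
        finally show ?thesis using C by (simp add: mult_left_mono)
      qed
      have \<delta>l: "\<delta> \<le> K * 2 powr (- (sqrt (real l) / 3))"
        unfolding \<delta>_def using K ml(2) by (intro mult_left_mono powr_mono) auto
      define P where "P = C * (\<delta> + R * \<theta> ^ l) + \<delta>"
      have P0: "P \<ge> 0" using C R \<theta> \<delta> by (simp add: P_def)
      have "\<bar>expectation (\<lambda>\<omega>. block_changes d m \<omega> * block_changes d l \<omega>) - expectation (block_changes d m) * expectation (block_changes d l)\<bar>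
          \<le> 4 * real (cells m) * real (cells l) * P"
        using good changes_cov[of "cells l" ?J' "\<lambda>i. weight d (node l i)" ?J P "\<lambda>i. weight d (node m i)" "cells m"] p
        by (simp add: block_changes_def P_def)
      also have "\<dots> \<le> 4 * (8 * (real l + 1) ^ 6) * (8 * (real l + 1) ^ 6) * P"
      proof (intro mult_right_mono mult_mono P0 mult_left_mono cells_le)
        have "real (cells m) \<le> 8 * (real m + 1) ^ 6" by (rule cells_le)
        also have "\<dots> \<le> 8 * (real l + 1) ^ 6" using ml by (intro mult_left_mono power_mono) auto
        finally show "real (cells m) \<le> 8 * (real l + 1) ^ 6" .
      qed auto
      also have "\<dots> = 256 * ((real l + 1) ^ 13 * P) / real (Suc l)"
      proof -
        have "(real l + 1) ^ 13 = (real l + 1) ^ 6 * (real l + 1) ^ 6 * real (Suc l)"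
          by (simp add: power_add[symmetric] add.commute flip: power_Suc2)
        then show ?thesis by (simp del: of_nat_Suc)
      qed
      also have "\<dots> \<le> A / real (Suc l)"
      proof (rule divide_right_mono)
        have "P \<le> (C + 1) * (K * 2 powr (- (sqrt (real l) / 3))) + C * R * \<theta> ^ l"
        proof -
          have "(C + 1) * \<delta> \<le> (C + 1) * (K * 2 powr (- (sqrt (real l) / 3)))" using C by (intro mult_left_mono \<delta>l) auto
          then show ?thesis by (simp add: P_def algebra_simps)
        qed
        then have "(real l + 1) ^ 13 * P \<le> (real l + 1) ^ 13 * ((C + 1) * (K * 2 powr (- (sqrt (real l) / 3))) + C * R * \<theta> ^ l)"
          by (intro mult_left_mono) auto
        also have "\<dots> = (C + 1) * K * ((real l + 1) ^ 13 * 2 powr (- (sqrt (real l) / 3))) + C * R * ((real l + 1) ^ 13 * \<theta> ^ l)"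
          by (simp only: distrib_left[of "(real l + 1) ^ 13"] mult_ac)
        also have "\<dots> \<le> (C + 1) * K * B2 + C * R * B1"
          using C K R B1 B2(2)[of l] by (intro add_mono mult_left_mono) auto
        finally show "256 * ((real l + 1) ^ 13 * P) \<le> A" by (simp add: A_def)
      qed simp
      finally show ?thesis .
    qed
  qed
qed

end

section \<open>The upper bound for the number of roots\<close>

lemma sign_changes_dyadic: "sign_changes s 0 (2 ^ T) = sign_changes s 0 1 + (\<Sum>m<T. sign_changes s (2 ^ m) (2 ^ (m + 1)))"
proof (induction T)
  case (Suc T)
  have "sign_changes s 0 (2 ^ Suc T) = sign_changes s 0 (2 ^ T) + sign_changes s (2 ^ T) (2 ^ (T + 1))"
    by (subst sign_changes_split[of 0 "2 ^ T"]) auto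
  then show ?case using Suc by simp
qed simp

lemma sum_eventually_le:
  fixes f :: "nat \<Rightarrow> real"
  assumes "\<forall>\<^sub>F m in sequentially. f m \<le> \<gamma>"
  obtains C where "\<And>T. (\<Sum>m<T. f m) \<le> \<gamma> * real T + C"
proof -
  obtain m0 where m0: "\<And>m. m \<ge> m0 \<Longrightarrow> f m \<le> \<gamma>" using assms by (auto simp: eventually_sequentially)
  have "(\<Sum>m<T. f m) \<le> \<gamma> * real T + (\<Sum>m<m0. \<bar>f m - \<gamma>\<bar>)" for T
  proof -
    have "(\<Sum>m<T. f m) - \<gamma> * real T = (\<Sum>m<T. f m - \<gamma>)" by (simp add: sum_subtractf)
    also have "\<dots> \<le> (\<Sum>m<T. if m < m0 then \<bar>f m - \<gamma>\<bar> else 0)"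
      using m0 by (intro sum_mono) (auto simp: not_less)
    also have "\<dots> = (\<Sum>m\<in>{..<T} \<inter> {..<m0}. \<bar>f m - \<gamma>\<bar>)" by (subst sum.inter_restrict) (auto intro!: sum.cong)
    also have "\<dots> \<le> (\<Sum>m<m0. \<bar>f m - \<gamma>\<bar>)" by (intro sum_mono2) auto
    finally show ?thesis by linarith
  qed
  then show thesis by (rule that)
qed

context kac_coeffs
begin

text \<open>
  The strong law for the block counts, with d so large that \<kappa> / pi is below \<gamma>.
\<close>

theorem roots_upper:
  assumes \<gamma>: "\<gamma> > 1 / (2 * pi)"
  shows "AE \<omega> in M. \<forall>\<^sub>F n in sequentially. real (num_roots_in (kac_poly (\<lambda>j. \<xi> j \<omega>) n) {0<..1}) \<le> \<gamma> * ln (real n)"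
proof -
  (* Halfway between the limiting constant 1 / 2 and the available pi * \<gamma>. *)
  define \<kappa> where "\<kappa> = (1 / 2 + pi * \<gamma>) / 2"
  have pg: "pi * \<gamma> > 1 / 2" using \<gamma> by (simp add: field_simps)
  then have \<kappa>: "\<kappa> > 1 / 2" "\<kappa> < pi * \<gamma>" by (auto simp: \<kappa>_def)
  have "(\<lambda>e. (2 * real (e + 2) + 1) / (4 * (2 * real (e + 2) - 1))) \<longlonglongrightarrow> 1 / 4" by real_asymp
  moreover have "1 / 4 < \<kappa>\<^sup>2"
    using power_strict_mono[OF \<kappa>(1), of 2] by (simp add: power2_eq_square)
  ultimately have "\<forall>\<^sub>F e in sequentially. (2 * real (e + 2) + 1) / (4 * (2 * real (e + 2) - 1)) < \<kappa>\<^sup>2" by (rule order_tendstoD)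
  then have "\<forall>\<^sub>F e in sequentially. (2 * real (e + 2) + 1) / (4 * (2 * real (e + 2) - 1)) < \<kappa>\<^sup>2 \<and> e \<ge> 5"
    using eventually_ge_at_top by (rule eventually_conj)
  then obtain e where e: "(2 * real (e + 2) + 1) / (4 * (2 * real (e + 2) - 1)) < \<kappa>\<^sup>2" "e \<ge> 5"
    by (auto simp: eventually_sequentially)
  define d where "d = e + 2"
  have l2: "ln (2::real) > 0" by simp
  have "\<kappa> * ln 2 / pi < \<gamma> * ln 2" using \<kappa>(2) l2 by (simp add: field_simps)
  then obtain \<gamma>1 where \<gamma>1: "\<kappa> * ln 2 / pi < \<gamma>1" "\<gamma>1 < \<gamma> * ln 2" using dense by blast
  obtain \<gamma>2 where \<gamma>2: "\<gamma>1 < \<gamma>2" "\<gamma>2 < \<gamma> * ln 2" using dense[OF \<gamma>1(2)] by blast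
  have \<gamma>20: "\<gamma>2 > 0"
  proof -
    have "0 < \<kappa> * ln 2 / pi" using \<kappa> l2 by simp
    then show ?thesis using \<gamma>1 \<gamma>2 by linarith
  qed
  have "\<forall>\<^sub>F m in sequentially. expectation (block_changes d m) \<le> \<gamma>1"
    unfolding d_def by (rule block_changes_mean[of \<kappa>]) (use \<kappa> e \<gamma>1 in auto)
  then obtain C1 where C1: "\<And>T. (\<Sum>m<T. expectation (block_changes d m)) \<le> \<gamma>1 * real T + C1" by (rule sum_eventually_le) blast
  obtain A1 where A1: "\<And>m. expectation (\<lambda>\<omega>. (block_changes d m \<omega>)\<^sup>2) \<le> A1"
    using block_changes_second_moment[of d] e by (auto simp: d_def)
  obtain A2 where A2: "A2 \<ge> 0" "\<And>m l. m < l \<Longrightarrow> real (l - m) > sqrt (real l) \<Longrightarrow>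
     \<bar>expectation (\<lambda>\<omega>. block_changes d m \<omega> * block_changes d l \<omega>) - expectation (block_changes d m) * expectation (block_changes d l)\<bar> \<le> A2 / real (Suc l)"
    using block_changes_cov[of d] by blast
  have intU: "integrable M (\<lambda>\<omega>. (block_changes d m \<omega>)\<^sup>2)" for m
  proof (rule integrable_const_bound[of _ "(real (cells m))\<^sup>2"])
    show "AE \<omega> in M. norm ((block_changes d m \<omega>)\<^sup>2) \<le> (real (cells m))\<^sup>2"
    proof (rule AE_I2)
      fix \<omega>
      have "block_changes d m \<omega> \<le> real (cells m)" by (simp add: block_changes_def changes_bounds)
      then show "norm ((block_changes d m \<omega>)\<^sup>2) \<le> (real (cells m))\<^sup>2" using block_changes_nonneg[of d m \<omega>] by (simp add: power_mono)
    qed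
  qed measurable
  have "AE \<omega> in M. (\<lambda>T. (\<Sum>m<T. block_changes d m \<omega> - expectation (block_changes d m)) / real T) \<longlonglongrightarrow> 0"
  proof (rule strong_law_weakly_dependent[where A = "max A1 A2"])
    fix m l :: nat assume "m < l" "real (l - m) > sqrt (real l)"
    then have "\<bar>expectation (\<lambda>\<omega>. block_changes d m \<omega> * block_changes d l \<omega>) - expectation (block_changes d m) * expectation (block_changes d l)\<bar> \<le> A2 / real (Suc l)" by (rule A2(2))
    also have "\<dots> \<le> max A1 A2 / real (Suc l)" by (intro divide_right_mono) auto
    finally show "\<bar>expectation (\<lambda>\<omega>. block_changes d m \<omega> * block_changes d l \<omega>) - expectation (block_changes d m) * expectation (block_changes d l)\<bar> \<le> max A1 A2 / real (Suc l)" .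
  qed (use intU A1 block_changes_nonneg in \<open>auto intro: max.coboundedI1\<close>)
  moreover have "AE \<omega> in M. \<forall>\<^sub>F m in sequentially. block_changes d m \<omega> = real (sign_changes (S (Suc d) \<omega>) (2 ^ m) (2 ^ (m + 1)))"
    by (rule AE_single_changes) (simp add: d_def)
  ultimately show ?thesis
  proof eventually_elim
    case (elim \<omega>)
    let ?s = "S (Suc d) \<omega>"
    obtain T0 where T0: "\<And>T. T \<ge> T0 \<Longrightarrow> (\<Sum>m<T. block_changes d m \<omega> - expectation (block_changes d m)) / real T < \<gamma>2 - \<gamma>1"
      using order_tendstoD(2)[OF elim(1), of "\<gamma>2 - \<gamma>1"] \<gamma>2 by (auto simp: eventually_sequentially)
    have "\<forall>\<^sub>F m in sequentially. real (sign_changes ?s (2 ^ m) (2 ^ (m + 1))) - block_changes d m \<omega> \<le> 0"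
      using elim(2) by eventually_elim simp
    then obtain C2 where C2: "\<And>T. (\<Sum>m<T. real (sign_changes ?s (2 ^ m) (2 ^ (m + 1))) - block_changes d m \<omega>) \<le> 0 * real T + C2" by (rule sum_eventually_le) blast
    define C3 where "C3 = C1 + C2 + 1 + 2 * real (Suc d) + 1"
    have bound: "real (num_roots_in (kac_poly (\<lambda>j. \<xi> j \<omega>) n) {0<..1}) \<le> \<gamma>2 * real T + C3"
      if T: "T \<ge> T0" "T > 0" "n \<le> 2 ^ T" for n T
    proof -
      have "num_roots_in (kac_poly (\<lambda>j. \<xi> j \<omega>) n) {0<..1} \<le> sign_changes ?s 0 n + 2 * Suc d + 1"
        unfolding S_def by (rule num_roots_le_sign_changes)
      also have "sign_changes ?s 0 n \<le> sign_changes ?s 0 (2 ^ T)" using T by (intro sign_changes_mono) auto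
      also have "\<dots> = sign_changes ?s 0 1 + (\<Sum>m<T. sign_changes ?s (2 ^ m) (2 ^ (m + 1)))" by (rule sign_changes_dyadic)
      also have "sign_changes ?s 0 1 \<le> 1" using sign_changes_le[of ?s 0 1] by simp
      finally have "real (num_roots_in (kac_poly (\<lambda>j. \<xi> j \<omega>) n) {0<..1}) \<le> real (1 + (\<Sum>m<T. sign_changes ?s (2 ^ m) (2 ^ (m + 1))) + 2 * Suc d + 1)"
        by (intro of_nat_mono) simp
      also have "\<dots> = (\<Sum>m<T. real (sign_changes ?s (2 ^ m) (2 ^ (m + 1)))) + (1 + 2 * real (Suc d) + 1)" by simp
      also have "(\<Sum>m<T. real (sign_changes ?s (2 ^ m) (2 ^ (m + 1)))) \<le> (\<Sum>m<T. block_changes d m \<omega>) + C2"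
        using C2[of T] by (simp add: sum_subtractf)
      also have "(\<Sum>m<T. block_changes d m \<omega>) \<le> (\<Sum>m<T. expectation (block_changes d m)) + (\<gamma>2 - \<gamma>1) * real T"
        using T0[OF T(1)] T(2) by (simp add: divide_less_eq sum_subtractf)
      also have "(\<Sum>m<T. expectation (block_changes d m)) \<le> \<gamma>1 * real T + C1" by (rule C1)
      finally show ?thesis by (simp add: C3_def algebra_simps)
    qed
    (* The number of dyadic blocks that cover the indices up to n. *)
    define Tf where "Tf n = (LEAST t. n < (2::nat) ^ t)" for n :: nat
    have Tf: "n < 2 ^ Tf n" for n unfolding Tf_def by (rule LeastI_ex) (use less_exp in blast)
    have Tf_lim: "filterlim Tf at_top sequentially"
    proof (rule filterlim_at_top[THEN iffD2, rule_format])
      fix Z :: nat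
      show "\<forall>\<^sub>F n in sequentially. Z \<le> Tf n"
        using eventually_ge_at_top[of "2 ^ Z"]
      proof eventually_elim
        case (elim n)
        have "(2::nat) ^ Z < 2 ^ Tf n" using elim Tf[of n] by linarith
        then show ?case by simp
      qed
    qed
    have Tf_le: "real (Tf n) \<le> ln (real n) / ln 2 + 1" if n: "n \<ge> 1" for n
    proof (cases "Tf n")
      case 0
      have "ln (real n) \<ge> 0" using n by simp
      then show ?thesis using 0 l2 by simp
    next
      case (Suc t)
      then have "\<not> n < 2 ^ t" unfolding Tf_def by (intro not_less_Least) auto
      then have "real (2 ^ t) \<le> real n" by (intro of_nat_mono) simp
      then have "ln (2 ^ t) \<le> ln (real n)" using n by (subst ln_le_cancel_iff) auto
      then have "real t * ln 2 \<le> ln (real n)" by (simp add: ln_realpow)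
      then show ?thesis using Suc l2 by (simp add: field_simps)
    qed
    have lnlim: "filterlim (\<lambda>n. ln (real n)) at_top sequentially" by real_asymp
    have "\<forall>\<^sub>F n in sequentially. ln (real n) \<ge> (\<gamma>2 + C3) / (\<gamma> - \<gamma>2 / ln 2)"
      using lnlim by (simp add: filterlim_at_top)
    moreover have "\<forall>\<^sub>F n in sequentially. Tf n \<ge> max T0 1" using filterlim_at_top[THEN iffD1, OF Tf_lim, rule_format, of "max T0 1"] .
    ultimately show ?case using eventually_ge_at_top[of 1]
    proof eventually_elim
      case (elim n)
      have pos: "\<gamma> - \<gamma>2 / ln 2 > 0" using \<gamma>2 l2 by (simp add: field_simps)
      have "real (num_roots_in (kac_poly (\<lambda>j. \<xi> j \<omega>) n) {0<..1}) \<le> \<gamma>2 * real (Tf n) + C3"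
        using elim Tf[of n] by (intro bound) auto
      also have "\<dots> \<le> \<gamma>2 * (ln (real n) / ln 2 + 1) + C3"
        using \<gamma>20 elim by (intro add_right_mono mult_left_mono Tf_le) auto
      also have "\<dots> = \<gamma>2 / ln 2 * ln (real n) + (\<gamma>2 + C3)" by (simp add: algebra_simps)
      also have "\<gamma>2 + C3 \<le> (\<gamma> - \<gamma>2 / ln 2) * ln (real n)" using elim(1) pos by (simp add: pos_divide_le_eq mult.commute)
      finally show ?case by (simp add: algebra_simps)
    qed
  qed
qed

end

section \<open>Truncated Kac polynomials on a geometric grid\<close>

context
  fixes \<beta> :: real
  assumes \<beta>: "\<beta> > 1"
begin

definition grid_point :: "nat \<Rightarrow> real" where "grid_point m = 1 - 1 / \<beta> ^ m"

text \<open>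
  The number of coefficients that are kept at the m-th grid point. The factor (m + 1)^2 makes the next
  power of the grid point at most exp (- (m + 1)^2), which beats any power of \<beta>^m.
\<close>

definition cutoff :: "nat \<Rightarrow> nat" where "cutoff m = nat \<lceil>(real m + 1)\<^sup>2 * \<beta> ^ m\<rceil>"

definition grid_norm :: "nat \<Rightarrow> real" where "grid_norm m = sqrt (\<Sum>j<cutoff m. (grid_point m ^ j)\<^sup>2)"

text \<open>
  The polynomial, truncated at the cutoff and evaluated at the grid point, as a linear form of unit
  length.
\<close>

definition grid_weight :: "nat \<Rightarrow> nat \<Rightarrow> real" where "grid_weight m j = (if j < cutoff m then grid_point m ^ j / grid_norm m else 0)"

lemma bpow: "\<beta> ^ m \<ge> 1" "\<beta> ^ m > 0"
  using \<beta> by (auto simp: one_le_power)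

lemma grid_point_bounds: "0 \<le> grid_point m" "grid_point m < 1"
  using bpow[of m] by (auto simp: grid_point_def divide_le_eq_1)

lemma grid_point_strict_mono: "grid_point m < grid_point (Suc m)"
  using \<beta> bpow[of m] by (auto simp: grid_point_def field_simps)

lemma cutoff_bounds: "(real m + 1)\<^sup>2 * \<beta> ^ m \<le> real (cutoff m)" "real (cutoff m) \<le> (real m + 1)\<^sup>2 * \<beta> ^ m + 1"
proof -
  have "0 \<le> (real m + 1)\<^sup>2 * \<beta> ^ m" using bpow[of m] by simp
  then show "(real m + 1)\<^sup>2 * \<beta> ^ m \<le> real (cutoff m)" "real (cutoff m) \<le> (real m + 1)\<^sup>2 * \<beta> ^ m + 1"
    unfolding cutoff_def by linarith+
qed

lemma cutoff_mono: "m \<le> n \<Longrightarrow> cutoff m \<le> cutoff n"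
  unfolding cutoff_def using \<beta> by (intro nat_mono ceiling_mono mult_mono power_mono power_increasing) auto

lemma cutoff_ge: "cutoff m \<ge> Suc m"
proof -
  have "(real m + 1) * 1 \<le> (real m + 1)\<^sup>2 * \<beta> ^ m"
    unfolding power2_eq_square using bpow[of m] by (intro mult_mono) (auto simp: mult_ge1_I)
  then have "real (Suc m) \<le> real (cutoff m)" using cutoff_bounds(1)[of m] by simp
  then show ?thesis by (simp only: of_nat_le_iff)
qed

lemma grid_point_pow_cutoff: "grid_point m ^ cutoff m \<le> exp (- (real m + 1)\<^sup>2)"
proof -
  have "grid_point m \<le> exp (- (1 / \<beta> ^ m))" using exp_ge_add_one_self[of "- (1 / \<beta> ^ m)"] by (simp add: grid_point_def)
  then have "grid_point m ^ cutoff m \<le> exp (- (1 / \<beta> ^ m)) ^ cutoff m" using grid_point_bounds by (intro power_mono) auto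
  also have "\<dots> = exp (- (real (cutoff m) / \<beta> ^ m))" by (simp add: exp_of_nat_mult[symmetric])
  also have "\<dots> \<le> exp (- (real m + 1)\<^sup>2)"
    using cutoff_bounds(1)[of m] bpow(2)[of m] by (simp add: pos_le_divide_eq)
  finally show ?thesis .
qed

lemma grid_norm_sq: "(grid_norm m)\<^sup>2 = (1 - (grid_point m ^ cutoff m)\<^sup>2) / (1 - (grid_point m)\<^sup>2)"
proof -
  have x: "(grid_point m)\<^sup>2 \<noteq> 1" using grid_point_bounds[of m] by (simp add: power2_eq_1_iff)
  have "(grid_norm m)\<^sup>2 = (\<Sum>j<cutoff m. ((grid_point m)\<^sup>2) ^ j)"
  proof -
    have "(grid_norm m)\<^sup>2 = (\<Sum>j<cutoff m. (grid_point m ^ j)\<^sup>2)" by (simp add: grid_norm_def sum_nonneg)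
    also have "\<dots> = (\<Sum>j<cutoff m. ((grid_point m)\<^sup>2) ^ j)" by (intro sum.cong refl) (simp add: power_mult[symmetric] mult.commute)
    finally show ?thesis .
  qed
  also have "\<dots> = (((grid_point m)\<^sup>2) ^ cutoff m - 1) / ((grid_point m)\<^sup>2 - 1)" by (rule geometric_sum[OF x])
  also have "((grid_point m)\<^sup>2) ^ cutoff m = (grid_point m ^ cutoff m)\<^sup>2" by (simp add: power_mult[symmetric] mult.commute)
  finally show ?thesis by (simp add: minus_divide_divide[symmetric, of "_ - 1"])
qed

lemma one_minus_grid_point_sq: "1 - (grid_point m)\<^sup>2 = 1 / \<beta> ^ m * (2 - 1 / \<beta> ^ m)"
  by (simp add: grid_point_def power2_eq_square algebra_simps)

lemma grid_norm_sq_ge: "(grid_norm m)\<^sup>2 \<ge> \<beta> ^ m / 4"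
proof -
  have "grid_point m ^ cutoff m \<le> exp (- (real m + 1)\<^sup>2)" by (rule grid_point_pow_cutoff)
  also have "\<dots> \<le> exp (- 1)" by simp
  also have "\<dots> \<le> 1 / 2" using exp_ge_add_one_self[of 1] by (simp add: exp_minus field_simps)
  finally have "(grid_point m ^ cutoff m)\<^sup>2 \<le> (1/2)\<^sup>2" using grid_point_bounds by (intro power_mono) auto
  then have 1: "1 - (grid_point m ^ cutoff m)\<^sup>2 \<ge> 1 / 2" by (simp add: power2_eq_square)
  have 2: "1 - (grid_point m)\<^sup>2 \<le> 2 / \<beta> ^ m"
    unfolding one_minus_grid_point_sq using bpow[of m] by (simp add: field_simps)
  have 3: "1 - (grid_point m)\<^sup>2 > 0" using grid_point_bounds[of m] by (simp add: power_less_one_iff abs_square_less_1)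
  have "\<beta> ^ m / 4 = (1/2) / (2 / \<beta> ^ m)" by simp
  also have "\<dots> \<le> (grid_norm m)\<^sup>2" unfolding grid_norm_sq using 1 2 3 by (intro frac_le) auto
  finally show ?thesis .
qed

lemma grid_norm_pos: "grid_norm m > 0"
proof -
  have "(grid_norm m)\<^sup>2 > 0" using grid_norm_sq_ge[of m] bpow(2)[of m] by linarith
  then show ?thesis unfolding grid_norm_def by (simp add: sum_nonneg order_less_le)
qed

lemma grid_weight_sq_le: "(grid_weight m j)\<^sup>2 \<le> 4 / \<beta> ^ m"
proof -
  have "(grid_point m ^ j)\<^sup>2 \<le> 1" using grid_point_bounds[of m] by (simp add: power_le_one)
  then have "(grid_weight m j)\<^sup>2 \<le> 1 / (grid_norm m)\<^sup>2" by (auto simp: grid_weight_def power_divide divide_right_mono)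
  also have "\<dots> \<le> 1 / (\<beta> ^ m / 4)" using bpow(2)[of m] grid_norm_pos[of m] by (intro divide_left_mono grid_norm_sq_ge) auto
  finally show ?thesis by simp
qed

lemma sum_grid_weight:
  assumes "cutoff m \<le> J"
  shows "(\<Sum>j<J. (grid_weight m j)\<^sup>2) = 1"
proof -
  have "(\<Sum>j<J. (grid_weight m j)\<^sup>2) = (\<Sum>j<cutoff m. (grid_point m ^ j)\<^sup>2 / (grid_norm m)\<^sup>2)"
    using assms by (intro sum.mono_neutral_cong_right) (auto simp: grid_weight_def power_divide)
  also have "\<dots> = (grid_norm m)\<^sup>2 / (grid_norm m)\<^sup>2" unfolding sum_divide_distrib[symmetric] by (simp add: grid_norm_def sum_nonneg)
  finally show ?thesis using grid_norm_pos[of m] by simp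
qed

definition grid_weight_bound :: "nat \<Rightarrow> real" where "grid_weight_bound m = min 1 (2 / sqrt (\<beta> ^ m))"

lemma grid_weight_bound_bounds: "0 < grid_weight_bound m" "grid_weight_bound m \<le> 1"
  using bpow(2)[of m] by (auto simp: grid_weight_bound_def)

lemma grid_weight_le_grid_weight_bound: "\<bar>grid_weight m j\<bar> \<le> grid_weight_bound m"
proof -
  have "(grid_weight m j)\<^sup>2 \<le> (\<Sum>i<Suc (cutoff m + j). (grid_weight m i)\<^sup>2)" by (intro member_le_sum) auto
  also have "\<dots> = 1" by (rule sum_grid_weight) simp
  finally have 1: "\<bar>grid_weight m j\<bar> \<le> 1" by (simp add: abs_square_le_1)
  have "\<bar>grid_weight m j\<bar> \<le> 2 / sqrt (\<beta> ^ m)"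
  proof (rule power2_le_imp_le)
    have "(2 / sqrt (\<beta> ^ m))\<^sup>2 = 4 / \<beta> ^ m" using bpow(2)[of m] by (simp only: power_divide) simp
    then show "\<bar>grid_weight m j\<bar>\<^sup>2 \<le> (2 / sqrt (\<beta> ^ m))\<^sup>2" using grid_weight_sq_le[of m j] by (simp only: power2_abs)
    show "0 \<le> 2 / sqrt (\<beta> ^ m)" using bpow(2)[of m] by simp
  qed
  then show ?thesis using 1 by (simp add: grid_weight_bound_def)
qed

lemma grid_weight_bound_Suc_le: "grid_weight_bound (Suc m) \<le> grid_weight_bound m"
  unfolding grid_weight_bound_def using \<beta> bpow[of m] bpow[of "Suc m"] by (intro min.mono divide_left_mono) auto

text \<open>
  The limit of the correlation of neighbouring grid forms. For the untruncated geometric sequences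
  x^j and y^j it is sqrt ((1 - x^2) * (1 - y^2)) / (1 - x * y), where 1 - x and 1 - y have ratio \<beta>.
\<close>

definition grid_correlation :: real where "grid_correlation = 2 * sqrt \<beta> / (1 + \<beta>)"

lemma grid_weight_correlation_tendsto: "(\<lambda>m. \<Sum>j<cutoff (Suc m). grid_weight m j * grid_weight (Suc m) j) \<longlonglongrightarrow> grid_correlation"
proof -
  define a where "a m = 1 / \<beta> ^ m" for m
  have a: "a m > 0" "a m \<le> 1" for m using bpow[of m] by (auto simp: a_def)
  have aS: "a (Suc m) = a m / \<beta>" for m by (simp add: a_def)
  have a_lim: "a \<longlonglongrightarrow> 0"
  proof -
    have "(\<lambda>m. (1 / \<beta>) ^ m) \<longlonglongrightarrow> 0" using \<beta> by (intro LIMSEQ_power_zero) auto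
    then show ?thesis by (simp add: a_def[abs_def] power_divide)
  qed
  (* X and Y are the truncation errors of the geometric sums, which vanish in the limit. *)
  define X where "X m = grid_point m ^ cutoff m" for m
  have X: "0 \<le> X m" "X m \<le> exp (- (real m + 1)\<^sup>2)" for m using grid_point_bounds grid_point_pow_cutoff by (auto simp: X_def)
  have X_lim: "X \<longlonglongrightarrow> 0"
  proof (rule tendsto_sandwich[of "\<lambda>_. 0" X _ "\<lambda>m. exp (- (real m + 1)\<^sup>2)"])
    show "(\<lambda>m. exp (- (real m + 1)\<^sup>2)) \<longlonglongrightarrow> 0" by real_asymp
  qed (use X in auto)
  define Y where "Y m = (grid_point m * grid_point (Suc m)) ^ cutoff m" for m
  have Y: "0 \<le> Y m" "Y m \<le> X m" for m
  proof -
    show "0 \<le> Y m" using grid_point_bounds by (simp add: Y_def)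
    have "grid_point m * grid_point (Suc m) \<le> grid_point m * 1" using grid_point_bounds[of m] grid_point_bounds[of "Suc m"] by (intro mult_left_mono) auto
    then show "Y m \<le> X m" unfolding Y_def X_def using grid_point_bounds by (intro power_mono) auto
  qed
  have Y_lim: "Y \<longlonglongrightarrow> 0"
    by (rule tendsto_sandwich[of "\<lambda>_. 0" Y _ X]) (use Y X_lim in auto)
  have eq: "(\<Sum>j<cutoff (Suc m). grid_weight m j * grid_weight (Suc m) j) =
      (1 - Y m) / (1 + 1 / \<beta> - a m / \<beta>) * sqrt ((2 - a m) * (2 - a m / \<beta>) / \<beta> / ((1 - (X m)\<^sup>2) * (1 - (X (Suc m))\<^sup>2)))" for m
  proof -
    have J: "cutoff m \<le> cutoff (Suc m)" by (rule cutoff_mono) simp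
    have "(\<Sum>j<cutoff (Suc m). grid_weight m j * grid_weight (Suc m) j) = (\<Sum>j<cutoff m. (grid_point m * grid_point (Suc m)) ^ j / (grid_norm m * grid_norm (Suc m)))"
      using J by (intro sum.mono_neutral_cong_right) (auto simp: grid_weight_def power_mult_distrib)
    also have "\<dots> = (\<Sum>j<cutoff m. (grid_point m * grid_point (Suc m)) ^ j) / (grid_norm m * grid_norm (Suc m))" by (simp add: sum_divide_distrib)
    also have "(\<Sum>j<cutoff m. (grid_point m * grid_point (Suc m)) ^ j) = (1 - Y m) / (1 - grid_point m * grid_point (Suc m))"
    proof -
      have "grid_point m * grid_point (Suc m) \<le> 1 * grid_point (Suc m)" using grid_point_bounds[of m] grid_point_bounds[of "Suc m"] by (intro mult_right_mono) auto
      then have ne: "grid_point m * grid_point (Suc m) \<noteq> 1" using grid_point_bounds[of "Suc m"] by linarith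
      show ?thesis unfolding geometric_sum[OF ne] Y_def by (metis minus_diff_eq minus_divide_divide)
    qed
    also have "1 - grid_point m * grid_point (Suc m) = a m * (1 + 1 / \<beta> - a m / \<beta>)"
    proof -
      have "grid_point m = 1 - a m" "grid_point (Suc m) = 1 - a m / \<beta>" by (simp_all add: grid_point_def a_def)
      then show ?thesis by (simp only:) (simp add: algebra_simps add_divide_distrib diff_divide_distrib)
    qed
    also have "grid_norm m * grid_norm (Suc m) = sqrt ((grid_norm m)\<^sup>2 * (grid_norm (Suc m))\<^sup>2)"
      using grid_norm_pos[of m] grid_norm_pos[of "Suc m"] by (simp add: real_sqrt_mult)
    also have "(grid_norm m)\<^sup>2 * (grid_norm (Suc m))\<^sup>2 = ((1 - (X m)\<^sup>2) * (1 - (X (Suc m))\<^sup>2)) / ((a m)\<^sup>2 * ((2 - a m) * (2 - a m / \<beta>) / \<beta>))"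
      unfolding grid_norm_sq one_minus_grid_point_sq X_def[symmetric] a_def[symmetric] aS by (simp add: power2_eq_square mult_ac)
    also have "sqrt (((1 - (X m)\<^sup>2) * (1 - (X (Suc m))\<^sup>2)) / ((a m)\<^sup>2 * ((2 - a m) * (2 - a m / \<beta>) / \<beta>)))
       = 1 / a m * sqrt (((1 - (X m)\<^sup>2) * (1 - (X (Suc m))\<^sup>2)) / ((2 - a m) * (2 - a m / \<beta>) / \<beta>))"
      using a[of m] by (simp add: real_sqrt_divide real_sqrt_mult)
    also have "((1 - Y m) / (a m * (1 + 1 / \<beta> - a m / \<beta>))) / (1 / a m * sqrt (((1 - (X m)\<^sup>2) * (1 - (X (Suc m))\<^sup>2)) / ((2 - a m) * (2 - a m / \<beta>) / \<beta>)))
       = (1 - Y m) / (1 + 1 / \<beta> - a m / \<beta>) * (1 / sqrt (((1 - (X m)\<^sup>2) * (1 - (X (Suc m))\<^sup>2)) / ((2 - a m) * (2 - a m / \<beta>) / \<beta>)))"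
      using a[of m] by simp
    also have "1 / sqrt (((1 - (X m)\<^sup>2) * (1 - (X (Suc m))\<^sup>2)) / ((2 - a m) * (2 - a m / \<beta>) / \<beta>)) = sqrt ((2 - a m) * (2 - a m / \<beta>) / \<beta> / ((1 - (X m)\<^sup>2) * (1 - (X (Suc m))\<^sup>2)))"
      by (simp add: real_sqrt_divide)
    finally show ?thesis .
  qed
  have "(\<lambda>m. (1 - Y m) / (1 + 1 / \<beta> - a m / \<beta>) * sqrt ((2 - a m) * (2 - a m / \<beta>) / \<beta> / ((1 - (X m)\<^sup>2) * (1 - (X (Suc m))\<^sup>2))))
     \<longlonglongrightarrow> (1 - 0) / (1 + 1 / \<beta> - 0 / \<beta>) * sqrt ((2 - 0) * (2 - 0 / \<beta>) / \<beta> / ((1 - 0\<^sup>2) * (1 - 0\<^sup>2)))"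
    using \<beta> by (intro tendsto_intros Y_lim X_lim a_lim LIMSEQ_Suc[OF X_lim]) (auto simp: add_pos_pos intro!: less_imp_neq[symmetric])
  also have "(1 - 0) / (1 + 1 / \<beta> - 0 / \<beta>) * sqrt ((2 - 0) * (2 - 0 / \<beta>) / \<beta> / ((1 - 0\<^sup>2) * (1 - 0\<^sup>2))) = grid_correlation"
  proof -
    have "sqrt (4 / \<beta>) = 2 * sqrt \<beta> / \<beta>"
    proof -
      have "4 / \<beta> = (2 * sqrt \<beta> / \<beta>)\<^sup>2" using \<beta> by (simp add: power_divide power_mult_distrib power2_eq_square)
      then show ?thesis using \<beta> by (simp only: real_sqrt_abs) simp
    qed
    then show ?thesis using \<beta> by (simp add: grid_correlation_def field_simps)
  qed
  finally show ?thesis unfolding eq .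
qed

lemma grid_correlation_bounds: "0 < grid_correlation" "grid_correlation < 1"
proof -
  show "0 < grid_correlation" using \<beta> by (simp add: grid_correlation_def)
  have "sqrt \<beta> \<noteq> 1" using \<beta> by simp
  then have "0 < (sqrt \<beta> - 1)\<^sup>2" by simp
  also have "(sqrt \<beta> - 1)\<^sup>2 = \<beta> + 1 - 2 * sqrt \<beta>" using \<beta> by (simp add: power2_diff)
  finally show "grid_correlation < 1" using \<beta> by (simp add: grid_correlation_def divide_less_eq)
qed

lemma arccos_grid_correlation_ge: "arccos grid_correlation \<ge> (\<beta> - 1) / (\<beta> + 1)"
proof -
  have "sin (arccos grid_correlation) = sqrt (1 - grid_correlation\<^sup>2)" using grid_correlation_bounds by (intro sin_arccos) auto
  also have "1 - grid_correlation\<^sup>2 = ((\<beta> - 1) / (\<beta> + 1))\<^sup>2"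
  proof -
    have "grid_correlation\<^sup>2 = 4 * \<beta> / (1 + \<beta>)\<^sup>2" using \<beta> by (simp add: grid_correlation_def power_divide power_mult_distrib)
    moreover have "(1 + \<beta>)\<^sup>2 \<noteq> 0" using \<beta> by simp
    ultimately have "1 - grid_correlation\<^sup>2 = ((1 + \<beta>)\<^sup>2 - 4 * \<beta>) / (1 + \<beta>)\<^sup>2" by (simp add: field_simps)
    also have "(1 + \<beta>)\<^sup>2 - 4 * \<beta> = (\<beta> - 1)\<^sup>2" by (simp add: power2_eq_square algebra_simps)
    finally show ?thesis by (simp add: power_divide add.commute)
  qed
  also have "sqrt (((\<beta> - 1) / (\<beta> + 1))\<^sup>2) = (\<beta> - 1) / (\<beta> + 1)" using \<beta> by simp
  finally have "(\<beta> - 1) / (\<beta> + 1) = sin (arccos grid_correlation)" ..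
  also have "\<dots> \<le> arccos grid_correlation" using grid_correlation_bounds by (intro sin_x_le_x arccos_lbound) auto
  finally show ?thesis .
qed

end

section \<open>Sign changes along the geometric grid\<close>

lemma poly_kac_poly: "poly (kac_poly a n) x = (\<Sum>j\<le>n. a j * x ^ j)"
  by (simp add: kac_poly_def poly_sum poly_monom)

text \<open>
  Half of the decay of x^j is spent on the linear growth of the coefficients; the other half gives the
  bound.
\<close>

lemma weighted_tail_le:
  fixes a :: "nat \<Rightarrow> real" and x :: real
  assumes x: "0 \<le> x" "x < 1" and a: "\<And>j. j \<ge> J \<Longrightarrow> \<bar>a j\<bar> \<le> real j + 1"
  shows "\<bar>\<Sum>j\<in>{J..n}. a j * x ^ j\<bar> \<le> sqrt x ^ J / (1 - sqrt x)\<^sup>2"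
proof -
  define z where "z = sqrt x"
  have z: "0 \<le> z" "z < 1" using x by (auto simp: z_def)
  have zx: "x ^ j = z ^ j * z ^ j" for j using x by (simp add: z_def power_mult_distrib[symmetric])
  have g: "(\<Sum>i<m. z ^ i) \<le> 1 / (1 - z)" for m
  proof -
    have "(\<Sum>i<m. z ^ i) = (1 - z ^ m) / (1 - z)" using z by (simp add: sum_gp_strict)
    also have "\<dots> \<le> 1 / (1 - z)" using z by (intro divide_right_mono) auto
    finally show ?thesis .
  qed
  have w: "(real j + 1) * z ^ j \<le> 1 / (1 - z)" for j
  proof -
    have "(real j + 1) * z ^ j = (\<Sum>i<Suc j. z ^ j)" by (simp add: add.commute)
    also have "\<dots> \<le> (\<Sum>i<Suc j. z ^ i)" using z by (intro sum_mono power_decreasing) auto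
    also have "\<dots> \<le> 1 / (1 - z)" by (rule g)
    finally show ?thesis .
  qed
  have "\<bar>\<Sum>j\<in>{J..n}. a j * x ^ j\<bar> \<le> (\<Sum>j\<in>{J..n}. \<bar>a j * x ^ j\<bar>)" by (rule sum_abs)
  also have "\<dots> \<le> (\<Sum>j\<in>{J..n}. 1 / (1 - z) * z ^ j)"
  proof (rule sum_mono)
    fix j assume j: "j \<in> {J..n}"
    have "\<bar>a j * x ^ j\<bar> = \<bar>a j\<bar> * (z ^ j * z ^ j)" using z by (simp add: abs_mult zx)
    also have "\<dots> \<le> (real j + 1) * (z ^ j * z ^ j)" using j a z by (intro mult_right_mono) auto
    also have "\<dots> = ((real j + 1) * z ^ j) * z ^ j" by simp
    also have "\<dots> \<le> 1 / (1 - z) * z ^ j" using z by (intro mult_right_mono w) auto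
    finally show "\<bar>a j * x ^ j\<bar> \<le> 1 / (1 - z) * z ^ j" .
  qed
  also have "\<dots> = 1 / (1 - z) * (\<Sum>j\<in>{J..n}. z ^ j)" by (simp add: sum_distrib_left)
  also have "\<dots> \<le> 1 / (1 - z) * (z ^ J * (1 / (1 - z)))"
  proof (rule mult_left_mono)
    have "(\<Sum>j\<in>{J..n}. z ^ j) = (\<Sum>i<Suc n - J. z ^ J * z ^ i)"
      by (rule sum.reindex_bij_witness[of _ "\<lambda>i. i + J" "\<lambda>j. j - J"]) (auto simp: power_add[symmetric])
    also have "\<dots> = z ^ J * (\<Sum>i<Suc n - J. z ^ i)" by (simp only: sum_distrib_left)
    also have "\<dots> \<le> z ^ J * (1 / (1 - z))" using z by (intro mult_left_mono g) auto
    finally show "(\<Sum>j\<in>{J..n}. z ^ j) \<le> z ^ J * (1 / (1 - z))" .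
  qed (use z in simp)
  also have "1 / (1 - z) * (z ^ J * (1 / (1 - z))) = z ^ J / (1 - z)\<^sup>2" by (simp add: power2_eq_square)
  finally show ?thesis by (simp only: z_def)
qed

text \<open>
  Each sign change encloses a root by the intermediate value theorem, and the enclosing intervals are
  disjoint.
\<close>

lemma num_roots_ge_sign_changes:
  fixes p :: "real poly" and t :: "nat \<Rightarrow> real"
  assumes t: "\<And>i. 0 \<le> t i" "\<And>i. t i < 1" "strict_mono t" and nz: "\<And>i. m0 \<le> i \<Longrightarrow> i \<le> M \<Longrightarrow> poly p (t i) \<noteq> 0"
    and "m0 \<le> M"
  shows "card {i \<in> {m0..<M}. sg (poly p (t i)) \<noteq> sg (poly p (t (Suc i)))} \<le> num_roots_in p {0<..1}"
proof -
  define A where "A = {i \<in> {m0..<M}. sg (poly p (t i)) \<noteq> sg (poly p (t (Suc i)))}"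
  have p0: "p \<noteq> 0" using nz[of M] \<open>m0 \<le> M\<close> by auto
  have ex: "\<exists>r. t i < r \<and> r < t (Suc i) \<and> poly p r = 0" if "i \<in> A" for i
  proof -
    have lt: "t i < t (Suc i)" using t(3) by (simp add: strict_mono_Suc_iff)
    have "poly p (t i) \<noteq> 0" "poly p (t (Suc i)) \<noteq> 0" using nz that by (auto simp: A_def)
    moreover have "(poly p (t i) < 0) \<noteq> (poly p (t (Suc i)) < 0)" using that by (auto simp: A_def sg_def split: if_splits)
    ultimately consider "poly p (t i) < 0 \<and> poly p (t (Suc i)) > 0" | "poly p (t i) > 0 \<and> poly p (t (Suc i)) < 0"
      by (metis linorder_neqE_linordered_idom)
    then show ?thesis
    proof cases
      case 1 then show ?thesis using poly_IVT_pos[OF lt] by blast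
    next
      case 2 then show ?thesis using poly_IVT_neg[OF lt] by blast
    qed
  qed
  define r where "r i = (SOME r. t i < r \<and> r < t (Suc i) \<and> poly p r = 0)" for i
  have r: "t i < r i \<and> r i < t (Suc i) \<and> poly p (r i) = 0" if "i \<in> A" for i
    unfolding r_def by (rule someI_ex[OF ex[OF that]])
  have inj: "inj_on r A"
  proof (rule inj_onI, rule ccontr)
    fix i j assume ij: "i \<in> A" "j \<in> A" "r i = r j" "i \<noteq> j"
    have lt: "r i < r j" if "i \<in> A" "j \<in> A" "i < j" for i j
    proof -
      have "t (Suc i) \<le> t j" using strict_mono_leD[OF t(3), of "Suc i" j] that(3) by simp
      then show ?thesis using r[OF that(1)] r[OF that(2)] by linarith
    qed
    from ij(4) have "i < j \<or> j < i" by (rule linorder_neq_iff[THEN iffD1])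
    then show False using lt[OF ij(1,2)] lt[OF ij(2,1)] ij(3) by auto
  qed
  let ?F = "filter_mset (\<lambda>x. x \<in> {0<..1}) (proots p)"
  have "card A = card (r ` A)" using inj by (simp add: card_image)
  also have "\<dots> \<le> card (set_mset ?F)"
  proof (rule card_mono)
    show "r ` A \<subseteq> set_mset ?F"
    proof (rule image_subsetI)
      fix i assume "i \<in> A"
      then have ri: "t i < r i" "r i < t (Suc i)" "poly p (r i) = 0" using r by auto
      have "0 < r i" "r i \<le> 1" using ri t(1)[of i] t(2)[of "Suc i"] by linarith+
      then show "r i \<in> set_mset ?F" using ri p0 by simp
    qed
  qed simp
  also have "\<dots> = (\<Sum>x\<in>set_mset ?F. 1)" by simp
  also have "\<dots> \<le> (\<Sum>x\<in>set_mset ?F. count ?F x)" by (intro sum_mono) (simp only: Suc_le_eq One_nat_def count_greater_zero_iff)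
  also have "\<dots> = size ?F" by (rule size_multiset_overloaded_eq[symmetric])
  finally show ?thesis by (simp add: num_roots_in_def A_def)
qed

context kac_coeffs
begin

lemma AE_xi_growth: "AE \<omega> in M. \<forall>\<^sub>F j in sequentially. \<bar>\<xi> j \<omega>\<bar> \<le> real j + 1"
proof -
  define A where "A j = {\<omega> \<in> space M. (real (Suc j))\<^sup>2 \<le> (\<xi> j \<omega>)\<^sup>2}" for j
  have A_sets: "A j \<in> events" for j unfolding A_def by measurable
  have PA: "prob (A j) \<le> inverse (real (Suc j) ^ 2)" for j
    unfolding A_def using integral_Markov_inequality_measure[OF int_sq[of j], of "space M" "(real (Suc j))\<^sup>2"] second[of j]
    by (simp add: inverse_eq_divide)
  have "summable (\<lambda>j. prob (A j))"
  proof (rule summable_comparison_test_ev)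
    show "\<forall>\<^sub>F j in sequentially. norm (prob (A j)) \<le> inverse (real (Suc j) ^ 2)" using PA by simp
    show "summable (\<lambda>m. inverse (real (Suc m) ^ 2))"
      using inverse_power_summable[of 2, where 'a = real] by (subst summable_Suc_iff[of "\<lambda>m. inverse (real m ^ 2)"], simp)
  qed
  then have "AE \<omega> in M. \<forall>\<^sub>F j in sequentially. \<omega> \<in> space M - A j"
    using A_sets by (intro borel_cantelli_AE1) (auto simp: emeasure_eq_measure)
  then show ?thesis
  proof eventually_elim
    case (elim \<omega>)
    then show ?case
    proof eventually_elim
      case (elim j)
      then have "(\<xi> j \<omega>)\<^sup>2 \<le> (real (Suc j))\<^sup>2" by (auto simp: A_def)
      then have "\<bar>\<xi> j \<omega>\<bar> \<le> \<bar>real (Suc j)\<bar>" by (rule abs_le_square_iff[THEN iffD2])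
      then show ?case by simp
    qed
  qed
qed

context
  fixes \<beta> :: real
  assumes \<beta>: "\<beta> > 1"
begin

text \<open>
  The rate of the error terms along the geometric grid.
\<close>

definition \<theta>g :: real where "\<theta>g = \<beta> powr (- (rate / 2))"

lemma \<theta>g: "0 < \<theta>g" "\<theta>g < 1"
  using rate_pos \<beta> by (auto simp: \<theta>g_def powr_less_one)

lemma grid_weight_bound_powr_le: "grid_weight_bound \<beta> m powr rate \<le> 2 powr rate * \<theta>g ^ m"
proof -
  have b: "\<beta> ^ m > 0" using \<beta> by simp
  have "grid_weight_bound \<beta> m powr rate \<le> (2 / sqrt (\<beta> ^ m)) powr rate"
    using rate_pos grid_weight_bound_bounds(1)[OF \<beta>, of m] by (intro powr_mono2) (auto simp: grid_weight_bound_def[OF \<beta>])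
  also have "\<dots> = 2 powr rate / sqrt (\<beta> ^ m) powr rate" by (rule powr_divide)
  also have "sqrt (\<beta> ^ m) powr rate = (\<beta> ^ m) powr (rate / 2)"
  proof -
    have "sqrt (\<beta> ^ m) = (\<beta> ^ m) powr (1/2)" using b by (simp add: powr_half_sqrt)
    then have "sqrt (\<beta> ^ m) powr rate = (\<beta> ^ m) powr (1/2 * rate)" by (simp only: powr_powr)
    then show ?thesis by simp
  qed
  also have "2 powr rate / (\<beta> ^ m) powr (rate / 2) = 2 powr rate * (\<beta> ^ m) powr (- (rate / 2))"
    by (simp only: powr_minus divide_inverse)
  also have "(\<beta> ^ m) powr (- (rate / 2)) = \<theta>g ^ m"
  proof -
    have "(\<beta> ^ m) powr (- (rate / 2)) = (\<beta> powr real m) powr (- (rate / 2))" using \<beta> by (simp add: powr_realpow)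
    also have "\<dots> = (\<beta> powr (- (rate / 2))) powr real m" by (simp only: powr_powr mult.commute)
    also have "\<dots> = \<theta>g ^ m" using \<beta> by (simp add: \<theta>g_def powr_realpow)
    finally show ?thesis .
  qed
  finally show ?thesis .
qed

text \<open>
  The indicator of a sign change between grid points m and m + 1, written as a count so that changes_cov
  applies.
\<close>

definition grid_change :: "nat \<Rightarrow> 'a \<Rightarrow> real"
  where "grid_change m = changes (cutoff \<beta> (Suc m)) (\<lambda>i. grid_weight \<beta> (m + i)) 1"

lemma grid_change_measurable [measurable]: "grid_change m \<in> borel_measurable M" by (simp add: grid_change_def)

lemma grid_change_bounds: "0 \<le> grid_change m \<omega>" "grid_change m \<omega> \<le> 1"
  using changes_bounds[where n = 1] by (auto simp: grid_change_def simp del: One_nat_def)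

lemma lin_grid_weight_extend:
  assumes "cutoff \<beta> m \<le> J"
  shows "lin J (grid_weight \<beta> m) \<omega> = (\<Sum>j<cutoff \<beta> m. \<xi> j \<omega> * grid_point \<beta> m ^ j) / grid_norm \<beta> m"
proof -
  have "lin J (grid_weight \<beta> m) \<omega> = (\<Sum>j<cutoff \<beta> m. \<xi> j \<omega> * grid_point \<beta> m ^ j / grid_norm \<beta> m)"
    unfolding lin_def using assms by (intro sum.mono_neutral_cong_right) (auto simp: grid_weight_def[OF \<beta>])
  then show ?thesis by (simp add: sum_divide_distrib)
qed

lemma grid_change_mean_tendsto: "(\<lambda>m. expectation (grid_change m)) \<longlonglongrightarrow> arccos (grid_correlation \<beta>) / pi"
proof -
  obtain C where C: "C > 0" "\<And>J (w :: nat \<Rightarrow> real) w' (\<epsilon> :: real). (\<And>j. j < J \<Longrightarrow> \<bar>w j\<bar> \<le> \<epsilon>) \<Longrightarrow> (\<And>j. j < J \<Longrightarrow> \<bar>w' j\<bar> \<le> \<epsilon>) \<Longrightarrow> 0 < \<epsilon> \<Longrightarrow> \<epsilon> \<le> 1 \<Longrightarrow>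
       (\<Sum>j<J. (w j)\<^sup>2) = 1 \<Longrightarrow> (\<Sum>j<J. (w' j)\<^sup>2) = 1 \<Longrightarrow>
       \<bar>prob {\<omega> \<in> space M. sg (lin J w \<omega>) \<noteq> sg (lin J w' \<omega>)} - arccos (\<Sum>j<J. w j * w' j) / pi\<bar> \<le> C * \<epsilon> powr rate"
    using sign_change_prob by blast
  define f where "f m = arccos (\<Sum>j<cutoff \<beta> (Suc m). grid_weight \<beta> m j * grid_weight \<beta> (Suc m) j) / pi" for m
  have f: "f \<longlonglongrightarrow> arccos (grid_correlation \<beta>) / pi"
    unfolding f_def[abs_def] using grid_correlation_bounds[OF \<beta>]
    by (intro tendsto_divide tendsto_const isCont_tendsto_compose[OF isCont_arccos] grid_weight_correlation_tendsto[OF \<beta>]) auto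
  have e: "\<bar>expectation (grid_change m) - f m\<bar> \<le> C * (2 powr rate * \<theta>g ^ m)" for m
  proof -
    have "\<bar>expectation (grid_change m) - f m\<bar> \<le> C * grid_weight_bound \<beta> m powr rate"
      unfolding grid_change_def f_def expectation_changes
      using C(2)[of "cutoff \<beta> (Suc m)" "grid_weight \<beta> m" "grid_weight_bound \<beta> m" "grid_weight \<beta> (Suc m)"] grid_weight_le_grid_weight_bound[OF \<beta>, of m] order_trans[OF grid_weight_le_grid_weight_bound[OF \<beta>, of "Suc m"] grid_weight_bound_Suc_le[OF \<beta>]]
        grid_weight_bound_bounds[OF \<beta>, of m] sum_grid_weight[OF \<beta> cutoff_mono[OF \<beta>, of m "Suc m"]] sum_grid_weight[OF \<beta>, of "Suc m" "cutoff \<beta> (Suc m)"] by simp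
    also have "\<dots> \<le> C * (2 powr rate * \<theta>g ^ m)" using C(1) by (intro mult_left_mono grid_weight_bound_powr_le) auto
    finally show ?thesis .
  qed
  have "(\<lambda>m. C * (2 powr rate * \<theta>g ^ m)) \<longlonglongrightarrow> C * (2 powr rate * 0)"
    using \<theta>g by (intro tendsto_intros LIMSEQ_power_zero) auto
  then have "(\<lambda>m. expectation (grid_change m) - f m) \<longlonglongrightarrow> 0"
    using e by (intro Lim_null_comparison[of "\<lambda>m. expectation (grid_change m) - f m"]) auto
  from tendsto_add[OF this f] show ?thesis by simp
qed

lemma grid_change_cov:
  obtains A where "A \<ge> 0" "\<And>m l. m < l \<Longrightarrow> real (l - m) > sqrt (real l) \<Longrightarrow>
     \<bar>expectation (\<lambda>\<omega>. grid_change m \<omega> * grid_change l \<omega>) - expectation (grid_change m) * expectation (grid_change l)\<bar> \<le> A / real (Suc l)"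
proof -
  obtain C where C: "C > 0" and sb: "\<And>J (w :: nat \<Rightarrow> real) (\<epsilon> :: real) \<tau>. (\<And>j. j < J \<Longrightarrow> \<bar>w j\<bar> \<le> \<epsilon>) \<Longrightarrow> 0 < \<epsilon> \<Longrightarrow> \<epsilon> \<le> 1 \<Longrightarrow> (\<Sum>j<J. (w j)\<^sup>2) = 1 \<Longrightarrow>
       prob {\<omega> \<in> space M. \<bar>lin J w \<omega>\<bar> \<le> \<tau>} \<le> C * (\<bar>\<tau>\<bar> + \<epsilon> powr rate)"
    using small_ball by blast
  define R where "R = 2 powr rate"
  have R: "R > 0" by (simp add: R_def)
  obtain B1 where B1: "B1 > 0" "\<And>m. (real m + 1) ^ 1 * \<theta>g ^ m \<le> B1" using poly_geometric_bounded[OF \<theta>g] by blast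
  define c where "c = ln \<beta> / 3"
  have c: "c > 0" using \<beta> by (simp add: c_def)
  have "(\<lambda>l. (real l + 2) ^ 3 * exp (- (c * sqrt (real l)))) \<longlonglongrightarrow> 0" using c by real_asymp
  then have "Bseq (\<lambda>l. (real l + 2) ^ 3 * exp (- (c * sqrt (real l))))"
    by (intro convergent_imp_Bseq) (auto simp: convergent_def)
  then obtain B2 where B2: "B2 > 0" "\<And>l. norm ((real l + 2) ^ 3 * exp (- (c * sqrt (real l)))) \<le> B2" by (auto simp: Bseq_def)
  define A where "A = 4 * ((C + 1) * (8 * \<beta> * B2) + C * R * B1)"
  show thesis
  proof (rule that[of A])
    show "A \<ge> 0" using C R B1 B2 \<beta> by (simp add: A_def)
    fix m l :: nat assume ml: "m < l" "real (l - m) > sqrt (real l)"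
    let ?J = "cutoff \<beta> (Suc m)" and ?J' = "cutoff \<beta> (Suc l)"
    define K where "K = 8 * \<beta> * (real l + 2)\<^sup>2"
    have "(real l + 2)\<^sup>2 \<ge> 1" by (simp add: one_le_power)
    then have "8 * \<beta> * (real l + 2)\<^sup>2 \<ge> 1 * 1" using \<beta> by (intro mult_mono) auto
    then have K: "K \<ge> 1" by (simp add: K_def)
    define \<delta> where "\<delta> = K * exp (- (c * real (l - m)))"
    have \<delta>: "\<delta> > 0" using K by (simp add: \<delta>_def)
    have JJ: "?J \<le> ?J'" using ml by (intro cutoff_mono[OF \<beta>]) auto
    have p: "prob {\<omega> \<in> space M. sg (lin ?J' (grid_weight \<beta> (l + i)) \<omega>) \<noteq> sg (lin ?J' (tail_weights ?J (grid_weight \<beta> (l + i))) \<omega>)} \<le> C * (\<delta> + R * \<theta>g ^ l) + \<delta>"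
      if i: "i \<le> 1" for i
    proof -
      have low: "(\<Sum>j<?J. (grid_weight \<beta> (l + i) j)\<^sup>2) \<le> \<delta> ^ 3"
      proof -
        have "(\<Sum>j<?J. (grid_weight \<beta> (l + i) j)\<^sup>2) \<le> (\<Sum>j<?J. 4 / \<beta> ^ (l + i))"
          by (intro sum_mono grid_weight_sq_le[OF \<beta>])
        also have "\<dots> = real ?J * (4 / \<beta> ^ (l + i))" by simp
        also have "\<dots> \<le> (2 * ((real l + 2)\<^sup>2 * \<beta> ^ Suc m)) * (4 / \<beta> ^ l)"
        proof (rule mult_mono)
          have "real ?J \<le> (real (Suc m) + 1)\<^sup>2 * \<beta> ^ Suc m + 1" by (rule cutoff_bounds(2)[OF \<beta>])
          also have "\<dots> \<le> (real l + 2)\<^sup>2 * \<beta> ^ Suc m + 1"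
            using ml \<beta> by (intro add_right_mono mult_right_mono power_mono) auto
          also have "1 \<le> (real l + 2)\<^sup>2 * \<beta> ^ Suc m"
          proof -
            have "1 * 1 \<le> (real l + 2)\<^sup>2 * \<beta> ^ Suc m"
              using \<open>(real l + 2)\<^sup>2 \<ge> 1\<close> \<beta> one_le_power[of \<beta> "Suc m"] by (intro mult_mono) auto
            then show ?thesis by simp
          qed
          finally show "real ?J \<le> 2 * ((real l + 2)\<^sup>2 * \<beta> ^ Suc m)" by (simp add: mult_ac)
          have "\<beta> ^ l \<le> \<beta> ^ (l + i)" using \<beta> by (intro power_increasing) auto
          then show "4 / \<beta> ^ (l + i) \<le> 4 / \<beta> ^ l" using \<beta> by (intro divide_left_mono) auto
        qed (use \<beta> in auto)
        also have "\<dots> = K * (\<beta> ^ m / \<beta> ^ l)" by (simp add: K_def)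
        also have "\<beta> ^ m / \<beta> ^ l = exp (- (c * real (l - m))) ^ 3"
        proof -
          have "exp (- (c * real (l - m))) ^ 3 = exp (- (ln \<beta> * real (l - m)))"
            by (simp add: exp_of_nat_mult[symmetric] c_def)
          also have "\<dots> = inverse (exp (real (l - m) * ln \<beta>))" by (simp add: exp_minus mult.commute)
          also have "exp (real (l - m) * ln \<beta>) = \<beta> ^ (l - m)" using \<beta> by (simp only: exp_of_nat_mult) simp
          finally have 1: "exp (- (c * real (l - m))) ^ 3 = inverse (\<beta> ^ (l - m))" .
          have "\<beta> ^ l = \<beta> ^ m * \<beta> ^ (l - m)" using ml by (simp add: power_add[symmetric])
          then show ?thesis unfolding 1 using \<beta> by (simp add: divide_inverse)
        qed
        also have "K * exp (- (c * real (l - m))) ^ 3 \<le> K ^ 3 * exp (- (c * real (l - m))) ^ 3"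
          using K power_increasing[of 1 3 K] by (intro mult_right_mono) auto
        also have "\<dots> = \<delta> ^ 3" by (simp add: \<delta>_def power_mult_distrib)
        finally show ?thesis .
      qed
      have g1: "grid_weight_bound \<beta> (l + i) \<le> grid_weight_bound \<beta> l" using i grid_weight_bound_Suc_le[OF \<beta>, of l] by (cases i) auto
      have "prob {\<omega> \<in> space M. sg (lin ?J' (grid_weight \<beta> (l + i)) \<omega>) \<noteq> sg (lin ?J' (tail_weights ?J (grid_weight \<beta> (l + i))) \<omega>)} \<le> C * (\<delta> + grid_weight_bound \<beta> l powr rate) + \<delta>"
      proof (rule truncation_prob[OF sb _ grid_weight_bound_bounds[OF \<beta>] _ JJ \<delta> low])
        show "\<bar>grid_weight \<beta> (l + i) j\<bar> \<le> grid_weight_bound \<beta> l" for j using grid_weight_le_grid_weight_bound[OF \<beta>, of "l + i" j] g1 by linarith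
        show "(\<Sum>j<?J'. (grid_weight \<beta> (l + i) j)\<^sup>2) = 1" using i by (intro sum_grid_weight[OF \<beta>] cutoff_mono[OF \<beta>]) auto
      qed
      also have "grid_weight_bound \<beta> l powr rate \<le> R * \<theta>g ^ l" unfolding R_def by (rule grid_weight_bound_powr_le)
      finally show ?thesis using C by (simp add: mult_left_mono)
    qed
    have \<delta>l: "\<delta> \<le> K * exp (- (c * sqrt (real l)))"
      unfolding \<delta>_def using K ml(2) c by (intro mult_left_mono) auto
    define P where "P = C * (\<delta> + R * \<theta>g ^ l) + \<delta>"
    have "\<bar>expectation (\<lambda>\<omega>. grid_change m \<omega> * grid_change l \<omega>) - expectation (grid_change m) * expectation (grid_change l)\<bar> \<le> 4 * real 1 * real 1 * P"
      unfolding grid_change_def P_def by (rule changes_cov) (rule p)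
    also have "\<dots> = 4 * ((real l + 1) * P) / real (Suc l)" by (simp add: add.commute)
    also have "\<dots> \<le> A / real (Suc l)"
    proof (rule divide_right_mono)
      have "P \<le> (C + 1) * (K * exp (- (c * sqrt (real l)))) + C * R * \<theta>g ^ l"
      proof -
        have "(C + 1) * \<delta> \<le> (C + 1) * (K * exp (- (c * sqrt (real l))))" using C by (intro mult_left_mono \<delta>l) auto
        then show ?thesis by (simp add: P_def algebra_simps)
      qed
      then have "(real l + 1) * P \<le> (real l + 1) * ((C + 1) * (K * exp (- (c * sqrt (real l)))) + C * R * \<theta>g ^ l)"
        by (intro mult_left_mono) auto
      also have "\<dots> = (C + 1) * (8 * \<beta> * ((real l + 1) * (real l + 2)\<^sup>2 * exp (- (c * sqrt (real l))))) + C * R * ((real l + 1) ^ 1 * \<theta>g ^ l)"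
        by (simp only: K_def distrib_left[of "real l + 1"] mult_ac power_one_right)
      also have "\<dots> \<le> (C + 1) * (8 * \<beta> * B2) + C * R * B1"
      proof (intro add_mono mult_left_mono B1)
        have "(real l + 1) * (real l + 2)\<^sup>2 * exp (- (c * sqrt (real l))) \<le> (real l + 2) * (real l + 2)\<^sup>2 * exp (- (c * sqrt (real l)))"
          by (intro mult_right_mono) auto
        also have "\<dots> = (real l + 2) ^ 3 * exp (- (c * sqrt (real l)))" by (simp add: power3_eq_cube power2_eq_square)
        also have "\<dots> \<le> B2" using B2(2)[of l] by simp
        finally show "(real l + 1) * (real l + 2)\<^sup>2 * exp (- (c * sqrt (real l))) \<le> B2" .
      qed (use C R \<beta> in auto)
      finally show "4 * ((real l + 1) * P) \<le> A" by (simp add: A_def)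
    qed simp
    finally show "\<bar>expectation (\<lambda>\<omega>. grid_change m \<omega> * grid_change l \<omega>) - expectation (grid_change m) * expectation (grid_change l)\<bar> \<le> A / real (Suc l)" .
  qed
qed

text \<open>
  With this lower bound the truncated sum dominates the tail that the truncation leaves out.
\<close>

lemma AE_not_small: "AE \<omega> in M. \<forall>\<^sub>F m in sequentially. \<bar>lin (cutoff \<beta> m) (grid_weight \<beta> m) \<omega>\<bar> > inverse ((real m + 1)\<^sup>2)"
proof -
  obtain C where C: "C > 0" and sb: "\<And>J (w :: nat \<Rightarrow> real) (\<epsilon> :: real) \<tau>. (\<And>j. j < J \<Longrightarrow> \<bar>w j\<bar> \<le> \<epsilon>) \<Longrightarrow> 0 < \<epsilon> \<Longrightarrow> \<epsilon> \<le> 1 \<Longrightarrow> (\<Sum>j<J. (w j)\<^sup>2) = 1 \<Longrightarrow>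
       prob {\<omega> \<in> space M. \<bar>lin J w \<omega>\<bar> \<le> \<tau>} \<le> C * (\<bar>\<tau>\<bar> + \<epsilon> powr rate)"
    using small_ball by blast
  define A where "A m = {\<omega> \<in> space M. \<bar>lin (cutoff \<beta> m) (grid_weight \<beta> m) \<omega>\<bar> \<le> inverse ((real m + 1)\<^sup>2)}" for m
  have A_sets: "A m \<in> events" for m unfolding A_def by measurable
  have PA: "prob (A m) \<le> C * inverse (real (Suc m) ^ 2) + C * 2 powr rate * \<theta>g ^ m" for m
  proof -
    have "prob (A m) \<le> C * (\<bar>inverse ((real m + 1)\<^sup>2)\<bar> + grid_weight_bound \<beta> m powr rate)"
      unfolding A_def by (intro sb grid_weight_le_grid_weight_bound[OF \<beta>] grid_weight_bound_bounds[OF \<beta>] sum_grid_weight[OF \<beta>]) auto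
    also have "\<dots> \<le> C * (inverse ((real m + 1)\<^sup>2) + 2 powr rate * \<theta>g ^ m)"
      using C grid_weight_bound_powr_le[of m] by (intro mult_left_mono) auto
    finally show ?thesis by (simp add: algebra_simps)
  qed
  have "summable (\<lambda>m. prob (A m))"
  proof (rule summable_comparison_test_ev)
    show "\<forall>\<^sub>F m in sequentially. norm (prob (A m)) \<le> C * inverse (real (Suc m) ^ 2) + C * 2 powr rate * \<theta>g ^ m" using PA by simp
    have "summable (\<lambda>m. inverse (real (Suc m) ^ 2))"
      using inverse_power_summable[of 2, where 'a = real] by (subst summable_Suc_iff[of "\<lambda>m. inverse (real m ^ 2)"], simp)
    then show "summable (\<lambda>m. C * inverse (real (Suc m) ^ 2) + C * 2 powr rate * \<theta>g ^ m)"
      using \<theta>g by (intro summable_add summable_mult summable_geometric) auto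
  qed
  then have "AE \<omega> in M. \<forall>\<^sub>F m in sequentially. \<omega> \<in> space M - A m"
    using A_sets by (intro borel_cantelli_AE1) (auto simp: emeasure_eq_measure)
  then show ?thesis
  proof eventually_elim
    case (elim \<omega>)
    then show ?case by eventually_elim (auto simp: A_def not_le)
  qed
qed

end
end

section \<open>The lower bound for the number of roots\<close>

context kac_coeffs
begin

text \<open>
  For large m and every n beyond the cutoff, the sign of the n-th polynomial at the m-th grid point is that of
  the grid form, because the tail is smaller than the form. So the strong law for the grid forms
  gives the number of sign changes up to the last grid point whose cutoff is at most n; the index of
  that point is asymptotic to ln n / ln \<beta>.
\<close>

lemma roots_lower_grid:
  fixes \<beta> \<gamma> :: real
  assumes \<beta>: "\<beta> > 1" and \<gamma>: "0 < \<gamma>" "\<gamma> * ln \<beta> < arccos (grid_correlation \<beta>) / pi"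
  shows "AE \<omega> in M. \<forall>\<^sub>F n in sequentially. \<gamma> * ln (real n) \<le> real (num_roots_in (kac_poly (\<lambda>j. \<xi> j \<omega>) n) {0<..1})"
proof -
  have lb: "ln \<beta> > 0" using \<beta> by simp
  (* The gap absorbs, in turn, the convergence of the means, the strong law, and the lower-order terms
     in the number of grid points. *)
  obtain \<gamma>1 where \<gamma>1: "\<gamma> * ln \<beta> < \<gamma>1" "\<gamma>1 < arccos (grid_correlation \<beta>) / pi" using dense[OF \<gamma>(2)] by blast
  obtain \<gamma>2 where \<gamma>2: "\<gamma> * ln \<beta> < \<gamma>2" "\<gamma>2 < \<gamma>1" using dense[OF \<gamma>1(1)] by blast
  obtain \<gamma>3 where \<gamma>3: "\<gamma> * ln \<beta> < \<gamma>3" "\<gamma>3 < \<gamma>2" using dense[OF \<gamma>2(1)] by blast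
  define \<eta> where "\<eta> = \<gamma>3 / \<gamma> - ln \<beta>"
  have \<eta>: "\<eta> > 0" using \<gamma>3 \<gamma> by (simp add: \<eta>_def field_simps)
  have \<gamma>\<eta>: "\<gamma> * (ln \<beta> + \<eta>) = \<gamma>3" using \<gamma> by (simp add: \<eta>_def)
  have "\<forall>\<^sub>F m in sequentially. expectation (grid_change \<beta> m) > \<gamma>1"
    by (rule order_tendstoD(1)[OF grid_change_mean_tendsto[OF \<beta>] \<gamma>1(2)])
  then have "\<forall>\<^sub>F m in sequentially. - expectation (grid_change \<beta> m) \<le> - \<gamma>1" by eventually_elim simp
  then obtain C1 where C1: "\<And>T. (\<Sum>m<T. - expectation (grid_change \<beta> m)) \<le> - \<gamma>1 * real T + C1" by (rule sum_eventually_le) blast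
  obtain A where A: "A \<ge> 0" "\<And>m l. m < l \<Longrightarrow> real (l - m) > sqrt (real l) \<Longrightarrow>
     \<bar>expectation (\<lambda>\<omega>. grid_change \<beta> m \<omega> * grid_change \<beta> l \<omega>) - expectation (grid_change \<beta> m) * expectation (grid_change \<beta> l)\<bar> \<le> A / real (Suc l)"
    using grid_change_cov[OF \<beta>] by blast
  have Z2: "0 \<le> (grid_change \<beta> m \<omega>)\<^sup>2" "(grid_change \<beta> m \<omega>)\<^sup>2 \<le> 1" for m \<omega>
    using grid_change_bounds[OF \<beta>, of m \<omega>] by (auto simp: power_le_one)
  have intZ: "integrable M (\<lambda>\<omega>. (grid_change \<beta> m \<omega>)\<^sup>2)" for m
    using Z2 grid_change_measurable[OF \<beta>, of m] by (intro integrable_const_bound[of _ 1]) auto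
  have "AE \<omega> in M. (\<lambda>T. (\<Sum>m<T. grid_change \<beta> m \<omega> - expectation (grid_change \<beta> m)) / real T) \<longlonglongrightarrow> 0"
  proof (rule strong_law_weakly_dependent[where A = "max 1 A"])
    fix m
    have "expectation (\<lambda>\<omega>. (grid_change \<beta> m \<omega>)\<^sup>2) \<le> expectation (\<lambda>_. 1)" using intZ Z2 by (intro integral_mono) auto
    then show "expectation (\<lambda>\<omega>. (grid_change \<beta> m \<omega>)\<^sup>2) \<le> max 1 A" by (simp add: prob_space)
  next
    fix m l :: nat assume "m < l" "real (l - m) > sqrt (real l)"
    then have "\<bar>expectation (\<lambda>\<omega>. grid_change \<beta> m \<omega> * grid_change \<beta> l \<omega>) - expectation (grid_change \<beta> m) * expectation (grid_change \<beta> l)\<bar> \<le> A / real (Suc l)" by (rule A(2))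
    also have "\<dots> \<le> max 1 A / real (Suc l)" by (intro divide_right_mono) auto
    finally show "\<bar>expectation (\<lambda>\<omega>. grid_change \<beta> m \<omega> * grid_change \<beta> l \<omega>) - expectation (grid_change \<beta> m) * expectation (grid_change \<beta> l)\<bar> \<le> max 1 A / real (Suc l)" .
  qed (use intZ grid_change_bounds[OF \<beta>] grid_change_measurable[OF \<beta>] in auto)
  moreover have "AE \<omega> in M. \<forall>\<^sub>F m in sequentially. \<bar>lin (cutoff \<beta> m) (grid_weight \<beta> m) \<omega>\<bar> > inverse ((real m + 1)\<^sup>2)"
    by (rule AE_not_small[OF \<beta>])
  ultimately show ?thesis using AE_xi_growth
  proof eventually_elim
    case (elim \<omega>)
    let ?p = "\<lambda>n. kac_poly (\<lambda>j. \<xi> j \<omega>) n"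
    obtain T0 where T0: "\<And>T. T \<ge> T0 \<Longrightarrow> (\<Sum>m<T. grid_change \<beta> m \<omega> - expectation (grid_change \<beta> m)) / real T > \<gamma>2 - \<gamma>1"
      using order_tendstoD(1)[OF elim(1), of "\<gamma>2 - \<gamma>1"] \<gamma>2 by (auto simp: eventually_sequentially)
    obtain j0 where j0: "\<And>j. j \<ge> j0 \<Longrightarrow> \<bar>\<xi> j \<omega>\<bar> \<le> real j + 1" using elim(3) by (auto simp: eventually_sequentially)
    have tail_small: "\<forall>\<^sub>F m in sequentially. 8 * (real m + 1)\<^sup>2 * exp (2 * ln \<beta> * real m) * exp (- ((real m + 1)\<^sup>2 / 2)) < 1"
    proof -
      have "(\<lambda>m. 8 * (real m + 1)\<^sup>2 * exp (2 * ln \<beta> * real m) * exp (- ((real m + 1)\<^sup>2 / 2))) \<longlonglongrightarrow> 0"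
        using lb by real_asymp
      then show ?thesis by (rule order_tendstoD) simp
    qed
    obtain m0 where m0: "m0 \<ge> j0" "\<And>m. m \<ge> m0 \<Longrightarrow> \<bar>lin (cutoff \<beta> m) (grid_weight \<beta> m) \<omega>\<bar> > inverse ((real m + 1)\<^sup>2)"
      "\<And>m. m \<ge> m0 \<Longrightarrow> 8 * (real m + 1)\<^sup>2 * exp (2 * ln \<beta> * real m) * exp (- ((real m + 1)\<^sup>2 / 2)) < 1"
    proof -
      have "\<forall>\<^sub>F m in sequentially. m \<ge> j0 \<and> \<bar>lin (cutoff \<beta> m) (grid_weight \<beta> m) \<omega>\<bar> > inverse ((real m + 1)\<^sup>2) \<and> 8 * (real m + 1)\<^sup>2 * exp (2 * ln \<beta> * real m) * exp (- ((real m + 1)\<^sup>2 / 2)) < 1"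
        using elim(2) tail_small eventually_ge_at_top[of j0] by eventually_elim auto
      then show thesis using that by (auto simp: eventually_sequentially)
    qed
    have agree: "poly (?p n) (grid_point \<beta> m) \<noteq> 0 \<and> sg (poly (?p n) (grid_point \<beta> m)) = sg (lin J (grid_weight \<beta> m) \<omega>)"
      if m: "m \<ge> m0" and n: "cutoff \<beta> m \<le> n" and J: "cutoff \<beta> m \<le> J" for m n J
    proof -
      define x where "x = grid_point \<beta> m"
      have x: "0 \<le> x" "x < 1" using grid_point_bounds[OF \<beta>, of m] by (auto simp: x_def)
      define F where "F = (\<Sum>j<cutoff \<beta> m. \<xi> j \<omega> * x ^ j)"
      define R where "R = (\<Sum>j\<in>{cutoff \<beta> m..n}. \<xi> j \<omega> * x ^ j)"
      have split: "poly (?p n) x = F + R"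
      proof -
        have "{..n} = {..<cutoff \<beta> m} \<union> {cutoff \<beta> m..n}" using n by auto
        then show ?thesis unfolding poly_kac_poly F_def R_def by (simp only:) (intro sum.union_disjoint; auto)
      qed
      have gs0: "grid_norm \<beta> m > 0" by (rule grid_norm_pos[OF \<beta>])
      have linF: "lin J (grid_weight \<beta> m) \<omega> = F / grid_norm \<beta> m" unfolding F_def x_def by (rule lin_grid_weight_extend[OF \<beta> J])
      have linF': "lin (cutoff \<beta> m) (grid_weight \<beta> m) \<omega> = F / grid_norm \<beta> m" unfolding F_def x_def by (rule lin_grid_weight_extend[OF \<beta>]) simp
      have gs2: "grid_norm \<beta> m \<ge> 1 / 2"
      proof (rule power2_le_imp_le)
        have "(1/2::real)\<^sup>2 \<le> \<beta> ^ m / 4" using bpow(1)[OF \<beta>, of m] by (simp add: power2_eq_square)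
        then show "(1/2)\<^sup>2 \<le> (grid_norm \<beta> m)\<^sup>2" using grid_norm_sq_ge[OF \<beta>, of m] by linarith
      qed (use gs0 in simp)
      have "inverse ((real m + 1)\<^sup>2) < \<bar>F\<bar> / grid_norm \<beta> m" using m0(2)[OF m] gs0 unfolding linF' by simp
      then have Fbig: "grid_norm \<beta> m * inverse ((real m + 1)\<^sup>2) < \<bar>F\<bar>" using gs0 by (simp add: field_simps)
      have "1 / 2 * inverse ((real m + 1)\<^sup>2) \<le> grid_norm \<beta> m * inverse ((real m + 1)\<^sup>2)" using gs2 by (intro mult_right_mono) auto
      then have F1: "1 / 2 * inverse ((real m + 1)\<^sup>2) < \<bar>F\<bar>" using Fbig by linarith
      have "\<bar>R\<bar> \<le> sqrt x ^ cutoff \<beta> m / (1 - sqrt x)\<^sup>2"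
        unfolding R_def
      proof (rule weighted_tail_le[OF x])
        fix j assume "cutoff \<beta> m \<le> j"
        then have "j \<ge> j0" using cutoff_ge[OF \<beta>, of m] m m0(1) by linarith
        then show "\<bar>\<xi> j \<omega>\<bar> \<le> real j + 1" by (rule j0)
      qed
      also have "\<dots> \<le> exp (- ((real m + 1)\<^sup>2 / 2)) / (1 / (2 * \<beta> ^ m))\<^sup>2"
      proof (rule frac_le)
        show "sqrt x ^ cutoff \<beta> m \<le> exp (- ((real m + 1)\<^sup>2 / 2))"
        proof (rule power2_le_imp_le)
          have "(sqrt x ^ cutoff \<beta> m)\<^sup>2 = x ^ cutoff \<beta> m"
            using x by (simp add: power_mult[symmetric] mult.commute[of _ 2]) (simp add: power_mult)
          also have "\<dots> \<le> exp (- (real m + 1)\<^sup>2)" unfolding x_def by (rule grid_point_pow_cutoff[OF \<beta>])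
          also have "\<dots> = (exp (- ((real m + 1)\<^sup>2 / 2)))\<^sup>2" by (simp add: exp_double[symmetric])
          finally show "(sqrt x ^ cutoff \<beta> m)\<^sup>2 \<le> (exp (- ((real m + 1)\<^sup>2 / 2)))\<^sup>2" .
        qed simp
        show "(1 / (2 * \<beta> ^ m))\<^sup>2 \<le> (1 - sqrt x)\<^sup>2"
        proof (rule power_mono)
          have sx: "0 \<le> sqrt x" "sqrt x \<le> 1" using x by auto
          have "1 / \<beta> ^ m = 1 - x" by (simp add: x_def grid_point_def[OF \<beta>])
          also have "\<dots> = (1 - sqrt x) * (1 + sqrt x)" using x by (simp add: algebra_simps)
          also have "\<dots> \<le> (1 - sqrt x) * 2" using sx by (intro mult_left_mono) auto
          finally show "1 / (2 * \<beta> ^ m) \<le> 1 - sqrt x" by simp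
        qed (use \<beta> in auto)
        show "0 < (1 / (2 * \<beta> ^ m))\<^sup>2" using \<beta> by simp
      qed auto
      also have "\<dots> = 4 * exp (2 * ln \<beta> * real m) * exp (- ((real m + 1)\<^sup>2 / 2))"
      proof -
        have "exp (2 * ln \<beta> * real m) = (\<beta> ^ m)\<^sup>2"
        proof -
          have "exp (2 * ln \<beta> * real m) = exp (real m * ln \<beta>) ^ 2" by (simp add: exp_double[symmetric] mult_ac)
          also have "exp (real m * ln \<beta>) = \<beta> ^ m" using \<beta> by (simp only: exp_of_nat_mult) simp
          finally show ?thesis .
        qed
        then show ?thesis using \<beta> by (simp add: power_divide power_mult_distrib)
      qed
      also have "\<dots> < 1 / 2 * inverse ((real m + 1)\<^sup>2)"
      proof -
        have "(real m + 1)\<^sup>2 > 0" by simp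
        then show ?thesis using m0(3)[OF m] by (simp add: field_simps)
      qed
      finally have "\<bar>R\<bar> < \<bar>F\<bar>" using F1 by linarith
      then have "F + R \<noteq> 0" "sg (F + R) = sg F" by (auto simp: sg_def)
      moreover have "sg (F / grid_norm \<beta> m) = sg F" using gs0 by (simp add: sg_def zero_le_divide_iff)
      ultimately show ?thesis unfolding linF using split by (simp add: x_def)
    qed
    have count: "(\<Sum>m<T. grid_change \<beta> m \<omega>) - real m0 \<le> real (num_roots_in (?p n) {0<..1})"
      if T: "m0 \<le> T" "cutoff \<beta> T \<le> n" for T n
    proof -
      let ?A = "{i \<in> {m0..<T}. sg (poly (?p n) (grid_point \<beta> i)) \<noteq> sg (poly (?p n) (grid_point \<beta> (Suc i)))}"
      have cutoff: "cutoff \<beta> i \<le> n" if "i \<le> T" for i using cutoff_mono[OF \<beta> that] T by linarith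
      have Zi: "grid_change \<beta> i \<omega> = (if sg (poly (?p n) (grid_point \<beta> i)) \<noteq> sg (poly (?p n) (grid_point \<beta> (Suc i))) then 1 else 0)" if "i \<in> {m0..<T}" for i
      proof -
        have "sg (poly (?p n) (grid_point \<beta> i)) = sg (lin (cutoff \<beta> (Suc i)) (grid_weight \<beta> i) \<omega>)"
          using agree[of i n "cutoff \<beta> (Suc i)"] that cutoff[of i] cutoff_mono[OF \<beta>, of i "Suc i"] by simp
        moreover have "sg (poly (?p n) (grid_point \<beta> (Suc i))) = sg (lin (cutoff \<beta> (Suc i)) (grid_weight \<beta> (Suc i)) \<omega>)"
          using agree[of "Suc i" n "cutoff \<beta> (Suc i)"] that cutoff[of "Suc i"] by simp
        ultimately show ?thesis by (simp add: grid_change_def[OF \<beta>] changes_def)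
      qed
      have "card ?A \<le> num_roots_in (?p n) {0<..1}"
      proof (rule num_roots_ge_sign_changes)
        show "strict_mono (grid_point \<beta>)" using grid_point_strict_mono[OF \<beta>] by (simp add: strict_mono_Suc_iff)
        fix i assume "m0 \<le> i" "i \<le> T"
        then show "poly (?p n) (grid_point \<beta> i) \<noteq> 0" using agree[of i n "cutoff \<beta> i"] cutoff[of i] by simp
      qed (use grid_point_bounds[OF \<beta>] T in auto)
      moreover have "(\<Sum>m\<in>{m0..<T}. grid_change \<beta> m \<omega>) = real (card ?A)"
        using Zi by (simp add: sum.If_cases Int_def)
      moreover have "(\<Sum>m<T. grid_change \<beta> m \<omega>) = (\<Sum>m<m0. grid_change \<beta> m \<omega>) + (\<Sum>m\<in>{m0..<T}. grid_change \<beta> m \<omega>)"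
        using T(1) by (simp add: lessThan_atLeast0 sum.atLeastLessThan_concat)
      moreover have "(\<Sum>m<m0. grid_change \<beta> m \<omega>) \<le> (\<Sum>m<m0. 1)" using grid_change_bounds[OF \<beta>] by (intro sum_mono) auto
      ultimately show ?thesis by simp
    qed
    (* The last grid point whose cutoff is at most n. *)
    define Mf where "Mf n = Max {T. cutoff \<beta> T \<le> n}" for n
    have fin: "finite {T. cutoff \<beta> T \<le> n}" for n
    proof (rule finite_subset)
      show "{T. cutoff \<beta> T \<le> n} \<subseteq> {..n}"
      proof
        fix T assume "T \<in> {T. cutoff \<beta> T \<le> n}"
        then show "T \<in> {..n}" using cutoff_ge[OF \<beta>, of T] by simp
      qed
    qed simp
    have Mf: "cutoff \<beta> (Mf n) \<le> n" "n < cutoff \<beta> (Suc (Mf n))" if "n \<ge> cutoff \<beta> 0" for n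
    proof -
      have ne: "{T. cutoff \<beta> T \<le> n} \<noteq> {}" using that by auto
      show "cutoff \<beta> (Mf n) \<le> n" using Max_in[OF fin ne] by (simp add: Mf_def)
      show "n < cutoff \<beta> (Suc (Mf n))"
      proof (rule ccontr)
        assume "\<not> ?thesis"
        then have "Suc (Mf n) \<le> Mf n" unfolding Mf_def[of n] by (intro Max_ge fin) (auto simp: Mf_def)
        then show False by simp
      qed
    qed
    have Mf_lim: "filterlim Mf at_top sequentially"
    proof (rule filterlim_at_top[THEN iffD2, rule_format])
      fix Z :: nat
      show "\<forall>\<^sub>F n in sequentially. Z \<le> Mf n"
        using eventually_ge_at_top[of "cutoff \<beta> Z"] by eventually_elim (auto simp: Mf_def intro!: Max_ge fin)
    qed
    have ln_le: "ln (real n) \<le> ln 2 + 2 * ln (real T + 2) + (real T + 1) * ln \<beta>"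
      if "1 \<le> n" "n < cutoff \<beta> (Suc T)" for n T
    proof -
      have b: "\<beta> ^ Suc T \<ge> 1" by (rule bpow(1)[OF \<beta>])
      have "real n \<le> real (cutoff \<beta> (Suc T))" using that by simp
      also have "\<dots> \<le> (real (Suc T) + 1)\<^sup>2 * \<beta> ^ Suc T + 1" by (rule cutoff_bounds(2)[OF \<beta>])
      finally have n1: "real n \<le> (real T + 2)\<^sup>2 * \<beta> ^ Suc T + 1" by (simp add: add.commute)
      have "1 \<le> (real (Suc T) + 1)\<^sup>2 * \<beta> ^ Suc T"
      proof -
        have "1 \<le> (real (Suc T) + 1)\<^sup>2" by (rule one_le_power) simp
        from mult_mono[OF this b] have "1 * 1 \<le> (real (Suc T) + 1)\<^sup>2 * \<beta> ^ Suc T" by (simp del: power_Suc)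
        then show ?thesis by (simp del: power_Suc)
      qed
      then have "1 \<le> (real T + 2)\<^sup>2 * \<beta> ^ Suc T" by (simp add: add.commute)
      with n1 have "real n \<le> 2 * ((real T + 2)\<^sup>2 * \<beta> ^ Suc T)" by linarith
      then have "ln (real n) \<le> ln (2 * ((real T + 2)\<^sup>2 * \<beta> ^ Suc T))"
        using that by (intro ln_mono) auto
      also have "\<dots> = ln 2 + (ln ((real T + 2)\<^sup>2) + ln (\<beta> ^ Suc T))"
      proof -
        have "(real T + 2)\<^sup>2 > 0" "\<beta> ^ Suc T > 0" using \<beta> by auto
        then show ?thesis by (subst ln_mult_pos) (auto simp: ln_mult_pos simp del: power_Suc)
      qed
      also have "ln (\<beta> ^ Suc T) = (real T + 1) * ln \<beta>" using \<beta> by (subst ln_realpow) (auto simp: algebra_simps)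
      also have "ln ((real T + 2)\<^sup>2) = 2 * ln (real T + 2)" by (subst ln_realpow) auto
      finally show ?thesis by simp
    qed
    have ev1: "\<forall>\<^sub>F T in sequentially. ln 2 + 2 * ln (real T + 2) + ln \<beta> \<le> \<eta> * real T"
    proof -
      have "(\<lambda>T. (ln 2 + 2 * ln (real T + 2) + ln \<beta>) / real T) \<longlonglongrightarrow> 0" by real_asymp
      then have "\<forall>\<^sub>F T in sequentially. (ln 2 + 2 * ln (real T + 2) + ln \<beta>) / real T < \<eta>" by (rule order_tendstoD) (rule \<eta>)
      then show ?thesis using eventually_gt_at_top[of 0]
        by eventually_elim (simp add: divide_less_eq)
    qed
    have ev2: "\<forall>\<^sub>F T in sequentially. C1 + real m0 \<le> (\<gamma>2 - \<gamma>3) * real T"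
    proof -
      have "filterlim (\<lambda>T. (\<gamma>2 - \<gamma>3) * real T) at_top sequentially"
        using \<gamma>3 by (intro filterlim_tendsto_pos_mult_at_top[OF tendsto_const] filterlim_real_sequentially) auto
      then show ?thesis by (simp add: filterlim_at_top)
    qed
    have "\<forall>\<^sub>F T in sequentially. T \<ge> m0 \<and> T \<ge> T0 \<and> T \<ge> 1 \<and> ln 2 + 2 * ln (real T + 2) + ln \<beta> \<le> \<eta> * real T \<and> C1 + real m0 \<le> (\<gamma>2 - \<gamma>3) * real T"
      using ev1 ev2 eventually_ge_at_top[of m0] eventually_ge_at_top[of T0] eventually_ge_at_top[of 1] by eventually_elim auto
    from eventually_compose_filterlim[OF this Mf_lim]
    show ?case using eventually_ge_at_top[of "cutoff \<beta> 0"] eventually_ge_at_top[of 1]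
    proof eventually_elim
      case (elim n)
      define T where "T = Mf n"
      have T: "T \<ge> m0" "T \<ge> T0" "T \<ge> 1" "ln 2 + 2 * ln (real T + 2) + ln \<beta> \<le> \<eta> * real T" "C1 + real m0 \<le> (\<gamma>2 - \<gamma>3) * real T"
        using elim(1) by (auto simp: T_def)
      have J: "cutoff \<beta> T \<le> n" "n < cutoff \<beta> (Suc T)" using Mf[OF elim(2)] by (auto simp: T_def)
      have "ln (real n) \<le> (ln \<beta> + \<eta>) * real T" using ln_le[OF elim(3) J(2)] T(4) by (simp add: algebra_simps)
      then have "\<gamma> * ln (real n) \<le> \<gamma> * ((ln \<beta> + \<eta>) * real T)" using \<gamma> by (intro mult_left_mono) auto
      also have "\<dots> = \<gamma>3 * real T" by (simp only: mult.assoc[symmetric] \<gamma>\<eta>)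
      also have "\<dots> \<le> \<gamma>2 * real T - C1 - real m0" using T(5) by (simp add: algebra_simps)
      also have "\<gamma>2 * real T - C1 \<le> (\<Sum>m<T. grid_change \<beta> m \<omega>)"
      proof -
        have "(\<gamma>2 - \<gamma>1) * real T \<le> (\<Sum>m<T. grid_change \<beta> m \<omega> - expectation (grid_change \<beta> m))"
          using T0[OF T(2)] T(3) by (simp add: less_divide_eq)
        moreover have "\<gamma>1 * real T - C1 \<le> (\<Sum>m<T. expectation (grid_change \<beta> m))" using C1[of T] by (simp add: sum_negf)
        ultimately show ?thesis by (simp add: sum_subtractf algebra_simps)
      qed
      also have "(\<Sum>m<T. grid_change \<beta> m \<omega>) - real m0 \<le> real (num_roots_in (?p n) {0<..1})" by (rule count[OF T(1) J(1)])
      finally show ?case by simp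
    qed
  qed
qed

text \<open>
  As \<beta> decreases to 1, the ratio (\<beta> - 1) / ((\<beta> + 1) * ln \<beta>) tends to 1 / 2.
\<close>

theorem roots_lower:
  assumes \<gamma>: "\<gamma> < 1 / (2 * pi)"
  shows "AE \<omega> in M. \<forall>\<^sub>F n in sequentially. \<gamma> * ln (real n) \<le> real (num_roots_in (kac_poly (\<lambda>j. \<xi> j \<omega>) n) {0<..1})"
proof -
  define \<gamma>' where "\<gamma>' = max \<gamma> (1 / (4 * pi))"
  have "1 / (4 * pi) < 1 / (2 * pi)" by (simp add: field_simps)
  then have \<gamma>': "0 < \<gamma>'" "\<gamma>' < 1 / (2 * pi)" "\<gamma> \<le> \<gamma>'" using \<gamma> by (auto simp: \<gamma>'_def less_max_iff_disj)
  have "((\<lambda>\<beta>::real. (\<beta> - 1) / (\<beta> + 1) / ln \<beta>) \<longlongrightarrow> 1 / 2) (at_right 1)" by real_asymp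
  moreover have "pi * \<gamma>' < 1 / 2" using \<gamma>'(2) by (simp add: field_simps)
  ultimately have "\<forall>\<^sub>F \<beta> in at_right 1. pi * \<gamma>' < (\<beta> - 1) / (\<beta> + 1) / ln (\<beta>::real)" by (rule order_tendstoD)
  then obtain \<beta> :: real where \<beta>: "\<beta> > 1" "pi * \<gamma>' < (\<beta> - 1) / (\<beta> + 1) / ln \<beta>"
    using eventually_happens[OF eventually_conj[OF _ eventually_at_right_less]] by (metis (mono_tags, lifting) trivial_limit_at_right_real)
  have "pi * \<gamma>' * ln \<beta> < (\<beta> - 1) / (\<beta> + 1)" using \<beta> by (simp only: pos_less_divide_eq ln_gt_zero)
  also have "\<dots> \<le> arccos (grid_correlation \<beta>)" by (rule arccos_grid_correlation_ge[OF \<beta>(1)])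
  finally have "\<gamma>' * ln \<beta> < arccos (grid_correlation \<beta>) / pi" by (simp add: pos_less_divide_eq mult_ac)
  from roots_lower_grid[OF \<beta>(1) \<gamma>'(1) this] show ?thesis
  proof eventually_elim
    case (elim \<omega>)
    from elim eventually_ge_at_top[of 1] show ?case
    proof eventually_elim
      case (elim n)
      have "\<gamma> * ln (real n) \<le> \<gamma>' * ln (real n)" using \<gamma>'(3) elim(2) by (intro mult_right_mono) auto
      then show ?case using elim(1) by linarith
    qed
  qed
qed

end

section \<open>Reflection, the root at zero, and the limit theorem\<close>

lemma pcompose_power: "pcompose (p ^ k) r = pcompose p r ^ k"
  by (induction k) (simp_all add: pcompose_mult pcompose_1)

lemma order_le_order_reflect:
  fixes p :: "real poly"
  assumes "p \<noteq> 0" and "pcompose p [:0, -1:] \<noteq> 0"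
  shows "order (- x) p \<le> order x (pcompose p [:0, -1:])"
proof -
  obtain r where r: "p = [:x, 1:] ^ order (- x) p * r" using order_1[of "- x" p] by (auto elim: dvdE)
  have lin: "pcompose [:x, 1:] [:0, -1:] = - [:- x, 1:]" by (simp add: pcompose_pCons)
  have "pcompose p [:0, -1:] = (- [:- x, 1:]) ^ order (- x) p * pcompose r [:0, -1:]"
    by (subst r) (simp only: pcompose_mult pcompose_power lin)
  also have "(- [:- x, 1:]) ^ order (- x) p = [:- x, 1:] ^ order (- x) p * (- 1) ^ order (- x) p"
    by (subst power_minus) (rule mult.commute)
  finally have "[:- x, 1:] ^ order (- x) p dvd pcompose p [:0, -1:]" by (simp only: mult.assoc dvd_triv_left)
  then show ?thesis using assms(2) by (simp add: order_divides)
qed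

lemma num_roots_in_reflect: "num_roots_in (pcompose p [:0, -1:]) I = num_roots_in p (uminus ` I)"
proof (cases "p = 0")
  case False
  define p' where "p' = pcompose p [:0, -1:]"
  have invol: "pcompose p' [:0, -1:] = p"
    by (simp add: poly_eq_poly_eq_iff[symmetric] fun_eq_iff poly_pcompose p'_def)
  have p': "p' \<noteq> 0" using invol False by auto
  have ord: "order x p' = order (- x) p" for x
    using order_le_order_reflect[OF False p'[unfolded p'_def], of x]
      order_le_order_reflect[OF p', of "- x"] invol False by (simp add: p'_def)
  then have "count (proots p') x = count (image_mset uminus (proots p)) x" for x
  proof -
    have "count (image_mset uminus X) x = count X (- x)" for X by (induction X) auto
    then show ?thesis using ord[of x] False p' by simp
  qed
  then have "proots p' = image_mset uminus (proots p)" by (rule multiset_eqI)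
  moreover have "size (filter_mset (\<lambda>x. x \<in> I) (image_mset uminus X)) = size (filter_mset (\<lambda>x. x \<in> uminus ` I) X)" for X
  proof -
    have "x \<in> uminus ` I \<longleftrightarrow> - x \<in> I" for x by (metis imageE imageI minus_minus)
    then show ?thesis by (induction X) auto
  qed
  ultimately show ?thesis by (simp add: num_roots_in_def p'_def)
qed (simp add: num_roots_in_def)

lemma kac_poly_reflect: "kac_poly (\<lambda>j. (- 1) ^ j * a j) n = pcompose (kac_poly a n) [:0, -1:]"
proof -
  have "poly (kac_poly (\<lambda>j. (- 1) ^ j * a j) n) x = poly (pcompose (kac_poly a n) [:0, -1:]) x" for x
    unfolding poly_pcompose poly_kac_poly
    by (intro sum.cong refl) (simp add: power_minus[of x])
  then show ?thesis by (simp add: poly_eq_poly_eq_iff[symmetric] fun_eq_iff)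
qed

lemma num_roots_in_Un:
  assumes "A \<inter> B = {}"
  shows "num_roots_in p (A \<union> B) = num_roots_in p A + num_roots_in p B"
proof -
  have "size (filter_mset (\<lambda>x. x \<in> A \<union> B) X) = size (filter_mset (\<lambda>x. x \<in> A) X) + size (filter_mset (\<lambda>x. x \<in> B) X)" for X
    using assms by (induction X) auto
  then show ?thesis by (simp add: num_roots_in_def)
qed

text \<open>
  The multiplicity of the root 0 is the index of the first nonvanishing coefficient.
\<close>

lemma num_roots_at_0_le:
  assumes "coeff p j \<noteq> 0"
  shows "num_roots_in p {0} \<le> j"
proof -
  have p: "p \<noteq> 0" using assms by auto
  have "filter_mset (\<lambda>x. x \<in> {0}) (proots p) = replicate_mset (order 0 p) 0"
    using p by (intro multiset_eqI) simp
  then have "num_roots_in p {0} = order 0 p" by (simp add: num_roots_in_def)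
  moreover have "order 0 p \<le> j"
  proof (rule ccontr)
    assume "\<not> ?thesis"
    then have "monom 1 (Suc j) dvd p" using p by (simp add: monom_1_dvd_iff)
    then show False using assms by (auto simp: monom_1_dvd_iff')
  qed
  ultimately show ?thesis by simp
qed

lemma (in kac_coeffs) roots_limit:
  "AE \<omega> in M. (\<lambda>n. real (num_roots_in (kac_poly (\<lambda>j. \<xi> j \<omega>) n) {0<..1}) / ln (real n)) \<longlonglongrightarrow> 1 / (2 * pi)"
proof -
  define N where "N n \<omega> = real (num_roots_in (kac_poly (\<lambda>j. \<xi> j \<omega>) n) {0<..1})" for n \<omega>
  define c where "c = 1 / (2 * pi)"
  have "AE \<omega> in M. \<forall>k. \<forall>\<^sub>F n in sequentially. N n \<omega> \<le> (c + 1 / real (Suc k)) * ln (real n)"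
    unfolding AE_all_countable N_def c_def by (intro allI roots_upper) simp
  moreover have "AE \<omega> in M. \<forall>k. \<forall>\<^sub>F n in sequentially. (c - 1 / real (Suc k)) * ln (real n) \<le> N n \<omega>"
    unfolding AE_all_countable N_def c_def by (intro allI roots_lower) simp
  ultimately have "AE \<omega> in M. (\<lambda>n. N n \<omega> / ln (real n)) \<longlonglongrightarrow> c"
  proof eventually_elim
    case (elim \<omega>)
    show ?case
    proof (rule tendstoI)
      fix e :: real assume "e > 0"
      then obtain k where k: "1 / real (Suc k) < e" using reals_Archimedean[of e] by (auto simp: inverse_eq_divide)
      show "\<forall>\<^sub>F n in sequentially. dist (N n \<omega> / ln (real n)) c < e"
        using elim(1)[rule_format, of k] elim(2)[rule_format, of k] eventually_gt_at_top[of 1]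
      proof eventually_elim
        case (elim n)
        then have ln: "ln (real n) > 0" by simp
        have "N n \<omega> / ln (real n) \<le> c + 1 / real (Suc k)" using elim(1) ln by (simp only: pos_divide_le_eq)
        moreover have "c - 1 / real (Suc k) \<le> N n \<omega> / ln (real n)" using elim(2) ln by (simp only: pos_le_divide_eq)
        ultimately show ?case using k unfolding dist_real_def by linarith
      qed
    qed
  qed
  then show ?thesis by (simp add: N_def c_def)
qed

text \<open>
  The sequence s will be the constant 1, for the roots in the positive half, and (-1)^j, for those in the
  negative half.
\<close>

lemma kac_coeffs_of_iid:
  fixes M :: "'a measure" and \<xi> :: "nat \<Rightarrow> 'a \<Rightarrow> real"
  assumes "prob_space M"
    and ind: "prob_space.indep_vars M (\<lambda>_. borel) \<xi> UNIV"
    and distr: "\<And>j. distr M borel (\<xi> j) = distr M borel (\<xi> 0)"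
    and mean: "prob_space.expectation M (\<xi> 0) = 0"
    and var: "prob_space.variance M (\<xi> 0) = 1"
    and "\<epsilon> > 0" and int: "integrable M (\<lambda>\<omega>. \<bar>\<xi> 0 \<omega>\<bar> powr (2 + \<epsilon>))"
    and s: "\<And>j. \<bar>s j\<bar> = 1"
  shows "kac_coeffs M (\<lambda>j \<omega>. s j * \<xi> j \<omega>) (2 + min \<epsilon> 1) (integral\<^sup>L M (\<lambda>\<omega>. \<bar>\<xi> 0 \<omega>\<bar> powr (2 + min \<epsilon> 1)))"
proof -
  interpret prob_space M by fact
  have rv [measurable]: "\<xi> j \<in> borel_measurable M" for j using ind by (auto simp: indep_vars_def)
  let ?q = "2 + min \<epsilon> 1"
  have exp: "expectation (\<lambda>\<omega>. f (\<xi> j \<omega>)) = expectation (\<lambda>\<omega>. f (\<xi> 0 \<omega>))" if "f \<in> borel_measurable borel" for f :: "real \<Rightarrow> real" and j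
    using integral_distr[OF rv[of j] that] integral_distr[OF rv[of 0] that] distr[of j] by simp
  have int_tr: "integrable M (\<lambda>\<omega>. f (\<xi> j \<omega>)) \<longleftrightarrow> integrable M (\<lambda>\<omega>. f (\<xi> 0 \<omega>))" if "f \<in> borel_measurable borel" for f :: "real \<Rightarrow> real" and j
    using integrable_distr_eq[OF rv[of j] that] integrable_distr_eq[OF rv[of 0] that] distr[of j] by simp
  have int0: "integrable M (\<lambda>\<omega>. \<bar>\<xi> 0 \<omega>\<bar> powr ?q)"
  proof (rule Bochner_Integration.integrable_bound)
    show "integrable M (\<lambda>\<omega>. 1 + \<bar>\<xi> 0 \<omega>\<bar> powr (2 + \<epsilon>))" using int by (intro Bochner_Integration.integrable_add) auto
    have "\<bar>x\<bar> powr ?q \<le> 1 + \<bar>x\<bar> powr (2 + \<epsilon>)" for x :: real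
    proof (cases "\<bar>x\<bar> \<le> 1")
      case True
      then have "\<bar>x\<bar> powr ?q \<le> 1" using \<open>\<epsilon> > 0\<close> by (intro powr_le1) auto
      then show ?thesis using powr_ge_zero[of "\<bar>x\<bar>" "2 + \<epsilon>"] by linarith
    next
      case False
      then have "\<bar>x\<bar> powr ?q \<le> \<bar>x\<bar> powr (2 + \<epsilon>)" by (intro powr_mono) auto
      then show ?thesis by linarith
    qed
    then show "AE \<omega> in M. norm (\<bar>\<xi> 0 \<omega>\<bar> powr ?q) \<le> norm (1 + \<bar>\<xi> 0 \<omega>\<bar> powr (2 + \<epsilon>))" by auto
  qed measurable
  show ?thesis
  proof unfold_locales
    show "indep_vars (\<lambda>_. borel) (\<lambda>j \<omega>. s j * \<xi> j \<omega>) UNIV"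
      using indep_vars_compose2[OF ind, of "\<lambda>j x. s j * x" "\<lambda>_. borel"] by simp
    fix j
    show "expectation (\<lambda>\<omega>. s j * \<xi> j \<omega>) = 0" using exp[of "\<lambda>x. x" j] mean by simp
    have "(s j * x)\<^sup>2 = x\<^sup>2" for x using s[of j] by (metis abs_mult mult_1 power2_abs)
    then show "expectation (\<lambda>\<omega>. (s j * \<xi> j \<omega>)\<^sup>2) = 1" using exp[of "\<lambda>x. x\<^sup>2" j] var mean by simp
    have a: "\<bar>s j * x\<bar> = \<bar>x\<bar>" for x using s[of j] by (simp add: abs_mult)
    show "integrable M (\<lambda>\<omega>. \<bar>s j * \<xi> j \<omega>\<bar> powr ?q)" unfolding a using int_tr[of "\<lambda>x. \<bar>x\<bar> powr ?q" j] int0 by simp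
    show "expectation (\<lambda>\<omega>. \<bar>s j * \<xi> j \<omega>\<bar> powr ?q) \<le> expectation (\<lambda>\<omega>. \<bar>\<xi> 0 \<omega>\<bar> powr ?q)"
      unfolding a using exp[of "\<lambda>x. \<bar>x\<bar> powr ?q" j] by simp
  qed (use \<open>\<epsilon> > 0\<close> in auto)
qed

theorem theorem1p1:
  fixes M :: "'a measure" and \<xi> :: "nat \<Rightarrow> 'a \<Rightarrow> real"
  assumes "prob_space M"
    and "prob_space.indep_vars M (\<lambda>_. borel) \<xi> UNIV"
    and "\<And>j. distr M borel (\<xi> j) = distr M borel (\<xi> 0)"
    and "prob_space.expectation M (\<xi> 0) = 0"
    and "prob_space.variance M (\<xi> 0) = 1"
    and "\<exists>\<epsilon>>0. integrable M (\<lambda>\<omega>. \<bar>\<xi> 0 \<omega>\<bar> powr (2 + \<epsilon>))"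
  shows "(AE \<omega> in M. (\<lambda>n. real (num_roots_in (kac_poly (\<lambda>j. \<xi> j \<omega>) n) {-1..1}) / ln (real n))
            \<longlonglongrightarrow> 1 / pi) \<and>
         (AE \<omega> in M.
            (\<lambda>n. real (num_roots_in (kac_poly (\<lambda>j. \<xi> j \<omega>) n) {0..1}) / ln (real n))
              \<longlonglongrightarrow> 1 / (2 * pi) \<and>
            (\<lambda>n. real (num_roots_in (kac_poly (\<lambda>j. \<xi> j \<omega>) n) {-1..0}) / ln (real n))
              \<longlonglongrightarrow> 1 / (2 * pi))"
proof -
  obtain \<epsilon> where "\<epsilon> > 0" "integrable M (\<lambda>\<omega>. \<bar>\<xi> 0 \<omega>\<bar> powr (2 + \<epsilon>))" using assms(6) by blast
  note iid = kac_coeffs_of_iid[OF assms(1-5) this]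
  let ?p = "\<lambda>\<omega> n. kac_poly (\<lambda>j. \<xi> j \<omega>) n"
  have pos: "AE \<omega> in M. (\<lambda>n. real (num_roots_in (?p \<omega> n) {0<..1}) / ln (real n)) \<longlonglongrightarrow> 1 / (2 * pi)"
    using kac_coeffs.roots_limit[OF iid[of "\<lambda>_. 1"]] by simp
  have "uminus ` {0<..1} = {-1..<0::real}" by simp
  then have neg: "AE \<omega> in M. (\<lambda>n. real (num_roots_in (?p \<omega> n) {-1..<0}) / ln (real n)) \<longlonglongrightarrow> 1 / (2 * pi)"
    using kac_coeffs.roots_limit[OF iid[of "\<lambda>j. (- 1) ^ j"]] by (simp add: kac_poly_reflect num_roots_in_reflect power_abs)
  have all: "AE \<omega> in M.
     (\<lambda>n. real (num_roots_in (?p \<omega> n) {-1..1}) / ln (real n)) \<longlonglongrightarrow> 1 / pi \<and>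
     (\<lambda>n. real (num_roots_in (?p \<omega> n) {0..1}) / ln (real n)) \<longlonglongrightarrow> 1 / (2 * pi) \<and>
     (\<lambda>n. real (num_roots_in (?p \<omega> n) {-1..0}) / ln (real n)) \<longlonglongrightarrow> 1 / (2 * pi)"
    using pos neg
  proof eventually_elim
    case (elim \<omega>)
    (* If all coefficients vanished, then so would all root counts, contrary to the limit of the positive half. *)
    have "\<exists>j. \<xi> j \<omega> \<noteq> 0"
    proof (rule ccontr)
      assume "\<not> ?thesis"
      then have "(\<lambda>n. 0) \<longlonglongrightarrow> 1 / (2 * pi)" using elim(1) by (simp add: kac_poly_def num_roots_in_def)
      from LIMSEQ_unique[OF this tendsto_const] show False by simp
    qed
    then obtain j where j: "\<xi> j \<omega> \<noteq> 0" by blast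
    have zero: "(\<lambda>n. real (num_roots_in (?p \<omega> n) {0}) / ln (real n)) \<longlonglongrightarrow> 0"
    proof (rule tendsto_sandwich[OF _ _ tendsto_const])
      show "\<forall>\<^sub>F n in sequentially. 0 \<le> real (num_roots_in (?p \<omega> n) {0}) / ln (real n)"
        using eventually_ge_at_top[of 1] by eventually_elim simp
      show "\<forall>\<^sub>F n in sequentially. real (num_roots_in (?p \<omega> n) {0}) / ln (real n) \<le> real j / ln (real n)"
        using eventually_ge_at_top[of "max 1 j"]
      proof eventually_elim
        case (elim n)
        have "num_roots_in (?p \<omega> n) {0} \<le> j" using j elim by (intro num_roots_at_0_le) (simp add: coeff_kac_poly)
        then show ?case using elim by (intro divide_right_mono) auto
      qed
      show "(\<lambda>n. real j / ln (real n)) \<longlonglongrightarrow> 0" by real_asymp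
    qed
    have "{0..1} = {0<..1} \<union> {0::real}" "{-1..0} = {-1..<0} \<union> {0::real}" "{-1..1} = {-1..<0} \<union> {0..1::real}" by auto
    moreover have "{0<..1} \<inter> {0::real} = {}" "{-1..<0} \<inter> {0::real} = {}" "{-1..<0} \<inter> {0..1::real} = {}" by auto
    ultimately have e: "num_roots_in p {0..1} = num_roots_in p {0<..1} + num_roots_in p {0}"
        "num_roots_in p {-1..0} = num_roots_in p {-1..<0} + num_roots_in p {0}"
        "num_roots_in p {-1..1} = num_roots_in p {-1..<0} + num_roots_in p {0..1}" for p
      by (metis num_roots_in_Un)+
    have "1 / (2 * pi) + (1 / (2 * pi) + 0) = 1 / pi" by simp
    with tendsto_add[OF elim(2) tendsto_add[OF elim(1) zero]] tendsto_add[OF elim(1) zero] tendsto_add[OF elim(2) zero]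
    show ?case by (simp add: e add_divide_distrib)
  qed
  show ?thesis
  proof
    show "AE \<omega> in M. (\<lambda>n. real (num_roots_in (?p \<omega> n) {-1..1}) / ln (real n)) \<longlonglongrightarrow> 1 / pi"
      using all by eventually_elim simp
    show "AE \<omega> in M. (\<lambda>n. real (num_roots_in (?p \<omega> n) {0..1}) / ln (real n)) \<longlonglongrightarrow> 1 / (2 * pi) \<and>
      (\<lambda>n. real (num_roots_in (?p \<omega> n) {-1..0}) / ln (real n)) \<longlonglongrightarrow> 1 / (2 * pi)"
      using all by eventually_elim simp
  qed
qed

end
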